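(* Let $(\eta^{ij})$ be a nondegenerate symmetric constant $N\times N$ matrix and let $$\{I,J\}_2=\int \frac{\delta I}{\delta u^i(x)}\,\eta^{ij}\frac{d}{dx}\,\frac{\delta J}{\delta u^j(x)}\,dx.$$ An arbitrary nonlocal Poisson bracket $\{I,J\}_1$ of the form $$\{I,J\}_1=\int \frac{\delta I}{\delta u^i(x)}\Big(g^{ij}(u)\frac{d}{dx}+b^{ij}_k(u)u^k_x+\sum_{\alpha=1}^L\varepsilon_\alpha (w^\alpha)^i_k(u)u^k_x\Big(\frac{d}{dx}\Big)^{-1}(w^\alpha)^j_s(u)u^s_x\Big)\frac{\delta J}{\delta u^j(x)}\,dx,\qquad \det(g^{ij}(u))\not\equiv 0,$$ is compatible with the constant Poisson bracket $\{I,J\}_2$ if and only if it has the form $$\{I,J\}_1=\int\frac{\delta I}{\delta u^i(x)}\Big(\Big[\eta^{is}\frac{\partial F^j}{\partial u^s}+\eta^{js}\frac{\partial F^i}{\partial u^s}-\eta^{is}\eta^{jk}\sum_{\alpha=1}^L\varepsilon_\alpha\frac{\partial\psi^\alpha}{\partial u^s}\frac{\partial\psi^\alpha}{\partial u^k}\Big]\frac{d}{dx}+\Big[\eta^{is}\frac{\partial^2F^j}{\partial u^s\partial u^k}-\eta^{is}\eta^{jp}\sum_{\alpha=1}^L\varepsilon_\alpha\frac{\partial^2\psi^\alpha}{\partial u^s\partial u^k}\frac{\partial\psi^\alpha}{\partial u^p}\Big]u^k_x$$ $$\qquad+\eta^{ip}\eta^{jr}\sum_{\alpha=1}^L\varepsilon_\alpha\frac{\partial^2\psi^\alpha}{\partial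 u^p\partial u^k}u^k_x\Big(\frac{d}{dx}\Big)^{-1}\frac{\partial^2\psi^\alpha}{\partial u^r\partial u^s}u^s_x\Big)\frac{\delta J}{\delta u^j(x)}\,dx,$$ where $F^i(u)$, $1\le i\le N$, and $\psi^\alpha(u)$, $1\le\alpha\le L$, are smooth functions defined in a certain domain of local coordinates.
   Context: Here $u=(u^1,\dots,u^N)$ are local coordinates on a smooth $N$-dimensional manifold, $u^i(x)$ are fields depending on one independent variable $x$, $I,J$ are functionals on the space of fields, the coefficients $g^{ij}(u)$, $b^{ij}_k(u)$, $(w^\alpha)^i_j(u)$ are smooth functions of $u$, and the $\varepsilon_\alpha$ are constants. Summation over repeated coordinate indices is understood; sums over $\alpha$ are written explicitly. The statement is local: the functions $F^i$, $\psi^\alpha$ are asserted to exist locally. A bracket is a Poisson bracket if it is skew-symmetric and satisfies the Jacobi identity for arbitrary functionals. Two Poisson brackets $\{\cdot,\cdot\}_1,\{\cdot,\cdot\}_2$ are compatible if every linear combination $\lambda_1\{\cdot,\cdot\}_1+\lambda_2\{\cdot,\cdot\}_2$ with constants $\lambda_1,\lambda_2$ is a Poisson bracket. Known criterion (Ferapontov) used by the paper: a bracket of the form $$\int \frac{\delta I}{\delta u^i}\Big(g^{ij}\frac{d}{dx}+b^{ij}_ku^k_x+\sum_{\alpha}\varepsilon_\alpha (w^\alpha)^i_ku^k_x\big(\tfrac{d}{dx}\big)^{-1}(w^\alpha)^j_su^s_x\Big)\frac{\delta J}{\delta u^j}\,dx,\quad \det(g^{ij})\not\equiv0,$$ is a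 Poisson bracket if and only if: $g^{ij}=g^{ji}$; $\partial g^{ij}/\partial u^k=b^{ij}_k+b^{ji}_k$; $g^{is}b^{jk}_s=g^{js}b^{ik}_s$; $g^{is}(w^\alpha)^j_s=g^{js}(w^\alpha)^i_s$; $(w^\alpha)^i_s(w^\beta)^s_j=(w^\beta)^i_s(w^\alpha)^s_j$; $g^{is}g^{jr}\frac{\partial (w^\alpha)^k_r}{\partial u^s}-g^{jr}b^{ik}_s(w^\alpha)^s_r=g^{js}g^{ir}\frac{\partial (w^\alpha)^k_r}{\partial u^s}-g^{ir}b^{jk}_s(w^\alpha)^s_r$; and $g^{is}\big(\frac{\partial b^{jk}_r}{\partial u^s}-\frac{\partial b^{jk}_s}{\partial u^r}\big)+b^{ik}_sb^{sj}_r-b^{ij}_sb^{sk}_r=\sum_{\alpha}\varepsilon_\alpha g^{is}\big((w^\alpha)^j_s(w^\alpha)^k_r-(w^\alpha)^j_r(w^\alpha)^k_s\big)$. *)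

theory Defs
  imports "HOL-Analysis.Analysis"
begin

section \<open>Smooth functions\<close>

fun Ck_on :: "nat \<Rightarrow> 'a::euclidean_space set \<Rightarrow> ('a \<Rightarrow> 'b::real_normed_vector) \<Rightarrow> bool" where
  "Ck_on 0 S f \<longleftrightarrow> continuous_on S f"
| "Ck_on (Suc k) S f \<longleftrightarrow> (\<forall>x\<in>S. f differentiable (at x)) \<and>
     (\<forall>v. Ck_on k S (\<lambda>x. frechet_derivative f (at x) v))"

text \<open>Only used for open \<open>S\<close>.\<close>
definition smooth_on :: "'a::euclidean_space set \<Rightarrow> ('a \<Rightarrow> 'b::real_normed_vector) \<Rightarrow> bool" where
  "smooth_on S f \<longleftrightarrow> (\<forall>k. Ck_on k S f)"

definition pd :: "'n::finite \<Rightarrow> (real^'n \<Rightarrow> real) \<Rightarrow> real^'n \<Rightarrow> real" where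
  "pd k f u = frechet_derivative f (at u) (axis k 1)"


section \<open>Fields, functionals, variational derivatives\<close>

text \<open>
  Fields are smooth maps from the line to the coordinate domain \<open>U\<close> that are constant near each
  end of the line (the two constants may differ); they are varied by compactly supported smooth
  functions.  Variational derivatives are required to be smooth with compact support, so that
  integrations by parts leave no boundary terms.
\<close>

type_synonym 'n field = "real \<Rightarrow> real^'n"
type_synonym 'n functional = "'n field \<Rightarrow> real"
type_synonym 'n bracket = "'n functional \<Rightarrow> 'n functional \<Rightarrow> 'n functional"

definition xderiv :: "(real \<Rightarrow> 'a::real_normed_vector) \<Rightarrow> real \<Rightarrow> 'a" where
  "xderiv f x = vector_derivative f (at x)"

definition fields :: "(real^'n) set \<Rightarrow> 'n::finite field set" where
  "fields U = {u. smooth_on UNIV u \<and> range u \<subseteq> U \<and> (\<exists>R. \<forall>x. \<bar>x\<bar> > R \<longrightarrow> xderiv u x = 0)}"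

definition test_functions :: "'n::finite field set" where
  "test_functions = {v. smooth_on UNIV v \<and> (\<exists>R. \<forall>x. \<bar>x\<bar> > R \<longrightarrow> v x = 0)}"

definition has_variational_derivative ::
    "'n::finite functional \<Rightarrow> 'n field \<Rightarrow> 'n field \<Rightarrow> bool" where
  "has_variational_derivative I \<xi> u \<longleftrightarrow> \<xi> \<in> test_functions \<and>
     (\<forall>v\<in>test_functions.
        ((\<lambda>t. I (\<lambda>x. u x + t *\<^sub>R v x)) has_real_derivative integral UNIV (\<lambda>x. \<xi> x \<bullet> v x)) (at 0))"

definition var_deriv :: "'n::finite functional \<Rightarrow> 'n field \<Rightarrow> 'n field" where
  "var_deriv I u = (THE \<xi>. has_variational_derivative I \<xi> u)"

text \<open>
  The functionals on which brackets are evaluated: the variational derivative exists at every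
  field and is smooth, with locally uniformly bounded support, along two-parameter variations
  (so that second variations exist and are symmetric).
\<close>
definition smooth_functional :: "(real^'n) set \<Rightarrow> 'n::finite functional \<Rightarrow> bool" where
  "smooth_functional U I \<longleftrightarrow> (\<forall>u\<in>fields U.
     (\<exists>\<xi>. has_variational_derivative I \<xi> u) \<and>
     (\<forall>v\<in>test_functions. \<forall>w\<in>test_functions. \<exists>r>0. \<exists>R.
        smooth_on ({-r<..<r} \<times> {-r<..<r} \<times> UNIV)
          (\<lambda>(s, t, x). var_deriv I (\<lambda>y. u y + s *\<^sub>R v y + t *\<^sub>R w y) x) \<and>
        (\<forall>s\<in>{-r<..<r}. \<forall>t\<in>{-r<..<r}. \<forall>x. \<bar>x\<bar> > R \<longrightarrow>
           var_deriv I (\<lambda>y. u y + s *\<^sub>R v y + t *\<^sub>R w y) x = 0)))"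


section \<open>Poisson brackets\<close>

text \<open>
  The first clause guarantees that the iterated brackets in the Jacobi identity are meaningful.
  It is no restriction on brackets of the form \<open>nonlocal_bracket\<close> with smooth coefficients,
  for which it always holds.
\<close>
definition poisson_bracket :: "(real^'n) set \<Rightarrow> 'n::finite bracket \<Rightarrow> bool" where
  "poisson_bracket U B \<longleftrightarrow>
     (\<forall>I J. smooth_functional U I \<longrightarrow> smooth_functional U J \<longrightarrow>
        (\<forall>u\<in>fields U. \<exists>\<xi>. has_variational_derivative (B I J) \<xi> u)) \<and>
     (\<forall>I J. smooth_functional U I \<longrightarrow> smooth_functional U J \<longrightarrow>
        (\<forall>u\<in>fields U. B I J u = - B J I u)) \<and>
     (\<forall>I J K. smooth_functional U I \<longrightarrow> smooth_functional U J \<longrightarrow> smooth_functional U K \<longrightarrow>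
        (\<forall>u\<in>fields U. B (B I J) K u + B (B J K) I u + B (B K I) J u = 0))"

definition compatible :: "(real^'n) set \<Rightarrow> 'n::finite bracket \<Rightarrow> 'n bracket \<Rightarrow> bool" where
  "compatible U B1 B2 \<longleftrightarrow>
     (\<forall>c1 c2. poisson_bracket U (\<lambda>I J u. c1 * B1 I J u + c2 * B2 I J u))"


section \<open>Brackets of hydrodynamic type\<close>

text \<open>The skew-symmetric inverse of \<open>d/dx\<close>, i.e. convolution with \<open>sgn x / 2\<close>.\<close>
definition dinv :: "(real \<Rightarrow> real) \<Rightarrow> real \<Rightarrow> real" where
  "dinv f x = (integral {..x} f - integral {x..} f) / 2"

text \<open>
  Index conventions: \<open>g u $ i $ j\<close> is \<open>g\<^sup>i\<^sup>j(u)\<close>; \<open>b u $ i $ j $ k\<close> is \<open>b\<^sup>i\<^sup>j\<^sub>k(u)\<close>;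
  \<open>w \<alpha> u $ i $ k\<close> is \<open>(w\<^sup>\<alpha>)\<^sup>i\<^sub>k(u)\<close>.
\<close>
definition nonlocal_operator ::
    "(real^'n \<Rightarrow> real^'n^'n) \<Rightarrow> (real^'n \<Rightarrow> real^'n^'n^'n) \<Rightarrow> nat \<Rightarrow> (nat \<Rightarrow> real)
      \<Rightarrow> (nat \<Rightarrow> real^'n \<Rightarrow> real^'n^'n) \<Rightarrow> 'n::finite field \<Rightarrow> 'n field \<Rightarrow> 'n field" where
  "nonlocal_operator g b L \<epsilon> w u \<xi> x = (\<chi> i.
     (\<Sum>j\<in>UNIV. g (u x) $ i $ j * xderiv \<xi> x $ j
        + (\<Sum>k\<in>UNIV. b (u x) $ i $ j $ k * xderiv u x $ k) * \<xi> x $ j)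
     + (\<Sum>\<alpha>=1..L. \<epsilon> \<alpha> * (\<Sum>k\<in>UNIV. w \<alpha> (u x) $ i $ k * xderiv u x $ k)
         * dinv (\<lambda>y. \<Sum>j\<in>UNIV. \<Sum>s\<in>UNIV. w \<alpha> (u y) $ j $ s * xderiv u y $ s * \<xi> y $ j) x))"

definition nonlocal_bracket ::
    "(real^'n \<Rightarrow> real^'n^'n) \<Rightarrow> (real^'n \<Rightarrow> real^'n^'n^'n) \<Rightarrow> nat \<Rightarrow> (nat \<Rightarrow> real)
      \<Rightarrow> (nat \<Rightarrow> real^'n \<Rightarrow> real^'n^'n) \<Rightarrow> 'n::finite bracket" where
  "nonlocal_bracket g b L \<epsilon> w I J u =
     integral UNIV (\<lambda>x. var_deriv I u x \<bullet> nonlocal_operator g b L \<epsilon> w u (var_deriv J u) x)"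

definition constant_bracket :: "real^'n^'n \<Rightarrow> 'n::finite bracket" where
  "constant_bracket \<eta> I J u =
     integral UNIV (\<lambda>x. \<Sum>i\<in>UNIV. \<Sum>j\<in>UNIV.
       var_deriv I u x $ i * \<eta> $ i $ j * xderiv (var_deriv J u) x $ j)"


section \<open>The canonical form\<close>

definition g_form :: "real^'n^'n \<Rightarrow> nat \<Rightarrow> (nat \<Rightarrow> real) \<Rightarrow> (real^'n \<Rightarrow> real^'n)
    \<Rightarrow> (nat \<Rightarrow> real^'n \<Rightarrow> real) \<Rightarrow> real^'n \<Rightarrow> real^'n^'n::finite" where
  "g_form \<eta> L \<epsilon> F \<psi> u = (\<chi> i j.
     (\<Sum>s\<in>UNIV. \<eta> $ i $ s * pd s (\<lambda>v. F v $ j) u)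
     + (\<Sum>s\<in>UNIV. \<eta> $ j $ s * pd s (\<lambda>v. F v $ i) u)
     - (\<Sum>s\<in>UNIV. \<Sum>k\<in>UNIV. \<eta> $ i $ s * \<eta> $ j $ k *
          (\<Sum>\<alpha>=1..L. \<epsilon> \<alpha> * pd s (\<psi> \<alpha>) u * pd k (\<psi> \<alpha>) u)))"

definition b_form :: "real^'n^'n \<Rightarrow> nat \<Rightarrow> (nat \<Rightarrow> real) \<Rightarrow> (real^'n \<Rightarrow> real^'n)
    \<Rightarrow> (nat \<Rightarrow> real^'n \<Rightarrow> real) \<Rightarrow> real^'n \<Rightarrow> real^'n^'n^'n::finite" where
  "b_form \<eta> L \<epsilon> F \<psi> u = (\<chi> i j k.
     (\<Sum>s\<in>UNIV. \<eta> $ i $ s * pd s (pd k (\<lambda>v. F v $ j)) u)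
     - (\<Sum>s\<in>UNIV. \<Sum>p\<in>UNIV. \<eta> $ i $ s * \<eta> $ j $ p *
          (\<Sum>\<alpha>=1..L. \<epsilon> \<alpha> * pd s (pd k (\<psi> \<alpha>)) u * pd p (\<psi> \<alpha>) u)))"

definition w_form :: "real^'n^'n \<Rightarrow> (nat \<Rightarrow> real^'n \<Rightarrow> real) \<Rightarrow> nat \<Rightarrow> real^'n
    \<Rightarrow> real^'n^'n::finite" where
  "w_form \<eta> \<psi> \<alpha> u = (\<chi> i k. \<Sum>p\<in>UNIV. \<eta> $ i $ p * pd p (pd k (\<psi> \<alpha>)) u)"

text \<open>
  \<open>B\<close> is, as a bracket on functionals of \<open>V\<close>-valued fields, the bracket given by functions
  \<open>F\<close>, \<open>\<psi>\<close> that are smooth on \<open>V\<close>.  The coefficients \<open>w\<^sup>\<alpha>\<close> are not determined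
  by the bracket (for instance, terms with \<open>w\<^sup>1 = w\<^sup>2\<close> and \<open>\<epsilon>\<^sub>1 = - \<epsilon>\<^sub>2\<close> cancel), so it is the
  brackets that are compared, not the coefficients.
\<close>
definition has_canonical_form ::
    "(real^'n) set \<Rightarrow> real^'n^'n \<Rightarrow> nat \<Rightarrow> (nat \<Rightarrow> real) \<Rightarrow> 'n::finite bracket \<Rightarrow> bool" where
  "has_canonical_form V \<eta> L \<epsilon> B \<longleftrightarrow> (\<exists>F \<psi>.
     smooth_on V F \<and> (\<forall>\<alpha>\<in>{1..L}. smooth_on V (\<psi> \<alpha>)) \<and>
     (\<forall>I J. smooth_functional V I \<longrightarrow> smooth_functional V J \<longrightarrow>
        (\<forall>u\<in>fields V. B I J u =
           nonlocal_bracket (g_form \<eta> L \<epsilon> F \<psi>) (b_form \<eta> L \<epsilon> F \<psi>) L \<epsilon> (w_form \<eta> \<psi>) I J u)))"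

end

theory Submission
  imports Defs
begin

text \<open>
  Write the bracket as a bilinear form \<open>B(u; f, h)\<close> in the variational derivatives. Evaluated on linear
  functionals, the mixed terms of the Jacobi identity of the pencil say that \<open>B\<close> is closed: the
  cyclic sum over \<open>(f, h, k)\<close> of the derivatives of \<open>B(u; f, h)\<close> in the direction \<open>\<eta> k\<^sub>x\<close> vanishes.

  For a bracket of the canonical form, integration by parts expresses \<open>B\<close> through the first derivatives
  of \<open>F\<close> and \<open>\<psi>\<close> in the directions \<open>\<eta> f\<^sub>x\<close>, \<open>\<eta> h\<^sub>x\<close> alone; closedness is then the symmetry of second
  derivatives, and the terms with second variations of the functionals cancel by skewness of \<open>\<eta> d/dx\<close>.

  Conversely, let \<open>B\<close> be closed and skew. If one test function lives far away from the other two, only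
  the nonlocal tail survives. Since the \<open>w\<^sup>\<alpha>\<close> need not be linearly independent, one concludes only for
  the kernel \<open>\<Sum> \<epsilon>\<^sub>\<alpha> w\<^sup>\<alpha>(p) w\<^sup>\<alpha>(q)\<close> that its slices, lowered by \<open>\<eta>\<^sup>-\<^sup>1\<close>, are symmetric and curl free.
  The kernel has a representation of the same shape by combinations of its slices, so by Hessians of functions \<open>\<psi>\<^sup>\<alpha>\<close>.
  Subtracting the canonical bracket of \<open>\<psi>\<close> leaves a closed local form, whose lowered coefficients
  \<open>b\<^sub>i\<^sub>j\<^sub>k\<close> are for each \<open>j\<close> symmetric in \<open>i, k\<close> and curl free, hence Hessians; then \<open>g\<close> is determined
  up to a constant symmetric matrix, which a linear term in \<open>F\<close> absorbs.
\<close>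

section \<open>Smooth functions\<close>

text \<open>Since both brackets are Poisson, the Jacobi expression of a combination with constants
  c1, c2 is c1 c2 times a mixed part, so a single pair of nonzero constants decides compatibility.
  On linear functionals the constant bracket does not depend on the field, and only derivatives of B
  remain: closedness says that B is a 2-cocycle of the constant Poisson structure, and F, \<psi> are
  its potentials.

  The obstacle to the converse is that a bracket does not determine its coefficients. Local ones are
  read off from jets of bump functions at the point 0. Of the w only the two-point kernel is
  visible, so fields with prescribed value and slope (up to scale) at the distant points 0 and 10
  are constructed. Near 0 the test functions are multiples of columns of the inverse of \<eta>,
  which makes the directions \<eta> k_x coordinate axes. Convexity serves three purposes: joining p
  to q by a field, the Poincare lemma, and the constancy of functions with zero gradient.

  In the forward direction the regularity demanded of functionals makes second variations exist and
  be symmetric, which frees the direction of variation in the derivative of a bracket.\<close>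

lemma Ck_on_cong:
  assumes "open S" "\<And>x. x \<in> S \<Longrightarrow> f x = g x"
  shows "Ck_on k S f \<longleftrightarrow> Ck_on k S g"
  using assms(2)
proof (induction k arbitrary: f g)
  case 0
  then show ?case by (simp cong: continuous_on_cong)
next
  case (Suc k)
  have d: "(f has_derivative D) (at x) \<longleftrightarrow> (g has_derivative D) (at x)" if "x \<in> S" for x D
    using has_derivative_transform_within_open[OF _ assms(1) that] Suc.prems by metis
  have "frechet_derivative f (at x) = frechet_derivative g (at x)" if "x \<in> S" for x
    using d[OF that] by (simp add: frechet_derivative_def)
  then have "Ck_on k S (\<lambda>x. frechet_derivative f (at x) v) \<longleftrightarrow> Ck_on k S (\<lambda>x. frechet_derivative g (at x) v)" for v
    by (intro Suc.IH) auto
  moreover have "f differentiable (at x) \<longleftrightarrow> g differentiable (at x)" if "x \<in> S" for x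
    using d[OF that] by (simp add: differentiable_def)
  ultimately show ?case by simp
qed

text \<open>Any formula for the derivative may stand in for \<open>frechet_derivative\<close>,
  because the two agree on an open set. The closure properties below are inductions through this
  rule.\<close>

lemma Ck_on_SucI:
  assumes "open S" "\<And>x. x \<in> S \<Longrightarrow> (f has_derivative f' x) (at x)" "\<And>v. Ck_on k S (\<lambda>x. f' x v)"
  shows "Ck_on (Suc k) S f"
proof -
  have "frechet_derivative f (at x) = f' x" if "x \<in> S" for x
    using frechet_derivative_at[OF assms(2)[OF that]] by simp
  then have "Ck_on k S (\<lambda>x. frechet_derivative f (at x) v)" for v
    using Ck_on_cong[OF assms(1), of "\<lambda>x. frechet_derivative f (at x) v" "\<lambda>x. f' x v"] assms(3) by auto
  then show ?thesis using assms(2) by (auto simp: differentiable_def)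
qed

lemma Ck_on_pred: "Ck_on (Suc k) S f \<Longrightarrow> Ck_on k S f"
proof (induction k arbitrary: f)
  case 0
  then show ?case
    by (auto intro!: differentiable_imp_continuous_on simp: differentiable_on_def differentiable_at_withinI)
next
  case (Suc k)
  then show ?case by (metis Ck_on.simps(2))
qed

lemma Ck_on_Suc_has_derivative:
  "Ck_on (Suc k) S f \<Longrightarrow> x \<in> S \<Longrightarrow> (f has_derivative frechet_derivative f (at x)) (at x)"
  by (simp add: frechet_derivative_works)

lemma Ck_on_const: "open S \<Longrightarrow> Ck_on k S (\<lambda>x. c)"
proof (induction k arbitrary: c)
  case (Suc k)
  then show ?case by (intro Ck_on_SucI[where f'="\<lambda>x v. 0"]) auto
qed simp

lemma Ck_on_add:
  "open S \<Longrightarrow> Ck_on k S f \<Longrightarrow> Ck_on k S g \<Longrightarrow> Ck_on k S (\<lambda>x. f x + g x)"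
proof (induction k arbitrary: f g)
  case 0
  then show ?case by (auto intro: continuous_on_add)
next
  case (Suc k)
  show ?case
  proof (rule Ck_on_SucI[where f'="\<lambda>x v. frechet_derivative f (at x) v + frechet_derivative g (at x) v"])
    show "Ck_on k S (\<lambda>x. frechet_derivative f (at x) v + frechet_derivative g (at x) v)" for v
      using Suc by (intro Suc.IH) auto
  qed (use Suc.prems in \<open>auto intro!: derivative_eq_intros Ck_on_Suc_has_derivative\<close>)
qed

text \<open>In the product rule each summand pairs a derivative with an undifferentiated factor; the
  latter is lowered by \<open>Ck_on_pred\<close>, so that the induction hypothesis applies to
  both.\<close>

lemma Ck_on_bilinear:
  assumes "bounded_bilinear P" "open S"
  shows "Ck_on k S f \<Longrightarrow> Ck_on k S g \<Longrightarrow> Ck_on k S (\<lambda>x. P (f x) (g x))"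
proof (induction k arbitrary: f g)
  case 0
  then show ?case using bounded_bilinear.continuous_on[OF assms(1)] by auto
next
  case (Suc k)
  show ?case
  proof (rule Ck_on_SucI[where f'="\<lambda>x v. P (f x) (frechet_derivative g (at x) v) + P (frechet_derivative f (at x) v) (g x)"])
    show "Ck_on k S (\<lambda>x. P (f x) (frechet_derivative g (at x) v) + P (frechet_derivative f (at x) v) (g x))" for v
      using Suc.prems Ck_on_pred[OF Suc.prems(1)] Ck_on_pred[OF Suc.prems(2)] assms
      by (intro Ck_on_add Suc.IH) auto
  qed (use Suc.prems assms in \<open>auto intro!: bounded_bilinear.FDERIV[OF assms(1)] Ck_on_Suc_has_derivative\<close>)
qed

lemma Ck_on_bounded_linear:
  assumes "bounded_linear l" "open S"
  shows "Ck_on k S f \<Longrightarrow> Ck_on k S (\<lambda>x. l (f x))"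
proof (induction k arbitrary: f)
  case 0
  then show ?case using bounded_linear.continuous_on[OF assms(1)] by auto
next
  case (Suc k)
  show ?case
  proof (rule Ck_on_SucI[where f'="\<lambda>x v. l (frechet_derivative f (at x) v)"])
    show "Ck_on k S (\<lambda>x. l (frechet_derivative f (at x) v))" for v
      using Suc.prems by (intro Suc.IH) auto
  qed (use Suc.prems assms in \<open>auto intro!: bounded_linear.has_derivative[OF assms(1)] Ck_on_Suc_has_derivative\<close>)
qed

lemma Ck_on_sum:
  assumes "open S" "\<And>i. i \<in> A \<Longrightarrow> Ck_on k S (f i)"
  shows "Ck_on k S (\<lambda>x. \<Sum>i\<in>A. f i x)"
  using assms(2)
  by (induction A rule: infinite_finite_induct) (auto intro!: Ck_on_const Ck_on_add assms(1))

lemma Ck_on_subset: "Ck_on k S f \<Longrightarrow> T \<subseteq> S \<Longrightarrow> Ck_on k T f"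
proof (induction k arbitrary: f)
  case 0
  then show ?case by (auto intro: continuous_on_subset)
qed auto

text \<open>\<open>Ck_on\<close> speaks of derivatives in fixed directions only, whereas the chain
  rule produces a direction that moves with the point. Expansion in a basis turns the moving
  direction into scalar factors.\<close>

lemma frechet_derivative_euclidean:
  assumes "f differentiable (at x)"
  shows "frechet_derivative f (at x) v = (\<Sum>b\<in>Basis. (v \<bullet> b) *\<^sub>R frechet_derivative f (at x) b)"
proof -
  have l: "linear (frechet_derivative f (at x))" using assms by (rule linear_frechet_derivative)
  have "frechet_derivative f (at x) v = frechet_derivative f (at x) (\<Sum>b\<in>Basis. (v \<bullet> b) *\<^sub>R b)"
    by (simp add: euclidean_representation)
  also have "\<dots> = (\<Sum>b\<in>Basis. (v \<bullet> b) *\<^sub>R frechet_derivative f (at x) b)"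
    by (simp add: linear_sum[OF l] linear_cmul[OF l])
  finally show ?thesis .
qed

lemma Ck_on_compose:
  fixes f :: "'b::euclidean_space \<Rightarrow> 'c::real_normed_vector" and g :: "'a::euclidean_space \<Rightarrow> 'b"
  assumes "open S" "open T" "\<And>x. x \<in> S \<Longrightarrow> g x \<in> T"
  shows "Ck_on k T f \<Longrightarrow> Ck_on k S g \<Longrightarrow> Ck_on k S (\<lambda>x. f (g x))"
proof (induction k arbitrary: f)
  case 0
  then show ?case using assms by (auto intro: continuous_on_compose2)
next
  case (Suc k)
  have d: "f differentiable (at (g x))" "g differentiable (at x)" if "x \<in> S" for x
    using Suc.prems that assms(3) unfolding Ck_on.simps by blast+
  show ?case
  proof (rule Ck_on_SucI[where f'="\<lambda>x v. \<Sum>b\<in>Basis. (frechet_derivative g (at x) v \<bullet> b) *\<^sub>R frechet_derivative f (at (g x)) b"])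
    fix x assume x: "x \<in> S"
    have "((\<lambda>x. f (g x)) has_derivative (\<lambda>v. frechet_derivative f (at (g x)) (frechet_derivative g (at x) v))) (at x)"
      by (rule has_derivative_compose) (use d[OF x] in \<open>simp_all only: frechet_derivative_works\<close>)
    then show "((\<lambda>x. f (g x)) has_derivative (\<lambda>v. \<Sum>b\<in>Basis. (frechet_derivative g (at x) v \<bullet> b) *\<^sub>R frechet_derivative f (at (g x)) b)) (at x)"
      by (subst frechet_derivative_euclidean[OF d(1)[OF x], symmetric])
  next
    show "Ck_on k S (\<lambda>x. \<Sum>b\<in>Basis. (frechet_derivative g (at x) v \<bullet> b) *\<^sub>R frechet_derivative f (at (g x)) b)" for v
    proof (intro Ck_on_sum Ck_on_bilinear[OF bounded_bilinear_scaleR] assms)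
      show "Ck_on k S (\<lambda>x. frechet_derivative g (at x) v \<bullet> b)" for b
        using Suc.prems by (intro Ck_on_bounded_linear[OF bounded_linear_inner_left] assms) auto
      show "Ck_on k S (\<lambda>x. frechet_derivative f (at (g x)) b)" for b
        using Suc.prems Ck_on_pred[OF Suc.prems(2)] by (intro Suc.IH) auto
    qed
  qed (fact assms(1))
qed

lemma Ck_on_id: "open S \<Longrightarrow> Ck_on k S (\<lambda>x. x)"
  by (cases k) (auto intro!: Ck_on_SucI[where f'="\<lambda>x v. v"] Ck_on_const)

lemma Ck_on_inverse:
  "open (S::real set) \<Longrightarrow> 0 \<notin> S \<Longrightarrow> Ck_on k S (\<lambda>x. inverse x)"
proof (induction k)
  case 0
  then show ?case by (auto intro!: continuous_intros)
next
  case (Suc k)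
  show ?case
  proof (rule Ck_on_SucI[where f'="\<lambda>x v. v * (- (inverse x * inverse x))"])
    fix x assume "x \<in> S"
    then show "(inverse has_derivative (\<lambda>v. v * (- (inverse x * inverse x)))) (at x)"
      using Suc.prems by (auto intro!: derivative_eq_intros)
  next
    show "Ck_on k S (\<lambda>x. v * (- (inverse x * inverse x)))" for v
      using Suc by (intro Ck_on_bounded_linear[OF bounded_linear_mult_right]
          Ck_on_bounded_linear[OF bounded_linear_minus[OF bounded_linear_ident]]
          Ck_on_bilinear[OF bounded_bilinear_mult]) auto
  qed (use Suc in auto)
qed

lemma smooth_on_cong:
  "open S \<Longrightarrow> (\<And>x. x \<in> S \<Longrightarrow> f x = g x) \<Longrightarrow> smooth_on S f \<longleftrightarrow> smooth_on S g"
  unfolding smooth_on_def using Ck_on_cong by blast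

lemma smooth_on_derivative:
  "smooth_on S f \<Longrightarrow> smooth_on S (\<lambda>x. frechet_derivative f (at x) v)"
  unfolding smooth_on_def by (metis Ck_on.simps(2))

lemma smooth_on_differentiable: "smooth_on S f \<Longrightarrow> x \<in> S \<Longrightarrow> f differentiable (at x)"
  unfolding smooth_on_def by (metis Ck_on.simps(2))

lemma smooth_on_continuous: "smooth_on S f \<Longrightarrow> continuous_on S f"
  unfolding smooth_on_def by (metis Ck_on.simps(1))

lemma smooth_on_has_derivative:
  "smooth_on S f \<Longrightarrow> x \<in> S \<Longrightarrow> (f has_derivative frechet_derivative f (at x)) (at x)"
  using smooth_on_differentiable frechet_derivative_works by blast

lemma smooth_on_subset: "smooth_on S f \<Longrightarrow> T \<subseteq> S \<Longrightarrow> smooth_on T f"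
  unfolding smooth_on_def using Ck_on_subset by blast

lemma smooth_on_compose:
  fixes f :: "'b::euclidean_space \<Rightarrow> 'c::real_normed_vector" and g :: "'a::euclidean_space \<Rightarrow> 'b"
  assumes "smooth_on T f" "smooth_on S g" "open S" "open T" "\<And>x. x \<in> S \<Longrightarrow> g x \<in> T"
  shows "smooth_on S (\<lambda>x. f (g x))"
  using assms Ck_on_compose[of S T g] unfolding smooth_on_def by blast

lemma smooth_on_const: "open S \<Longrightarrow> smooth_on S (\<lambda>x. c)"
  by (simp add: smooth_on_def Ck_on_const)

lemma smooth_on_id: "open S \<Longrightarrow> smooth_on S (\<lambda>x. x)"
  by (simp add: smooth_on_def Ck_on_id)

lemma smooth_on_bounded_linear:
  "bounded_linear l \<Longrightarrow> smooth_on S f \<Longrightarrow> open S \<Longrightarrow> smooth_on S (\<lambda>x. l (f x))"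
  by (simp add: smooth_on_def Ck_on_bounded_linear)

lemma smooth_on_add:
  "open S \<Longrightarrow> smooth_on S f \<Longrightarrow> smooth_on S g \<Longrightarrow> smooth_on S (\<lambda>x. f x + g x)"
  by (simp add: smooth_on_def Ck_on_add)

lemma smooth_on_sum:
  "open S \<Longrightarrow> (\<And>i. i \<in> A \<Longrightarrow> smooth_on S (f i)) \<Longrightarrow> smooth_on S (\<lambda>x. \<Sum>i\<in>A. f i x)"
  by (simp add: smooth_on_def Ck_on_sum)

lemma smooth_on_minus: "open S \<Longrightarrow> smooth_on S f \<Longrightarrow> smooth_on S (\<lambda>x. - f x)"
  by (rule smooth_on_bounded_linear[OF bounded_linear_minus[OF bounded_linear_ident]])

lemma smooth_on_diff:
  "open S \<Longrightarrow> smooth_on S f \<Longrightarrow> smooth_on S g \<Longrightarrow> smooth_on S (\<lambda>x. f x - g x)"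
  using smooth_on_add[of S f "\<lambda>x. - g x"] by (simp add: smooth_on_minus)

lemma smooth_on_mult:
  fixes f g :: "'a::euclidean_space \<Rightarrow> real"
  shows "open S \<Longrightarrow> smooth_on S f \<Longrightarrow> smooth_on S g \<Longrightarrow> smooth_on S (\<lambda>x. f x * g x)"
  by (simp add: smooth_on_def Ck_on_bilinear[OF bounded_bilinear_mult])

lemma smooth_on_scaleR:
  "open S \<Longrightarrow> smooth_on S f \<Longrightarrow> smooth_on S g \<Longrightarrow> smooth_on S (\<lambda>x. f x *\<^sub>R g x)"
  by (simp add: smooth_on_def Ck_on_bilinear[OF bounded_bilinear_scaleR])

lemma smooth_on_inner:
  "open S \<Longrightarrow> smooth_on S f \<Longrightarrow> smooth_on S g \<Longrightarrow> smooth_on S (\<lambda>x. f x \<bullet> g x)"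
  by (simp add: smooth_on_def Ck_on_bilinear[OF bounded_bilinear_inner])

lemma smooth_on_vec_nth: "open S \<Longrightarrow> smooth_on S f \<Longrightarrow> smooth_on S (\<lambda>x. f x $ i)"
  by (rule smooth_on_bounded_linear[OF bounded_linear_vec_nth])

lemma smooth_on_vecI:
  fixes f :: "'a::euclidean_space \<Rightarrow> 'b::real_normed_vector^'n"
  assumes "open S" "\<And>i. smooth_on S (\<lambda>x. f x $ i)"
  shows "smooth_on S f"
proof -
  have b: "bounded_linear (\<lambda>y. axis i y :: 'b^'n)" for i
    by (rule bounded_linear_intro[where K=1])
       (auto simp: vec_eq_iff axis_def norm_vec_def L2_set_def if_distrib[of norm] if_distrib[of "\<lambda>x. x^2"] cong: if_cong)
  have "smooth_on S (\<lambda>x. \<Sum>i\<in>UNIV. axis i (f x $ i))"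
    using assms by (intro smooth_on_sum smooth_on_bounded_linear[OF b]) auto
  moreover have "(\<Sum>i\<in>UNIV. axis i (v $ i)) = v" for v :: "'b^'n"
    by (auto simp: vec_eq_iff axis_def sum.delta)
  ultimately show ?thesis by simp
qed

lemma smooth_on_matrix_vector_mult:
  "open S \<Longrightarrow> smooth_on S f \<Longrightarrow> smooth_on S (\<lambda>x. (A::real^'n^'m) *v f x)"
  by (rule smooth_on_bounded_linear[OF matrix_vector_mul_bounded_linear])

lemma smooth_on_inverse:
  fixes f :: "'a::euclidean_space \<Rightarrow> real"
  assumes "open S" "smooth_on S f" "\<And>x. x \<in> S \<Longrightarrow> f x \<noteq> 0"
  shows "smooth_on S (\<lambda>x. inverse (f x))"
  by (rule smooth_on_compose[where T="- {0}"])
     (use assms in \<open>auto simp: smooth_on_def intro!: Ck_on_inverse\<close>)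

lemma smooth_on_Pair:
  fixes f :: "'a::euclidean_space \<Rightarrow> 'b::real_normed_vector" and g :: "'a \<Rightarrow> 'c::real_normed_vector"
  assumes "open S" "smooth_on S f" "smooth_on S g"
  shows "smooth_on S (\<lambda>x. (f x, g x))"
proof -
  have "smooth_on S (\<lambda>x. (f x, 0) + (0, g x))"
    using assms by (intro smooth_on_add smooth_on_bounded_linear[where l="\<lambda>x. (x, 0)"]
        smooth_on_bounded_linear[where l="\<lambda>x. (0, x)"]) (auto intro!: bounded_linear_Pair bounded_linear_zero bounded_linear_ident)
  then show ?thesis by simp
qed

lemma smooth_on_fst: "open S \<Longrightarrow> smooth_on S f \<Longrightarrow> smooth_on S (\<lambda>x. fst (f x))"
  by (rule smooth_on_bounded_linear[OF bounded_linear_fst])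

lemma smooth_on_snd: "open S \<Longrightarrow> smooth_on S f \<Longrightarrow> smooth_on S (\<lambda>x. snd (f x))"
  by (rule smooth_on_bounded_linear[OF bounded_linear_snd])

section \<open>Partial derivatives in coordinates\<close>

lemma pd_smooth_on: "smooth_on S f \<Longrightarrow> smooth_on S (pd k f)"
  unfolding pd_def by (rule smooth_on_derivative)

lemma pd_cong:
  assumes "open S" "u \<in> S" "\<And>x. x \<in> S \<Longrightarrow> f x = g x"
  shows "pd k f u = pd k g u"
proof -
  have "(f has_derivative D) (at u) \<longleftrightarrow> (g has_derivative D) (at u)" for D
    using has_derivative_transform_within_open[OF _ assms(1,2)] assms(3) by metis
  then show ?thesis by (simp add: pd_def frechet_derivative_def)
qed

lemma pd_eqI: "(f has_derivative D) (at u) \<Longrightarrow> pd k f u = D (axis k 1)"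
  unfolding pd_def using frechet_derivative_at by metis

lemma has_derivative_pd:
  assumes "smooth_on S f" "u \<in> S"
  shows "(f has_derivative (\<lambda>v. \<Sum>k\<in>UNIV. pd k f u * v $ k)) (at u)"
proof -
  have d: "(f has_derivative frechet_derivative f (at u)) (at u)"
    using smooth_on_has_derivative assms by blast
  then have l: "linear (frechet_derivative f (at u))" by (rule has_derivative_linear)
  have "frechet_derivative f (at u) v = (\<Sum>k\<in>UNIV. pd k f u * v $ k)" for v
  proof -
    have "frechet_derivative f (at u) v = frechet_derivative f (at u) (\<Sum>k\<in>UNIV. v $ k *\<^sub>R axis k 1)"
      by (simp add: basis_expansion scalar_mult_eq_scaleR[symmetric])
    then show ?thesis by (simp add: linear_sum[OF l] linear_cmul[OF l] pd_def mult.commute)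
  qed
  then have "frechet_derivative f (at u) = (\<lambda>v. \<Sum>k\<in>UNIV. pd k f u * v $ k)" by (rule ext)
  then show ?thesis using d by simp
qed


section \<open>Parameter integrals and symmetry of second derivatives\<close>

text \<open>\<open>leibniz_rule\<close> asks for a convex domain and for a derivative that is
  jointly continuous as a bounded linear map. Hence the ball around z, the packing into
  \<open>Blinfun\<close>, and the check of continuity on basis vectors.\<close>

lemma parameter_integral_has_derivative:
  fixes H :: "'a::euclidean_space \<times> real \<Rightarrow> real"
  assumes "open S" "open D" "S \<times> {a..b} \<subseteq> D" "smooth_on D H" "z \<in> S"
  shows "((\<lambda>z. integral {a..b} (\<lambda>s. H (z, s))) has_derivative
     (\<lambda>v. integral {a..b} (\<lambda>s. frechet_derivative H (at (z, s)) (v, 0)))) (at z)"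
proof -
  obtain e where e: "e > 0" "ball z e \<subseteq> S"
    using assms(1,5) open_contains_ball by blast
  define B where "B = ball z e"
  define F where "F x s = Blinfun (\<lambda>v. frechet_derivative H (at (x, s)) (v, 0))" for x s
  have BD: "(x, s) \<in> D" if "x \<in> B" "s \<in> {a..b}" for x s
    using e that assms(3) unfolding B_def by blast
  have F: "blinfun_apply (F x s) = (\<lambda>v. frechet_derivative H (at (x, s)) (v, 0))" if "x \<in> B" "s \<in> {a..b}" for x s
  proof -
    have "bounded_linear (frechet_derivative H (at (x, s)))"
      using smooth_on_has_derivative[OF assms(4) BD[OF that]] has_derivative_bounded_linear by blast
    then have "bounded_linear (\<lambda>v. frechet_derivative H (at (x, s)) (v, 0))"
      by (rule bounded_linear_compose) (auto intro!: bounded_linear_Pair bounded_linear_zero bounded_linear_ident)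
    then show ?thesis unfolding F_def by (rule bounded_linear_Blinfun_apply)
  qed
  have cont: "continuous_on (B \<times> {a..b}) (\<lambda>(x, t). F x t)"
  proof (rule continuous_on_blinfun_componentwise)
    fix i :: 'a assume "i \<in> Basis"
    have "continuous_on (B \<times> {a..b}) (\<lambda>y. frechet_derivative H (at y) (i, 0))"
      by (rule continuous_on_subset[OF smooth_on_continuous[OF smooth_on_derivative[OF assms(4)]]])
         (use BD in auto)
    then show "continuous_on (B \<times> {a..b}) (\<lambda>x. blinfun_apply (case x of (x, t) \<Rightarrow> F x t) i)"
      by (rule continuous_on_eq) (auto simp: F)
  qed
  have "((\<lambda>x. integral (cbox a b) (\<lambda>s. H (x, s))) has_derivative blinfun_apply (integral (cbox a b) (F z))) (at z within B)"
  proof (rule leibniz_rule)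
    fix x t assume xt: "x \<in> B" "t \<in> cbox a b"
    have "((\<lambda>x. H (x, t)) has_derivative (\<lambda>v. frechet_derivative H (at (x, t)) (v, 0))) (at x)"
      by (rule has_derivative_compose[where f="\<lambda>x. (x, t)"])
         (use xt BD in \<open>auto intro!: derivative_eq_intros smooth_on_has_derivative[OF assms(4)]\<close>)
    then show "((\<lambda>x. H (x, t)) has_derivative blinfun_apply (F x t)) (at x within B)"
      using xt by (simp add: F has_derivative_at_withinI)
  next
    fix x assume x: "x \<in> B"
    have "continuous_on {a..b} (\<lambda>s. H (x, s))"
      by (rule continuous_on_compose2[OF smooth_on_continuous[OF assms(4)]])
         (use BD[OF x] in \<open>auto intro!: continuous_intros\<close>)
    then show "(\<lambda>s. H (x, s)) integrable_on cbox a b"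
      by (simp add: integrable_continuous_real)
  next
    show "continuous_on (B \<times> cbox a b) (\<lambda>(x, t). F x t)" using cont by simp
  next
    show "z \<in> B" "convex B" unfolding B_def using e(1) by (rule centre_in_ball[THEN iffD2]) (rule convex_ball)
  qed
  moreover have "at z within B = at z"
    unfolding B_def by (rule at_within_open) (use e in auto)
  moreover have "blinfun_apply (integral (cbox a b) (F z)) = (\<lambda>v. integral {a..b} (\<lambda>s. frechet_derivative H (at (z, s)) (v, 0)))"
  proof
    fix v
    have zB: "z \<in> B" using e by (simp add: B_def)
    have "continuous_on {a..b} (\<lambda>s. case (z, s) of (x, t) \<Rightarrow> F x t)"
      by (rule continuous_on_compose2[OF cont]) (use zB in \<open>auto intro!: continuous_on_Pair continuous_on_const continuous_on_id\<close>)
    then have "F z integrable_on {a..b}" by (simp add: integrable_continuous_real)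
    then have "blinfun_apply (integral (cbox a b) (F z)) v = integral {a..b} (\<lambda>s. F z s v)"
      by (simp add: blinfun_apply_integral)
    also have "\<dots> = integral {a..b} (\<lambda>s. frechet_derivative H (at (z, s)) (v, 0))"
      by (rule integral_cong) (simp add: F[OF zB])
    finally show "blinfun_apply (integral (cbox a b) (F z)) v = integral {a..b} (\<lambda>s. frechet_derivative H (at (z, s)) (v, 0))" .
  qed
  ultimately show ?thesis by simp
qed

text \<open>Integrals of this shape are closed under differentiation: a derivative is again such an
  integral, with \<open>H\<close> replaced by one of its directional derivatives. The induction
  therefore runs over all \<open>H\<close> at once.\<close>

lemma smooth_on_parameter_integral:
  fixes H :: "'a::euclidean_space \<times> real \<Rightarrow> real"
  assumes "open S" "open D" "S \<times> {a..b} \<subseteq> D" "smooth_on D H"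
  shows "smooth_on S (\<lambda>z. integral {a..b} (\<lambda>s. H (z, s)))"
proof -
  have "smooth_on D H \<Longrightarrow> Ck_on k S (\<lambda>z. integral {a..b} (\<lambda>s. H (z, s)))" for k
  proof (induction k arbitrary: H)
    case 0
    show ?case
      unfolding Ck_on.simps
      by (rule has_derivative_continuous_on[OF has_derivative_at_withinI[OF parameter_integral_has_derivative[OF assms(1-3) 0]]])
  next
    case (Suc k)
    show ?case
      by (rule Ck_on_SucI[OF assms(1) parameter_integral_has_derivative[OF assms(1-3) Suc.prems]])
         (auto intro: Suc.IH[OF smooth_on_derivative[OF Suc.prems]])
  qed
  then show ?thesis using assms(4) by (simp add: smooth_on_def)
qed

text \<open>Schwarz's theorem with hypotheses on separate partial derivatives only, so that it also
  covers a functional along a two-parameter variation. The mean value theorem, applied twice in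
  either order to the second difference over a small square, gives the area times a value of
  \<open>P'\<close> and the area times a value of \<open>Q'\<close>; continuity at the corner does
  the rest.\<close>

lemma mixed_partials_eq:
  fixes \<phi> P Q P' Q' :: "real \<Rightarrow> real \<Rightarrow> real"
  assumes r: "r > 0"
    and d: "\<And>s t. \<bar>s\<bar> < r \<Longrightarrow> \<bar>t\<bar> < r \<Longrightarrow> ((\<lambda>s. \<phi> s t) has_real_derivative P s t) (at s)"
      "\<And>s t. \<bar>s\<bar> < r \<Longrightarrow> \<bar>t\<bar> < r \<Longrightarrow> ((\<lambda>t. \<phi> s t) has_real_derivative Q s t) (at t)"
      "\<And>s t. \<bar>s\<bar> < r \<Longrightarrow> \<bar>t\<bar> < r \<Longrightarrow> ((\<lambda>t. P s t) has_real_derivative P' s t) (at t)"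
      "\<And>s t. \<bar>s\<bar> < r \<Longrightarrow> \<bar>t\<bar> < r \<Longrightarrow> ((\<lambda>s. Q s t) has_real_derivative Q' s t) (at s)"
    and c: "isCont (\<lambda>(s, t). P' s t) (0, 0)" "isCont (\<lambda>(s, t). Q' s t) (0, 0)"
  shows "P' 0 0 = Q' 0 0"
proof (rule ccontr)
  assume ne: "P' 0 0 \<noteq> Q' 0 0"
  \<comment> \<open>Half of the supposed gap, so that values within \<open>e\<close> of the two
    limits cannot coincide.\<close>
  define e where "e = \<bar>P' 0 0 - Q' 0 0\<bar> / 2"
  have e: "e > 0" using ne by (simp add: e_def)
  obtain d1 where d1: "d1 > 0" "\<And>y. dist y (0, 0) < d1 \<Longrightarrow> dist (case y of (s, t) \<Rightarrow> P' s t) (P' 0 0) < e"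
    using c(1) e unfolding continuous_at_eps_delta by (metis (mono_tags, lifting) case_prod_conv)
  obtain d2 where d2: "d2 > 0" "\<And>y. dist y (0, 0) < d2 \<Longrightarrow> dist (case y of (s, t) \<Rightarrow> Q' s t) (Q' 0 0) < e"
    using c(2) e unfolding continuous_at_eps_delta by (metis (mono_tags, lifting) case_prod_conv)
  \<comment> \<open>Points of the open square of side h are at distance less than 2 h from the
    corner; division by three keeps 2 h below both radii.\<close>
  define h where "h = min r (min d1 d2) / 3"
  have h: "0 < h" "h < r" "2 * h < d1" "2 * h < d2" using r d1 d2 by (auto simp: h_def)
  have near: "dist (s, t) (0, 0) < d1" "dist (s, t) (0, 0) < d2" if "0 < s" "s < h" "0 < t" "t < h" for s t
  proof -
    have "dist (s, t) (0, 0) \<le> \<bar>s\<bar> + \<bar>t\<bar>"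
      using sqrt_sum_squares_le_sum_abs[of s t] by (simp add: dist_Pair_Pair)
    then show "dist (s, t) (0, 0) < d1" "dist (s, t) (0, 0) < d2" using that h by linarith+
  qed
  let ?\<Delta> = "\<phi> h h - \<phi> h 0 - \<phi> 0 h + \<phi> 0 0"
  obtain s t where st: "0 < s" "s < h" "0 < t" "t < h" "?\<Delta> = h * (h * P' s t)"
  proof -
    have "\<exists>s. 0 < s \<and> s < h \<and> (\<phi> h h - \<phi> h 0) - (\<phi> 0 h - \<phi> 0 0) = (h - 0) * (P s h - P s 0)"
      by (rule MVT2[where f="\<lambda>s. \<phi> s h - \<phi> s 0"]) (use h d in \<open>auto intro!: DERIV_diff\<close>)
    then obtain s where s: "0 < s" "s < h" "?\<Delta> = h * (P s h - P s 0)" by auto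
    have "\<exists>t. 0 < t \<and> t < h \<and> P s h - P s 0 = (h - 0) * P' s t"
      by (rule MVT2) (use h d s in auto)
    then show thesis using s that by auto
  qed
  obtain s' t' where st': "0 < s'" "s' < h" "0 < t'" "t' < h" "?\<Delta> = h * (h * Q' s' t')"
  proof -
    have "\<exists>t. 0 < t \<and> t < h \<and> (\<phi> h h - \<phi> 0 h) - (\<phi> h 0 - \<phi> 0 0) = (h - 0) * (Q h t - Q 0 t)"
      by (rule MVT2[where f="\<lambda>t. \<phi> h t - \<phi> 0 t"]) (use h d in \<open>auto intro!: DERIV_diff\<close>)
    then obtain t where t: "0 < t" "t < h" "?\<Delta> = h * (Q h t - Q 0 t)" by (auto simp: algebra_simps)
    have "\<exists>s. 0 < s \<and> s < h \<and> Q h t - Q 0 t = (h - 0) * Q' s t"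
      by (rule MVT2[where f="\<lambda>s. Q s t"]) (use h d t in auto)
    then show thesis using t that by auto
  qed
  have "P' s t = Q' s' t'" using st(5) st'(5) h by simp
  moreover have "dist (P' s t) (P' 0 0) < e" using d1(2)[OF near(1)[OF st(1-4)]] by simp
  moreover have "dist (Q' s' t') (Q' 0 0) < e" using d2(2)[OF near(2)[OF st'(1-4)]] by simp
  ultimately show False unfolding e_def dist_real_def by (simp add: abs_if split: if_splits)
qed

lemma smooth_on_line_derivative:
  fixes f :: "'a::euclidean_space \<Rightarrow> real"
  assumes "smooth_on S f" "y + c *\<^sub>R v \<in> S"
  shows "((\<lambda>s. f (y + s *\<^sub>R v)) has_real_derivative frechet_derivative f (at (y + c *\<^sub>R v)) v) (at c)"
proof -
  have "linear (frechet_derivative f (at (y + c *\<^sub>R v)))"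
    by (intro linear_frechet_derivative smooth_on_differentiable[OF assms])
  moreover have "((\<lambda>s. f (y + s *\<^sub>R v)) has_derivative (\<lambda>s. frechet_derivative f (at (y + c *\<^sub>R v)) (s *\<^sub>R v))) (at c)"
    by (rule has_derivative_compose[where f="\<lambda>s. y + s *\<^sub>R v"])
       (auto intro!: derivative_eq_intros smooth_on_has_derivative[OF assms])
  ultimately show ?thesis
    by (simp add: linear_cmul has_field_derivative_def mult_commute_abs)
qed

lemma second_derivative_symmetric:
  fixes f :: "'a::euclidean_space \<Rightarrow> real"
  assumes "open S" "smooth_on S f" "x \<in> S"
  shows "frechet_derivative (\<lambda>z. frechet_derivative f (at z) v) (at x) w
       = frechet_derivative (\<lambda>z. frechet_derivative f (at z) w) (at x) v"
proof -
  obtain e where e: "e > 0" "ball x e \<subseteq> S"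
    using assms(1,3) open_contains_ball by blast
  \<comment> \<open>The summand 1 keeps the denominator positive when v and w both vanish.\<close>
  define r where "r = e / (norm v + norm w + 1)"
  have r: "r > 0" using e by (simp add: r_def add_nonneg_pos)
  have inS: "x + s *\<^sub>R v + t *\<^sub>R w \<in> S" if "\<bar>s\<bar> < r" "\<bar>t\<bar> < r" for s t
  proof -
    have "norm (s *\<^sub>R v + t *\<^sub>R w) \<le> \<bar>s\<bar> * norm v + \<bar>t\<bar> * norm w"
      by (metis norm_triangle_ineq norm_scaleR)
    also have "\<dots> \<le> r * norm v + r * norm w"
      using that by (intro add_mono mult_right_mono) auto
    also have "\<dots> < r * (norm v + norm w + 1)" using r by (simp add: algebra_simps)
    also have "\<dots> = e" by (simp add: r_def add_nonneg_pos less_imp_neq[THEN not_sym])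
    finally have "dist (x + s *\<^sub>R v + t *\<^sub>R w) x < e"
      by (simp add: dist_norm add.assoc)
    then have "dist x (x + s *\<^sub>R v + t *\<^sub>R w) < e"
      by (simp only: dist_commute)
    then show ?thesis using e by auto
  qed
  have d1: "((\<lambda>s. k (x + s *\<^sub>R v + t *\<^sub>R w)) has_real_derivative frechet_derivative k (at (x + s *\<^sub>R v + t *\<^sub>R w)) v) (at s)"
    if "\<bar>s\<bar> < r" "\<bar>t\<bar> < r" "smooth_on S k" for s t k
    using smooth_on_line_derivative[OF that(3), of "x + t *\<^sub>R w" s v] inS[OF that(1,2)]
    by (simp add: add.commute add.left_commute)
  have d2: "((\<lambda>t. k (x + s *\<^sub>R v + t *\<^sub>R w)) has_real_derivative frechet_derivative k (at (x + s *\<^sub>R v + t *\<^sub>R w)) w) (at t)"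
    if "\<bar>s\<bar> < r" "\<bar>t\<bar> < r" "smooth_on S k" for s t k
    using smooth_on_line_derivative[OF that(3), of "x + s *\<^sub>R v" t w] inS[OF that(1,2)] by simp
  have c: "isCont (\<lambda>(s, t). k (x + s *\<^sub>R v + t *\<^sub>R w)) (0, 0)" if "smooth_on S k" for k :: "'a \<Rightarrow> real"
  proof -
    have a: "isCont (\<lambda>y::real\<times>real. x + fst y *\<^sub>R v + snd y *\<^sub>R w) (0, 0)"
      by (intro continuous_add continuous_scaleR continuous_const continuous_fst continuous_snd continuous_ident)
    have "isCont k x"
      using smooth_on_continuous[OF that] assms(1,3) by (simp add: continuous_on_eq_continuous_at)
    then show ?thesis using isCont_o2[OF a, of k] by (simp add: case_prod_unfold)
  qed
  note s = smooth_on_derivative[OF assms(2)]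
  have "frechet_derivative (\<lambda>z. frechet_derivative f (at z) v) (at (x + 0 *\<^sub>R v + 0 *\<^sub>R w)) w
       = frechet_derivative (\<lambda>z. frechet_derivative f (at z) w) (at (x + 0 *\<^sub>R v + 0 *\<^sub>R w)) v"
    by (rule mixed_partials_eq[OF r d1 d2 d2 d1 c[OF smooth_on_derivative[OF s]] c[OF smooth_on_derivative[OF s]]])
       (auto intro: assms(2) s)
  then show ?thesis by simp
qed

lemma pd_commute: "open S \<Longrightarrow> smooth_on S f \<Longrightarrow> x \<in> S \<Longrightarrow> pd i (pd j f) x = pd j (pd i f) x"
  unfolding pd_def by (rule second_derivative_symmetric)


section \<open>Cut-off functions\<close>

definition flat :: "nat \<Rightarrow> real \<Rightarrow> real" where
  "flat n x = (if x > 0 then inverse x ^ n * exp (- inverse x) else 0)"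

lemma flat_tendsto_0: "((\<lambda>x. inverse x ^ n * exp (- inverse x)) \<longlongrightarrow> 0) (at_right (0::real))"
  using filterlim_compose[OF tendsto_power_div_exp_0[of n] filterlim_inverse_at_top_right]
  by (simp add: exp_minus divide_inverse)

lemma flat_has_derivative: "(flat n has_real_derivative flat (n + 2) x - real n * flat (n + 1) x) (at x)"
proof (cases x "0::real" rule: linorder_cases)
  case less
  have "((\<lambda>x. 0) has_real_derivative 0) (at x)" by simp
  then have "(flat n has_real_derivative 0) (at x)"
    by (rule has_field_derivative_transform_within_open[where S="{..<0}"]) (use less in \<open>auto simp: flat_def\<close>)
  then show ?thesis using less by (simp add: flat_def)
next
  case equal
  \<comment> \<open>From the right the difference quotient is the same expression with exponent n +
    1, which tends to 0 by \<open>flat_tendsto_0\<close>; from the left it is identically 0.\<close>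
  have "((\<lambda>y. (flat n y - flat n 0) / (y - 0)) \<longlongrightarrow> 0) (at 0)"
  proof (rule filterlim_split_at)
    have "\<forall>\<^sub>F y in at_left (0::real). 0 = (flat n y - flat n 0) / (y - 0)"
      by (auto simp: eventually_at_left[of "-1"] flat_def intro!: exI[of _ "-1"])
    then show "((\<lambda>y. (flat n y - flat n 0) / (y - 0)) \<longlongrightarrow> 0) (at_left 0)"
      by (rule Lim_transform_eventually[OF tendsto_const])
    have "\<forall>\<^sub>F y in at_right (0::real). inverse y ^ (n + 1) * exp (- inverse y) = (flat n y - flat n 0) / (y - 0)"
      by (auto simp: eventually_at_right[of _ 1] flat_def field_simps intro!: exI[of _ 1])
    then show "((\<lambda>y. (flat n y - flat n 0) / (y - 0)) \<longlongrightarrow> 0) (at_right 0)"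
      by (rule Lim_transform_eventually[OF flat_tendsto_0])
  qed
  then show ?thesis using equal by (simp add: has_field_derivative_iff flat_def)
next
  case greater
  have "((\<lambda>x. inverse x ^ n * exp (- inverse x)) has_real_derivative
      inverse x ^ n * (exp (- inverse x) * (inverse x * inverse x))
      + real n * (inverse x ^ (n - 1) * (- (inverse x * inverse x))) * exp (- inverse x)) (at x)"
    using greater by (auto intro!: derivative_eq_intros)
  moreover have "inverse x ^ n * (exp (- inverse x) * (inverse x * inverse x))
      + real n * (inverse x ^ (n - 1) * (- (inverse x * inverse x))) * exp (- inverse x)
      = flat (n + 2) x - real n * flat (n + 1) x"
    using greater by (cases n) (simp_all add: flat_def algebra_simps)
  ultimately have "((\<lambda>x. inverse x ^ n * exp (- inverse x)) has_real_derivative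
      flat (n + 2) x - real n * flat (n + 1) x) (at x)"
    by (simp only:)
  then show ?thesis
    by (rule has_field_derivative_transform_within_open[where S="{0<..}"]) (use greater in \<open>auto simp: flat_def\<close>)
qed

lemma smooth_on_flat: "smooth_on UNIV (flat n)"
proof -
  have "Ck_on k UNIV (flat n)" for k
  proof (induction k arbitrary: n)
    case 0
    have "isCont (flat n) x" for x using flat_has_derivative DERIV_isCont by blast
    then show ?case by (simp add: continuous_at_imp_continuous_on)
  next
    case (Suc k)
    have "Ck_on k UNIV (\<lambda>x. v * (flat (n + 2) x + (- real n) * flat (n + 1) x))" for v
      by (intro Ck_on_bounded_linear[OF bounded_linear_mult_right] Ck_on_add Suc.IH open_UNIV)
    then show ?case
      using flat_has_derivative[of n]
      by (intro Ck_on_SucI[where f'="\<lambda>x v. v * (flat (n + 2) x + (- real n) * flat (n + 1) x)"])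
         (auto simp: has_field_derivative_def mult_commute_abs)
  qed
  then show ?thesis by (simp add: smooth_on_def)
qed

definition smooth_step :: "real \<Rightarrow> real" where
  "smooth_step x = flat 0 x * inverse (flat 0 x + flat 0 (1 - x))"

lemma smooth_step_denominator: "flat 0 x + flat 0 (1 - x) > 0"
  by (auto simp: flat_def add_pos_pos)

lemma smooth_step_smooth: "smooth_on UNIV smooth_step"
proof -
  have "smooth_on UNIV (\<lambda>x::real. flat 0 (1 - x))"
    by (rule smooth_on_compose[OF smooth_on_flat]) (auto intro!: smooth_on_diff smooth_on_const smooth_on_id)
  then have "smooth_on UNIV (\<lambda>x. flat 0 x * inverse (flat 0 x + flat 0 (1 - x)))"
    using smooth_step_denominator
    by (intro smooth_on_mult smooth_on_inverse smooth_on_add smooth_on_flat) (auto simp: less_imp_neq[THEN not_sym])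
  then show ?thesis by (simp add: smooth_step_def[abs_def])
qed

lemma smooth_step_0: "x \<le> 0 \<Longrightarrow> smooth_step x = 0"
  by (simp add: smooth_step_def flat_def)

lemma smooth_step_1: "x \<ge> 1 \<Longrightarrow> smooth_step x = 1"
  by (simp add: smooth_step_def flat_def)

lemma smooth_step_bounds: "0 \<le> smooth_step x" "smooth_step x \<le> 1"
proof -
  have "flat 0 x \<ge> 0" "flat 0 (1 - x) \<ge> 0" by (auto simp: flat_def)
  then show "0 \<le> smooth_step x" "smooth_step x \<le> 1"
    using smooth_step_denominator[of x] by (auto simp: smooth_step_def field_simps)
qed

definition plateau :: "real \<Rightarrow> real" where
  "plateau x = smooth_step (2 + x) * smooth_step (2 - x)"

lemma plateau_smooth: "smooth_on UNIV plateau"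
proof -
  have "smooth_on UNIV (\<lambda>x. smooth_step (2 + x) * smooth_step (2 - x))"
    by (intro smooth_on_mult smooth_on_compose[OF smooth_step_smooth] smooth_on_add smooth_on_diff
        smooth_on_const smooth_on_id) auto
  then show ?thesis by (simp add: plateau_def[abs_def])
qed

lemma plateau_1: "\<bar>x\<bar> \<le> 1 \<Longrightarrow> plateau x = 1"
  by (simp add: plateau_def smooth_step_1)

lemma plateau_0: "\<bar>x\<bar> \<ge> 2 \<Longrightarrow> plateau x = 0"
  by (auto simp: plateau_def smooth_step_0 abs_if split: if_splits)

lemma plateau_bounds: "0 \<le> plateau x" "plateau x \<le> 1"
  by (auto simp: plateau_def smooth_step_bounds mult_le_one)

lemma smooth_on_affine_compose:
  fixes f :: "real \<Rightarrow> 'b::real_normed_vector"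
  shows "smooth_on UNIV f \<Longrightarrow> smooth_on UNIV (\<lambda>x. f (a * x + b))"
  by (rule smooth_on_compose) (auto intro!: smooth_on_add smooth_on_mult smooth_on_const smooth_on_id)

text \<open>The fundamental lemma of the calculus of variations at one point, with test functions
  confined to distance \<open>d\<close>; this makes it usable under support restrictions. If C were
  positive at \<open>x0\<close>, a bump placed where C is positive would give a nonnegative
  continuous integrand with integral 0 that is not 0 at \<open>x0\<close>. The other sign is the
  same argument for - C.\<close>

lemma fundamental_lemma:
  fixes C :: "real \<Rightarrow> real"
  assumes "d > (0::real)" "continuous_on UNIV C"
    and "\<And>\<phi>. smooth_on UNIV \<phi> \<Longrightarrow> (\<And>x. \<bar>x - x0\<bar> > d \<Longrightarrow> \<phi> x = 0) \<Longrightarrow> integral UNIV (\<lambda>x. \<phi> x * C x) = 0"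
  shows "C x0 = 0"
proof -
  have nonpos: "C x0 \<le> 0"
    if c: "continuous_on UNIV C"
    and i: "\<And>\<phi>. smooth_on UNIV \<phi> \<Longrightarrow> (\<And>x. \<bar>x - x0\<bar> > d \<Longrightarrow> \<phi> x = 0) \<Longrightarrow> integral UNIV (\<lambda>x. \<phi> x * C x) = 0"
    for C :: "real \<Rightarrow> real"
  proof (rule ccontr)
    assume "\<not> C x0 \<le> 0"
    then have pos: "C x0 > 0" by simp
    have "isCont C x0" using c by (simp add: continuous_on_eq_continuous_at)
    then obtain \<delta> where \<delta>: "\<delta> > 0" "\<And>x. dist x x0 < \<delta> \<Longrightarrow> dist (C x) (C x0) < C x0"
      using pos unfolding continuous_at_eps_delta by blast
    \<comment> \<open>The bump will have half-width 2 q, which has to stay below \<delta> for the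
      sign of C and below d for the support condition.\<close>
    define q where "q = min \<delta> d / 3"
    have q: "q > 0" "2 * q < \<delta>" "2 * q < d" using \<delta> assms(1) by (auto simp: q_def)
    define \<phi> where "\<phi> x = plateau ((1 / q) * x + (- x0 / q))" for x
    have \<phi>eq: "\<phi> x = plateau ((x - x0) / q)" for x using q by (simp add: \<phi>_def diff_divide_distrib)
    have sm: "smooth_on UNIV \<phi>" unfolding \<phi>_def by (rule smooth_on_affine_compose[OF plateau_smooth])
    have z: "\<phi> x = 0" if "\<bar>x - x0\<bar> \<ge> 2 * q" for x
      unfolding \<phi>eq using that q by (intro plateau_0) (simp add: field_simps)
    have ge: "0 \<le> \<phi> x * C x" for x
    proof (cases "\<bar>x - x0\<bar> \<ge> 2 * q")
      case False
      then have "dist (C x) (C x0) < C x0" using q by (intro \<delta>) (auto simp: dist_real_def)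
      then have "C x > 0" by (auto simp: dist_real_def abs_if split: if_splits)
      then show ?thesis using plateau_bounds by (simp add: \<phi>eq)
    qed (simp add: z)
    have cont: "continuous_on {x0 - 2 * q..x0 + 2 * q} (\<lambda>x. \<phi> x * C x)"
      by (intro continuous_on_mult continuous_on_subset[OF smooth_on_continuous[OF sm]] continuous_on_subset[OF c]) auto
    have "integral UNIV (\<lambda>x. \<phi> x * C x) = integral UNIV (\<lambda>x. if x \<in> {x0 - 2 * q..x0 + 2 * q} then \<phi> x * C x else 0)"
      by (rule integral_cong) (auto simp: z)
    then have "integral {x0 - 2 * q..x0 + 2 * q} (\<lambda>x. \<phi> x * C x) = integral UNIV (\<lambda>x. \<phi> x * C x)"
      by (simp only: integral_restrict_UNIV)
    also have "\<dots> = 0" using q z by (intro i sm) auto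
    finally have "\<phi> x0 * C x0 = 0"
      using integral_eq_0_iff[OF cont] ge q by simp
    then show False using pos by (simp add: \<phi>eq plateau_1)
  qed
  have "- C x0 \<le> 0"
    by (rule nonpos[of "\<lambda>x. - C x"]) (use assms in \<open>auto intro: continuous_on_minus\<close>)
  with nonpos[OF assms(2,3)] show ?thesis by simp
qed


section \<open>Continuous functions of compact support and the inverse of the derivative\<close>

text \<open>The integrands of the file: \<open>integral UNIV\<close> is additive on this class, and
  \<open>dinv\<close> of a member is differentiable everywhere. The class is not stable under
  \<open>dinv\<close>, whose values far out are plus or minus half of the total integral, but it is
  stable under products with such continuous functions.\<close>

definition cont_cs :: "(real \<Rightarrow> real) \<Rightarrow> bool" where
  "cont_cs f \<longleftrightarrow> continuous_on UNIV f \<and> (\<exists>R. \<forall>x. \<bar>x\<bar> > R \<longrightarrow> f x = 0)"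

lemma cont_csI: "continuous_on UNIV f \<Longrightarrow> (\<And>x. \<bar>x\<bar> > R \<Longrightarrow> f x = 0) \<Longrightarrow> cont_cs f"
  unfolding cont_cs_def by blast

lemma cont_csE:
  assumes "cont_cs f"
  obtains R where "R > 0" "\<And>x. \<bar>x\<bar> > R \<Longrightarrow> f x = 0" "continuous_on UNIV f"
proof -
  obtain R where "\<forall>x. \<bar>x\<bar> > R \<longrightarrow> f x = 0" using assms by (auto simp: cont_cs_def)
  then show thesis using that[of "\<bar>R\<bar> + 1"] assms by (auto simp: cont_cs_def)
qed

lemma cont_cs_mult_left:
  assumes "continuous_on UNIV c" "cont_cs f"
  shows "cont_cs (\<lambda>x. c x * f x)"
proof (rule cont_csE[OF assms(2)])
  fix R assume "\<And>x. \<bar>x\<bar> > R \<Longrightarrow> f x = 0" "continuous_on UNIV f"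
  then show ?thesis using assms(1) by (intro cont_csI[where R=R] continuous_on_mult) auto
qed

lemma cont_cs_mult_right: "continuous_on UNIV c \<Longrightarrow> cont_cs f \<Longrightarrow> cont_cs (\<lambda>x. f x * c x)"
  using cont_cs_mult_left[of c f] by (simp add: mult.commute)

lemma cont_cs_cmult: "cont_cs f \<Longrightarrow> cont_cs (\<lambda>x. c * f x)"
  by (rule cont_cs_mult_left) auto

lemma cont_cs_zero: "cont_cs (\<lambda>x. 0)"
  by (rule cont_csI) auto

lemma cont_cs_add:
  assumes "cont_cs f" "cont_cs g"
  shows "cont_cs (\<lambda>x. f x + g x)"
proof (rule cont_csE[OF assms(1)], rule cont_csE[OF assms(2)])
  fix R Q assume "\<And>x. \<bar>x\<bar> > R \<Longrightarrow> f x = 0" "continuous_on UNIV f"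
    "\<And>x. \<bar>x\<bar> > Q \<Longrightarrow> g x = 0" "continuous_on UNIV g"
  then show ?thesis by (intro cont_csI[where R="max R Q"] continuous_on_add) auto
qed

lemma cont_cs_minus: "cont_cs f \<Longrightarrow> cont_cs (\<lambda>x. - f x)"
  using cont_cs_cmult[of f "-1"] by simp

lemma cont_cs_diff: "cont_cs f \<Longrightarrow> cont_cs g \<Longrightarrow> cont_cs (\<lambda>x. f x - g x)"
  using cont_cs_add[of f "\<lambda>x. - g x"] by (simp add: cont_cs_minus)

lemma cont_cs_sum: "(\<And>i. i \<in> A \<Longrightarrow> cont_cs (f i)) \<Longrightarrow> cont_cs (\<lambda>x. \<Sum>i\<in>A. f i x)"
  by (induction A rule: infinite_finite_induct) (auto intro!: cont_cs_zero cont_cs_add)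

lemma integral_UNIV_eq:
  fixes f :: "real \<Rightarrow> real"
  assumes "\<And>x. x \<notin> S \<Longrightarrow> f x = 0"
  shows "integral UNIV f = integral S f"
proof -
  have "integral UNIV f = integral UNIV (\<lambda>x. if x \<in> S then f x else 0)"
    by (rule integral_cong) (auto simp: assms)
  then show ?thesis by (simp only: integral_restrict_UNIV)
qed

lemma integral_subset_eq:
  fixes f :: "real \<Rightarrow> real"
  assumes "S \<subseteq> T" "\<And>x. x \<in> T - S \<Longrightarrow> f x = 0"
  shows "integral T f = integral S f"
proof -
  have "integral T f = integral UNIV (\<lambda>x. if x \<in> T then f x else 0)"
    by (simp only: integral_restrict_UNIV)
  also have "\<dots> = integral UNIV (\<lambda>x. if x \<in> S then f x else 0)"
    by (rule integral_cong) (use assms in auto)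
  finally show ?thesis by (simp only: integral_restrict_UNIV)
qed

lemma cont_cs_integrable:
  assumes "cont_cs f" shows "f integrable_on UNIV"
proof (rule cont_csE[OF assms])
  fix R assume R: "\<And>x. \<bar>x\<bar> > R \<Longrightarrow> f x = 0" "continuous_on UNIV f"
  have "f integrable_on {-R..R}"
    by (intro integrable_continuous_real continuous_on_subset[OF R(2)]) simp
  moreover have "(\<lambda>x. if x \<in> {-R..R} then f x else 0) = f"
    using R(1) by (auto simp: fun_eq_iff)
  ultimately show ?thesis using integrable_restrict_UNIV[of "{-R..R}" f] by simp
qed

lemma integral_cs_add:
  "cont_cs f \<Longrightarrow> cont_cs g \<Longrightarrow> integral UNIV (\<lambda>x. f x + g x) = integral UNIV f + integral UNIV g"
  by (intro integral_add cont_cs_integrable)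

lemma integral_cs_diff:
  "cont_cs f \<Longrightarrow> cont_cs g \<Longrightarrow> integral UNIV (\<lambda>x. f x - g x) = integral UNIV f - integral UNIV g"
  by (intro integral_diff cont_cs_integrable)

lemma integral_cs_sum:
  "finite A \<Longrightarrow> (\<And>i. i \<in> A \<Longrightarrow> cont_cs (f i)) \<Longrightarrow>
    integral UNIV (\<lambda>x. \<Sum>i\<in>A. f i x) = (\<Sum>i\<in>A. integral UNIV (f i))"
  by (intro integral_sum cont_cs_integrable)

lemma cont_cs_integrable_atMost:
  assumes "cont_cs f" shows "f integrable_on {..x}"
proof (rule cont_csE[OF assms])
  fix R assume R: "\<And>x. \<bar>x\<bar> > R \<Longrightarrow> f x = 0" "continuous_on UNIV f"
  have "f integrable_on {-R..x}"
    by (intro integrable_continuous_real continuous_on_subset[OF R(2)]) simp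
  moreover have "(\<lambda>y. if y \<in> {-R..x} then f y else 0) = (\<lambda>y. if y \<in> {..x} then f y else 0)"
    using R(1) by (auto simp: fun_eq_iff)
  ultimately show ?thesis
    using integrable_restrict_UNIV[of "{-R..x}" f] integrable_restrict_UNIV[of "{..x}" f] by simp
qed

lemma cont_cs_integrable_atLeast:
  assumes "cont_cs f" shows "f integrable_on {x..}"
proof (rule cont_csE[OF assms])
  fix R assume R: "\<And>x. \<bar>x\<bar> > R \<Longrightarrow> f x = 0" "continuous_on UNIV f"
  have "f integrable_on {x..R}"
    by (intro integrable_continuous_real continuous_on_subset[OF R(2)]) simp
  moreover have "(\<lambda>y. if y \<in> {x..R} then f y else 0) = (\<lambda>y. if y \<in> {x..} then f y else 0)"
    using R(1) by (auto simp: fun_eq_iff)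
  ultimately show ?thesis
    using integrable_restrict_UNIV[of "{x..R}" f] integrable_restrict_UNIV[of "{x..}" f] by simp
qed

section \<open>The skew inverse of the derivative\<close>

lemma dinv_add: "cont_cs f \<Longrightarrow> cont_cs g \<Longrightarrow> dinv (\<lambda>y. f y + g y) x = dinv f x + dinv g x"
  by (simp add: dinv_def integral_add cont_cs_integrable_atMost cont_cs_integrable_atLeast field_simps)

lemma dinv_cmult: "dinv (\<lambda>y. c * f y) x = c * dinv f x"
  by (simp add: dinv_def right_diff_distrib)

lemma dinv_zero: "dinv (\<lambda>y. 0) x = 0"
  by (simp add: dinv_def)

lemma dinv_sum:
  "finite A \<Longrightarrow> (\<And>i. i \<in> A \<Longrightarrow> cont_cs (f i)) \<Longrightarrow> dinv (\<lambda>y. \<Sum>i\<in>A. f i y) x = (\<Sum>i\<in>A. dinv (f i) x)"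
proof (induction A rule: finite_induct)
  case (insert i A)
  then have "dinv (\<lambda>y. f i y + (\<Sum>i\<in>A. f i y)) x = dinv (f i) x + dinv (\<lambda>y. \<Sum>i\<in>A. f i y) x"
    by (intro dinv_add cont_cs_sum) auto
  with insert show ?case by simp
qed (simp add: dinv_zero)

text \<open>Beyond the support only one of the two half-line integrals is left. The constants plus
  and minus one half of the total are the nonlocal tail by which distant test functions interact
  later.\<close>

lemma dinv_right:
  assumes "\<And>y. y \<ge> x \<Longrightarrow> f y = 0"
  shows "dinv f x = integral UNIV f / 2"
proof -
  have "integral {x..} f = integral {x..} (\<lambda>x. 0)" by (rule integral_cong) (use assms in auto)
  moreover have "integral UNIV f = integral {..x} f"
    by (rule integral_UNIV_eq) (use assms in auto)
  ultimately show ?thesis by (simp add: dinv_def)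
qed

lemma dinv_left:
  assumes "\<And>y. y \<le> x \<Longrightarrow> f y = 0"
  shows "dinv f x = - integral UNIV f / 2"
proof -
  have "integral {..x} f = integral {..x} (\<lambda>x. 0)" by (rule integral_cong) (use assms in auto)
  moreover have "integral UNIV f = integral {x..} f"
    by (rule integral_UNIV_eq) (use assms in auto)
  ultimately show ?thesis by (simp add: dinv_def)
qed

lemma dinv_has_derivative:
  assumes "cont_cs f"
  shows "(dinv f has_real_derivative f x) (at x)"
proof (rule cont_csE[OF assms])
  fix R assume R: "\<And>x. \<bar>x\<bar> > R \<Longrightarrow> f x = 0" "continuous_on UNIV f"
  \<comment> \<open>The interval from - c to c contains the support of f and has x in its interior,
    so near x the two half-line integrals become integrals over bounded intervals.\<close>
  define c where "c = \<bar>R\<bar> + \<bar>x\<bar> + 1"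
  have cont: "continuous_on S f" for S using R(2) continuous_on_subset by blast
  have eq: "dinv f y = integral {-c..y} f - integral {-c..c} f / 2" if y: "y \<in> {-c<..<c}" for y
  proof -
    have "integral {..y} f = integral {-c..y} f"
      by (rule integral_subset_eq) (use R(1) in \<open>auto simp: c_def\<close>)
    moreover have "integral {y..} f = integral {y..c} f"
      by (rule integral_subset_eq) (use R(1) in \<open>auto simp: c_def\<close>)
    moreover have "integral {-c..y} f + integral {y..c} f = integral {-c..c} f"
      by (rule Henstock_Kurzweil_Integration.integral_combine) (use y in \<open>auto intro!: integrable_continuous_real cont\<close>)
    ultimately show ?thesis by (simp add: dinv_def)
  qed
  have "((\<lambda>y. integral {-c..y} f) has_real_derivative f x) (at x within {-c..c})"
    by (rule integral_has_real_derivative[OF cont]) (auto simp: c_def)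
  moreover have "at x within {-c..c} = at x"
    by (rule at_within_interior) (auto simp: c_def)
  ultimately have "((\<lambda>y. integral {-c..y} f - integral {-c..c} f / 2) has_real_derivative f x - 0) (at x)"
    by (intro DERIV_diff DERIV_const) simp
  then have "((\<lambda>y. integral {-c..y} f - integral {-c..c} f / 2) has_real_derivative f x) (at x)" by simp
  then show ?thesis
  proof (rule has_field_derivative_transform_within_open)
    show "x \<in> {-c<..<c}" by (auto simp: c_def)
  qed (simp_all only: open_greaterThanLessThan eq)
qed

lemma dinv_continuous: "cont_cs f \<Longrightarrow> continuous_on UNIV (dinv f)"
  by (meson DERIV_continuous_on dinv_has_derivative has_field_derivative_at_within)

lemma derivative_zero_outside:
  assumes "\<And>x. (F has_real_derivative f x) (at x)" "\<And>x. \<bar>x\<bar> > R \<Longrightarrow> F x = 0" "\<bar>x\<bar> > R"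
  shows "f x = 0"
proof -
  have o: "open {y::real. \<bar>y\<bar> > R}" by (intro open_Collect_less continuous_intros)
  have "(F has_real_derivative 0) (at x)"
    by (rule has_field_derivative_transform_within_open[OF DERIV_const o]) (use assms in auto)
  then show ?thesis using DERIV_unique assms(1) by blast
qed

lemma integral_of_derivative_0:
  assumes "\<And>x. (F has_real_derivative f x) (at x)" "\<And>x. \<bar>x\<bar> > R \<Longrightarrow> F x = 0"
  shows "integral UNIV f = 0"
proof -
  define S where "S = \<bar>R\<bar> + 1"
  have "(f has_integral F S - F (- S)) {-S..S}"
    by (rule fundamental_theorem_of_calculus)
       (auto simp: S_def intro!: has_vector_derivative_at_within assms(1)[unfolded has_real_derivative_iff_has_vector_derivative])
  moreover have "F S = 0" "F (- S) = 0" using assms(2) by (auto simp: S_def)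
  ultimately have "integral {-S..S} f = 0" by auto
  moreover have "integral UNIV f = integral {-S..S} f"
    by (rule integral_UNIV_eq, rule derivative_zero_outside[OF assms]) (auto simp: S_def)
  ultimately show ?thesis by simp
qed

text \<open>Both sides are primitives of f, and both vanish far to the right: there
  \<open>dinv f\<close> is half of the integral of a derivative with compactly supported
  primitive.\<close>

lemma dinv_of_derivative:
  assumes "\<And>x. (F has_real_derivative f x) (at x)" "\<And>x. \<bar>x\<bar> > R \<Longrightarrow> F x = 0" "continuous_on UNIV f"
  shows "dinv f x = F x"
proof -
  have f0: "f y = 0" if "\<bar>y\<bar> > R" for y by (rule derivative_zero_outside[OF assms(1,2) that])
  have cs: "cont_cs f" by (rule cont_csI[OF assms(3) f0])
  have "((\<lambda>x. dinv f x - F x) has_real_derivative f x - f x) (at x)" for x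
    by (intro DERIV_diff dinv_has_derivative assms cs)
  then have "dinv f x - F x = dinv f (\<bar>R\<bar> + 1) - F (\<bar>R\<bar> + 1)"
    by (intro DERIV_isconst_all) simp
  moreover have "dinv f (\<bar>R\<bar> + 1) = 0"
    using dinv_right[of "\<bar>R\<bar> + 1" f] f0 integral_of_derivative_0[OF assms(1,2)] by simp
  ultimately show ?thesis using assms(2)[of "\<bar>R\<bar> + 1"] by simp
qed

text \<open>The sum of the two integrands is the derivative of \<open>dinv a x * dinv b x\<close>.
  Both factors change sign from one end of the line to the other while keeping their modulus, so the
  boundary values of the product agree. This is where the symmetric choice of the primitive
  matters.\<close>

lemma dinv_skew:
  assumes "cont_cs a" "cont_cs b"
  shows "integral UNIV (\<lambda>x. a x * dinv b x) = - integral UNIV (\<lambda>x. b x * dinv a x)"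
proof (rule cont_csE[OF assms(1)], rule cont_csE[OF assms(2)])
  fix R1 R2 assume R: "\<And>x. \<bar>x\<bar> > R1 \<Longrightarrow> a x = 0" "\<And>x. \<bar>x\<bar> > R2 \<Longrightarrow> b x = 0"
  define S where "S = \<bar>R1\<bar> + \<bar>R2\<bar> + 1"
  note cs = cont_cs_mult_right[OF dinv_continuous[OF assms(2)] assms(1)]
    cont_cs_mult_right[OF dinv_continuous[OF assms(1)] assms(2)]
  have "((\<lambda>x. a x * dinv b x + b x * dinv a x) has_integral dinv a S * dinv b S - dinv a (- S) * dinv b (- S)) {-S..S}"
  proof (rule fundamental_theorem_of_calculus[where f="\<lambda>x. dinv a x * dinv b x"])
    fix x
    show "((\<lambda>x. dinv a x * dinv b x) has_vector_derivative a x * dinv b x + b x * dinv a x) (at x within {-S..S})"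
      using DERIV_mult[OF dinv_has_derivative[OF assms(1)] dinv_has_derivative[OF assms(2)]]
      unfolding has_real_derivative_iff_has_vector_derivative by (rule has_vector_derivative_at_within)
  qed (simp add: S_def)
  moreover have "dinv a S = integral UNIV a / 2"
    by (rule dinv_right, rule R(1)) (simp add: S_def)
  moreover have "dinv a (- S) = - integral UNIV a / 2"
    by (rule dinv_left, rule R(1)) (simp add: S_def)
  moreover have "dinv b S = integral UNIV b / 2"
    by (rule dinv_right, rule R(2)) (simp add: S_def)
  moreover have "dinv b (- S) = - integral UNIV b / 2"
    by (rule dinv_left, rule R(2)) (simp add: S_def)
  ultimately have "integral {-S..S} (\<lambda>x. a x * dinv b x + b x * dinv a x) = 0" by (auto dest!: integral_unique)
  moreover have "integral UNIV (\<lambda>x. a x * dinv b x + b x * dinv a x) = integral {-S..S} (\<lambda>x. a x * dinv b x + b x * dinv a x)"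
    by (rule integral_UNIV_eq) (use R in \<open>auto simp: S_def\<close>)
  ultimately show ?thesis using integral_cs_add[OF cs] by simp
qed


section \<open>Differentiation with respect to a parameter\<close>

text \<open>Families of functions of x that depend on a parameter t are encoded as functions on the
  plane, so that smoothness is joint smoothness and the two derivatives commute.\<close>

definition dt :: "(real \<times> real \<Rightarrow> 'a::real_normed_vector) \<Rightarrow> real \<times> real \<Rightarrow> 'a" where
  "dt H p = frechet_derivative H (at p) (1, 0)"

definition dx :: "(real \<times> real \<Rightarrow> 'a::real_normed_vector) \<Rightarrow> real \<times> real \<Rightarrow> 'a" where
  "dx H p = frechet_derivative H (at p) (0, 1)"

lemma smooth_on_dt: "smooth_on D H \<Longrightarrow> smooth_on D (dt H)"
  unfolding dt_def[abs_def] by (rule smooth_on_derivative)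

lemma smooth_on_dx: "smooth_on D H \<Longrightarrow> smooth_on D (dx H)"
  unfolding dx_def[abs_def] by (rule smooth_on_derivative)

lemma dt_has_derivative:
  assumes "smooth_on D H" "(t, x) \<in> D"
  shows "((\<lambda>t. H (t, x)) has_vector_derivative dt H (t, x)) (at t)"
proof -
  have "((\<lambda>t. H (t, x)) has_derivative (\<lambda>v. frechet_derivative H (at (t, x)) (v, 0))) (at t)"
    by (rule has_derivative_compose[where f="\<lambda>t. (t, x)"])
       (auto intro!: derivative_eq_intros smooth_on_has_derivative[OF assms])
  moreover have "linear (frechet_derivative H (at (t, x)))"
    by (intro linear_frechet_derivative smooth_on_differentiable[OF assms])
  then have "frechet_derivative H (at (t, x)) (v, 0) = v *\<^sub>R dt H (t, x)" for v
    unfolding dt_def using linear_cmul[of "frechet_derivative H (at (t, x))" v "(1, 0)"] by simp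
  ultimately show ?thesis by (simp add: has_vector_derivative_def)
qed

lemma dx_has_derivative:
  assumes "smooth_on D H" "(t, x) \<in> D"
  shows "((\<lambda>x. H (t, x)) has_vector_derivative dx H (t, x)) (at x)"
proof -
  have "((\<lambda>x. H (t, x)) has_derivative (\<lambda>v. frechet_derivative H (at (t, x)) (0, v))) (at x)"
    by (rule has_derivative_compose[where f="\<lambda>x. (t, x)"])
       (auto intro!: derivative_eq_intros smooth_on_has_derivative[OF assms])
  moreover have "linear (frechet_derivative H (at (t, x)))"
    by (intro linear_frechet_derivative smooth_on_differentiable[OF assms])
  then have "frechet_derivative H (at (t, x)) (0, v) = v *\<^sub>R dx H (t, x)" for v
    unfolding dx_def using linear_cmul[of "frechet_derivative H (at (t, x))" v "(0, 1)"] by simp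
  ultimately show ?thesis by (simp add: has_vector_derivative_def)
qed

lemma dt_real_derivative:
  fixes H :: "real \<times> real \<Rightarrow> real"
  shows "smooth_on D H \<Longrightarrow> (t, x) \<in> D \<Longrightarrow> ((\<lambda>t. H (t, x)) has_real_derivative dt H (t, x)) (at t)"
  by (simp add: dt_has_derivative has_real_derivative_iff_has_vector_derivative)

lemma dt_eqI:
  assumes "smooth_on D H" "(t, x) \<in> D" "((\<lambda>t. H (t, x)) has_vector_derivative h) (at t)"
  shows "dt H (t, x) = h"
  using vector_derivative_unique_at[OF dt_has_derivative[OF assms(1,2)] assms(3)] .

lemma dt_zero:
  assumes "open T" "smooth_on (T \<times> UNIV) H" "t \<in> T" "\<And>t. t \<in> T \<Longrightarrow> H (t, x) = 0"
  shows "dt H (t, x) = 0"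
proof (rule dt_eqI[OF assms(2)])
  show "((\<lambda>t. H (t, x)) has_vector_derivative 0) (at t)"
    by (rule has_vector_derivative_transform_within_open[OF _ assms(1,3), of "\<lambda>_. 0"]) (use assms(4) in auto)
qed (use assms in auto)

lemma partial_integral_interval:
  fixes H :: "real \<times> real \<Rightarrow> real"
  assumes "open T" "smooth_on (T \<times> UNIV) H" "t \<in> T"
  shows "((\<lambda>t. integral {a..b} (\<lambda>x. H (t, x))) has_real_derivative integral {a..b} (\<lambda>x. dt H (t, x))) (at t)"
proof -
  have "((\<lambda>t. integral {a..b} (\<lambda>x. H (t, x))) has_derivative
     (\<lambda>v. integral {a..b} (\<lambda>x. frechet_derivative H (at (t, x)) (v, 0)))) (at t)"
    by (rule parameter_integral_has_derivative[where S=T and D="T \<times> UNIV"])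
       (use assms in \<open>auto intro: open_Times\<close>)
  moreover have "frechet_derivative H (at (t, x)) (v, 0) = dt H (t, x) * v" for v x
  proof -
    have "linear (frechet_derivative H (at (t, x)))"
      using assms by (intro linear_frechet_derivative smooth_on_differentiable[OF assms(2)]) auto
    then show ?thesis
      unfolding dt_def using linear_cmul[of "frechet_derivative H (at (t, x))" v "(1, 0)"] by simp
  qed
  ultimately show ?thesis by (simp add: has_field_derivative_def)
qed

text \<open>The support is bounded uniformly in t, hence the integral over the line is one over a
  fixed interval, for all parameters simultaneously.\<close>

lemma partial_integral:
  fixes H :: "real \<times> real \<Rightarrow> real"
  assumes "open T" "smooth_on (T \<times> UNIV) H" "t \<in> T" "\<And>t x. t \<in> T \<Longrightarrow> \<bar>x\<bar> > R \<Longrightarrow> H (t, x) = 0"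
  shows "((\<lambda>t. integral UNIV (\<lambda>x. H (t, x))) has_real_derivative integral UNIV (\<lambda>x. dt H (t, x))) (at t)"
proof -
  have e: "integral UNIV (\<lambda>x. H (t, x)) = integral {-R..R} (\<lambda>x. H (t, x))" if "t \<in> T" for t
    by (rule integral_UNIV_eq) (use assms(4)[OF that] in auto)
  have "integral UNIV (\<lambda>x. dt H (t, x)) = integral {-R..R} (\<lambda>x. dt H (t, x))"
    by (rule integral_UNIV_eq, rule dt_zero[OF assms(1-3)]) (use assms(4) in auto)
  then show ?thesis
    using has_field_derivative_transform_within_open[OF partial_integral_interval[OF assms(1-3)] assms(1,3), of "-R" R] e
    by simp
qed

lemma smooth_on_section:
  fixes H :: "real \<times> real \<Rightarrow> 'a::real_normed_vector"
  assumes "open T" "smooth_on (T \<times> UNIV) H" "t \<in> T"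
  shows "smooth_on UNIV (\<lambda>x. H (t, x))"
  by (rule smooth_on_compose[OF assms(2)]) (use assms in \<open>auto intro!: smooth_on_Pair smooth_on_const smooth_on_id open_Times\<close>)

lemma section_cont_cs:
  assumes "open T" "smooth_on (T \<times> UNIV) H" "t \<in> T" "\<And>t x. t \<in> T \<Longrightarrow> \<bar>x\<bar> > R \<Longrightarrow> H (t, x) = 0"
  shows "cont_cs (\<lambda>x. H (t, x))" "cont_cs (\<lambda>x. dt H (t, x))"
proof -
  show "cont_cs (\<lambda>x. H (t, x))"
    by (rule cont_csI[OF smooth_on_continuous[OF smooth_on_section[OF assms(1-3)]]]) (use assms in auto)
  show "cont_cs (\<lambda>x. dt H (t, x))"
    by (rule cont_csI[OF smooth_on_continuous[OF smooth_on_section[OF assms(1) smooth_on_dt[OF assms(2)] assms(3)]]],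
        rule dt_zero[OF assms(1-3)]) (use assms(4) in auto)
qed

text \<open>Rescaling moves the variable limit of integration into the integrand. In this form
  \<open>dinv\<close> is an integral with fixed limits, and the results on parameter integrals apply
  to it.\<close>

lemma dinv_integral_formula:
  assumes "cont_cs b" "\<And>y. y \<le> c \<Longrightarrow> b y = 0"
  shows "dinv b x = integral {0..1} (\<lambda>s. b (c + s * (x - c)) * (x - c)) - integral UNIV b / 2"
proof -
  have "((\<lambda>s. b (c + s * (x - c)) * (x - c)) has_integral dinv b (c + 1 * (x - c)) - dinv b (c + 0 * (x - c))) {0..1}"
  proof (rule fundamental_theorem_of_calculus[where f="\<lambda>s. dinv b (c + s * (x - c))"])
    fix s :: real
    have "((\<lambda>s. dinv b (c + s * (x - c))) has_real_derivative b (c + s * (x - c)) * (x - c)) (at s)"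
      by (rule DERIV_chain2[OF dinv_has_derivative[OF assms(1)]]) (auto intro!: derivative_eq_intros)
    then show "((\<lambda>s. dinv b (c + s * (x - c))) has_vector_derivative b (c + s * (x - c)) * (x - c)) (at s within {0..1})"
      by (simp add: has_real_derivative_iff_has_vector_derivative has_vector_derivative_at_within)
  qed simp
  then have "integral {0..1} (\<lambda>s. b (c + s * (x - c)) * (x - c)) = dinv b x - dinv b c"
    by (auto dest!: integral_unique)
  moreover have "dinv b c = - integral UNIV b / 2" by (rule dinv_left[OF assms(2)])
  ultimately show ?thesis by simp
qed

section \<open>Smooth dependence of the skew inverse on a parameter\<close>

context
  fixes T :: "real set" and H :: "real \<times> real \<Rightarrow> real" and R :: real
  assumes T: "open T" and H: "smooth_on (T \<times> UNIV) H"
    and R: "\<And>t x. t \<in> T \<Longrightarrow> \<bar>x\<bar> > R \<Longrightarrow> H (t, x) = 0"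
begin

private lemma formula:
  assumes "t \<in> T"
  shows "dinv (\<lambda>y. H (t, y)) x = integral {0..1} (\<lambda>s. H (t, - \<bar>R\<bar> - 1 + s * (x + \<bar>R\<bar> + 1)) * (x + \<bar>R\<bar> + 1))
     - integral {- \<bar>R\<bar> - 1..\<bar>R\<bar> + 1} (\<lambda>y. H (t, y)) / 2"
proof -
  have "integral UNIV (\<lambda>y. H (t, y)) = integral {- \<bar>R\<bar> - 1..\<bar>R\<bar> + 1} (\<lambda>y. H (t, y))"
    by (rule integral_UNIV_eq) (use R[OF assms] in auto)
  then show ?thesis
    using dinv_integral_formula[OF section_cont_cs(1)[OF T H assms R], where c="- \<bar>R\<bar> - 1" and x=x] R[OF assms]
    by (simp add: diff_diff_eq2 add_ac)
qed

private lemma formula_dt: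
  assumes "t \<in> T"
  shows "dinv (\<lambda>y. dt H (t, y)) x = integral {0..1} (\<lambda>s. dt H (t, - \<bar>R\<bar> - 1 + s * (x + \<bar>R\<bar> + 1)) * (x + \<bar>R\<bar> + 1))
     - integral {- \<bar>R\<bar> - 1..\<bar>R\<bar> + 1} (\<lambda>y. dt H (t, y)) / 2"
proof -
  have z: "dt H (t, y) = 0" if "\<bar>y\<bar> > R" for y
    by (rule dt_zero[OF T H assms R]) (use that in auto)
  have "integral UNIV (\<lambda>y. dt H (t, y)) = integral {- \<bar>R\<bar> - 1..\<bar>R\<bar> + 1} (\<lambda>y. dt H (t, y))"
    by (rule integral_UNIV_eq) (use z in auto)
  then show ?thesis
    using dinv_integral_formula[OF section_cont_cs(2)[OF T H assms R], where c="- \<bar>R\<bar> - 1" and x=x] z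
    by (simp add: diff_diff_eq2 add_ac)
qed

lemma dinv_parameter_smooth: "smooth_on (T \<times> UNIV) (\<lambda>p. dinv (\<lambda>y. H (fst p, y)) (snd p))"
proof -
  have o: "open (T \<times> (UNIV :: real set))" "open ((T \<times> (UNIV :: real set)) \<times> (UNIV :: real set))"
    using T by (auto intro: open_Times)
  have "smooth_on (T \<times> UNIV) (\<lambda>p. integral {0..1} (\<lambda>s. (\<lambda>q. H (fst (fst q), - \<bar>R\<bar> - 1 + snd q * (snd (fst q) + \<bar>R\<bar> + 1)) * (snd (fst q) + \<bar>R\<bar> + 1)) (p, s)))"
    by (rule smooth_on_parameter_integral[OF o])
       (auto intro!: smooth_on_mult smooth_on_add smooth_on_fst smooth_on_snd smooth_on_const smooth_on_id
         smooth_on_compose[OF H] smooth_on_Pair o simp: o)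
  moreover have "smooth_on (T \<times> UNIV) (\<lambda>p :: real \<times> real. integral {- \<bar>R\<bar> - 1..\<bar>R\<bar> + 1} (\<lambda>y. (\<lambda>q. H (fst (fst q), snd q)) (p, y)))"
    by (rule smooth_on_parameter_integral[OF o, where H="\<lambda>q. H (fst (fst q), snd q)"])
       (auto intro!: smooth_on_fst smooth_on_snd smooth_on_id
         smooth_on_compose[OF H] smooth_on_Pair o simp: o)
  ultimately have "smooth_on (T \<times> UNIV) (\<lambda>p.
    integral {0..1} (\<lambda>s. H (fst p, - \<bar>R\<bar> - 1 + s * (snd p + \<bar>R\<bar> + 1)) * (snd p + \<bar>R\<bar> + 1))
    - (1 / 2) * integral {- \<bar>R\<bar> - 1..\<bar>R\<bar> + 1} (\<lambda>y. H (fst p, y)))"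
    by (intro smooth_on_diff smooth_on_mult smooth_on_const o) simp_all
  then show ?thesis
    by (rule smooth_on_cong[OF o(1), THEN iffD1, rotated]) (auto simp: formula)
qed

lemma dinv_parameter_derivative:
  assumes t: "t \<in> T"
  shows "((\<lambda>t. dinv (\<lambda>y. H (t, y)) x) has_real_derivative dinv (\<lambda>y. dt H (t, y)) x) (at t)"
proof -
  have o: "open (T \<times> (UNIV :: real set))" using T by (auto intro: open_Times)
  define G where "G q = H (fst q, - \<bar>R\<bar> - 1 + snd q * (x + \<bar>R\<bar> + 1)) * (x + \<bar>R\<bar> + 1)" for q
  have G: "smooth_on (T \<times> UNIV) G"
    unfolding G_def
    by (auto intro!: smooth_on_mult smooth_on_add smooth_on_fst smooth_on_snd smooth_on_const smooth_on_id
         smooth_on_compose[OF H] smooth_on_Pair o)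
  have dG: "dt G (t, s) = dt H (t, - \<bar>R\<bar> - 1 + s * (x + \<bar>R\<bar> + 1)) * (x + \<bar>R\<bar> + 1)" for s
  proof (rule dt_eqI[OF G])
    show "((\<lambda>t. G (t, s)) has_vector_derivative dt H (t, - \<bar>R\<bar> - 1 + s * (x + \<bar>R\<bar> + 1)) * (x + \<bar>R\<bar> + 1)) (at t)"
      unfolding G_def fst_conv snd_conv
      by (rule has_vector_derivative_mult_left, rule dt_has_derivative[OF H]) (use t in auto)
  qed (use t in auto)
  have "((\<lambda>t. integral {0..1} (\<lambda>s. G (t, s)) - integral {- \<bar>R\<bar> - 1..\<bar>R\<bar> + 1} (\<lambda>y. H (t, y)) / 2)
    has_real_derivative integral {0..1} (\<lambda>s. dt G (t, s)) - integral {- \<bar>R\<bar> - 1..\<bar>R\<bar> + 1} (\<lambda>y. dt H (t, y)) / 2) (at t)"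
    by (intro DERIV_diff DERIV_cdivide partial_integral_interval[OF T _ t] G H)
  then have "((\<lambda>t. integral {0..1} (\<lambda>s. G (t, s)) - integral {- \<bar>R\<bar> - 1..\<bar>R\<bar> + 1} (\<lambda>y. H (t, y)) / 2)
    has_real_derivative dinv (\<lambda>y. dt H (t, y)) x) (at t)"
    by (simp add: formula_dt[OF t] dG)
  then show ?thesis
    by (rule has_field_derivative_transform_within_open[OF _ T t]) (simp add: formula G_def)
qed

end

lemma dinv_pairing_derivative:
  fixes a b :: "real \<times> real \<Rightarrow> real"
  assumes T: "open T" "t \<in> T" and a: "smooth_on (T \<times> UNIV) a" and b: "smooth_on (T \<times> UNIV) b"
    and R: "\<And>t x. t \<in> T \<Longrightarrow> \<bar>x\<bar> > R \<Longrightarrow> a (t, x) = 0" "\<And>t x. t \<in> T \<Longrightarrow> \<bar>x\<bar> > R \<Longrightarrow> b (t, x) = 0"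
  shows "((\<lambda>t. integral UNIV (\<lambda>x. a (t, x) * dinv (\<lambda>y. b (t, y)) x)) has_real_derivative
     integral UNIV (\<lambda>x. dt a (t, x) * dinv (\<lambda>y. b (t, y)) x) + integral UNIV (\<lambda>x. a (t, x) * dinv (\<lambda>y. dt b (t, y)) x)) (at t)"
proof -
  define G where "G p = a p * dinv (\<lambda>y. b (fst p, y)) (snd p)" for p
  have o: "open (T \<times> (UNIV :: real set))" using T by (auto intro: open_Times)
  have G: "smooth_on (T \<times> UNIV) G"
    unfolding G_def by (intro smooth_on_mult o a dinv_parameter_smooth[OF T(1) b R(2)])
  have dG: "dt G (t, x) = dt a (t, x) * dinv (\<lambda>y. b (t, y)) x + a (t, x) * dinv (\<lambda>y. dt b (t, y)) x" for x
  proof (rule dt_eqI[OF G])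
    have "((\<lambda>t. a (t, x) * dinv (\<lambda>y. b (t, y)) x) has_real_derivative
       dt a (t, x) * dinv (\<lambda>y. b (t, y)) x + dinv (\<lambda>y. dt b (t, y)) x * a (t, x)) (at t)"
      using T by (intro DERIV_mult dt_real_derivative[OF a] dinv_parameter_derivative[OF T(1) b R(2)]) auto
    then show "((\<lambda>t. G (t, x)) has_vector_derivative dt a (t, x) * dinv (\<lambda>y. b (t, y)) x + a (t, x) * dinv (\<lambda>y. dt b (t, y)) x) (at t)"
      unfolding G_def by (simp add: has_real_derivative_iff_has_vector_derivative mult.commute)
  qed (use T in auto)
  have "((\<lambda>t. integral UNIV (\<lambda>x. G (t, x))) has_real_derivative integral UNIV (\<lambda>x. dt G (t, x))) (at t)"
    by (rule partial_integral[OF T(1) G T(2)]) (use R in \<open>auto simp: G_def\<close>)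
  moreover have "integral UNIV (\<lambda>x. dt G (t, x)) = integral UNIV (\<lambda>x. dt a (t, x) * dinv (\<lambda>y. b (t, y)) x)
      + integral UNIV (\<lambda>x. a (t, x) * dinv (\<lambda>y. dt b (t, y)) x)"
    unfolding dG
    by (intro integral_cs_add cont_cs_mult_right dinv_continuous section_cont_cs[OF T(1) a T(2) R(1)]
        section_cont_cs[OF T(1) b T(2) R(2)])
  ultimately show ?thesis by (simp add: G_def)
qed


section \<open>Fields, test functions and variational derivatives\<close>

lemma smooth_on_line_vector_derivative:
  fixes f :: "'a::euclidean_space \<Rightarrow> 'b::real_normed_vector"
  assumes "smooth_on S f" "y + c *\<^sub>R v \<in> S"
  shows "((\<lambda>s. f (y + s *\<^sub>R v)) has_vector_derivative frechet_derivative f (at (y + c *\<^sub>R v)) v) (at c)"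
proof -
  have l: "linear (frechet_derivative f (at (y + c *\<^sub>R v)))"
    by (intro linear_frechet_derivative smooth_on_differentiable[OF assms])
  have "((\<lambda>s. f (y + s *\<^sub>R v)) has_derivative (\<lambda>s. frechet_derivative f (at (y + c *\<^sub>R v)) (s *\<^sub>R v))) (at c)"
    by (rule has_derivative_compose[where f="\<lambda>s. y + s *\<^sub>R v"])
       (auto intro!: derivative_eq_intros smooth_on_has_derivative[OF assms])
  then show ?thesis
    by (simp add: linear_cmul[OF l] has_vector_derivative_def)
qed

lemma frechet_derivative_inner:
  assumes "f differentiable (at x)"
  shows "frechet_derivative (\<lambda>x. f x \<bullet> b) (at x) v = frechet_derivative f (at x) v \<bullet> b"
proof -
  have "((\<lambda>x. f x \<bullet> b) has_derivative (\<lambda>v. frechet_derivative f (at x) v \<bullet> b)) (at x)"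
    using assms by (intro has_derivative_inner_left) (simp only: frechet_derivative_works)
  from frechet_derivative_at[OF this] show ?thesis by metis
qed

lemma second_derivative_symmetric_vector:
  fixes f :: "'a::euclidean_space \<Rightarrow> 'b::euclidean_space"
  assumes "open S" "smooth_on S f" "x \<in> S"
  shows "frechet_derivative (\<lambda>z. frechet_derivative f (at z) v) (at x) w
       = frechet_derivative (\<lambda>z. frechet_derivative f (at z) w) (at x) v"
proof (rule euclidean_eqI)
  fix b :: 'b
  have sm: "smooth_on S (\<lambda>z. f z \<bullet> b)"
    by (rule smooth_on_bounded_linear[OF bounded_linear_inner_left assms(2,1)])
  have e: "frechet_derivative (\<lambda>z. frechet_derivative f (at z) v) (at x) w \<bullet> b
      = frechet_derivative (\<lambda>z. frechet_derivative (\<lambda>z. f z \<bullet> b) (at z) v) (at x) w" for v w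
  proof -
    have "frechet_derivative (\<lambda>z. frechet_derivative f (at z) v) (at x) w \<bullet> b
      = frechet_derivative (\<lambda>z. frechet_derivative f (at z) v \<bullet> b) (at x) w"
      by (rule frechet_derivative_inner[symmetric])
         (rule smooth_on_differentiable[OF smooth_on_derivative[OF assms(2)] assms(3)])
    also have "\<dots> = frechet_derivative (\<lambda>z. frechet_derivative (\<lambda>z. f z \<bullet> b) (at z) v) (at x) w"
    proof -
      have d: "((\<lambda>z. frechet_derivative f (at z) v \<bullet> b) has_derivative
         frechet_derivative (\<lambda>z. frechet_derivative f (at z) v \<bullet> b) (at x)) (at x)"
        by (rule smooth_on_has_derivative[OF smooth_on_bounded_linear[OF bounded_linear_inner_left
              smooth_on_derivative[OF assms(2)] assms(1)] assms(3)])
      have "((\<lambda>z. frechet_derivative (\<lambda>z. f z \<bullet> b) (at z) v) has_derivative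
         frechet_derivative (\<lambda>z. frechet_derivative f (at z) v \<bullet> b) (at x)) (at x)"
        by (rule has_derivative_transform_within_open[OF d assms(1,3)])
           (simp add: frechet_derivative_inner[OF smooth_on_differentiable[OF assms(2)]])
      from frechet_derivative_at[OF this] show ?thesis by simp
    qed
    finally show ?thesis .
  qed
  show "frechet_derivative (\<lambda>z. frechet_derivative f (at z) v) (at x) w \<bullet> b
       = frechet_derivative (\<lambda>z. frechet_derivative f (at z) w) (at x) v \<bullet> b"
    unfolding e by (rule second_derivative_symmetric[OF assms(1) sm assms(3)])
qed

lemma dt_dx_commute:
  fixes H :: "real \<times> real \<Rightarrow> 'b::euclidean_space"
  assumes "open D" "smooth_on D H" "p \<in> D"
  shows "dt (dx H) p = dx (dt H) p"
  unfolding dt_def[abs_def] dx_def[abs_def] by (rule second_derivative_symmetric_vector[OF assms])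

lemma xderiv_eqI: "(f has_vector_derivative d) (at x) \<Longrightarrow> xderiv f x = d"
  by (simp add: xderiv_def vector_derivative_at)

lemma xderiv_works:
  "smooth_on UNIV f \<Longrightarrow> (f has_vector_derivative xderiv f x) (at x)"
  by (simp add: xderiv_def smooth_on_differentiable vector_derivative_works[symmetric])

lemma xderiv_frechet:
  assumes "smooth_on UNIV f" shows "xderiv f x = frechet_derivative f (at x) 1"
  using smooth_on_line_vector_derivative[OF assms, of 0 x 1] by (intro xderiv_eqI) simp

lemma smooth_on_xderiv:
  assumes "smooth_on UNIV f" shows "smooth_on UNIV (xderiv f)"
  using smooth_on_derivative[OF assms, of 1] by (simp add: xderiv_frechet[OF assms, symmetric])

lemma xderiv_section: "smooth_on D X \<Longrightarrow> (t, x) \<in> D \<Longrightarrow> xderiv (\<lambda>x. X (t, x)) x = dx X (t, x)"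
  by (intro xderiv_eqI dx_has_derivative)

lemma xderiv_zero_outside:
  fixes f :: "real \<Rightarrow> 'a::real_normed_vector"
  assumes "\<And>x. \<bar>x\<bar> > R \<Longrightarrow> f x = 0" "\<bar>x\<bar> > R"
  shows "xderiv f x = 0"
proof (rule xderiv_eqI)
  have o: "open {y::real. \<bar>y\<bar> > R}" by (intro open_Collect_less continuous_intros)
  show "(f has_vector_derivative 0) (at x)"
    by (rule has_vector_derivative_transform_within_open[OF has_vector_derivative_const o]) (use assms in auto)
qed

section \<open>Compactly supported test functions\<close>

lemma test_functionI:
  "smooth_on UNIV v \<Longrightarrow> (\<And>x. \<bar>x\<bar> > R \<Longrightarrow> v x = 0) \<Longrightarrow> v \<in> test_functions"
  unfolding test_functions_def by blast

lemma test_function_smooth: "v \<in> test_functions \<Longrightarrow> smooth_on UNIV v"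
  by (simp add: test_functions_def)

lemma test_functionE:
  assumes "v \<in> test_functions"
  obtains R where "R > 0" "\<And>x. \<bar>x\<bar> > R \<Longrightarrow> v x = 0"
proof -
  obtain R where "\<forall>x. \<bar>x\<bar> > R \<longrightarrow> v x = 0" using assms by (auto simp: test_functions_def)
  then show thesis using that[of "\<bar>R\<bar> + 1"] by auto
qed

lemma test_function_zero: "(\<lambda>x. 0) \<in> test_functions"
  by (rule test_functionI[where R=0]) (auto intro: smooth_on_const)

lemma test_function_add:
  assumes "f \<in> test_functions" "g \<in> test_functions"
  shows "(\<lambda>x. f x + g x) \<in> test_functions"
proof (rule test_functionE[OF assms(1)], rule test_functionE[OF assms(2)])
  fix R Q assume "\<And>x. \<bar>x\<bar> > R \<Longrightarrow> f x = 0" "\<And>x. \<bar>x\<bar> > Q \<Longrightarrow> g x = 0"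
  then show ?thesis
    by (intro test_functionI[where R="max R Q"] smooth_on_add assms[THEN test_function_smooth] open_UNIV) auto
qed

lemma test_function_linear:
  assumes "f \<in> test_functions" "bounded_linear l"
  shows "(\<lambda>x. l (f x)) \<in> test_functions"
proof (rule test_functionE[OF assms(1)])
  fix R assume "\<And>x. \<bar>x\<bar> > R \<Longrightarrow> f x = 0"
  then show ?thesis
    using assms(2) by (intro test_functionI[where R=R] smooth_on_bounded_linear[OF assms(2)] assms(1)[THEN test_function_smooth] open_UNIV)
      (auto simp: linear_simps)
qed

lemma test_function_scaleR: "f \<in> test_functions \<Longrightarrow> (\<lambda>x. c *\<^sub>R f x) \<in> test_functions"
  by (rule test_function_linear[OF _ bounded_linear_scaleR_right])

lemma test_function_minus: "f \<in> test_functions \<Longrightarrow> (\<lambda>x. - f x) \<in> test_functions"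
  by (rule test_function_linear[OF _ bounded_linear_minus[OF bounded_linear_ident]])

lemma test_function_diff:
  "f \<in> test_functions \<Longrightarrow> g \<in> test_functions \<Longrightarrow> (\<lambda>x. f x - g x) \<in> test_functions"
  using test_function_add[of f "\<lambda>x. - g x"] by (simp add: test_function_minus)

lemma test_function_xderiv:
  assumes "f \<in> test_functions" shows "xderiv f \<in> test_functions"
proof (rule test_functionE[OF assms])
  fix R assume "\<And>x. \<bar>x\<bar> > R \<Longrightarrow> f x = 0"
  then show ?thesis
    by (intro test_functionI[where R=R] smooth_on_xderiv assms[THEN test_function_smooth] xderiv_zero_outside)
qed

lemma test_function_continuous: "v \<in> test_functions \<Longrightarrow> continuous_on UNIV v"
  by (rule smooth_on_continuous[OF test_function_smooth])

lemma test_function_cont_cs_nth: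
  assumes "v \<in> test_functions" shows "cont_cs (\<lambda>x. v x $ i)"
proof (rule test_functionE[OF assms])
  fix R assume "\<And>x. \<bar>x\<bar> > R \<Longrightarrow> v x = 0"
  then show ?thesis
    by (intro cont_csI[where R=R] continuous_on_component test_function_continuous[OF assms]) auto
qed

lemma test_function_cont_cs_inner:
  assumes "v \<in> test_functions" "continuous_on UNIV w" shows "cont_cs (\<lambda>x. v x \<bullet> w x)"
proof (rule test_functionE[OF assms(1)])
  fix R assume "\<And>x. \<bar>x\<bar> > R \<Longrightarrow> v x = 0"
  then show ?thesis
    by (intro cont_csI[where R=R] continuous_on_inner test_function_continuous[OF assms(1)] assms(2)) auto
qed

definition eta_dx :: "real^'n^'n \<Rightarrow> 'n::finite field \<Rightarrow> 'n field" where
  "eta_dx \<eta> f x = \<eta> *v xderiv f x"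

lemma test_function_eta_dx: "f \<in> test_functions \<Longrightarrow> eta_dx \<eta> f \<in> test_functions"
  unfolding eta_dx_def[abs_def]
  by (rule test_function_linear[OF test_function_xderiv matrix_vector_mul_bounded_linear])

lemma xderiv_add:
  "smooth_on UNIV f \<Longrightarrow> smooth_on UNIV g \<Longrightarrow> xderiv (\<lambda>x. f x + g x) x = xderiv f x + xderiv g x"
  by (intro xderiv_eqI has_vector_derivative_add xderiv_works)

lemma xderiv_linear:
  "bounded_linear l \<Longrightarrow> smooth_on UNIV f \<Longrightarrow> xderiv (\<lambda>x. l (f x)) x = l (xderiv f x)"
  by (rule xderiv_eqI, rule bounded_linear.has_vector_derivative[OF _ xderiv_works])

lemma eta_dx_add:
  "f \<in> test_functions \<Longrightarrow> g \<in> test_functions \<Longrightarrow> eta_dx \<eta> (\<lambda>x. f x + g x) x = eta_dx \<eta> f x + eta_dx \<eta> g x"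
  by (simp add: eta_dx_def xderiv_add test_function_smooth matrix_vector_right_distrib)

lemma eta_dx_minus:
  "f \<in> test_functions \<Longrightarrow> eta_dx \<eta> (\<lambda>x. - f x) x = - eta_dx \<eta> f x"
  using xderiv_linear[OF bounded_linear_minus[OF bounded_linear_ident], of f x]
  by (simp add: eta_dx_def test_function_smooth vec.neg)

text \<open>Integration by parts makes d/dx skew, and a symmetric constant matrix commutes with it;
  the primitive \<open>f x \<bullet> (\<eta> *v h x)\<close> has compact support, so no boundary
  term appears.\<close>

lemma integral_eta_dx_skew:
  fixes f h :: "'n::finite field"
  assumes "transpose \<eta> = \<eta>" "f \<in> test_functions" "h \<in> test_functions"
  shows "integral UNIV (\<lambda>x. f x \<bullet> eta_dx \<eta> h x) = - integral UNIV (\<lambda>x. eta_dx \<eta> f x \<bullet> h x)"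
proof (rule test_functionE[OF assms(2)])
  fix R assume R: "\<And>x. \<bar>x\<bar> > R \<Longrightarrow> f x = 0"
  have sym: "(\<eta> *v a) \<bullet> b = a \<bullet> (\<eta> *v b)" for a b
    by (metis assms(1) dot_lmul_matrix vector_transpose_matrix)
  have d: "((\<lambda>x. f x \<bullet> (\<eta> *v h x)) has_real_derivative f x \<bullet> eta_dx \<eta> h x + eta_dx \<eta> f x \<bullet> h x) (at x)" for x
  proof -
    have "((\<lambda>x. f x \<bullet> (\<eta> *v h x)) has_vector_derivative f x \<bullet> (\<eta> *v xderiv h x) + xderiv f x \<bullet> (\<eta> *v h x)) (at x)"
      by (rule bounded_bilinear.has_vector_derivative[OF bounded_bilinear_inner xderiv_works[OF test_function_smooth[OF assms(2)]]
          bounded_linear.has_vector_derivative[OF matrix_vector_mul_bounded_linear xderiv_works[OF test_function_smooth[OF assms(3)]]]])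
    then show ?thesis by (simp add: has_real_derivative_iff_has_vector_derivative eta_dx_def sym)
  qed
  have c: "cont_cs (\<lambda>x. f x \<bullet> eta_dx \<eta> h x)" "cont_cs (\<lambda>x. eta_dx \<eta> f x \<bullet> h x)"
    by (rule test_function_cont_cs_inner, use assms in \<open>auto intro: test_function_eta_dx test_function_continuous\<close>)+
  have "integral UNIV (\<lambda>x. f x \<bullet> eta_dx \<eta> h x + eta_dx \<eta> f x \<bullet> h x) = 0"
    by (rule integral_of_derivative_0[OF d, where R=R]) (simp add: R)
  then show ?thesis using integral_cs_add[OF c] by simp
qed

lemma cont_cs_integral_square_0:
  assumes "v \<in> test_functions" "integral UNIV (\<lambda>x. v x \<bullet> v x) = 0"
  shows "v x = 0"
proof (rule test_functionE[OF assms(1)])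
  fix R assume R: "\<And>x. \<bar>x\<bar> > R \<Longrightarrow> v x = 0"
  define S where "S = \<bar>R\<bar> + \<bar>x\<bar> + 1"
  have "integral UNIV (\<lambda>x. v x \<bullet> v x) = integral {-S..S} (\<lambda>x. v x \<bullet> v x)"
    by (rule integral_UNIV_eq) (auto simp: S_def R)
  then have "integral {-S..S} (\<lambda>x. v x \<bullet> v x) = 0" using assms(2) by simp
  moreover have "continuous_on {-S..S} (\<lambda>x. v x \<bullet> v x)"
    by (intro continuous_on_inner continuous_on_subset[OF test_function_continuous[OF assms(1)]]) auto
  ultimately have "\<forall>x\<in>{-S..S}. v x \<bullet> v x = 0"
    by (subst integral_eq_0_iff[symmetric]) (auto simp: S_def)
  moreover have "x \<in> {-S..S}" by (auto simp: S_def abs_if)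
  ultimately show ?thesis by auto
qed

text \<open>The difference of two candidates is itself an admissible variation. Testing with it
  makes the integral of its square vanish. This justifies the definite description in
  \<open>var_deriv\<close>.\<close>

lemma has_variational_derivative_unique:
  fixes u :: "'n::finite field"
  assumes "has_variational_derivative I \<xi> u" "has_variational_derivative I \<zeta> u"
  shows "\<xi> = \<zeta>"
proof
  fix x
  define v where "v x = \<xi> x - \<zeta> x" for x
  have t: "\<xi> \<in> test_functions" "\<zeta> \<in> test_functions" using assms by (auto simp: has_variational_derivative_def)
  then have v: "v \<in> test_functions" unfolding v_def by (rule test_function_diff)
  have "integral UNIV (\<lambda>x. \<xi> x \<bullet> v x) = integral UNIV (\<lambda>x. \<zeta> x \<bullet> v x)"
    using assms v unfolding has_variational_derivative_def by (meson DERIV_unique)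
  moreover have "integral UNIV (\<lambda>x. \<xi> x \<bullet> v x - \<zeta> x \<bullet> v x) = integral UNIV (\<lambda>x. \<xi> x \<bullet> v x) - integral UNIV (\<lambda>x. \<zeta> x \<bullet> v x)"
    by (intro integral_cs_diff test_function_cont_cs_inner t test_function_continuous v)
  ultimately have "integral UNIV (\<lambda>x. v x \<bullet> v x) = 0"
    by (simp add: v_def inner_diff_left)
  from cont_cs_integral_square_0[OF v this] show "\<xi> x = \<zeta> x" by (simp add: v_def)
qed

lemma var_deriv_eqI: "has_variational_derivative I \<xi> u \<Longrightarrow> var_deriv I u = \<xi>"
  unfolding var_deriv_def using has_variational_derivative_unique by blast

lemma var_deriv_works: "\<exists>\<xi>. has_variational_derivative I \<xi> u \<Longrightarrow> has_variational_derivative I (var_deriv I u) u"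
  using var_deriv_eqI by metis

lemma var_deriv_test: "\<exists>\<xi>. has_variational_derivative I \<xi> u \<Longrightarrow> var_deriv I u \<in> test_functions"
  using var_deriv_works has_variational_derivative_def by blast

lemma has_variational_derivative_add:
  assumes "has_variational_derivative I \<xi> u" "has_variational_derivative J \<zeta> u"
  shows "has_variational_derivative (\<lambda>u. a * I u + b * J u) (\<lambda>x. a *\<^sub>R \<xi> x + b *\<^sub>R \<zeta> x) u"
proof -
  have t: "\<xi> \<in> test_functions" "\<zeta> \<in> test_functions" using assms by (auto simp: has_variational_derivative_def)
  have "((\<lambda>t. a * I (\<lambda>x. u x + t *\<^sub>R v x) + b * J (\<lambda>x. u x + t *\<^sub>R v x)) has_real_derivative
     integral UNIV (\<lambda>x. (a *\<^sub>R \<xi> x + b *\<^sub>R \<zeta> x) \<bullet> v x)) (at 0)" if v: "v \<in> test_functions" for v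
  proof -
    have "integral UNIV (\<lambda>x. a * (\<xi> x \<bullet> v x) + b * (\<zeta> x \<bullet> v x))
      = integral UNIV (\<lambda>x. a * (\<xi> x \<bullet> v x)) + integral UNIV (\<lambda>x. b * (\<zeta> x \<bullet> v x))"
      by (intro integral_cs_add cont_cs_cmult test_function_cont_cs_inner t test_function_continuous v)
    then have "integral UNIV (\<lambda>x. (a *\<^sub>R \<xi> x + b *\<^sub>R \<zeta> x) \<bullet> v x)
      = a * integral UNIV (\<lambda>x. \<xi> x \<bullet> v x) + b * integral UNIV (\<lambda>x. \<zeta> x \<bullet> v x)"
      by (simp add: inner_add_left)
    then show ?thesis
      using assms v by (auto simp: has_variational_derivative_def intro!: DERIV_add DERIV_cmult)
  qed
  then show ?thesis
    using t by (auto simp: has_variational_derivative_def intro!: test_function_add test_function_scaleR)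
qed

text \<open>The probes of the converse direction: their variational derivative is the same at every
  field and can be any test function, so brackets of linear functionals show the whole bilinear
  form.\<close>

definition linear_functional :: "'n::finite field \<Rightarrow> 'n functional" where
  "linear_functional f u = integral UNIV (\<lambda>x. f x \<bullet> u x)"

lemma linear_functional_derivative:
  assumes "f \<in> test_functions" "continuous_on UNIV u"
  shows "has_variational_derivative (linear_functional f) f u"
proof -
  have "((\<lambda>t. linear_functional f (\<lambda>x. u x + t *\<^sub>R v x)) has_real_derivative integral UNIV (\<lambda>x. f x \<bullet> v x)) (at 0)"
    if v: "v \<in> test_functions" for v
  proof -
    have "integral UNIV (\<lambda>x. f x \<bullet> u x + t * (f x \<bullet> v x)) = integral UNIV (\<lambda>x. f x \<bullet> u x) + integral UNIV (\<lambda>x. t * (f x \<bullet> v x))" for t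
      by (intro integral_cs_add cont_cs_cmult test_function_cont_cs_inner assms test_function_continuous v)
    then have "linear_functional f (\<lambda>x. u x + t *\<^sub>R v x) = integral UNIV (\<lambda>x. f x \<bullet> u x) + t * integral UNIV (\<lambda>x. f x \<bullet> v x)" for t
      by (simp add: linear_functional_def inner_add_right)
    then show ?thesis by (auto intro!: derivative_eq_intros)
  qed
  then show ?thesis using assms by (simp add: has_variational_derivative_def)
qed

lemma field_smooth: "u \<in> fields U \<Longrightarrow> smooth_on UNIV u"
  by (simp add: fields_def)

lemma field_continuous: "u \<in> fields U \<Longrightarrow> continuous_on UNIV u"
  by (rule smooth_on_continuous[OF field_smooth])

lemma field_in: "u \<in> fields U \<Longrightarrow> u x \<in> U"
  by (auto simp: fields_def)

lemma fields_mono: "V \<subseteq> U \<Longrightarrow> fields V \<subseteq> fields U"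
  by (auto simp: fields_def)

lemma var_deriv_linear_functional:
  "f \<in> test_functions \<Longrightarrow> u \<in> fields U \<Longrightarrow> var_deriv (linear_functional f) u = f"
  by (intro var_deriv_eqI linear_functional_derivative field_continuous)

lemma smooth_functional_linear:
  fixes f :: "'n::finite field"
  assumes "f \<in> test_functions"
  shows "smooth_functional U (linear_functional f)"
  unfolding smooth_functional_def
proof (intro ballI conjI)
  fix u assume u: "u \<in> fields U"
  show "\<exists>\<xi>. has_variational_derivative (linear_functional f) \<xi> u"
    using linear_functional_derivative[OF assms field_continuous[OF u]] by blast
next
  fix u v w :: "'n field" assume u: "u \<in> fields U" and v: "v \<in> test_functions" "w \<in> test_functions"
  obtain R where R: "\<And>x. \<bar>x\<bar> > R \<Longrightarrow> f x = 0" using test_functionE[OF assms] by metis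
  have c: "var_deriv (linear_functional f) (\<lambda>y. u y + s *\<^sub>R v y + t *\<^sub>R w y) = f" for s t
    by (intro var_deriv_eqI linear_functional_derivative assms continuous_on_add continuous_on_scaleR
        field_continuous[OF u] test_function_continuous v continuous_on_const)
  have o: "open ({-1<..<1::real} \<times> {-1<..<1::real} \<times> (UNIV::real set))" by (intro open_Times) auto
  have "smooth_on ({-1<..<1::real} \<times> {-1<..<1::real} \<times> (UNIV::real set)) (\<lambda>p. f (snd (snd p)))"
    by (rule smooth_on_compose[OF test_function_smooth[OF assms]]) (auto intro!: smooth_on_snd smooth_on_id o)
  then have "smooth_on ({-1<..<1::real} \<times> {-1<..<1::real} \<times> (UNIV::real set))
      (\<lambda>(s, t, x). var_deriv (linear_functional f) (\<lambda>y. u y + s *\<^sub>R v y + t *\<^sub>R w y) x)"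
    by (simp add: c case_prod_unfold)
  then show "\<exists>r>0. \<exists>R. smooth_on ({-r<..<r} \<times> {-r<..<r} \<times> UNIV)
          (\<lambda>(s, t, x). var_deriv (linear_functional f) (\<lambda>y. u y + s *\<^sub>R v y + t *\<^sub>R w y) x) \<and>
        (\<forall>s\<in>{-r<..<r}. \<forall>t\<in>{-r<..<r}. \<forall>x. \<bar>x\<bar> > R \<longrightarrow>
           var_deriv (linear_functional f) (\<lambda>y. u y + s *\<^sub>R v y + t *\<^sub>R w y) x = 0)"
    using R by (intro exI[of _ "1::real"] exI[of _ R] conjI ballI allI impI) (simp_all add: c)
qed

text \<open>Being constant on both ends, a field has the same range as its restriction to a bounded
  interval. The range is therefore compact and keeps a positive distance from the complement of an
  open domain, which is why small variations are again fields.\<close>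

lemma field_constant_outside:
  fixes u :: "'n::finite field"
  assumes "smooth_on UNIV u" "\<And>x. \<bar>x\<bar> > R \<Longrightarrow> xderiv u x = 0"
  shows "range u \<subseteq> u ` {-\<bar>R\<bar> - 1..\<bar>R\<bar> + 1}"
proof
  fix z assume "z \<in> range u"
  then obtain x where z: "z = u x" by auto
  have d: "(u has_vector_derivative 0) (at y within S)" if "\<bar>y\<bar> > R" for y S
    using has_vector_derivative_at_within[OF xderiv_works[OF assms(1)], of y S] assms(2)[OF that] by simp
  consider "x > \<bar>R\<bar> + 1" | "x < - \<bar>R\<bar> - 1" | "x \<in> {-\<bar>R\<bar> - 1..\<bar>R\<bar> + 1}" by fastforce
  then show "z \<in> u ` {-\<bar>R\<bar> - 1..\<bar>R\<bar> + 1}"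
  proof cases
    case 1
    obtain c where "\<And>y. y \<in> {\<bar>R\<bar> + 1..} \<Longrightarrow> u y = c"
      using has_vector_derivative_zero_constant[of "{\<bar>R\<bar> + 1..}" u] d by auto
    then have "u x = u (\<bar>R\<bar> + 1)" using 1 by auto
    then show ?thesis using z by auto
  next
    case 2
    obtain c where "\<And>y. y \<in> {..-\<bar>R\<bar> - 1} \<Longrightarrow> u y = c"
      using has_vector_derivative_zero_constant[of "{..-\<bar>R\<bar> - 1}" u] d by auto
    then have "u x = u (-\<bar>R\<bar> - 1)" using 2 by auto
    then show ?thesis using z by auto
  qed (use z in auto)
qed

lemma test_function_bounded:
  assumes "v \<in> test_functions"
  obtains M where "M > 0" "\<And>x. norm (v x) \<le> M"
proof (rule test_functionE[OF assms])
  fix R assume R: "\<And>x. \<bar>x\<bar> > R \<Longrightarrow> v x = 0"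
  have "compact (v ` {-R..R})"
    by (intro compact_continuous_image continuous_on_subset[OF test_function_continuous[OF assms]]) auto
  then obtain M where M: "M > 0" "\<forall>y\<in>v ` {-R..R}. norm y \<le> M"
    using compact_imp_bounded bounded_pos by blast
  have "norm (v x) \<le> M" for x
  proof (cases "\<bar>x\<bar> > R")
    case False
    then have "x \<in> {-R..R}" by auto
    then show ?thesis using M by blast
  qed (use R M in auto)
  then show thesis using that M by blast
qed

lemma field_variation:
  fixes u :: "'n::finite field"
  assumes "open U" "u \<in> fields U" "v \<in> test_functions" "w \<in> test_functions"
  obtains r where "r > 0" "\<And>s t. \<bar>s\<bar> < r \<Longrightarrow> \<bar>t\<bar> < r \<Longrightarrow> (\<lambda>x. u x + s *\<^sub>R v x + t *\<^sub>R w x) \<in> fields U"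
proof -
  obtain R where R: "\<And>x. \<bar>x\<bar> > R \<Longrightarrow> xderiv u x = 0" and sm: "smooth_on UNIV u" and rU: "range u \<subseteq> U"
    using assms(2) by (auto simp: fields_def)
  define K where "K = u ` {-\<bar>R\<bar> - 1..\<bar>R\<bar> + 1}"
  have K: "compact K" "K \<subseteq> U" "range u \<subseteq> K"
    unfolding K_def using field_constant_outside[OF sm R] rU
    by (auto intro!: compact_continuous_image continuous_on_subset[OF smooth_on_continuous[OF sm]])
  obtain e where e: "e > 0" "(\<Union>x\<in>K. ball x e) \<subseteq> U"
    using compact_subset_open_imp_ball_epsilon_subset[OF K(1) assms(1) K(2)] by metis
  obtain Mv where Mv: "Mv > 0" "\<And>x. norm (v x) \<le> Mv" using test_function_bounded[OF assms(3)] by metis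
  obtain Mw where Mw: "Mw > 0" "\<And>x. norm (w x) \<le> Mw" using test_function_bounded[OF assms(4)] by metis
  obtain Rv where Rv: "\<And>x. \<bar>x\<bar> > Rv \<Longrightarrow> v x = 0" using test_functionE[OF assms(3)] by metis
  obtain Rw where Rw: "\<And>x. \<bar>x\<bar> > Rw \<Longrightarrow> w x = 0" using test_functionE[OF assms(4)] by metis
  \<comment> \<open>For parameters below r the perturbation is shorter than e at every point, by the
    bounds Mv and Mw.\<close>
  define r where "r = e / (Mv + Mw)"
  have r: "r > 0" using e Mv Mw by (simp add: r_def)
  show thesis
  proof (rule that[OF r])
    fix s t :: real assume st: "\<bar>s\<bar> < r" "\<bar>t\<bar> < r"
    have smv: "smooth_on UNIV (\<lambda>x. s *\<^sub>R v x)" "smooth_on UNIV (\<lambda>x. t *\<^sub>R w x)"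
      using test_function_smooth[OF test_function_scaleR] assms(3,4) by auto
    have sm': "smooth_on UNIV (\<lambda>x. u x + s *\<^sub>R v x + t *\<^sub>R w x)"
      by (intro smooth_on_add open_UNIV sm smv)
    have "u x + s *\<^sub>R v x + t *\<^sub>R w x \<in> U" for x
    proof -
      have "norm (s *\<^sub>R v x + t *\<^sub>R w x) \<le> \<bar>s\<bar> * norm (v x) + \<bar>t\<bar> * norm (w x)"
        by (metis norm_triangle_ineq norm_scaleR)
      also have "\<dots> \<le> \<bar>s\<bar> * Mv + \<bar>t\<bar> * Mw"
        using Mv(2) Mw(2) by (intro add_mono mult_left_mono) auto
      also have "\<dots> < r * Mv + r * Mw"
        using st Mv Mw by (intro add_strict_mono mult_strict_right_mono) auto
      also have "\<dots> = r * (Mv + Mw)" by (simp add: distrib_left)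
      also have "\<dots> = e" using add_pos_pos[OF Mv(1) Mw(1)] by (simp add: r_def)
      finally have "dist (u x + s *\<^sub>R v x + t *\<^sub>R w x) (u x) < e"
        by (simp add: dist_norm add.assoc)
      then have "u x + s *\<^sub>R v x + t *\<^sub>R w x \<in> ball (u x) e"
        by (simp only: mem_ball dist_commute)
      then show ?thesis using e(2) K(3) by blast
    qed
    moreover have "xderiv (\<lambda>x. u x + s *\<^sub>R v x + t *\<^sub>R w x) x = 0" if "\<bar>x\<bar> > max R (max Rv Rw)" for x
    proof -
      have "xderiv (\<lambda>x. s *\<^sub>R v x) x = 0" "xderiv (\<lambda>x. t *\<^sub>R w x) x = 0"
        using that by (auto intro: xderiv_zero_outside[where R=Rv] xderiv_zero_outside[where R=Rw] simp: Rv Rw)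
      then show ?thesis
        using that R by (simp add: xderiv_add smooth_on_add sm smv)
    qed
    ultimately show "(\<lambda>x. u x + s *\<^sub>R v x + t *\<^sub>R w x) \<in> fields U"
      using sm' unfolding fields_def by (auto intro!: exI[of _ "max R (max Rv Rw)"])
  qed
qed


section \<open>Second variations\<close>

text \<open>The second variation of \<open>I\<close> at \<open>u\<close>, viewed as an operator that
  sends a direction \<open>w\<close> to a field.\<close>

definition dvar :: "'n::finite functional \<Rightarrow> 'n field \<Rightarrow> 'n field \<Rightarrow> 'n field" where
  "dvar I u w x = vector_derivative (\<lambda>t. var_deriv I (\<lambda>y. u y + t *\<^sub>R w y) x) (at 0)"

lemma smooth_functional_variation2:
  fixes u :: "'n::finite field"
  assumes "open U" "smooth_functional U I" "u \<in> fields U" "v \<in> test_functions" "w \<in> test_functions"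
  obtains r R where "r > 0"
    "smooth_on ({-r<..<r} \<times> {-r<..<r} \<times> UNIV) (\<lambda>(s, t, x). var_deriv I (\<lambda>y. u y + s *\<^sub>R v y + t *\<^sub>R w y) x)"
    "\<And>s t x. \<bar>s\<bar> < r \<Longrightarrow> \<bar>t\<bar> < r \<Longrightarrow> \<bar>x\<bar> > R \<Longrightarrow> var_deriv I (\<lambda>y. u y + s *\<^sub>R v y + t *\<^sub>R w y) x = 0"
    "\<And>s t. \<bar>s\<bar> < r \<Longrightarrow> \<bar>t\<bar> < r \<Longrightarrow> (\<lambda>y. u y + s *\<^sub>R v y + t *\<^sub>R w y) \<in> fields U"
proof -
  obtain r1 where r1: "r1 > 0"
    "\<And>s t. \<bar>s\<bar> < r1 \<Longrightarrow> \<bar>t\<bar> < r1 \<Longrightarrow> (\<lambda>y. u y + s *\<^sub>R v y + t *\<^sub>R w y) \<in> fields U"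
    by (rule field_variation[OF assms(1,3-5)], rule that; blast)
  obtain r2 R where r2: "r2 > 0"
    "smooth_on ({-r2<..<r2} \<times> {-r2<..<r2} \<times> UNIV) (\<lambda>(s, t, x). var_deriv I (\<lambda>y. u y + s *\<^sub>R v y + t *\<^sub>R w y) x)"
    "\<forall>s\<in>{-r2<..<r2}. \<forall>t\<in>{-r2<..<r2}. \<forall>x. \<bar>x\<bar> > R \<longrightarrow> var_deriv I (\<lambda>y. u y + s *\<^sub>R v y + t *\<^sub>R w y) x = 0"
    using assms(2-5) unfolding smooth_functional_def by blast
  show thesis
  proof (rule that[of "min r1 r2" R])
    show "smooth_on ({-min r1 r2<..<min r1 r2} \<times> {-min r1 r2<..<min r1 r2} \<times> UNIV)
       (\<lambda>(s, t, x). var_deriv I (\<lambda>y. u y + s *\<^sub>R v y + t *\<^sub>R w y) x)"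
      by (rule smooth_on_subset[OF r2(2)]) auto
    show "var_deriv I (\<lambda>y. u y + s *\<^sub>R v y + t *\<^sub>R w y) x = 0"
      if "\<bar>s\<bar> < min r1 r2" "\<bar>t\<bar> < min r1 r2" "\<bar>x\<bar> > R" for s t x
      using r2(3)[rule_format, of s t x] that by (auto simp: abs_less_iff)
  qed (use r1 r2 in auto)
qed

lemma smooth_functional_variation:
  fixes u :: "'n::finite field"
  assumes "open U" "smooth_functional U I" "u \<in> fields U" "w \<in> test_functions"
  obtains r R where "r > 0"
    "smooth_on ({-r<..<r} \<times> UNIV) (\<lambda>(t, x). var_deriv I (\<lambda>y. u y + t *\<^sub>R w y) x)"
    "\<And>t x. \<bar>t\<bar> < r \<Longrightarrow> \<bar>x\<bar> > R \<Longrightarrow> var_deriv I (\<lambda>y. u y + t *\<^sub>R w y) x = 0"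
    "\<And>t. \<bar>t\<bar> < r \<Longrightarrow> (\<lambda>y. u y + t *\<^sub>R w y) \<in> fields U"
proof -
  obtain r R where r: "r > 0"
    "smooth_on ({-r<..<r} \<times> {-r<..<r} \<times> UNIV) (\<lambda>(s, t, x). var_deriv I (\<lambda>y. u y + s *\<^sub>R w y + t *\<^sub>R w y) x)"
    "\<And>s t x. \<bar>s\<bar> < r \<Longrightarrow> \<bar>t\<bar> < r \<Longrightarrow> \<bar>x\<bar> > R \<Longrightarrow> var_deriv I (\<lambda>y. u y + s *\<^sub>R w y + t *\<^sub>R w y) x = 0"
    "\<And>s t. \<bar>s\<bar> < r \<Longrightarrow> \<bar>t\<bar> < r \<Longrightarrow> (\<lambda>y. u y + s *\<^sub>R w y + t *\<^sub>R w y) \<in> fields U"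
    by (rule smooth_functional_variation2[OF assms(1-4,4)], rule that; blast)
  have o: "open ({-r<..<r} \<times> (UNIV::real set))" "open ({-r<..<r} \<times> {-r<..<r} \<times> (UNIV::real set))"
    by (intro open_Times; simp)+
  have "smooth_on ({-r<..<r} \<times> UNIV) (\<lambda>p. (\<lambda>(s, t, x). var_deriv I (\<lambda>y. u y + s *\<^sub>R w y + t *\<^sub>R w y) x) (0, fst p, snd p))"
    by (rule smooth_on_compose[OF r(2)])
       (use r(1) in \<open>auto intro!: smooth_on_Pair smooth_on_const smooth_on_fst smooth_on_snd smooth_on_id o\<close>)
  then have "smooth_on ({-r<..<r} \<times> UNIV) (\<lambda>(t, x). var_deriv I (\<lambda>y. u y + t *\<^sub>R w y) x)"
    by (simp add: case_prod_unfold)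
  then show thesis
    using that[of r R] r(3,4)[of 0] r(1) by simp
qed

lemma dvar_eq_dt:
  fixes u :: "'n::finite field"
  assumes "r > 0" "smooth_on ({-r<..<r} \<times> UNIV) (\<lambda>(t, x). var_deriv I (\<lambda>y. u y + t *\<^sub>R w y) x)"
  shows "dt (\<lambda>(t, x). var_deriv I (\<lambda>y. u y + t *\<^sub>R w y) x) (0, x) = dvar I u w x"
proof -
  have "((\<lambda>t. (\<lambda>(t, x). var_deriv I (\<lambda>y. u y + t *\<^sub>R w y) x) (t, x)) has_vector_derivative
    dt (\<lambda>(t, x). var_deriv I (\<lambda>y. u y + t *\<^sub>R w y) x) (0, x)) (at 0)"
    by (rule dt_has_derivative[OF assms(2)]) (use assms(1) in auto)
  then show ?thesis by (simp add: dvar_def vector_derivative_at)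
qed

lemma dvar_test_function:
  fixes u :: "'n::finite field"
  assumes "open U" "smooth_functional U I" "u \<in> fields U" "w \<in> test_functions"
  shows "dvar I u w \<in> test_functions"
proof (rule smooth_functional_variation[OF assms])
  fix r R
  assume r: "r > 0"
    "smooth_on ({-r<..<r} \<times> UNIV) (\<lambda>(t, x). var_deriv I (\<lambda>y. u y + t *\<^sub>R w y) x)"
    "\<And>t x. \<bar>t\<bar> < r \<Longrightarrow> \<bar>x\<bar> > R \<Longrightarrow> var_deriv I (\<lambda>y. u y + t *\<^sub>R w y) x = 0"
  have t0: "(0::real) \<in> {-r<..<r}" using r(1) by simp
  show ?thesis
  proof (rule test_functionI[where R=R])
    show "smooth_on UNIV (dvar I u w)"
      using smooth_on_section[OF open_greaterThanLessThan smooth_on_dt[OF r(2)] t0]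
      by (simp add: dvar_eq_dt[OF r(1,2)])
    fix x :: real assume x: "\<bar>x\<bar> > R"
    have "dt (\<lambda>(t, x). var_deriv I (\<lambda>y. u y + t *\<^sub>R w y) x) (0, x) = 0"
      by (rule dt_zero[OF open_greaterThanLessThan r(2) t0]) (use r(3) x in \<open>auto simp: abs_less_iff\<close>)
    then show "dvar I u w x = 0" by (simp add: dvar_eq_dt[OF r(1,2)])
  qed
qed

lemma var_deriv_smooth_functional:
  assumes "smooth_functional U I" "u \<in> fields U"
  shows "has_variational_derivative I (var_deriv I u) u" "var_deriv I u \<in> test_functions"
  using assms var_deriv_works var_deriv_test unfolding smooth_functional_def by blast+

lemma functional_line_derivative:
  assumes "smooth_functional U I" "(\<lambda>x. y x + c *\<^sub>R v x) \<in> fields U" "v \<in> test_functions"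
  shows "((\<lambda>s. I (\<lambda>x. y x + s *\<^sub>R v x)) has_real_derivative
    integral UNIV (\<lambda>x. var_deriv I (\<lambda>x. y x + c *\<^sub>R v x) x \<bullet> v x)) (at c)"
proof -
  have "((\<lambda>t. I (\<lambda>x. (y x + c *\<^sub>R v x) + t *\<^sub>R v x)) has_real_derivative
    integral UNIV (\<lambda>x. var_deriv I (\<lambda>x. y x + c *\<^sub>R v x) x \<bullet> v x)) (at 0)"
    using var_deriv_smooth_functional(1)[OF assms(1,2)] assms(3) by (simp add: has_variational_derivative_def)
  then have "((\<lambda>t. I (\<lambda>x. y x + (t + c) *\<^sub>R v x)) has_real_derivative
    integral UNIV (\<lambda>x. var_deriv I (\<lambda>x. y x + c *\<^sub>R v x) x \<bullet> v x)) (at 0)"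
    by (simp add: scaleR_add_left add_ac)
  then show ?thesis
    using DERIV_shift[of "\<lambda>s. I (\<lambda>x. y x + s *\<^sub>R v x)" _ 0 c] by simp
qed

context
  fixes T :: "real set" and \<xi> :: "real \<times> real \<times> real \<Rightarrow> real^'n::finite" and v :: "'n field"
  assumes T: "open T" and \<xi>: "smooth_on (T \<times> T \<times> UNIV) \<xi>" and v: "v \<in> test_functions"
begin

text \<open>A curve \<open>e\<close> in the parameter square treats both partial derivatives at
  once; horizontal and vertical lines are inserted in the next two lemmas.\<close>

private lemma pairing:
  assumes e: "\<And>t. t \<in> T \<Longrightarrow> e t \<in> T \<times> T" and sm: "smooth_on T e"
    and d: "\<And>x t. t \<in> T \<Longrightarrow> ((\<lambda>t. \<xi> (fst (e t), snd (e t), x)) has_vector_derivative D (e t) x) (at t)" and t: "t \<in> T"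
  shows "((\<lambda>t. integral UNIV (\<lambda>x. \<xi> (fst (e t), snd (e t), x) \<bullet> v x)) has_real_derivative
    integral UNIV (\<lambda>x. D (e t) x \<bullet> v x)) (at t)"
proof -
  have o: "open (T \<times> (UNIV::real set))" "open (T \<times> T \<times> (UNIV::real set))" using T by (auto intro!: open_Times)
  define H where "H p = \<xi> (fst (e (fst p)), snd (e (fst p)), snd p) \<bullet> v (snd p)" for p :: "real \<times> real"
  have sme: "smooth_on (T \<times> UNIV) (\<lambda>p :: real \<times> real. e (fst p))"
    by (rule smooth_on_compose[OF sm]) (auto intro!: smooth_on_fst smooth_on_id o T)
  have smv: "smooth_on (T \<times> UNIV) (\<lambda>p :: real \<times> real. v (snd p))"
    by (rule smooth_on_compose[OF test_function_smooth[OF v]]) (auto intro!: smooth_on_snd smooth_on_id o)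
  have "smooth_on (T \<times> UNIV) (\<lambda>p :: real \<times> real. \<xi> (fst (e (fst p)), snd (e (fst p)), snd p))"
    by (rule smooth_on_compose[OF \<xi>])
       (use e in \<open>auto simp: mem_Times_iff intro!: smooth_on_Pair smooth_on_fst smooth_on_snd smooth_on_id sme o\<close>)
  then have H: "smooth_on (T \<times> UNIV) H" unfolding H_def by (intro smooth_on_inner smv o)
  obtain R where R: "\<And>x. \<bar>x\<bar> > R \<Longrightarrow> v x = 0" using test_functionE[OF v] by metis
  have dH: "dt H (t, x) = D (e t) x \<bullet> v x" for x
  proof (rule dt_eqI[OF H])
    show "((\<lambda>t. H (t, x)) has_vector_derivative D (e t) x \<bullet> v x) (at t)"
      unfolding H_def fst_conv snd_conv
      by (rule bounded_linear.has_vector_derivative[OF bounded_linear_inner_left d[OF t]])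
  qed (use t in auto)
  have "((\<lambda>t. integral UNIV (\<lambda>x. H (t, x))) has_real_derivative integral UNIV (\<lambda>x. dt H (t, x))) (at t)"
    by (rule partial_integral[OF T H t, where R=R]) (auto simp: H_def R)
  then show ?thesis unfolding dH by (simp add: H_def)
qed

lemma pairing_derivative_2:
  assumes "s \<in> T" "t \<in> T"
  shows "((\<lambda>t. integral UNIV (\<lambda>x. \<xi> (s, t, x) \<bullet> v x)) has_real_derivative
    integral UNIV (\<lambda>x. frechet_derivative \<xi> (at (s, t, x)) (0, 1, 0) \<bullet> v x)) (at t)"
  using pairing[where e="\<lambda>t. (s, t)" and D="\<lambda>p x. frechet_derivative \<xi> (at (fst p, snd p, x)) (0, 1, 0)" and t=t]
    smooth_on_line_vector_derivative[OF \<xi>, of "(s, 0, _)" _ "(0, 1, 0)"] assms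
    smooth_on_Pair[OF T smooth_on_const[OF T, of s] smooth_on_id[OF T]]
  by auto

lemma pairing_derivative_1:
  assumes "s \<in> T" "t \<in> T"
  shows "((\<lambda>s. integral UNIV (\<lambda>x. \<xi> (s, t, x) \<bullet> v x)) has_real_derivative
    integral UNIV (\<lambda>x. frechet_derivative \<xi> (at (s, t, x)) (1, 0, 0) \<bullet> v x)) (at s)"
  using pairing[where e="\<lambda>s. (s, t)" and D="\<lambda>p x. frechet_derivative \<xi> (at (fst p, snd p, x)) (1, 0, 0)" and t=s]
    smooth_on_line_vector_derivative[OF \<xi>, of "(0, t, _)" _ "(1, 0, 0)"] assms
    smooth_on_Pair[OF T smooth_on_id[OF T] smooth_on_const[OF T, of t]]
  by auto

lemma pairing_derivative_continuous:
  "continuous_on (T \<times> T) (\<lambda>(s, t). integral UNIV (\<lambda>x. frechet_derivative \<xi> (at (s, t, x)) k \<bullet> v x))"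
proof -
  have o: "open (T \<times> T)" "open ((T \<times> T) \<times> (UNIV::real set))" "open (T \<times> T \<times> (UNIV::real set))"
    using T by (auto intro!: open_Times)
  define G where "G q = frechet_derivative \<xi> (at (fst (fst q), snd (fst q), snd q)) k \<bullet> v (snd q)" for q
  obtain R where R: "\<And>x. \<bar>x\<bar> > R \<Longrightarrow> v x = 0" using test_functionE[OF v] by metis
  have "smooth_on ((T \<times> T) \<times> UNIV) (\<lambda>q. frechet_derivative \<xi> (at (fst (fst q), snd (fst q), snd q)) k)"
    by (rule smooth_on_compose[OF smooth_on_derivative[OF \<xi>]])
       (auto intro!: smooth_on_Pair smooth_on_fst smooth_on_snd smooth_on_id o)
  moreover have "smooth_on ((T \<times> T) \<times> UNIV) (\<lambda>q. v (snd q))"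
    by (rule smooth_on_compose[OF test_function_smooth[OF v]]) (auto intro!: smooth_on_snd smooth_on_id o)
  ultimately have G: "smooth_on ((T \<times> T) \<times> UNIV) G" unfolding G_def by (intro smooth_on_inner o)
  have "smooth_on (T \<times> T) (\<lambda>z. integral {-R..R} (\<lambda>x. G (z, x)))"
    by (rule smooth_on_parameter_integral[OF o(1,2) _ G]) auto
  then have "continuous_on (T \<times> T) (\<lambda>z. integral {-R..R} (\<lambda>x. G (z, x)))" by (rule smooth_on_continuous)
  moreover have "integral UNIV (\<lambda>x. G (z, x)) = integral {-R..R} (\<lambda>x. G (z, x))" for z
    by (rule integral_UNIV_eq) (auto simp: G_def R)
  ultimately show ?thesis by (simp add: G_def case_prod_unfold)
qed

end

text \<open>The two sides are the mixed second derivatives, at the origin, of \<open>I\<close> along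
  the two-parameter variation by v and w. First derivatives are pairings with the variational
  derivative, and joint smoothness of that derivative supplies the continuity required by
  \<open>mixed_partials_eq\<close>.\<close>

lemma dvar_symmetric:
  fixes u :: "'n::finite field"
  assumes "open U" "smooth_functional U I" "u \<in> fields U" and vw: "v \<in> test_functions" "w \<in> test_functions"
  shows "integral UNIV (\<lambda>x. dvar I u w x \<bullet> v x) = integral UNIV (\<lambda>x. dvar I u v x \<bullet> w x)"
proof (rule smooth_functional_variation2[OF assms])
  fix r R
  define \<xi> where "\<xi> = (\<lambda>(s, t, x). var_deriv I (\<lambda>y. u y + s *\<^sub>R v y + t *\<^sub>R w y) x)"
  assume r: "r > 0" "smooth_on ({-r<..<r} \<times> {-r<..<r} \<times> UNIV) (\<lambda>(s, t, x). var_deriv I (\<lambda>y. u y + s *\<^sub>R v y + t *\<^sub>R w y) x)"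
    "\<And>s t. \<bar>s\<bar> < r \<Longrightarrow> \<bar>t\<bar> < r \<Longrightarrow> (\<lambda>y. u y + s *\<^sub>R v y + t *\<^sub>R w y) \<in> fields U"
  note sm = r(2)[folded \<xi>_def]
  have cont: "isCont (\<lambda>(s, t). integral UNIV (\<lambda>x. frechet_derivative \<xi> (at (s, t, x)) k \<bullet> z x)) (0, 0)"
    if "z \<in> test_functions" for k and z :: "'n field"
    using pairing_derivative_continuous[OF open_greaterThanLessThan sm that, of k]
    unfolding continuous_on_eq_continuous_at[OF open_Times[OF open_greaterThanLessThan open_greaterThanLessThan]]
    by (rule bspec) (use r(1) in simp)
  have "integral UNIV (\<lambda>x. frechet_derivative \<xi> (at (0, 0, x)) (0, 1, 0) \<bullet> v x)
      = integral UNIV (\<lambda>x. frechet_derivative \<xi> (at (0, 0, x)) (1, 0, 0) \<bullet> w x)"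
  proof (rule mixed_partials_eq[where \<phi>="\<lambda>s t. I (\<lambda>x. u x + s *\<^sub>R v x + t *\<^sub>R w x)"
        and P'="\<lambda>s t. integral UNIV (\<lambda>x. frechet_derivative \<xi> (at (s, t, x)) (0, 1, 0) \<bullet> v x)"
        and Q'="\<lambda>s t. integral UNIV (\<lambda>x. frechet_derivative \<xi> (at (s, t, x)) (1, 0, 0) \<bullet> w x)", OF r(1)])
    fix s t :: real assume st: "\<bar>s\<bar> < r" "\<bar>t\<bar> < r"
    then have st': "s \<in> {-r<..<r}" "t \<in> {-r<..<r}" by auto
    have comm: "u x + t *\<^sub>R w x + s *\<^sub>R v x = u x + s *\<^sub>R v x + t *\<^sub>R w x" for x s by simp
    show "((\<lambda>s. I (\<lambda>x. u x + s *\<^sub>R v x + t *\<^sub>R w x)) has_real_derivative integral UNIV (\<lambda>x. \<xi> (s, t, x) \<bullet> v x)) (at s)"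
      using functional_line_derivative[OF assms(2), of "\<lambda>x. u x + t *\<^sub>R w x" s v] r(3)[OF st] vw(1)
      unfolding comm by (simp add: \<xi>_def)
    show "((\<lambda>t. I (\<lambda>x. u x + s *\<^sub>R v x + t *\<^sub>R w x)) has_real_derivative integral UNIV (\<lambda>x. \<xi> (s, t, x) \<bullet> w x)) (at t)"
      using functional_line_derivative[OF assms(2), of "\<lambda>x. u x + s *\<^sub>R v x" t w] r(3)[OF st] vw(2)
      by (simp add: \<xi>_def)
    show "((\<lambda>t. integral UNIV (\<lambda>x. \<xi> (s, t, x) \<bullet> v x)) has_real_derivative
      integral UNIV (\<lambda>x. frechet_derivative \<xi> (at (s, t, x)) (0, 1, 0) \<bullet> v x)) (at t)"
      by (rule pairing_derivative_2[OF open_greaterThanLessThan sm vw(1) st'])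
    show "((\<lambda>s. integral UNIV (\<lambda>x. \<xi> (s, t, x) \<bullet> w x)) has_real_derivative
      integral UNIV (\<lambda>x. frechet_derivative \<xi> (at (s, t, x)) (1, 0, 0) \<bullet> w x)) (at s)"
      by (rule pairing_derivative_1[OF open_greaterThanLessThan sm vw(2) st'])
  qed (rule cont[OF vw(1)], rule cont[OF vw(2)])
  moreover have "frechet_derivative \<xi> (at (0, 0, x)) (0, 1, 0) = dvar I u w x" for x
    using smooth_on_line_vector_derivative[OF sm, of "(0, 0, x)" 0 "(0, 1, 0)"] r(1)
    by (simp add: dvar_def \<xi>_def vector_derivative_at)
  moreover have "frechet_derivative \<xi> (at (0, 0, x)) (1, 0, 0) = dvar I u v x" for x
    using smooth_on_line_vector_derivative[OF sm, of "(0, 0, x)" 0 "(1, 0, 0)"] r(1)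
    by (simp add: dvar_def \<xi>_def vector_derivative_at)
  ultimately show ?thesis by simp
qed

section \<open>The variational derivative of the constant bracket\<close>

lemma constant_bracket_eq:
  "constant_bracket \<eta> I J u = integral UNIV (\<lambda>x. var_deriv I u x \<bullet> eta_dx \<eta> (var_deriv J u) x)"
  by (simp add: constant_bracket_def eta_dx_def inner_vec_def matrix_vector_mult_def sum_distrib_left mult.assoc)

text \<open>Differentiation in direction v leaves v inside the second variations of I and J. In one
  term symmetry of the second variation frees it at once; in the other
  \<open>integral_eta_dx_skew\<close> first removes the derivative from it, which produces the minus
  sign.\<close>

lemma constant_bracket_variational_derivative:
  fixes u :: "'n::finite field"
  assumes U: "open U" and \<eta>: "transpose \<eta> = \<eta>" and IJ: "smooth_functional U I" "smooth_functional U J" and u: "u \<in> fields U"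
  shows "has_variational_derivative (constant_bracket \<eta> I J)
    (\<lambda>x. dvar I u (eta_dx \<eta> (var_deriv J u)) x - dvar J u (eta_dx \<eta> (var_deriv I u)) x) u"
proof -
  let ?I = "eta_dx \<eta> (var_deriv I u)" and ?J = "eta_dx \<eta> (var_deriv J u)"
  have tI: "?I \<in> test_functions" "?J \<in> test_functions"
    using var_deriv_smooth_functional(2)[OF IJ(1) u] var_deriv_smooth_functional(2)[OF IJ(2) u]
    by (auto intro: test_function_eta_dx)
  have tD: "dvar I u ?J \<in> test_functions" "dvar J u ?I \<in> test_functions"
    by (auto intro!: dvar_test_function[OF U] IJ u tI)
  have "((\<lambda>t. constant_bracket \<eta> I J (\<lambda>x. u x + t *\<^sub>R v x)) has_real_derivative
     integral UNIV (\<lambda>x. (dvar I u ?J x - dvar J u ?I x) \<bullet> v x)) (at 0)" if v: "v \<in> test_functions" for v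
  proof -
    obtain r1 R1 where 1: "r1 > 0"
      "smooth_on ({-r1<..<r1} \<times> UNIV) (\<lambda>(t, x). var_deriv I (\<lambda>y. u y + t *\<^sub>R v y) x)"
      "\<And>t x. \<bar>t\<bar> < r1 \<Longrightarrow> \<bar>x\<bar> > R1 \<Longrightarrow> var_deriv I (\<lambda>y. u y + t *\<^sub>R v y) x = 0"
      by (rule smooth_functional_variation[OF U IJ(1) u v], rule that; blast)
    obtain r2 R2 where 2: "r2 > 0"
      "smooth_on ({-r2<..<r2} \<times> UNIV) (\<lambda>(t, x). var_deriv J (\<lambda>y. u y + t *\<^sub>R v y) x)"
      by (rule smooth_functional_variation[OF U IJ(2) u v], rule that; blast)
    define T where "T = {-min r1 r2<..<min r1 r2}"
    define X where "X = (\<lambda>(t, x). var_deriv I (\<lambda>y. u y + t *\<^sub>R v y) x)"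
    define Y where "Y = (\<lambda>(t, x). var_deriv J (\<lambda>y. u y + t *\<^sub>R v y) x)"
    have T: "open T" "0 \<in> T" using 1 2 by (auto simp: T_def)
    have o: "open (T \<times> (UNIV::real set))" using T by (auto intro: open_Times)
    have sm: "smooth_on (T \<times> UNIV) X" "smooth_on (T \<times> UNIV) Y"
      unfolding X_def Y_def T_def by (rule smooth_on_subset[OF 1(2)] smooth_on_subset[OF 2(2)]; auto)+
    have dX: "dt X (0, x) = dvar I u v x" for x unfolding X_def by (rule dvar_eq_dt[OF 1(1,2)])
    have dY: "dt Y (0, x) = dvar J u v x" for x unfolding Y_def by (rule dvar_eq_dt[OF 2(1,2)])
    define H where "H p = X p \<bullet> (\<eta> *v dx Y p)" for p
    have H: "smooth_on (T \<times> UNIV) H"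
      unfolding H_def by (intro smooth_on_inner smooth_on_matrix_vector_mult smooth_on_dx sm o)
    have HC: "constant_bracket \<eta> I J (\<lambda>x. u x + t *\<^sub>R v x) = integral UNIV (\<lambda>x. H (t, x))" if "t \<in> T" for t
    proof -
      have "xderiv (var_deriv J (\<lambda>x. u x + t *\<^sub>R v x)) x = dx Y (t, x)" for x
        using xderiv_section[OF sm(2), of t x] that by (simp add: Y_def)
      then show ?thesis by (simp add: constant_bracket_eq H_def X_def eta_dx_def)
    qed
    \<comment> \<open>Parameter and space derivatives commute, so varying the x-derivative of the
      variational derivative gives the x-derivative of the second variation.\<close>
    have dxY: "dt (dx Y) (0, x) = xderiv (dvar J u v) x" for x
    proof -
      have "dt (dx Y) (0, x) = dx (dt Y) (0, x)" by (rule dt_dx_commute[OF o sm(2)]) (use T in auto)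
      also have "\<dots> = xderiv (\<lambda>x. dt Y (0, x)) x"
        by (rule xderiv_section[OF smooth_on_dt[OF sm(2)], symmetric]) (use T in auto)
      finally show ?thesis by (simp add: dY)
    qed
    have dH: "dt H (0, x) = dvar I u v x \<bullet> ?J x + var_deriv I u x \<bullet> eta_dx \<eta> (dvar J u v) x" for x
    proof (rule dt_eqI[OF H])
      have p: "(0, x) \<in> T \<times> UNIV" using T by auto
      have "((\<lambda>t. X (t, x) \<bullet> (\<eta> *v dx Y (t, x))) has_vector_derivative
         X (0, x) \<bullet> (\<eta> *v dt (dx Y) (0, x)) + dt X (0, x) \<bullet> (\<eta> *v dx Y (0, x))) (at 0)"
        by (rule bounded_bilinear.has_vector_derivative[OF bounded_bilinear_inner dt_has_derivative[OF sm(1) p]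
          bounded_linear.has_vector_derivative[OF matrix_vector_mul_bounded_linear dt_has_derivative[OF smooth_on_dx[OF sm(2)] p]]])
      moreover have "dx Y (0, x) = xderiv (var_deriv J u) x"
        using xderiv_section[OF sm(2) p] by (simp add: Y_def)
      moreover have "X (0, x) = var_deriv I u x" by (simp add: X_def)
      ultimately show "((\<lambda>t. H (t, x)) has_vector_derivative dvar I u v x \<bullet> ?J x + var_deriv I u x \<bullet> eta_dx \<eta> (dvar J u v) x) (at 0)"
        by (simp add: H_def dX dxY eta_dx_def add.commute)
    qed (use T in auto)
    have tv: "dvar I u v \<in> test_functions" "dvar J u v \<in> test_functions"
      by (auto intro!: dvar_test_function[OF U] IJ u v)
    have "((\<lambda>t. integral UNIV (\<lambda>x. H (t, x))) has_real_derivative integral UNIV (\<lambda>x. dt H (0, x))) (at 0)"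
    proof (rule partial_integral[OF T(1) H T(2), where R=R1])
      fix t x :: real assume a: "t \<in> T" "\<bar>x\<bar> > R1"
      then have "\<bar>t\<bar> < r1" by (auto simp: T_def min_def split: if_splits)
      then show "H (t, x) = 0" using 1(3)[of t x] a by (simp add: H_def X_def)
    qed
    then have "((\<lambda>t. constant_bracket \<eta> I J (\<lambda>x. u x + t *\<^sub>R v x)) has_real_derivative integral UNIV (\<lambda>x. dt H (0, x))) (at 0)"
      by (rule has_field_derivative_transform_within_open[OF _ T]) (simp add: HC)
    moreover have "integral UNIV (\<lambda>x. dt H (0, x)) = integral UNIV (\<lambda>x. (dvar I u ?J x - dvar J u ?I x) \<bullet> v x)"
    proof -
      have "integral UNIV (\<lambda>x. dt H (0, x)) = integral UNIV (\<lambda>x. dvar I u v x \<bullet> ?J x)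
         + integral UNIV (\<lambda>x. var_deriv I u x \<bullet> eta_dx \<eta> (dvar J u v) x)"
        unfolding dH
        by (intro integral_cs_add test_function_cont_cs_inner test_function_continuous tv tI
            test_function_eta_dx var_deriv_smooth_functional(2)[OF IJ(1) u])
      also have "integral UNIV (\<lambda>x. dvar I u v x \<bullet> ?J x) = integral UNIV (\<lambda>x. dvar I u ?J x \<bullet> v x)"
        by (rule dvar_symmetric[OF U IJ(1) u tI(2) v])
      also have "integral UNIV (\<lambda>x. var_deriv I u x \<bullet> eta_dx \<eta> (dvar J u v) x) = - integral UNIV (\<lambda>x. ?I x \<bullet> dvar J u v x)"
        by (rule integral_eta_dx_skew[OF \<eta> var_deriv_smooth_functional(2)[OF IJ(1) u] tv(2)])
      also have "integral UNIV (\<lambda>x. ?I x \<bullet> dvar J u v x) = integral UNIV (\<lambda>x. dvar J u ?I x \<bullet> v x)"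
        using dvar_symmetric[OF U IJ(2) u tI(1) v] by (simp add: inner_commute)
      also have "integral UNIV (\<lambda>x. dvar I u ?J x \<bullet> v x) + - integral UNIV (\<lambda>x. dvar J u ?I x \<bullet> v x)
         = integral UNIV (\<lambda>x. dvar I u ?J x \<bullet> v x - dvar J u ?I x \<bullet> v x)"
        by (subst integral_cs_diff) (auto intro!: test_function_cont_cs_inner tD test_function_continuous v)
      finally show ?thesis by (simp add: inner_diff_left)
    qed
    ultimately show ?thesis by simp
  qed
  then show ?thesis
    using test_function_diff[OF tD] by (simp add: has_variational_derivative_def)
qed


section \<open>The canonical bilinear form\<close>

definition d1 :: "(real^'n::finite \<Rightarrow> real) \<Rightarrow> real^'n \<Rightarrow> real^'n \<Rightarrow> real" where
  "d1 \<phi> u a = (\<Sum>s\<in>UNIV. pd s \<phi> u * a $ s)"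

definition d2 :: "(real^'n::finite \<Rightarrow> real) \<Rightarrow> real^'n \<Rightarrow> real^'n \<Rightarrow> real^'n \<Rightarrow> real" where
  "d2 \<phi> u a b = (\<Sum>s\<in>UNIV. (\<Sum>l\<in>UNIV. pd l (pd s \<phi>) u * a $ l) * b $ s)"

lemma d2_symmetric:
  assumes "open V" "smooth_on V \<phi>" "u \<in> V"
  shows "d2 \<phi> u a b = d2 \<phi> u b a"
proof -
  have "d2 \<phi> u a b = (\<Sum>s\<in>UNIV. \<Sum>l\<in>UNIV. pd s (pd l \<phi>) u * a $ l * b $ s)"
    using pd_commute[OF assms] by (simp add: d2_def sum_distrib_right)
  also have "\<dots> = (\<Sum>l\<in>UNIV. \<Sum>s\<in>UNIV. pd s (pd l \<phi>) u * a $ l * b $ s)" by (rule sum.swap)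
  also have "\<dots> = d2 \<phi> u b a" by (simp add: d2_def sum_distrib_right sum_distrib_left mult_ac)
  finally show ?thesis .
qed

lemma d1_add: "d1 \<phi> u (a + b) = d1 \<phi> u a + d1 \<phi> u b"
  by (simp add: d1_def distrib_left sum.distrib)

lemma d1_minus: "d1 \<phi> u (- a) = - d1 \<phi> u a"
  by (simp add: d1_def sum_negf)

lemma d1_zero: "d1 \<phi> u 0 = 0"
  by (simp add: d1_def)

lemma d2_zero: "d2 \<phi> u a 0 = 0"
  by (simp add: d2_def)

lemma d1_sum: "(\<Sum>i\<in>A. c i * d1 \<phi> u (a i)) = d1 \<phi> u (\<Sum>i\<in>A. c i *\<^sub>R a i)"
  by (simp add: d1_def sum_distrib_left sum.swap[of _ A] mult_ac)

lemma d1_has_derivative: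
  assumes \<phi>: "smooth_on V \<phi>" and z: "(z has_vector_derivative z') (at t)" "z t \<in> V"
    and a: "(a has_vector_derivative a') (at t)"
  shows "((\<lambda>t. d1 \<phi> (z t) (a t)) has_real_derivative d2 \<phi> (z t) z' (a t) + d1 \<phi> (z t) a') (at t)"
proof -
  have p: "((\<lambda>t. pd s \<phi> (z t)) has_real_derivative (\<Sum>l\<in>UNIV. pd l (pd s \<phi>) (z t) * z' $ l)) (at t)" for s
  proof -
    have "((\<lambda>t. pd s \<phi> (z t)) has_derivative (\<lambda>h. \<Sum>l\<in>UNIV. pd l (pd s \<phi>) (z t) * (h *\<^sub>R z') $ l)) (at t)"
      by (rule has_derivative_compose[OF z(1)[unfolded has_vector_derivative_def] has_derivative_pd[OF pd_smooth_on[OF \<phi>] z(2)]])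
    moreover have "(\<lambda>h. \<Sum>l\<in>UNIV. pd l (pd s \<phi>) (z t) * (h *\<^sub>R z') $ l) = (*) (\<Sum>l\<in>UNIV. pd l (pd s \<phi>) (z t) * z' $ l)"
      by (simp add: fun_eq_iff sum_distrib_left sum_distrib_right mult_ac)
    ultimately show ?thesis by (simp only: has_field_derivative_def)
  qed
  have c: "((\<lambda>t. a t $ s) has_real_derivative a' $ s) (at t)" for s
    using bounded_linear.has_vector_derivative[OF bounded_linear_vec_nth a]
    by (simp add: has_real_derivative_iff_has_vector_derivative)
  have "((\<lambda>t. \<Sum>s\<in>UNIV. pd s \<phi> (z t) * a t $ s) has_real_derivative
    (\<Sum>s\<in>UNIV. (\<Sum>l\<in>UNIV. pd l (pd s \<phi>) (z t) * z' $ l) * a t $ s + a' $ s * pd s \<phi> (z t))) (at t)"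
    by (rule DERIV_sum, rule DERIV_mult[OF p c])
  then show ?thesis by (simp add: d1_def d2_def sum.distrib mult.commute)
qed

lemma smooth_on_d1:
  assumes "open S" "open V" "smooth_on V \<phi>" "smooth_on S Z" "\<And>p. p \<in> S \<Longrightarrow> Z p \<in> V" "smooth_on S A"
  shows "smooth_on S (\<lambda>p. d1 \<phi> (Z p) (A p))"
  unfolding d1_def
  by (rule smooth_on_sum[OF assms(1)], rule smooth_on_mult[OF assms(1)],
      rule smooth_on_compose[OF pd_smooth_on[OF assms(3)] assms(4,1,2)], rule assms(5), assumption,
      rule smooth_on_vec_nth[OF assms(1,6)])

lemma continuous_on_d1:
  assumes "open V" "smooth_on V \<phi>" "u \<in> fields V" "continuous_on UNIV a"
  shows "continuous_on UNIV (\<lambda>x. d1 \<phi> (u x) (a x))"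
  unfolding d1_def
  by (rule continuous_on_sum, rule continuous_on_mult,
      rule continuous_on_compose2[OF smooth_on_continuous[OF pd_smooth_on[OF assms(2)]] field_continuous[OF assms(3)]])
     (use field_in[OF assms(3)] assms(4) in \<open>auto intro: continuous_on_component\<close>)

lemma continuous_on_d2:
  assumes "open V" "smooth_on V \<phi>" "u \<in> fields V" "continuous_on UNIV a" "continuous_on UNIV b"
  shows "continuous_on UNIV (\<lambda>x. d2 \<phi> (u x) (a x) (b x))"
  unfolding d2_def
  by (rule continuous_on_sum, rule continuous_on_mult, rule continuous_on_sum, rule continuous_on_mult,
      rule continuous_on_compose2[OF smooth_on_continuous[OF pd_smooth_on[OF pd_smooth_on[OF assms(2)]]] field_continuous[OF assms(3)]])
     (use field_in[OF assms(3)] assms(4,5) in \<open>auto intro: continuous_on_component\<close>)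

lemma cont_cs_d1:
  assumes "open V" "smooth_on V \<phi>" "u \<in> fields V" "a \<in> test_functions"
  shows "cont_cs (\<lambda>x. d1 \<phi> (u x) (a x))"
proof (rule test_functionE[OF assms(4)])
  fix R assume "\<And>x. \<bar>x\<bar> > R \<Longrightarrow> a x = 0"
  then show ?thesis
    using continuous_on_d1[OF assms(1-3) test_function_continuous[OF assms(4)]]
    by (intro cont_csI[where R=R]) (auto simp: d1_zero)
qed

lemma cont_cs_d2:
  assumes "open V" "smooth_on V \<phi>" "u \<in> fields V" "continuous_on UNIV v" "a \<in> test_functions"
  shows "cont_cs (\<lambda>x. d2 \<phi> (u x) (v x) (a x))"
proof (rule test_functionE[OF assms(5)])
  fix R assume "\<And>x. \<bar>x\<bar> > R \<Longrightarrow> a x = 0"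
  then show ?thesis
    using continuous_on_d2[OF assms(1-4) test_function_continuous[OF assms(5)]]
    by (intro cont_csI[where R=R]) (auto simp: d2_zero)
qed

section \<open>The canonical bilinear form and its dependence on the field\<close>

definition dinv_pairing :: "(real \<Rightarrow> real) \<Rightarrow> (real \<Rightarrow> real) \<Rightarrow> real" where
  "dinv_pairing a b = integral UNIV (\<lambda>x. a x * dinv b x)"

lemma dinv_pairing_skew: "cont_cs a \<Longrightarrow> cont_cs b \<Longrightarrow> dinv_pairing a b = - dinv_pairing b a"
  unfolding dinv_pairing_def by (rule dinv_skew)

lemma dinv_pairing_add_left:
  assumes "cont_cs a" "cont_cs a'" "cont_cs b"
  shows "dinv_pairing (\<lambda>x. a x + a' x) b = dinv_pairing a b + dinv_pairing a' b"
  unfolding dinv_pairing_def distrib_right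
  by (rule integral_cs_add[OF cont_cs_mult_right[OF dinv_continuous[OF assms(3)] assms(1)]
        cont_cs_mult_right[OF dinv_continuous[OF assms(3)] assms(2)]])

lemma dinv_pairing_add_right:
  assumes "cont_cs a" "cont_cs b" "cont_cs b'"
  shows "dinv_pairing a (\<lambda>x. b x + b' x) = dinv_pairing a b + dinv_pairing a b'"
  using assms dinv_pairing_skew[OF assms(1) cont_cs_add[OF assms(2,3)]]
  by (simp add: dinv_pairing_add_left dinv_pairing_skew[OF assms(2,1)] dinv_pairing_skew[OF assms(3,1)])

definition canon_F :: "real^'n^'n \<Rightarrow> (real^'n \<Rightarrow> real^'n::finite) \<Rightarrow> 'n field \<Rightarrow> 'n field \<Rightarrow> 'n field \<Rightarrow> 'n \<Rightarrow> real \<Rightarrow> real" where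
  "canon_F \<eta> F u f h i x = f x $ i * d1 (\<lambda>v. F v $ i) (u x) (eta_dx \<eta> h x) - h x $ i * d1 (\<lambda>v. F v $ i) (u x) (eta_dx \<eta> f x)"

text \<open>What the canonical bracket becomes after integration by parts (see
  \<open>bil_canonical\<close>): second derivatives of F and \<psi> and the factor u_x have
  disappeared, and skewness in f and h is visible in each term.\<close>

definition canon :: "real^'n^'n \<Rightarrow> nat \<Rightarrow> (nat \<Rightarrow> real) \<Rightarrow> (real^'n \<Rightarrow> real^'n) \<Rightarrow> (nat \<Rightarrow> real^'n \<Rightarrow> real)
    \<Rightarrow> 'n::finite field \<Rightarrow> 'n field \<Rightarrow> 'n field \<Rightarrow> real" where
  "canon \<eta> L \<epsilon> F \<psi> u f h = (\<Sum>i\<in>UNIV. integral UNIV (canon_F \<eta> F u f h i))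
     + (\<Sum>\<alpha>=1..L. \<epsilon> \<alpha> * dinv_pairing (\<lambda>x. d1 (\<psi> \<alpha>) (u x) (eta_dx \<eta> f x)) (\<lambda>x. d1 (\<psi> \<alpha>) (u x) (eta_dx \<eta> h x)))"

definition canon_F_var :: "real^'n^'n \<Rightarrow> (real^'n \<Rightarrow> real^'n::finite) \<Rightarrow> 'n field \<Rightarrow> 'n field \<Rightarrow> 'n field \<Rightarrow> 'n field \<Rightarrow> 'n \<Rightarrow> real \<Rightarrow> real" where
  "canon_F_var \<eta> F u v f h i x = f x $ i * d2 (\<lambda>v. F v $ i) (u x) (v x) (eta_dx \<eta> h x)
     - h x $ i * d2 (\<lambda>v. F v $ i) (u x) (v x) (eta_dx \<eta> f x)"

text \<open>The derivative of \<open>canon\<close> with respect to the field in direction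
  \<open>v\<close>, the arguments f and h being held fixed.\<close>

definition canon_var :: "real^'n^'n \<Rightarrow> nat \<Rightarrow> (nat \<Rightarrow> real) \<Rightarrow> (real^'n \<Rightarrow> real^'n) \<Rightarrow> (nat \<Rightarrow> real^'n \<Rightarrow> real)
    \<Rightarrow> 'n::finite field \<Rightarrow> 'n field \<Rightarrow> 'n field \<Rightarrow> 'n field \<Rightarrow> real" where
  "canon_var \<eta> L \<epsilon> F \<psi> u v f h = (\<Sum>i\<in>UNIV. integral UNIV (canon_F_var \<eta> F u v f h i))
     + (\<Sum>\<alpha>=1..L. \<epsilon> \<alpha> *
        (dinv_pairing (\<lambda>x. d2 (\<psi> \<alpha>) (u x) (v x) (eta_dx \<eta> f x)) (\<lambda>x. d1 (\<psi> \<alpha>) (u x) (eta_dx \<eta> h x))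
       + dinv_pairing (\<lambda>x. d1 (\<psi> \<alpha>) (u x) (eta_dx \<eta> f x)) (\<lambda>x. d2 (\<psi> \<alpha>) (u x) (v x) (eta_dx \<eta> h x))))"

context
  fixes V :: "(real^'n::finite) set" and F :: "real^'n \<Rightarrow> real^'n" and \<psi> :: "nat \<Rightarrow> real^'n \<Rightarrow> real" and L :: nat
    and \<eta> :: "real^'n^'n" and \<epsilon> :: "nat \<Rightarrow> real"
  assumes V: "open V" and F: "smooth_on V F" and \<psi>: "\<And>\<alpha>. \<alpha> \<in> {1..L} \<Longrightarrow> smooth_on V (\<psi> \<alpha>)"
begin

lemma F_nth: "smooth_on V (\<lambda>v. F v $ i)"
  by (rule smooth_on_vec_nth[OF V F])

lemma canon_F_cont_cs:
  assumes u: "u \<in> fields V" and f: "f \<in> test_functions" "h \<in> test_functions"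
  shows "cont_cs (canon_F \<eta> F u f h i)"
  unfolding canon_F_def
  by (rule cont_cs_diff; rule cont_cs_mult_right[OF continuous_on_d1[OF V F_nth u test_function_continuous[OF test_function_eta_dx]] test_function_cont_cs_nth])
     (rule f)+

lemma canon_F_var_cont_cs:
  assumes u: "u \<in> fields V" and v: "continuous_on UNIV v" and f: "f \<in> test_functions" "h \<in> test_functions"
  shows "cont_cs (canon_F_var \<eta> F u v f h i)"
  unfolding canon_F_var_def
  by (rule cont_cs_diff; rule cont_cs_mult_right[OF continuous_on_d2[OF V F_nth u v test_function_continuous[OF test_function_eta_dx]] test_function_cont_cs_nth])
     (rule f)+

lemma canon_add_left:
  assumes u: "u \<in> fields V" and f: "f \<in> test_functions" "f' \<in> test_functions" "h \<in> test_functions"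
  shows "canon \<eta> L \<epsilon> F \<psi> u (\<lambda>x. f x + f' x) h = canon \<eta> L \<epsilon> F \<psi> u f h + canon \<eta> L \<epsilon> F \<psi> u f' h"
proof -
  have "canon_F \<eta> F u (\<lambda>x. f x + f' x) h i = (\<lambda>x. canon_F \<eta> F u f h i x + canon_F \<eta> F u f' h i x)" for i
    using f by (simp add: canon_F_def eta_dx_add d1_add algebra_simps fun_eq_iff)
  then have 1: "integral UNIV (canon_F \<eta> F u (\<lambda>x. f x + f' x) h i)
     = integral UNIV (canon_F \<eta> F u f h i) + integral UNIV (canon_F \<eta> F u f' h i)" for i
    using integral_cs_add[OF canon_F_cont_cs canon_F_cont_cs] u f by simp
  have 2: "dinv_pairing (\<lambda>x. d1 (\<psi> \<alpha>) (u x) (eta_dx \<eta> (\<lambda>x. f x + f' x) x)) (\<lambda>x. d1 (\<psi> \<alpha>) (u x) (eta_dx \<eta> h x))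
    = dinv_pairing (\<lambda>x. d1 (\<psi> \<alpha>) (u x) (eta_dx \<eta> f x)) (\<lambda>x. d1 (\<psi> \<alpha>) (u x) (eta_dx \<eta> h x))
    + dinv_pairing (\<lambda>x. d1 (\<psi> \<alpha>) (u x) (eta_dx \<eta> f' x)) (\<lambda>x. d1 (\<psi> \<alpha>) (u x) (eta_dx \<eta> h x))"
    if "\<alpha> \<in> {1..L}" for \<alpha>
    using f by (simp add: eta_dx_add d1_add dinv_pairing_add_left cont_cs_d1[OF V \<psi>[OF that] u] test_function_eta_dx)
  have "(\<Sum>\<alpha>=1..L. \<epsilon> \<alpha> * dinv_pairing (\<lambda>x. d1 (\<psi> \<alpha>) (u x) (eta_dx \<eta> (\<lambda>x. f x + f' x) x)) (\<lambda>x. d1 (\<psi> \<alpha>) (u x) (eta_dx \<eta> h x)))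
    = (\<Sum>\<alpha>=1..L. \<epsilon> \<alpha> * dinv_pairing (\<lambda>x. d1 (\<psi> \<alpha>) (u x) (eta_dx \<eta> f x)) (\<lambda>x. d1 (\<psi> \<alpha>) (u x) (eta_dx \<eta> h x))
      + \<epsilon> \<alpha> * dinv_pairing (\<lambda>x. d1 (\<psi> \<alpha>) (u x) (eta_dx \<eta> f' x)) (\<lambda>x. d1 (\<psi> \<alpha>) (u x) (eta_dx \<eta> h x)))"
    by (rule sum.cong[OF refl]) (simp only: 2 distrib_left)
  then show ?thesis by (simp add: canon_def 1 sum.distrib)
qed

lemma canon_skew:
  assumes u: "u \<in> fields V" and f: "f \<in> test_functions" "h \<in> test_functions"
  shows "canon \<eta> L \<epsilon> F \<psi> u f h = - canon \<eta> L \<epsilon> F \<psi> u h f"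
proof -
  have 1: "canon_F \<eta> F u f h i = (\<lambda>x. - canon_F \<eta> F u h f i x)" for i
    by (simp add: canon_F_def fun_eq_iff)
  have 2: "dinv_pairing (\<lambda>x. d1 (\<psi> \<alpha>) (u x) (eta_dx \<eta> f x)) (\<lambda>x. d1 (\<psi> \<alpha>) (u x) (eta_dx \<eta> h x))
    = - dinv_pairing (\<lambda>x. d1 (\<psi> \<alpha>) (u x) (eta_dx \<eta> h x)) (\<lambda>x. d1 (\<psi> \<alpha>) (u x) (eta_dx \<eta> f x))"
    if "\<alpha> \<in> {1..L}" for \<alpha>
    by (intro dinv_pairing_skew cont_cs_d1[OF V \<psi>[OF that] u] test_function_eta_dx f)
  have "(\<Sum>\<alpha>=1..L. \<epsilon> \<alpha> * dinv_pairing (\<lambda>x. d1 (\<psi> \<alpha>) (u x) (eta_dx \<eta> f x)) (\<lambda>x. d1 (\<psi> \<alpha>) (u x) (eta_dx \<eta> h x)))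
    = - (\<Sum>\<alpha>=1..L. \<epsilon> \<alpha> * dinv_pairing (\<lambda>x. d1 (\<psi> \<alpha>) (u x) (eta_dx \<eta> h x)) (\<lambda>x. d1 (\<psi> \<alpha>) (u x) (eta_dx \<eta> f x)))"
    unfolding sum_negf[symmetric] by (rule sum.cong[OF refl]) (subst 2, simp_all)
  then show ?thesis by (simp add: canon_def 1 sum_negf)
qed

lemma canon_minus_left:
  assumes f: "f \<in> test_functions"
  shows "canon \<eta> L \<epsilon> F \<psi> u (\<lambda>x. - f x) h = - canon \<eta> L \<epsilon> F \<psi> u f h"
proof -
  have 1: "canon_F \<eta> F u (\<lambda>x. - f x) h i = (\<lambda>x. - canon_F \<eta> F u f h i x)" for i
    using f by (simp add: canon_F_def eta_dx_minus d1_minus fun_eq_iff)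
  show ?thesis
    using f by (simp add: canon_def 1 eta_dx_minus d1_minus dinv_pairing_def sum_negf)
qed

lemma canon_diff_left:
  assumes u: "u \<in> fields V" and f: "f \<in> test_functions" "f' \<in> test_functions" "h \<in> test_functions"
  shows "canon \<eta> L \<epsilon> F \<psi> u (\<lambda>x. f x - f' x) h = canon \<eta> L \<epsilon> F \<psi> u f h - canon \<eta> L \<epsilon> F \<psi> u f' h"
  using canon_add_left[OF u f(1) test_function_minus[OF f(2)] f(3)] canon_minus_left[OF f(2)] by simp

text \<open>The terms with F cancel pointwise. The six nonlocal terms form three pairs with the same
  Hessian factor and the same gradient factor in opposite order, for instance the first with the
  fourth; symmetry of the Hessian and skewness of \<open>dinv_pairing\<close> cancel each
  pair.\<close>

lemma canon_var_cyclic: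
  assumes u: "u \<in> fields V" and f: "f \<in> test_functions" "h \<in> test_functions" "k \<in> test_functions"
  shows "canon_var \<eta> L \<epsilon> F \<psi> u (eta_dx \<eta> k) f h + canon_var \<eta> L \<epsilon> F \<psi> u (eta_dx \<eta> f) h k
    + canon_var \<eta> L \<epsilon> F \<psi> u (eta_dx \<eta> h) k f = 0"
proof -
  note te = f[THEN test_function_eta_dx, of \<eta>]
  note co = te[THEN test_function_continuous]
  have sF: "d2 (\<lambda>v. F v $ i) (u x) a b = d2 (\<lambda>v. F v $ i) (u x) b a" for i x a b
    by (rule d2_symmetric[OF V F_nth field_in[OF u]])
  have z: "(\<lambda>x. canon_F_var \<eta> F u (eta_dx \<eta> k) f h i x + canon_F_var \<eta> F u (eta_dx \<eta> f) h k i x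
     + canon_F_var \<eta> F u (eta_dx \<eta> h) k f i x) = (\<lambda>x. 0)" for i
    unfolding canon_F_var_def using sF by (auto simp: fun_eq_iff algebra_simps)
  have 1: "integral UNIV (canon_F_var \<eta> F u (eta_dx \<eta> k) f h i) + integral UNIV (canon_F_var \<eta> F u (eta_dx \<eta> f) h k i)
     + integral UNIV (canon_F_var \<eta> F u (eta_dx \<eta> h) k f i) = 0" for i
  proof -
    have "integral UNIV (\<lambda>x. canon_F_var \<eta> F u (eta_dx \<eta> k) f h i x + canon_F_var \<eta> F u (eta_dx \<eta> f) h k i x
     + canon_F_var \<eta> F u (eta_dx \<eta> h) k f i x) = integral UNIV (canon_F_var \<eta> F u (eta_dx \<eta> k) f h i) + integral UNIV (canon_F_var \<eta> F u (eta_dx \<eta> f) h k i)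
     + integral UNIV (canon_F_var \<eta> F u (eta_dx \<eta> h) k f i)"
      by (simp only: integral_cs_add cont_cs_add canon_F_var_cont_cs u f co)
    then show ?thesis unfolding z by simp
  qed
  let ?D = "\<lambda>\<alpha> a b x. d2 (\<psi> \<alpha>) (u x) (eta_dx \<eta> a x) (eta_dx \<eta> b x)"
  let ?A = "\<lambda>\<alpha> a x. d1 (\<psi> \<alpha>) (u x) (eta_dx \<eta> a x)"
  have 2: "(dinv_pairing (?D \<alpha> k f) (?A \<alpha> h) + dinv_pairing (?A \<alpha> f) (?D \<alpha> k h))
     + (dinv_pairing (?D \<alpha> f h) (?A \<alpha> k) + dinv_pairing (?A \<alpha> h) (?D \<alpha> f k))
     + (dinv_pairing (?D \<alpha> h k) (?A \<alpha> f) + dinv_pairing (?A \<alpha> k) (?D \<alpha> h f)) = 0" if \<alpha>: "\<alpha> \<in> {1..L}" for \<alpha>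
  proof -
    have s: "?D \<alpha> a b = ?D \<alpha> b a" for a b
      using d2_symmetric[OF V \<psi>[OF \<alpha>] field_in[OF u]] by (simp add: fun_eq_iff)
    have cA: "cont_cs (?A \<alpha> a)" if "a \<in> test_functions" for a
      by (rule cont_cs_d1[OF V \<psi>[OF \<alpha>] u test_function_eta_dx[OF that]])
    have cD: "cont_cs (?D \<alpha> a b)" if "a \<in> test_functions" "b \<in> test_functions" for a b
      by (rule cont_cs_d2[OF V \<psi>[OF \<alpha>] u test_function_continuous[OF test_function_eta_dx[OF that(1)]] test_function_eta_dx[OF that(2)]])
    show ?thesis
      using dinv_pairing_skew[OF cD[OF f(3,1)] cA[OF f(2)]] dinv_pairing_skew[OF cD[OF f(1,2)] cA[OF f(3)]]
        dinv_pairing_skew[OF cD[OF f(2,3)] cA[OF f(1)]]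
      by (simp add: s[of f k] s[of h f] s[of h k])
  qed
  have "(\<Sum>\<alpha>=1..L. \<epsilon> \<alpha> * ((dinv_pairing (?D \<alpha> k f) (?A \<alpha> h) + dinv_pairing (?A \<alpha> f) (?D \<alpha> k h))
     + (dinv_pairing (?D \<alpha> f h) (?A \<alpha> k) + dinv_pairing (?A \<alpha> h) (?D \<alpha> f k))
     + (dinv_pairing (?D \<alpha> h k) (?A \<alpha> f) + dinv_pairing (?A \<alpha> k) (?D \<alpha> h f)))) = 0"
    by (rule sum.neutral, rule ballI) (simp only: 2 mult_zero_right)
  moreover have "(\<Sum>i\<in>UNIV. integral UNIV (canon_F_var \<eta> F u (eta_dx \<eta> k) f h i) + integral UNIV (canon_F_var \<eta> F u (eta_dx \<eta> f) h k i)
     + integral UNIV (canon_F_var \<eta> F u (eta_dx \<eta> h) k f i)) = 0"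
    by (simp only: 1 sum.neutral_const)
  ultimately show ?thesis
    unfolding canon_var_def by (simp only: sum.distrib distrib_left)
qed

text \<open>The arguments are allowed to depend on t as well, because the variational derivatives of
  general functionals change along a variation of the field. The constant R bounds all supports
  uniformly in t.\<close>

lemma canon_derivative:
  fixes u v :: "'n field" and X Y :: "real \<times> real \<Rightarrow> real^'n"
  assumes T: "open T" "0 \<in> T" and u: "u \<in> fields V" and v: "v \<in> test_functions"
    and uT: "\<And>t x. t \<in> T \<Longrightarrow> u x + t *\<^sub>R v x \<in> V"
    and X: "smooth_on (T \<times> UNIV) X" "\<And>t x. t \<in> T \<Longrightarrow> \<bar>x\<bar> > R \<Longrightarrow> X (t, x) = 0"
    and Y: "smooth_on (T \<times> UNIV) Y" "\<And>t x. t \<in> T \<Longrightarrow> \<bar>x\<bar> > R \<Longrightarrow> Y (t, x) = 0"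
  shows "((\<lambda>t. canon \<eta> L \<epsilon> F \<psi> (\<lambda>x. u x + t *\<^sub>R v x) (\<lambda>x. X (t, x)) (\<lambda>x. Y (t, x))) has_real_derivative
    canon_var \<eta> L \<epsilon> F \<psi> u v (\<lambda>x. X (0, x)) (\<lambda>x. Y (0, x))
    + canon \<eta> L \<epsilon> F \<psi> u (\<lambda>x. dt X (0, x)) (\<lambda>x. Y (0, x))
    + canon \<eta> L \<epsilon> F \<psi> u (\<lambda>x. X (0, x)) (\<lambda>x. dt Y (0, x))) (at 0)"
proof -
  have o: "open (T \<times> (UNIV::real set))" using T by (auto intro: open_Times)
  have p0: "(0, x) \<in> T \<times> (UNIV::real set)" for x using T by auto
  define Z where "Z p = u (snd p) + fst p *\<^sub>R v (snd p)" for p :: "real \<times> real"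
  have Z: "smooth_on (T \<times> UNIV) Z"
    unfolding Z_def
    by (intro smooth_on_add smooth_on_scaleR o smooth_on_fst smooth_on_id
        smooth_on_compose[OF field_smooth[OF u]] smooth_on_compose[OF test_function_smooth[OF v]] smooth_on_snd open_UNIV UNIV_I)
  have ZV: "Z p \<in> V" if "p \<in> T \<times> UNIV" for p using uT that by (auto simp: Z_def)
  have Z0: "Z (0, x) = u x" for x by (simp add: Z_def)
  have Zd: "((\<lambda>t. Z (t, x)) has_vector_derivative v x) (at 0)" for x
    unfolding Z_def by (auto intro!: derivative_eq_intros)
  define PX where "PX p = \<eta> *v dx X p" for p
  define PY where "PY p = \<eta> *v dx Y p" for p
  have PX: "smooth_on (T \<times> UNIV) PX" and PY: "smooth_on (T \<times> UNIV) PY"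
    unfolding PX_def PY_def by (intro smooth_on_matrix_vector_mult smooth_on_dx X Y o)+
  have PXe: "eta_dx \<eta> (\<lambda>x. X (t, x)) x = PX (t, x)" if "t \<in> T" for t x
    using xderiv_section[OF X(1), of t x] that by (simp add: eta_dx_def PX_def)
  have PYe: "eta_dx \<eta> (\<lambda>x. Y (t, x)) x = PY (t, x)" if "t \<in> T" for t x
    using xderiv_section[OF Y(1), of t x] that by (simp add: eta_dx_def PY_def)
  have dP: "((\<lambda>t. \<eta> *v dx W (t, x)) has_vector_derivative eta_dx \<eta> (\<lambda>x. dt W (0, x)) x) (at 0)"
    if W: "smooth_on (T \<times> UNIV) W" for W :: "real \<times> real \<Rightarrow> real^'n" and x
  proof -
    have "((\<lambda>t. \<eta> *v dx W (t, x)) has_vector_derivative \<eta> *v dt (dx W) (0, x)) (at 0)"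
      by (rule bounded_linear.has_vector_derivative[OF matrix_vector_mul_bounded_linear dt_has_derivative[OF smooth_on_dx[OF W] p0]])
    moreover have "dt (dx W) (0, x) = xderiv (\<lambda>x. dt W (0, x)) x"
      using dt_dx_commute[OF o W p0] xderiv_section[OF smooth_on_dt[OF W] p0] by simp
    ultimately show ?thesis by (simp add: eta_dx_def)
  qed
  have dPX: "((\<lambda>t. PX (t, x)) has_vector_derivative eta_dx \<eta> (\<lambda>x. dt X (0, x)) x) (at 0)" for x
    unfolding PX_def by (rule dP[OF X(1)])
  have dPY: "((\<lambda>t. PY (t, x)) has_vector_derivative eta_dx \<eta> (\<lambda>x. dt Y (0, x)) x) (at 0)" for x
    unfolding PY_def by (rule dP[OF Y(1)])
  have X0: "(\<lambda>x. X (0, x)) \<in> test_functions" "(\<lambda>x. Y (0, x)) \<in> test_functions"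
    by (rule test_functionI[where R=R], rule smooth_on_section[OF T(1) X(1) T(2)], rule X(2)[OF T(2)], assumption,
        rule test_functionI[where R=R], rule smooth_on_section[OF T(1) Y(1) T(2)], rule Y(2)[OF T(2)])
  have dX0: "(\<lambda>x. dt X (0, x)) \<in> test_functions" "(\<lambda>x. dt Y (0, x)) \<in> test_functions"
    by (rule test_functionI[where R=R], rule smooth_on_section[OF T(1) smooth_on_dt[OF X(1)] T(2)], rule dt_zero[OF T(1) X(1) T(2) X(2)], assumption+,
        rule test_functionI[where R=R], rule smooth_on_section[OF T(1) smooth_on_dt[OF Y(1)] T(2)], rule dt_zero[OF T(1) Y(1) T(2) Y(2)])
  note vc = test_function_continuous[OF v]
  have PXR: "PX (t, x) = 0" if "t \<in> T" "\<bar>x\<bar> > R" for t x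
    using PXe[OF that(1), symmetric] xderiv_zero_outside[of R "\<lambda>x. X (t, x)" x] X(2)[OF that(1)] that by (simp add: eta_dx_def)
  have PYR: "PY (t, x) = 0" if "t \<in> T" "\<bar>x\<bar> > R" for t x
    using PYe[OF that(1), symmetric] xderiv_zero_outside[of R "\<lambda>x. Y (t, x)" x] Y(2)[OF that(1)] that by (simp add: eta_dx_def)
  let ?X = "\<lambda>x. X (0, x)" and ?Y = "\<lambda>x. Y (0, x)" and ?dX = "\<lambda>x. dt X (0, x)" and ?dY = "\<lambda>x. dt Y (0, x)"
  have partF: "((\<lambda>t. integral UNIV (canon_F \<eta> F (\<lambda>x. u x + t *\<^sub>R v x) (\<lambda>x. X (t, x)) (\<lambda>x. Y (t, x)) i)) has_real_derivative
    integral UNIV (canon_F_var \<eta> F u v ?X ?Y i) + integral UNIV (canon_F \<eta> F u ?dX ?Y i) + integral UNIV (canon_F \<eta> F u ?X ?dY i)) (at 0)" for i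
  proof -
    define G where "G p = X p $ i * d1 (\<lambda>v. F v $ i) (Z p) (PY p) - Y p $ i * d1 (\<lambda>v. F v $ i) (Z p) (PX p)" for p
    have G: "smooth_on (T \<times> UNIV) G"
      unfolding G_def
      by (intro smooth_on_diff smooth_on_mult o smooth_on_vec_nth X(1) Y(1) smooth_on_d1[OF o V F_nth Z ZV] PX PY)
    have Gd: "dt G (0, x) = canon_F_var \<eta> F u v ?X ?Y i x + canon_F \<eta> F u ?dX ?Y i x + canon_F \<eta> F u ?X ?dY i x" for x
    proof (rule dt_eqI[OF G p0])
      have cX: "((\<lambda>t. X (t, x) $ i) has_real_derivative dt X (0, x) $ i) (at 0)"
        using bounded_linear.has_vector_derivative[OF bounded_linear_vec_nth dt_has_derivative[OF X(1) p0]]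
        by (simp add: has_real_derivative_iff_has_vector_derivative)
      have cY: "((\<lambda>t. Y (t, x) $ i) has_real_derivative dt Y (0, x) $ i) (at 0)"
        using bounded_linear.has_vector_derivative[OF bounded_linear_vec_nth dt_has_derivative[OF Y(1) p0]]
        by (simp add: has_real_derivative_iff_has_vector_derivative)
      have "((\<lambda>t. G (t, x)) has_real_derivative
         (dt X (0, x) $ i * d1 (\<lambda>v. F v $ i) (Z (0, x)) (PY (0, x)) + (d2 (\<lambda>v. F v $ i) (Z (0, x)) (v x) (PY (0, x)) + d1 (\<lambda>v. F v $ i) (Z (0, x)) (eta_dx \<eta> ?dY x)) * X (0, x) $ i)
       - (dt Y (0, x) $ i * d1 (\<lambda>v. F v $ i) (Z (0, x)) (PX (0, x)) + (d2 (\<lambda>v. F v $ i) (Z (0, x)) (v x) (PX (0, x)) + d1 (\<lambda>v. F v $ i) (Z (0, x)) (eta_dx \<eta> ?dX x)) * Y (0, x) $ i)) (at 0)"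
        unfolding G_def
        by (rule DERIV_diff[OF DERIV_mult[OF cX d1_has_derivative[OF F_nth Zd ZV[OF p0] dPY]]
              DERIV_mult[OF cY d1_has_derivative[OF F_nth Zd ZV[OF p0] dPX]]])
      then show "((\<lambda>t. G (t, x)) has_vector_derivative canon_F_var \<eta> F u v ?X ?Y i x + canon_F \<eta> F u ?dX ?Y i x + canon_F \<eta> F u ?X ?dY i x) (at 0)"
        unfolding has_real_derivative_iff_has_vector_derivative[symmetric] Z0
        by (simp add: canon_F_def canon_F_var_def PXe PYe T(2) algebra_simps)
    qed
    have "((\<lambda>t. integral UNIV (\<lambda>x. G (t, x))) has_real_derivative integral UNIV (\<lambda>x. dt G (0, x))) (at 0)"
      by (rule partial_integral[OF T(1) G T(2), where R=R]) (simp add: G_def X(2) Y(2))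
    moreover have "integral UNIV (\<lambda>x. dt G (0, x)) =
       integral UNIV (canon_F_var \<eta> F u v ?X ?Y i) + integral UNIV (canon_F \<eta> F u ?dX ?Y i) + integral UNIV (canon_F \<eta> F u ?X ?dY i)"
      unfolding Gd
      by (simp only: integral_cs_add cont_cs_add canon_F_var_cont_cs canon_F_cont_cs u vc X0 dX0)
    ultimately have "((\<lambda>t. integral UNIV (\<lambda>x. G (t, x))) has_real_derivative
        integral UNIV (canon_F_var \<eta> F u v ?X ?Y i) + integral UNIV (canon_F \<eta> F u ?dX ?Y i) + integral UNIV (canon_F \<eta> F u ?X ?dY i)) (at 0)" by simp
    then show ?thesis
    proof (rule has_field_derivative_transform_within_open[OF _ T])
      fix t assume t: "t \<in> T"
      have "G (t, x) = canon_F \<eta> F (\<lambda>x. u x + t *\<^sub>R v x) (\<lambda>x. X (t, x)) (\<lambda>x. Y (t, x)) i x" for x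
        by (simp add: G_def canon_F_def PXe[OF t] PYe[OF t] Z_def)
      then show "integral UNIV (\<lambda>x. G (t, x)) = integral UNIV (canon_F \<eta> F (\<lambda>x. u x + t *\<^sub>R v x) (\<lambda>x. X (t, x)) (\<lambda>x. Y (t, x)) i)"
        by simp
    qed
  qed
  have part\<psi>: "((\<lambda>t. dinv_pairing (\<lambda>x. d1 (\<psi> \<alpha>) (u x + t *\<^sub>R v x) (eta_dx \<eta> (\<lambda>x. X (t, x)) x))
       (\<lambda>x. d1 (\<psi> \<alpha>) (u x + t *\<^sub>R v x) (eta_dx \<eta> (\<lambda>x. Y (t, x)) x))) has_real_derivative
     (dinv_pairing (\<lambda>x. d2 (\<psi> \<alpha>) (u x) (v x) (eta_dx \<eta> ?X x)) (\<lambda>x. d1 (\<psi> \<alpha>) (u x) (eta_dx \<eta> ?Y x))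
       + dinv_pairing (\<lambda>x. d1 (\<psi> \<alpha>) (u x) (eta_dx \<eta> ?X x)) (\<lambda>x. d2 (\<psi> \<alpha>) (u x) (v x) (eta_dx \<eta> ?Y x)))
     + dinv_pairing (\<lambda>x. d1 (\<psi> \<alpha>) (u x) (eta_dx \<eta> ?dX x)) (\<lambda>x. d1 (\<psi> \<alpha>) (u x) (eta_dx \<eta> ?Y x))
     + dinv_pairing (\<lambda>x. d1 (\<psi> \<alpha>) (u x) (eta_dx \<eta> ?X x)) (\<lambda>x. d1 (\<psi> \<alpha>) (u x) (eta_dx \<eta> ?dY x))) (at 0)"
    if \<alpha>: "\<alpha> \<in> {1..L}" for \<alpha>
  proof -
    define a where "a p = d1 (\<psi> \<alpha>) (Z p) (PX p)" for p
    define b where "b p = d1 (\<psi> \<alpha>) (Z p) (PY p)" for p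
    have a: "smooth_on (T \<times> UNIV) a" and b: "smooth_on (T \<times> UNIV) b"
      unfolding a_def b_def by (intro smooth_on_d1[OF o V \<psi>[OF \<alpha>] Z ZV] PX PY; assumption)+
    have da: "dt a (0, x) = d2 (\<psi> \<alpha>) (u x) (v x) (eta_dx \<eta> ?X x) + d1 (\<psi> \<alpha>) (u x) (eta_dx \<eta> ?dX x)" for x
      by (rule dt_eqI[OF a p0])
         (use d1_has_derivative[OF \<psi>[OF \<alpha>] Zd ZV[OF p0] dPX, of x] in \<open>simp add: a_def has_real_derivative_iff_has_vector_derivative Z0 PXe T(2)\<close>)
    have db: "dt b (0, x) = d2 (\<psi> \<alpha>) (u x) (v x) (eta_dx \<eta> ?Y x) + d1 (\<psi> \<alpha>) (u x) (eta_dx \<eta> ?dY x)" for x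
      by (rule dt_eqI[OF b p0])
         (use d1_has_derivative[OF \<psi>[OF \<alpha>] Zd ZV[OF p0] dPY, of x] in \<open>simp add: b_def has_real_derivative_iff_has_vector_derivative Z0 PYe T(2)\<close>)
    have "((\<lambda>t. dinv_pairing (\<lambda>x. a (t, x)) (\<lambda>x. b (t, x))) has_real_derivative
      dinv_pairing (\<lambda>x. dt a (0, x)) (\<lambda>x. b (0, x)) + dinv_pairing (\<lambda>x. a (0, x)) (\<lambda>x. dt b (0, x))) (at 0)"
      unfolding dinv_pairing_def
      by (rule dinv_pairing_derivative[OF T a b, where R=R]) (simp_all add: a_def b_def PXR PYR d1_zero)
    moreover have "(\<lambda>x. a (0, x)) = (\<lambda>x. d1 (\<psi> \<alpha>) (u x) (eta_dx \<eta> ?X x))" "(\<lambda>x. b (0, x)) = (\<lambda>x. d1 (\<psi> \<alpha>) (u x) (eta_dx \<eta> ?Y x))"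
      by (simp_all add: a_def b_def Z0 PXe PYe T(2))
    ultimately have "((\<lambda>t. dinv_pairing (\<lambda>x. a (t, x)) (\<lambda>x. b (t, x))) has_real_derivative
      (dinv_pairing (\<lambda>x. d2 (\<psi> \<alpha>) (u x) (v x) (eta_dx \<eta> ?X x)) (\<lambda>x. d1 (\<psi> \<alpha>) (u x) (eta_dx \<eta> ?Y x))
       + dinv_pairing (\<lambda>x. d1 (\<psi> \<alpha>) (u x) (eta_dx \<eta> ?X x)) (\<lambda>x. d2 (\<psi> \<alpha>) (u x) (v x) (eta_dx \<eta> ?Y x)))
     + dinv_pairing (\<lambda>x. d1 (\<psi> \<alpha>) (u x) (eta_dx \<eta> ?dX x)) (\<lambda>x. d1 (\<psi> \<alpha>) (u x) (eta_dx \<eta> ?Y x))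
     + dinv_pairing (\<lambda>x. d1 (\<psi> \<alpha>) (u x) (eta_dx \<eta> ?X x)) (\<lambda>x. d1 (\<psi> \<alpha>) (u x) (eta_dx \<eta> ?dY x))) (at 0)"
      by (simp add: da db dinv_pairing_add_left dinv_pairing_add_right cont_cs_d1[OF V \<psi>[OF \<alpha>] u]
          cont_cs_d2[OF V \<psi>[OF \<alpha>] u vc] test_function_eta_dx X0 dX0 add_ac)
    then show ?thesis
      by (rule has_field_derivative_transform_within_open[OF _ T]) (simp add: a_def b_def PXe PYe Z_def)
  qed
  show ?thesis
    unfolding canon_def canon_var_def
    by (rule DERIV_cong, rule DERIV_add[OF DERIV_sum DERIV_sum], rule partF, rule DERIV_cmult, rule part\<psi>, assumption)
       (simp add: sum.distrib distrib_left add_ac)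
qed

end


section \<open>Operator brackets as bilinear forms, and the canonical bracket after integration by
  parts\<close>

definition bil :: "(real^'n \<Rightarrow> real^'n^'n) \<Rightarrow> (real^'n \<Rightarrow> real^'n^'n^'n) \<Rightarrow> nat \<Rightarrow> (nat \<Rightarrow> real)
      \<Rightarrow> (nat \<Rightarrow> real^'n \<Rightarrow> real^'n^'n) \<Rightarrow> 'n::finite field \<Rightarrow> 'n field \<Rightarrow> 'n field \<Rightarrow> real" where
  "bil g b L \<epsilon> w u f h = integral UNIV (\<lambda>x. f x \<bullet> nonlocal_operator g b L \<epsilon> w u h x)"

lemma nonlocal_bracket_bil:
  "nonlocal_bracket g b L \<epsilon> w I J u = bil g b L \<epsilon> w u (var_deriv I u) (var_deriv J u)"
  by (simp add: nonlocal_bracket_def bil_def)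

lemma symmetric_matrix_nth:
  fixes \<eta> :: "real^'n^'n::finite"
  assumes "transpose \<eta> = \<eta>"
  shows "\<eta> $ i $ j = \<eta> $ j $ i"
proof -
  have "transpose \<eta> $ i $ j = \<eta> $ j $ i" by (simp add: transpose_def)
  then show ?thesis by (simp add: assms)
qed

lemma sum_rows_symmetric:
  fixes \<eta> :: "real^'n^'n::finite"
  assumes "transpose \<eta> = \<eta>"
  shows "(\<Sum>j\<in>UNIV. c $ j *\<^sub>R \<eta> $ j) = \<eta> *v c"
  using symmetric_matrix_nth[OF assms]
  by (simp add: vec_eq_iff matrix_vector_mult_def mult.commute)

lemma d1_rows:
  assumes "transpose \<eta> = \<eta>"
  shows "(\<Sum>j\<in>UNIV. d1 \<phi> u (\<eta> $ j) * c $ j) = d1 \<phi> u (\<eta> *v c)"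
  using d1_sum[of "\<lambda>j. c $ j" \<phi> u "\<lambda>j. \<eta> $ j" UNIV] by (simp add: sum_rows_symmetric[OF assms] mult.commute)

lemma d2_as_d1: "d2 \<phi> u a b = (\<Sum>s\<in>UNIV. d1 (pd s \<phi>) u a * b $ s)"
  by (simp add: d2_def d1_def)

lemma d2_rows:
  assumes "transpose \<eta> = \<eta>"
  shows "(\<Sum>j\<in>UNIV. d2 \<phi> u (\<eta> $ j) b * c $ j) = d2 \<phi> u (\<eta> *v c) b"
proof -
  have "(\<Sum>j\<in>UNIV. d2 \<phi> u (\<eta> $ j) b * c $ j) = (\<Sum>j\<in>UNIV. \<Sum>s\<in>UNIV. d1 (pd s \<phi>) u (\<eta> $ j) * c $ j * b $ s)"
    by (simp add: d2_as_d1 sum_distrib_left sum_distrib_right mult_ac)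
  also have "\<dots> = (\<Sum>s\<in>UNIV. \<Sum>j\<in>UNIV. d1 (pd s \<phi>) u (\<eta> $ j) * c $ j * b $ s)" by (rule sum.swap)
  also have "\<dots> = d2 \<phi> u (\<eta> *v c) b"
    by (simp add: d2_as_d1 sum_distrib_right[symmetric] d1_rows[OF assms])
  finally show ?thesis .
qed

lemma triple_sum:
  fixes x y :: "real^'n::finite"
  shows "(\<Sum>s\<in>UNIV. \<Sum>p\<in>UNIV. x $ s * y $ p * (\<Sum>\<alpha>\<in>A. e \<alpha> * P \<alpha> s * Q \<alpha> p))
    = (\<Sum>\<alpha>\<in>A. e \<alpha> * (\<Sum>s\<in>UNIV. P \<alpha> s * x $ s) * (\<Sum>p\<in>UNIV. Q \<alpha> p * y $ p))"
proof -
  have "(\<Sum>\<alpha>\<in>A. e \<alpha> * (\<Sum>s\<in>UNIV. P \<alpha> s * x $ s) * (\<Sum>p\<in>UNIV. Q \<alpha> p * y $ p))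
    = (\<Sum>\<alpha>\<in>A. \<Sum>s\<in>UNIV. \<Sum>p\<in>UNIV. x $ s * y $ p * (e \<alpha> * P \<alpha> s * Q \<alpha> p))"
    by (simp add: sum_distrib_left sum_distrib_right mult_ac)
  also have "\<dots> = (\<Sum>s\<in>UNIV. \<Sum>\<alpha>\<in>A. \<Sum>p\<in>UNIV. x $ s * y $ p * (e \<alpha> * P \<alpha> s * Q \<alpha> p))" by (rule sum.swap)
  also have "\<dots> = (\<Sum>s\<in>UNIV. \<Sum>p\<in>UNIV. \<Sum>\<alpha>\<in>A. x $ s * y $ p * (e \<alpha> * P \<alpha> s * Q \<alpha> p))"
    by (rule sum.cong[OF refl], rule sum.swap)
  finally show ?thesis by (simp add: sum_distrib_left)
qed

context
  fixes V :: "(real^'n::finite) set" and F :: "real^'n \<Rightarrow> real^'n" and \<psi> :: "nat \<Rightarrow> real^'n \<Rightarrow> real" and L :: nat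
    and \<eta> :: "real^'n^'n" and \<epsilon> :: "nat \<Rightarrow> real"
  assumes V: "open V" and F: "smooth_on V F" and \<psi>: "\<And>\<alpha>. \<alpha> \<in> {1..L} \<Longrightarrow> smooth_on V (\<psi> \<alpha>)"
    and \<eta>: "transpose \<eta> = \<eta>"
begin

lemma g_form_eq:
  "g_form \<eta> L \<epsilon> F \<psi> u $ i $ j = d1 (\<lambda>v. F v $ j) u (\<eta> $ i) + d1 (\<lambda>v. F v $ i) u (\<eta> $ j)
    - (\<Sum>\<alpha>=1..L. \<epsilon> \<alpha> * d1 (\<psi> \<alpha>) u (\<eta> $ i) * d1 (\<psi> \<alpha>) u (\<eta> $ j))"
  by (simp add: g_form_def triple_sum d1_def mult.commute[of "\<eta> $ a $ s" "pd s \<phi> u" for a s \<phi>])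

lemma b_form_eq:
  assumes "u \<in> V"
  shows "(\<Sum>k\<in>UNIV. b_form \<eta> L \<epsilon> F \<psi> u $ i $ j $ k * a $ k) = d2 (\<lambda>v. F v $ j) u a (\<eta> $ i)
    - (\<Sum>\<alpha>=1..L. \<epsilon> \<alpha> * d2 (\<psi> \<alpha>) u a (\<eta> $ i) * d1 (\<psi> \<alpha>) u (\<eta> $ j))"
proof -
  have "b_form \<eta> L \<epsilon> F \<psi> u $ i $ j $ k = d1 (pd k (\<lambda>v. F v $ j)) u (\<eta> $ i)
     - (\<Sum>\<alpha>=1..L. \<epsilon> \<alpha> * d1 (pd k (\<psi> \<alpha>)) u (\<eta> $ i) * d1 (\<psi> \<alpha>) u (\<eta> $ j))" for k
    by (simp add: b_form_def triple_sum d1_def mult.commute[of "\<eta> $ a $ s" "pd s \<phi> u" for a s \<phi>])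
  then have "(\<Sum>k\<in>UNIV. b_form \<eta> L \<epsilon> F \<psi> u $ i $ j $ k * a $ k) = (\<Sum>k\<in>UNIV. d1 (pd k (\<lambda>v. F v $ j)) u (\<eta> $ i) * a $ k)
     - (\<Sum>k\<in>UNIV. \<Sum>\<alpha>=1..L. \<epsilon> \<alpha> * (d1 (pd k (\<psi> \<alpha>)) u (\<eta> $ i) * a $ k) * d1 (\<psi> \<alpha>) u (\<eta> $ j))"
    by (simp add: left_diff_distrib right_diff_distrib sum_subtractf sum_distrib_left sum_distrib_right mult_ac)
  also have "(\<Sum>k\<in>UNIV. \<Sum>\<alpha>=1..L. \<epsilon> \<alpha> * (d1 (pd k (\<psi> \<alpha>)) u (\<eta> $ i) * a $ k) * d1 (\<psi> \<alpha>) u (\<eta> $ j))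
    = (\<Sum>\<alpha>=1..L. \<epsilon> \<alpha> * d2 (\<psi> \<alpha>) u (\<eta> $ i) a * d1 (\<psi> \<alpha>) u (\<eta> $ j))"
    by (subst sum.swap) (simp add: d2_as_d1 sum_distrib_left sum_distrib_right)
  also have "(\<Sum>k\<in>UNIV. d1 (pd k (\<lambda>v. F v $ j)) u (\<eta> $ i) * a $ k) = d2 (\<lambda>v. F v $ j) u a (\<eta> $ i)"
    using d2_symmetric[OF V smooth_on_vec_nth[OF V F] assms] by (simp add: d2_as_d1)
  also have "(\<Sum>\<alpha>=1..L. \<epsilon> \<alpha> * d2 (\<psi> \<alpha>) u (\<eta> $ i) a * d1 (\<psi> \<alpha>) u (\<eta> $ j))
     = (\<Sum>\<alpha>=1..L. \<epsilon> \<alpha> * d2 (\<psi> \<alpha>) u a (\<eta> $ i) * d1 (\<psi> \<alpha>) u (\<eta> $ j))"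
    by (rule sum.cong[OF refl]) (simp add: d2_symmetric[OF V \<psi> assms])
  finally show ?thesis .
qed

lemma w_form_eq:
  assumes "u \<in> V" "\<alpha> \<in> {1..L}"
  shows "(\<Sum>k\<in>UNIV. w_form \<eta> \<psi> \<alpha> u $ i $ k * a $ k) = d2 (\<psi> \<alpha>) u a (\<eta> $ i)"
  using d2_symmetric[OF V \<psi>[OF assms(2)] assms(1)] by (simp add: w_form_def d2_def mult.commute)

text \<open>The density on the left is the Hessian of \<psi> applied to u_x and \<eta> h. It is the
  x-derivative of the gradient term with \<eta> h, minus the gradient term with \<eta> h_x; on a
  total derivative \<open>dinv\<close> acts as the identity. So the nonlocal term splits off a local
  part.\<close>

lemma dinv_d2:
  assumes u: "u \<in> fields V" and h: "h \<in> test_functions" and \<alpha>: "\<alpha> \<in> {1..L}"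
  shows "dinv (\<lambda>y. \<Sum>j\<in>UNIV. \<Sum>s\<in>UNIV. w_form \<eta> \<psi> \<alpha> (u y) $ j $ s * xderiv u y $ s * h y $ j) x
    = d1 (\<psi> \<alpha>) (u x) (\<eta> *v h x) - dinv (\<lambda>y. d1 (\<psi> \<alpha>) (u y) (eta_dx \<eta> h y)) x"
proof -
  have eh: "(\<lambda>x. \<eta> *v h x) \<in> test_functions"
    by (rule test_function_linear[OF h matrix_vector_mul_bounded_linear])
  have uc: "continuous_on UNIV (xderiv u)"
    by (rule smooth_on_continuous[OF smooth_on_xderiv[OF field_smooth[OF u]]])
  have e: "(\<Sum>j\<in>UNIV. \<Sum>s\<in>UNIV. w_form \<eta> \<psi> \<alpha> (u y) $ j $ s * xderiv u y $ s * h y $ j)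
     = d2 (\<psi> \<alpha>) (u y) (xderiv u y) (\<eta> *v h y)" for y
  proof -
    have "(\<Sum>j\<in>UNIV. \<Sum>s\<in>UNIV. w_form \<eta> \<psi> \<alpha> (u y) $ j $ s * xderiv u y $ s * h y $ j)
      = (\<Sum>j\<in>UNIV. d2 (\<psi> \<alpha>) (u y) (\<eta> $ j) (xderiv u y) * h y $ j)"
      by (simp add: sum_distrib_right[symmetric] w_form_eq[OF field_in[OF u] \<alpha>] d2_symmetric[OF V \<psi>[OF \<alpha>] field_in[OF u], of _ "xderiv u y"])
    then show ?thesis
      by (simp add: d2_rows[OF \<eta>] d2_symmetric[OF V \<psi>[OF \<alpha>] field_in[OF u], of _ "xderiv u y"])
  qed
  have d: "((\<lambda>y. d1 (\<psi> \<alpha>) (u y) (\<eta> *v h y)) has_real_derivative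
     d2 (\<psi> \<alpha>) (u y) (xderiv u y) (\<eta> *v h y) + d1 (\<psi> \<alpha>) (u y) (eta_dx \<eta> h y)) (at y)" for y
    unfolding eta_dx_def
    by (rule d1_has_derivative[OF \<psi>[OF \<alpha>] xderiv_works[OF field_smooth[OF u]] field_in[OF u]
        bounded_linear.has_vector_derivative[OF matrix_vector_mul_bounded_linear xderiv_works[OF test_function_smooth[OF h]]]])
  have c: "cont_cs (\<lambda>y. d2 (\<psi> \<alpha>) (u y) (xderiv u y) (\<eta> *v h y))" "cont_cs (\<lambda>y. d1 (\<psi> \<alpha>) (u y) (eta_dx \<eta> h y))"
    by (rule cont_cs_d2[OF V \<psi>[OF \<alpha>] u uc eh], rule cont_cs_d1[OF V \<psi>[OF \<alpha>] u test_function_eta_dx[OF h]])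
  obtain R where R: "\<And>x. \<bar>x\<bar> > R \<Longrightarrow> h x = 0" using test_functionE[OF h] by metis
  have "dinv (\<lambda>y. d2 (\<psi> \<alpha>) (u y) (xderiv u y) (\<eta> *v h y) + d1 (\<psi> \<alpha>) (u y) (eta_dx \<eta> h y)) x = d1 (\<psi> \<alpha>) (u x) (\<eta> *v h x)"
    by (rule dinv_of_derivative[OF d, where R=R]) (use cont_cs_add[OF c] in \<open>auto simp: R d1_zero cont_cs_def\<close>)
  then show ?thesis by (simp add: e dinv_add[OF c])
qed

text \<open>The local part split off by \<open>dinv_d2\<close> cancels exactly the quadratic \<psi>
  term of \<open>b_form\<close>. The quadratic term of \<open>g_form\<close> remains and completes a
  product rule, which is exploited in \<open>bil_canonical\<close>.\<close>

lemma canonical_operator: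
  assumes u: "u \<in> fields V" and h: "h \<in> test_functions"
  shows "nonlocal_operator (g_form \<eta> L \<epsilon> F \<psi>) (b_form \<eta> L \<epsilon> F \<psi>) L \<epsilon> (w_form \<eta> \<psi>) u h x $ i =
    (\<Sum>j\<in>UNIV. d2 (\<lambda>v. F v $ j) (u x) (xderiv u x) (\<eta> $ i) * h x $ j + d1 (\<lambda>v. F v $ j) (u x) (\<eta> $ i) * xderiv h x $ j)
    - (\<Sum>\<alpha>=1..L. \<epsilon> \<alpha> * (d2 (\<psi> \<alpha>) (u x) (xderiv u x) (\<eta> $ i) * dinv (\<lambda>y. d1 (\<psi> \<alpha>) (u y) (eta_dx \<eta> h y)) x
        + d1 (\<psi> \<alpha>) (u x) (\<eta> $ i) * d1 (\<psi> \<alpha>) (u x) (eta_dx \<eta> h x)))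
    + d1 (\<lambda>v. F v $ i) (u x) (eta_dx \<eta> h x)"
proof -
  have G: "(\<Sum>j\<in>UNIV. g_form \<eta> L \<epsilon> F \<psi> (u x) $ i $ j * xderiv h x $ j)
    = (\<Sum>j\<in>UNIV. d1 (\<lambda>v. F v $ j) (u x) (\<eta> $ i) * xderiv h x $ j) + d1 (\<lambda>v. F v $ i) (u x) (eta_dx \<eta> h x)
     - (\<Sum>\<alpha>=1..L. \<epsilon> \<alpha> * (d1 (\<psi> \<alpha>) (u x) (\<eta> $ i) * d1 (\<psi> \<alpha>) (u x) (eta_dx \<eta> h x)))"
  proof -
    have "(\<Sum>j\<in>UNIV. (\<Sum>\<alpha>=1..L. \<epsilon> \<alpha> * d1 (\<psi> \<alpha>) (u x) (\<eta> $ i) * d1 (\<psi> \<alpha>) (u x) (\<eta> $ j)) * xderiv h x $ j)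
      = (\<Sum>\<alpha>=1..L. \<epsilon> \<alpha> * (d1 (\<psi> \<alpha>) (u x) (\<eta> $ i) * (\<Sum>j\<in>UNIV. d1 (\<psi> \<alpha>) (u x) (\<eta> $ j) * xderiv h x $ j)))"
      unfolding sum_distrib_right by (subst sum.swap) (simp add: sum_distrib_left mult.assoc)
    then show ?thesis
      by (simp add: g_form_eq left_diff_distrib distrib_right sum.distrib sum_subtractf d1_rows[OF \<eta>] eta_dx_def)
  qed
  have B: "(\<Sum>j\<in>UNIV. (\<Sum>k\<in>UNIV. b_form \<eta> L \<epsilon> F \<psi> (u x) $ i $ j $ k * xderiv u x $ k) * h x $ j)
    = (\<Sum>j\<in>UNIV. d2 (\<lambda>v. F v $ j) (u x) (xderiv u x) (\<eta> $ i) * h x $ j)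
     - (\<Sum>\<alpha>=1..L. \<epsilon> \<alpha> * (d2 (\<psi> \<alpha>) (u x) (xderiv u x) (\<eta> $ i) * d1 (\<psi> \<alpha>) (u x) (\<eta> *v h x)))"
  proof -
    have "(\<Sum>j\<in>UNIV. (\<Sum>\<alpha>=1..L. \<epsilon> \<alpha> * d2 (\<psi> \<alpha>) (u x) (xderiv u x) (\<eta> $ i) * d1 (\<psi> \<alpha>) (u x) (\<eta> $ j)) * h x $ j)
      = (\<Sum>\<alpha>=1..L. \<epsilon> \<alpha> * (d2 (\<psi> \<alpha>) (u x) (xderiv u x) (\<eta> $ i) * (\<Sum>j\<in>UNIV. d1 (\<psi> \<alpha>) (u x) (\<eta> $ j) * h x $ j)))"
      unfolding sum_distrib_right by (subst sum.swap) (simp add: sum_distrib_left mult.assoc)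
    then show ?thesis
      by (simp add: b_form_eq[OF field_in[OF u]] left_diff_distrib sum_subtractf d1_rows[OF \<eta>])
  qed
  have W: "(\<Sum>\<alpha>=1..L. \<epsilon> \<alpha> * (\<Sum>k\<in>UNIV. w_form \<eta> \<psi> \<alpha> (u x) $ i $ k * xderiv u x $ k)
         * dinv (\<lambda>y. \<Sum>j\<in>UNIV. \<Sum>s\<in>UNIV. w_form \<eta> \<psi> \<alpha> (u y) $ j $ s * xderiv u y $ s * h y $ j) x)
    = (\<Sum>\<alpha>=1..L. \<epsilon> \<alpha> * (d2 (\<psi> \<alpha>) (u x) (xderiv u x) (\<eta> $ i) * (d1 (\<psi> \<alpha>) (u x) (\<eta> *v h x) - dinv (\<lambda>y. d1 (\<psi> \<alpha>) (u y) (eta_dx \<eta> h y)) x)))"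
  proof (rule sum.cong[OF refl])
    fix \<alpha> assume \<alpha>: "\<alpha> \<in> {1..L}"
    show "\<epsilon> \<alpha> * (\<Sum>k\<in>UNIV. w_form \<eta> \<psi> \<alpha> (u x) $ i $ k * xderiv u x $ k)
         * dinv (\<lambda>y. \<Sum>j\<in>UNIV. \<Sum>s\<in>UNIV. w_form \<eta> \<psi> \<alpha> (u y) $ j $ s * xderiv u y $ s * h y $ j) x
       = \<epsilon> \<alpha> * (d2 (\<psi> \<alpha>) (u x) (xderiv u x) (\<eta> $ i) * (d1 (\<psi> \<alpha>) (u x) (\<eta> *v h x) - dinv (\<lambda>y. d1 (\<psi> \<alpha>) (u y) (eta_dx \<eta> h y)) x))"
      unfolding w_form_eq[OF field_in[OF u] \<alpha>] dinv_d2[OF u h \<alpha>] by (rule mult.assoc)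
  qed
  show ?thesis
    unfolding nonlocal_operator_def
    by (simp add: sum.distrib G B W distrib_left right_diff_distrib sum_subtractf del: One_nat_def)
qed

lemma bil_canonical:
  assumes u: "u \<in> fields V" and f: "f \<in> test_functions" and h: "h \<in> test_functions"
  shows "bil (g_form \<eta> L \<epsilon> F \<psi>) (b_form \<eta> L \<epsilon> F \<psi>) L \<epsilon> (w_form \<eta> \<psi>) u f h = canon \<eta> L \<epsilon> F \<psi> u f h"
proof -
  let ?b = "\<lambda>\<alpha> y. d1 (\<psi> \<alpha>) (u y) (eta_dx \<eta> h y)"
  \<comment> \<open>A primitive of component i of the operator without its last term in
    \<open>F\<close>. Its derivative contains the gradient of \<psi> times the undone
    \<open>dinv\<close>, and this is what the quadratic \<psi> term of the metric supplies.\<close>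
  define K where "K i x = (\<Sum>j\<in>UNIV. d1 (\<lambda>v. F v $ j) (u x) (\<eta> $ i) * h x $ j)
     - (\<Sum>\<alpha>=1..L. \<epsilon> \<alpha> * (d1 (\<psi> \<alpha>) (u x) (\<eta> $ i) * dinv (?b \<alpha>) x))" for i x
  define K' where "K' i x = (\<Sum>j\<in>UNIV. d2 (\<lambda>v. F v $ j) (u x) (xderiv u x) (\<eta> $ i) * h x $ j + d1 (\<lambda>v. F v $ j) (u x) (\<eta> $ i) * xderiv h x $ j)
    - (\<Sum>\<alpha>=1..L. \<epsilon> \<alpha> * (d2 (\<psi> \<alpha>) (u x) (xderiv u x) (\<eta> $ i) * dinv (?b \<alpha>) x
        + d1 (\<psi> \<alpha>) (u x) (\<eta> $ i) * ?b \<alpha> x))" for i x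
  have cb: "cont_cs (?b \<alpha>)" if "\<alpha> \<in> {1..L}" for \<alpha>
    by (rule cont_cs_d1[OF V \<psi>[OF that] u test_function_eta_dx[OF h]])
  have uc: "continuous_on UNIV (xderiv u)"
    by (rule smooth_on_continuous[OF smooth_on_xderiv[OF field_smooth[OF u]]])
  have der_nth: "((\<lambda>x. g x $ i) has_real_derivative xderiv g x $ i) (at x)" if "g \<in> test_functions" for g :: "'n field" and i x
    using bounded_linear.has_vector_derivative[OF bounded_linear_vec_nth xderiv_works[OF test_function_smooth[OF that]]]
    by (simp add: has_real_derivative_iff_has_vector_derivative)
  have dc: "((\<lambda>x. d1 \<phi> (u x) c) has_real_derivative d2 \<phi> (u x) (xderiv u x) c) (at x)" if "smooth_on V \<phi>" for \<phi> c x
    using d1_has_derivative[OF that xderiv_works[OF field_smooth[OF u]] field_in[OF u] has_vector_derivative_const[of c]]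
    by (simp add: d1_zero)
  have dK: "(K i has_real_derivative K' i x) (at x)" for i x
  proof -
    have 1: "((\<lambda>x. d1 (\<lambda>v. F v $ j) (u x) (\<eta> $ i) * h x $ j) has_real_derivative
       d2 (\<lambda>v. F v $ j) (u x) (xderiv u x) (\<eta> $ i) * h x $ j + d1 (\<lambda>v. F v $ j) (u x) (\<eta> $ i) * xderiv h x $ j) (at x)" for j
      using DERIV_mult[OF dc[OF smooth_on_vec_nth[OF V F]] der_nth[OF h]] by (simp add: mult.commute)
    have 2: "((\<lambda>x. \<epsilon> \<alpha> * (d1 (\<psi> \<alpha>) (u x) (\<eta> $ i) * dinv (?b \<alpha>) x)) has_real_derivative
       \<epsilon> \<alpha> * (d2 (\<psi> \<alpha>) (u x) (xderiv u x) (\<eta> $ i) * dinv (?b \<alpha>) x + d1 (\<psi> \<alpha>) (u x) (\<eta> $ i) * ?b \<alpha> x)) (at x)"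
      if "\<alpha> \<in> {1..L}" for \<alpha>
      using DERIV_cmult[OF DERIV_mult[OF dc[OF \<psi>[OF that]] dinv_has_derivative[OF cb[OF that]]]] by (simp add: mult.commute)
    show ?thesis
      unfolding K_def K'_def by (rule DERIV_diff[OF DERIV_sum DERIV_sum], rule 1, rule 2)
  qed
  have K'c: "continuous_on UNIV (K' i)" for i
    unfolding K'_def
    by (intro continuous_on_diff continuous_on_sum continuous_on_add continuous_on_mult continuous_on_const
        continuous_on_d1[OF V smooth_on_vec_nth[OF V F] u] continuous_on_d2[OF V smooth_on_vec_nth[OF V F] u uc] continuous_on_d1[OF V \<psi> u] continuous_on_d2[OF V \<psi> u uc]
        dinv_continuous cb continuous_on_component test_function_continuous h test_function_xderiv test_function_eta_dx)
  have Kc: "continuous_on UNIV (K i)" for i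
    using dK by (meson DERIV_continuous_on has_field_derivative_at_within)
  define D where "D x = (\<Sum>i\<in>UNIV. xderiv f x $ i * K i x + f x $ i * K' i x)" for x
  have dD: "((\<lambda>x. \<Sum>i\<in>UNIV. f x $ i * K i x) has_real_derivative D x) (at x)" for x
    unfolding D_def using DERIV_mult[OF der_nth[OF f] dK] by (intro DERIV_sum) (simp add: mult.commute)
  obtain R where R: "\<And>x. \<bar>x\<bar> > R \<Longrightarrow> f x = 0" using test_functionE[OF f] by metis
  have iD: "integral UNIV D = 0"
    by (rule integral_of_derivative_0[OF dD, where R=R]) (simp add: R)
  have cD: "cont_cs D"
    unfolding D_def
    by (rule cont_cs_sum, rule cont_cs_add; rule cont_cs_mult_right[OF _ test_function_cont_cs_nth])
       (rule Kc K'c f test_function_xderiv)+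
  \<comment> \<open>After integration by parts the derivative falls on f, and summation against the
    rows of \<eta> turns it into \<eta> f_x; these are the missing halves of
    \<open>canon\<close>.\<close>
  have fK: "(\<Sum>i\<in>UNIV. xderiv f x $ i * K i x) = (\<Sum>j\<in>UNIV. h x $ j * d1 (\<lambda>v. F v $ j) (u x) (eta_dx \<eta> f x))
     - (\<Sum>\<alpha>=1..L. \<epsilon> \<alpha> * (d1 (\<psi> \<alpha>) (u x) (eta_dx \<eta> f x) * dinv (?b \<alpha>) x))" for x
  proof -
    have "(\<Sum>i\<in>UNIV. xderiv f x $ i * (\<Sum>j\<in>UNIV. d1 (\<lambda>v. F v $ j) (u x) (\<eta> $ i) * h x $ j))
       = (\<Sum>j\<in>UNIV. h x $ j * (\<Sum>i\<in>UNIV. d1 (\<lambda>v. F v $ j) (u x) (\<eta> $ i) * xderiv f x $ i))"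
      unfolding sum_distrib_left by (subst sum.swap) (simp add: mult_ac)
    moreover have "(\<Sum>i\<in>UNIV. xderiv f x $ i * (\<Sum>\<alpha>=1..L. \<epsilon> \<alpha> * (d1 (\<psi> \<alpha>) (u x) (\<eta> $ i) * dinv (?b \<alpha>) x)))
       = (\<Sum>\<alpha>=1..L. \<epsilon> \<alpha> * ((\<Sum>i\<in>UNIV. d1 (\<psi> \<alpha>) (u x) (\<eta> $ i) * xderiv f x $ i) * dinv (?b \<alpha>) x))"
      unfolding sum_distrib_left sum_distrib_right by (subst sum.swap) (simp add: mult_ac)
    ultimately show ?thesis
      by (simp add: K_def right_diff_distrib sum_subtractf d1_rows[OF \<eta>] eta_dx_def)
  qed
  have pt: "f x \<bullet> nonlocal_operator (g_form \<eta> L \<epsilon> F \<psi>) (b_form \<eta> L \<epsilon> F \<psi>) L \<epsilon> (w_form \<eta> \<psi>) u h x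
     = (\<Sum>i\<in>UNIV. canon_F \<eta> F u f h i x) + (\<Sum>\<alpha>=1..L. \<epsilon> \<alpha> * (d1 (\<psi> \<alpha>) (u x) (eta_dx \<eta> f x) * dinv (?b \<alpha>) x)) + D x" for x
  proof -
    have "nonlocal_operator (g_form \<eta> L \<epsilon> F \<psi>) (b_form \<eta> L \<epsilon> F \<psi>) L \<epsilon> (w_form \<eta> \<psi>) u h x $ i
       = K' i x + d1 (\<lambda>v. F v $ i) (u x) (eta_dx \<eta> h x)" for i
      unfolding canonical_operator[OF u h] K'_def ..
    then have "f x \<bullet> nonlocal_operator (g_form \<eta> L \<epsilon> F \<psi>) (b_form \<eta> L \<epsilon> F \<psi>) L \<epsilon> (w_form \<eta> \<psi>) u h x
      = (\<Sum>i\<in>UNIV. f x $ i * K' i x) + (\<Sum>i\<in>UNIV. f x $ i * d1 (\<lambda>v. F v $ i) (u x) (eta_dx \<eta> h x))"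
      by (simp add: inner_vec_def distrib_left sum.distrib)
    then show ?thesis
      by (simp add: D_def sum.distrib fK canon_F_def sum_subtractf)
  qed
  have c1: "cont_cs (\<lambda>x. \<Sum>i\<in>UNIV. canon_F \<eta> F u f h i x)"
    by (rule cont_cs_sum[OF canon_F_cont_cs[OF V F \<psi> u f h]])
  have c2: "cont_cs (\<lambda>x. d1 (\<psi> \<alpha>) (u x) (eta_dx \<eta> f x) * dinv (?b \<alpha>) x)" if "\<alpha> \<in> {1..L}" for \<alpha>
    by (rule cont_cs_mult_right[OF dinv_continuous[OF cb[OF that]] cont_cs_d1[OF V \<psi>[OF that] u test_function_eta_dx[OF f]]])
  have c3: "cont_cs (\<lambda>x. \<Sum>\<alpha>=1..L. \<epsilon> \<alpha> * (d1 (\<psi> \<alpha>) (u x) (eta_dx \<eta> f x) * dinv (?b \<alpha>) x))"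
    by (rule cont_cs_sum[OF cont_cs_cmult[OF c2]])
  have "bil (g_form \<eta> L \<epsilon> F \<psi>) (b_form \<eta> L \<epsilon> F \<psi>) L \<epsilon> (w_form \<eta> \<psi>) u f h
    = integral UNIV (\<lambda>x. \<Sum>i\<in>UNIV. canon_F \<eta> F u f h i x)
     + integral UNIV (\<lambda>x. \<Sum>\<alpha>=1..L. \<epsilon> \<alpha> * (d1 (\<psi> \<alpha>) (u x) (eta_dx \<eta> f x) * dinv (?b \<alpha>) x))"
    unfolding bil_def pt using integral_cs_add[OF cont_cs_add[OF c1 c3] cD] integral_cs_add[OF c1 c3] iD by simp
  also have "integral UNIV (\<lambda>x. \<Sum>i\<in>UNIV. canon_F \<eta> F u f h i x) = (\<Sum>i\<in>UNIV. integral UNIV (canon_F \<eta> F u f h i))"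
    by (rule integral_cs_sum[OF finite canon_F_cont_cs[OF V F \<psi> u f h]])
  also have "integral UNIV (\<lambda>x. \<Sum>\<alpha>=1..L. \<epsilon> \<alpha> * (d1 (\<psi> \<alpha>) (u x) (eta_dx \<eta> f x) * dinv (?b \<alpha>) x))
     = (\<Sum>\<alpha>=1..L. integral UNIV (\<lambda>x. \<epsilon> \<alpha> * (d1 (\<psi> \<alpha>) (u x) (eta_dx \<eta> f x) * dinv (?b \<alpha>) x)))"
    by (rule integral_cs_sum[OF finite_atLeastAtMost cont_cs_cmult[OF c2]])
  finally show ?thesis by (simp add: canon_def dinv_pairing_def)
qed

end


section \<open>Brackets of canonical form are compatible with the constant bracket\<close>

lemma xderiv_scaleR: "smooth_on UNIV f \<Longrightarrow> xderiv (\<lambda>x. c *\<^sub>R f x) x = c *\<^sub>R xderiv f x"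
  by (rule xderiv_linear[OF bounded_linear_scaleR_right])

lemma eta_dx_scaleR: "f \<in> test_functions \<Longrightarrow> eta_dx \<eta> (\<lambda>x. c *\<^sub>R f x) x = c *\<^sub>R eta_dx \<eta> f x"
  by (simp add: eta_dx_def xderiv_scaleR test_function_smooth matrix_vector_mult_scaleR)

lemma d1_scaleR: "d1 \<phi> u (c *\<^sub>R a) = c * d1 \<phi> u a"
  by (simp add: d1_def sum_distrib_left mult_ac)

lemma canon_scaleR_left:
  assumes "f \<in> test_functions"
  shows "canon \<eta> L \<epsilon> F \<psi> u (\<lambda>x. c *\<^sub>R f x) h = c * canon \<eta> L \<epsilon> F \<psi> u f h"
proof -
  have "canon_F \<eta> F u (\<lambda>x. c *\<^sub>R f x) h i = (\<lambda>x. c * canon_F \<eta> F u f h i x)" for i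
    using assms by (simp add: canon_F_def eta_dx_scaleR d1_scaleR algebra_simps fun_eq_iff)
  then show ?thesis
    using assms by (simp add: canon_def eta_dx_scaleR d1_scaleR dinv_pairing_def sum_distrib_left distrib_left mult_ac)
qed

text \<open>The constant bracket is itself canonical with L = 0 and F(u) = u / 2; the half appears
  because the derivative of F enters the metric once for each order of the indices.\<close>

lemma constant_bracket_canon:
  fixes u :: "'n::finite field"
  assumes \<eta>: "transpose \<eta> = \<eta>" and f: "var_deriv I u \<in> test_functions" "var_deriv J u \<in> test_functions"
  shows "constant_bracket \<eta> I J u = canon \<eta> 0 \<epsilon> (\<lambda>v. (1 / 2) *\<^sub>R v) \<psi> u (var_deriv I u) (var_deriv J u)"
proof -
  let ?f = "var_deriv I u" and ?h = "var_deriv J u"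
  have p: "pd s (\<lambda>v. ((1 / 2) *\<^sub>R v) $ i) u = (if s = i then 1 / 2 else 0)" for s i and u :: "real^'n"
  proof -
    have "((\<lambda>v. ((1 / 2) *\<^sub>R v) $ i) has_derivative (\<lambda>v. ((1 / 2) *\<^sub>R v) $ i)) (at u)"
      by (rule bounded_linear_imp_has_derivative)
         (rule bounded_linear_compose[OF bounded_linear_vec_nth bounded_linear_scaleR_right])
    from pd_eqI[OF this, of s] show ?thesis by (auto simp: axis_def split: if_splits)
  qed
  have d: "d1 (\<lambda>v. ((1 / 2) *\<^sub>R v) $ i) u a = a $ i / 2" for i and u a :: "real^'n"
  proof -
    have "d1 (\<lambda>v. ((1 / 2) *\<^sub>R v) $ i) u a = (\<Sum>s\<in>UNIV. if s = i then a $ s / 2 else 0)"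
      unfolding d1_def p by (rule sum.cong) auto
    then show ?thesis by simp
  qed
  have F: "canon_F \<eta> (\<lambda>v. (1 / 2) *\<^sub>R v) u ?f ?h i x = (1 / 2) * (?f x $ i * eta_dx \<eta> ?h x $ i - eta_dx \<eta> ?f x $ i * ?h x $ i)" for i x
    unfolding canon_F_def d by (simp add: field_simps)
  have c: "cont_cs (\<lambda>x. canon_F \<eta> (\<lambda>v. (1 / 2) *\<^sub>R v) u ?f ?h i x)" for i
    unfolding F
    by (rule cont_cs_cmult, rule cont_cs_diff;
        rule cont_cs_mult_right[OF continuous_on_component[OF test_function_continuous] test_function_cont_cs_nth])
       (rule f test_function_eta_dx)+
  have ci: "cont_cs (\<lambda>x. ?f x \<bullet> eta_dx \<eta> ?h x)" "cont_cs (\<lambda>x. eta_dx \<eta> ?f x \<bullet> ?h x)"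
    by (rule test_function_cont_cs_inner, use f in \<open>auto intro: test_function_eta_dx test_function_continuous\<close>)+
  have "canon \<eta> 0 \<epsilon> (\<lambda>v. (1 / 2) *\<^sub>R v) \<psi> u ?f ?h = integral UNIV (\<lambda>x. \<Sum>i\<in>UNIV. canon_F \<eta> (\<lambda>v. (1 / 2) *\<^sub>R v) u ?f ?h i x)"
    unfolding canon_def by (subst integral_cs_sum) (use c in auto)
  also have "\<dots> = integral UNIV (\<lambda>x. (1 / 2) * (?f x \<bullet> eta_dx \<eta> ?h x - eta_dx \<eta> ?f x \<bullet> ?h x))"
    unfolding F by (simp only: sum_distrib_left[symmetric] sum_subtractf inner_vec_def inner_real_def)
  also have "\<dots> = (1 / 2) * (integral UNIV (\<lambda>x. ?f x \<bullet> eta_dx \<eta> ?h x) - integral UNIV (\<lambda>x. eta_dx \<eta> ?f x \<bullet> ?h x))"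
    using integral_cs_diff[OF ci] by simp
  also have "\<dots> = integral UNIV (\<lambda>x. ?f x \<bullet> eta_dx \<eta> ?h x)"
    using integral_eta_dx_skew[OF \<eta> f] by simp
  finally show ?thesis by (simp add: constant_bracket_eq)
qed

section \<open>The mixed Jacobi identity for arbitrary smooth functionals\<close>

context
  fixes U :: "(real^'n::finite) set" and F :: "real^'n \<Rightarrow> real^'n" and \<psi> :: "nat \<Rightarrow> real^'n \<Rightarrow> real" and L :: nat
    and \<eta> :: "real^'n^'n" and \<epsilon> :: "nat \<Rightarrow> real" and Br :: "'n bracket"
  assumes U: "open U" and F: "smooth_on U F" and \<psi>: "\<And>\<alpha>. \<alpha> \<in> {1..L} \<Longrightarrow> smooth_on U (\<psi> \<alpha>)"
    and \<eta>: "transpose \<eta> = \<eta>"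
    and Br: "\<And>I J u. u \<in> fields U \<Longrightarrow> var_deriv I u \<in> test_functions \<Longrightarrow> var_deriv J u \<in> test_functions \<Longrightarrow>
        Br I J u = canon \<eta> L \<epsilon> F \<psi> u (var_deriv I u) (var_deriv J u)"
    and ex: "\<And>I J u. smooth_functional U I \<Longrightarrow> smooth_functional U J \<Longrightarrow> u \<in> fields U \<Longrightarrow> \<exists>\<xi>. has_variational_derivative (Br I J) \<xi> u"
begin

text \<open>Existence of the variational derivative of \<open>Br I J\<close> is a hypothesis of the
  context, so its pairing with v can be computed as an ordinary derivative along u + t v, where
  \<open>canon_derivative\<close> applies.\<close>

lemma canonical_bracket_derivative:
  assumes IJ: "smooth_functional U I" "smooth_functional U J" and u: "u \<in> fields U" and v: "v \<in> test_functions"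
  shows "integral UNIV (\<lambda>x. var_deriv (Br I J) u x \<bullet> v x) =
    canon_var \<eta> L \<epsilon> F \<psi> u v (var_deriv I u) (var_deriv J u)
    + canon \<eta> L \<epsilon> F \<psi> u (dvar I u v) (var_deriv J u) + canon \<eta> L \<epsilon> F \<psi> u (var_deriv I u) (dvar J u v)"
proof -
  obtain r1 R1 where 1: "r1 > 0"
    "smooth_on ({-r1<..<r1} \<times> UNIV) (\<lambda>(t, x). var_deriv I (\<lambda>y. u y + t *\<^sub>R v y) x)"
    "\<And>t x. \<bar>t\<bar> < r1 \<Longrightarrow> \<bar>x\<bar> > R1 \<Longrightarrow> var_deriv I (\<lambda>y. u y + t *\<^sub>R v y) x = 0"
    "\<And>t. \<bar>t\<bar> < r1 \<Longrightarrow> (\<lambda>y. u y + t *\<^sub>R v y) \<in> fields U"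
    by (rule smooth_functional_variation[OF U IJ(1) u v], rule that; blast)
  obtain r2 R2 where 2: "r2 > 0"
    "smooth_on ({-r2<..<r2} \<times> UNIV) (\<lambda>(t, x). var_deriv J (\<lambda>y. u y + t *\<^sub>R v y) x)"
    "\<And>t x. \<bar>t\<bar> < r2 \<Longrightarrow> \<bar>x\<bar> > R2 \<Longrightarrow> var_deriv J (\<lambda>y. u y + t *\<^sub>R v y) x = 0"
    by (rule smooth_functional_variation[OF U IJ(2) u v], rule that; blast)
  define T where "T = {-min r1 r2<..<min r1 r2}"
  define X where "X = (\<lambda>(t, x). var_deriv I (\<lambda>y. u y + t *\<^sub>R v y) x)"
  define Y where "Y = (\<lambda>(t, x). var_deriv J (\<lambda>y. u y + t *\<^sub>R v y) x)"
  have T: "open T" "0 \<in> T" using 1 2 by (auto simp: T_def)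
  have Tr: "\<bar>t\<bar> < r1" "\<bar>t\<bar> < r2" if "t \<in> T" for t using that by (auto simp: T_def min_def split: if_splits)
  have sm: "smooth_on (T \<times> UNIV) X" "smooth_on (T \<times> UNIV) Y"
    unfolding X_def Y_def T_def by (rule smooth_on_subset[OF 1(2)] smooth_on_subset[OF 2(2)]; auto)+
  have dX: "(\<lambda>x. dt X (0, x)) = dvar I u v" unfolding X_def by (rule ext, rule dvar_eq_dt[OF 1(1,2)])
  have dY: "(\<lambda>x. dt Y (0, x)) = dvar J u v" unfolding Y_def by (rule ext, rule dvar_eq_dt[OF 2(1,2)])
  have X0: "(\<lambda>x. X (0, x)) = var_deriv I u" "(\<lambda>x. Y (0, x)) = var_deriv J u" by (simp_all add: X_def Y_def)
  have "((\<lambda>t. canon \<eta> L \<epsilon> F \<psi> (\<lambda>x. u x + t *\<^sub>R v x) (\<lambda>x. X (t, x)) (\<lambda>x. Y (t, x))) has_real_derivative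
    canon_var \<eta> L \<epsilon> F \<psi> u v (\<lambda>x. X (0, x)) (\<lambda>x. Y (0, x))
    + canon \<eta> L \<epsilon> F \<psi> u (\<lambda>x. dt X (0, x)) (\<lambda>x. Y (0, x))
    + canon \<eta> L \<epsilon> F \<psi> u (\<lambda>x. X (0, x)) (\<lambda>x. dt Y (0, x))) (at 0)"
  proof (rule canon_derivative[OF U F \<psi> T u v _ sm(1) _ sm(2), where R="max R1 R2"])
    show "u x + t *\<^sub>R v x \<in> U" if "t \<in> T" for t x
      using field_in[OF 1(4)[OF Tr(1)[OF that]]] .
    show "X (t, x) = 0" if "t \<in> T" "max R1 R2 < \<bar>x\<bar>" for t x
      using 1(3)[OF Tr(1)[OF that(1)], of x] that by (simp add: X_def)
    show "Y (t, x) = 0" if "t \<in> T" "max R1 R2 < \<bar>x\<bar>" for t x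
      using 2(3)[OF Tr(2)[OF that(1)], of x] that by (simp add: Y_def)
  qed
  then have "((\<lambda>t. Br I J (\<lambda>x. u x + t *\<^sub>R v x)) has_real_derivative
    canon_var \<eta> L \<epsilon> F \<psi> u v (\<lambda>x. X (0, x)) (\<lambda>x. Y (0, x))
    + canon \<eta> L \<epsilon> F \<psi> u (\<lambda>x. dt X (0, x)) (\<lambda>x. Y (0, x))
    + canon \<eta> L \<epsilon> F \<psi> u (\<lambda>x. X (0, x)) (\<lambda>x. dt Y (0, x))) (at 0)"
  proof (rule has_field_derivative_transform_within_open[OF _ T])
    fix t assume t: "t \<in> T"
    note ft = 1(4)[OF Tr(1)[OF t]]
    show "canon \<eta> L \<epsilon> F \<psi> (\<lambda>x. u x + t *\<^sub>R v x) (\<lambda>x. X (t, x)) (\<lambda>x. Y (t, x)) = Br I J (\<lambda>x. u x + t *\<^sub>R v x)"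
      using Br[OF ft var_deriv_smooth_functional(2)[OF IJ(1) ft] var_deriv_smooth_functional(2)[OF IJ(2) ft]]
      by (simp add: X_def Y_def)
  qed
  moreover have "((\<lambda>t. Br I J (\<lambda>x. u x + t *\<^sub>R v x)) has_real_derivative
      integral UNIV (\<lambda>x. var_deriv (Br I J) u x \<bullet> v x)) (at 0)"
    using var_deriv_works[OF ex[OF IJ u]] v by (simp add: has_variational_derivative_def)
  ultimately show ?thesis
    unfolding dX dY X0 by (rule DERIV_unique[rotated])
qed

text \<open>Each term \<open>?C (dvar A u (?P B)) (?\<delta> D)\<close> with distinct A, B, D occurs
  once in each of the two cyclic sums, with opposite signs. What is left are the
  \<open>canon_var\<close> terms, and these are cyclic.\<close>

lemma mixed_jacobi:
  assumes I: "smooth_functional U I" and J: "smooth_functional U J" and K: "smooth_functional U K" and u: "u \<in> fields U"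
  shows "(constant_bracket \<eta> (Br I J) K u + constant_bracket \<eta> (Br J K) I u + constant_bracket \<eta> (Br K I) J u)
    + (Br (constant_bracket \<eta> I J) K u + Br (constant_bracket \<eta> J K) I u + Br (constant_bracket \<eta> K I) J u) = 0"
proof -
  let ?C = "canon \<eta> L \<epsilon> F \<psi> u" and ?\<delta> = "\<lambda>I. var_deriv I u" and ?P = "\<lambda>I. eta_dx \<eta> (var_deriv I u)"
  have t: "?\<delta> A \<in> test_functions" if "smooth_functional U A" for A
    by (rule var_deriv_smooth_functional(2)[OF that u])
  have tP: "?P A \<in> test_functions" if "smooth_functional U A" for A
    by (rule test_function_eta_dx[OF t[OF that]])
  have td: "dvar A u (?P B) \<in> test_functions" if "smooth_functional U A" "smooth_functional U B" for A B
    by (rule dvar_test_function[OF U that(1) u tP[OF that(2)]])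
  have 1: "constant_bracket \<eta> (Br A B) D u = canon_var \<eta> L \<epsilon> F \<psi> u (?P D) (?\<delta> A) (?\<delta> B)
     + ?C (dvar A u (?P D)) (?\<delta> B) - ?C (dvar B u (?P D)) (?\<delta> A)"
    if A: "smooth_functional U A" and B: "smooth_functional U B" and D: "smooth_functional U D" for A B D
    using canonical_bracket_derivative[OF A B u tP[OF D]]
      canon_skew[OF U F \<psi> u t[OF A] td[OF B D], where \<eta>=\<eta> and \<epsilon>=\<epsilon>] by (simp add: constant_bracket_eq)
  have 2: "Br (constant_bracket \<eta> A B) D u = ?C (dvar A u (?P B)) (?\<delta> D) - ?C (dvar B u (?P A)) (?\<delta> D)"
    if A: "smooth_functional U A" and B: "smooth_functional U B" and D: "smooth_functional U D" for A B D
  proof -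
    have v: "var_deriv (constant_bracket \<eta> A B) u = (\<lambda>x. dvar A u (?P B) x - dvar B u (?P A) x)"
      by (rule var_deriv_eqI[OF constant_bracket_variational_derivative[OF U \<eta> A B u]])
    show ?thesis
      using Br[OF u _ t[OF D], of "constant_bracket \<eta> A B"] test_function_diff[OF td[OF A B] td[OF B A]]
        canon_diff_left[OF U F \<psi> u td[OF A B] td[OF B A] t[OF D], where \<eta>=\<eta> and \<epsilon>=\<epsilon>]
      unfolding v by simp
  qed
  have 3: "canon_var \<eta> L \<epsilon> F \<psi> u (?P K) (?\<delta> I) (?\<delta> J) + canon_var \<eta> L \<epsilon> F \<psi> u (?P I) (?\<delta> J) (?\<delta> K)
    + canon_var \<eta> L \<epsilon> F \<psi> u (?P J) (?\<delta> K) (?\<delta> I) = 0"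
    by (rule canon_var_cyclic[OF U F \<psi> u t[OF I] t[OF J] t[OF K]])
  show ?thesis
    unfolding 1[OF I J K] 1[OF J K I] 1[OF K I J] 2[OF I J K] 2[OF J K I] 2[OF K I J]
    using 3 by simp
qed

end

text \<open>By \<open>constant_bracket_canon\<close> the constant bracket may take the place of the
  canonical one in \<open>mixed_jacobi\<close>; the resulting identity is twice the Jacobi
  identity.\<close>

lemma constant_bracket_jacobi:
  fixes U :: "(real^'n::finite) set"
  assumes U: "open U" and \<eta>: "transpose \<eta> = \<eta>"
    and I: "smooth_functional U I" and J: "smooth_functional U J" and K: "smooth_functional U K" and u: "u \<in> fields U"
  shows "constant_bracket \<eta> (constant_bracket \<eta> I J) K u + constant_bracket \<eta> (constant_bracket \<eta> J K) I u
    + constant_bracket \<eta> (constant_bracket \<eta> K I) J u = 0"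
proof -
  have F: "smooth_on U (\<lambda>v. (1 / 2) *\<^sub>R v)"
    by (intro smooth_on_scaleR smooth_on_const smooth_on_id U)
  have "(constant_bracket \<eta> (constant_bracket \<eta> I J) K u + constant_bracket \<eta> (constant_bracket \<eta> J K) I u + constant_bracket \<eta> (constant_bracket \<eta> K I) J u)
    + (constant_bracket \<eta> (constant_bracket \<eta> I J) K u + constant_bracket \<eta> (constant_bracket \<eta> J K) I u + constant_bracket \<eta> (constant_bracket \<eta> K I) J u) = 0"
  proof (rule mixed_jacobi[OF U F _ \<eta> _ _ I J K u, where L=0 and \<epsilon>="\<lambda>_. 0" and \<psi>="\<lambda>_ _. 0"])
    fix I J :: "'n functional" and u assume "smooth_functional U I" "smooth_functional U J" "u \<in> fields U"
    then show "\<exists>\<xi>. has_variational_derivative (constant_bracket \<eta> I J) \<xi> u"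
      using constant_bracket_variational_derivative[OF U \<eta>] by blast
  qed (simp_all add: constant_bracket_canon[OF \<eta>, where \<epsilon>="\<lambda>_. 0" and \<psi>="\<lambda>_ _. 0"])
  then show ?thesis by simp
qed

theorem canonical_form_compatible:
  fixes U :: "(real^'n::finite) set"
  assumes U: "open U" and \<eta>: "transpose \<eta> = \<eta>"
    and P: "poisson_bracket U (nonlocal_bracket g b L \<epsilon> w)"
    and C: "has_canonical_form U \<eta> L \<epsilon> (nonlocal_bracket g b L \<epsilon> w)"
  shows "compatible U (nonlocal_bracket g b L \<epsilon> w) (constant_bracket \<eta>)"
proof -
  let ?B = "nonlocal_bracket g b L \<epsilon> w" and ?E = "constant_bracket \<eta>"
  obtain F \<psi> where F: "smooth_on U F" and \<psi>: "\<And>\<alpha>. \<alpha> \<in> {1..L} \<Longrightarrow> smooth_on U (\<psi> \<alpha>)"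
    and eq: "\<And>I J u. smooth_functional U I \<Longrightarrow> smooth_functional U J \<Longrightarrow> u \<in> fields U \<Longrightarrow>
      ?B I J u = nonlocal_bracket (g_form \<eta> L \<epsilon> F \<psi>) (b_form \<eta> L \<epsilon> F \<psi>) L \<epsilon> (w_form \<eta> \<psi>) I J u"
    using C unfolding has_canonical_form_def by blast
  \<comment> \<open>The canonical form is known on smooth functionals only, and an iterated bracket
    involves \<open>?B I J\<close>, which is merely known to have a variational derivative. Testing
    with linear functionals turns the equality of brackets into one of bilinear forms, valid for all
    pairs of test functions.\<close>
  have bil: "bil g b L \<epsilon> w u f h = canon \<eta> L \<epsilon> F \<psi> u f h"
    if u: "u \<in> fields U" and f: "f \<in> test_functions" and h: "h \<in> test_functions" for u f h
    using eq[OF smooth_functional_linear[OF f] smooth_functional_linear[OF h] u] bil_canonical[OF U F \<psi> \<eta> u f h, where \<epsilon>=\<epsilon>]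
    by (simp add: nonlocal_bracket_bil var_deriv_linear_functional[OF f u] var_deriv_linear_functional[OF h u])
  have Br: "?B I J u = canon \<eta> L \<epsilon> F \<psi> u (var_deriv I u) (var_deriv J u)"
    if "u \<in> fields U" "var_deriv I u \<in> test_functions" "var_deriv J u \<in> test_functions" for I J u
    using bil[OF that] by (simp add: nonlocal_bracket_bil)
  have ex: "\<exists>\<xi>. has_variational_derivative (?B I J) \<xi> u"
    if "smooth_functional U I" "smooth_functional U J" "u \<in> fields U" for I J u
    using P that unfolding poisson_bracket_def by blast
  have "poisson_bracket U (\<lambda>I J u. c1 * ?B I J u + c2 * ?E I J u)" for c1 c2
  proof -
    let ?Q = "\<lambda>I J u. c1 * ?B I J u + c2 * ?E I J u"
    have v: "has_variational_derivative (?Q I J) (\<lambda>x. c1 *\<^sub>R var_deriv (?B I J) u x + c2 *\<^sub>R var_deriv (?E I J) u x) u"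
      "var_deriv (?B I J) u \<in> test_functions" "var_deriv (?E I J) u \<in> test_functions"
      if "smooth_functional U I" "smooth_functional U J" "u \<in> fields U" for I J u
    proof -
      have e: "\<exists>\<xi>. has_variational_derivative (?E I J) \<xi> u"
        using constant_bracket_variational_derivative[OF U \<eta> that] by blast
      show "has_variational_derivative (?Q I J) (\<lambda>x. c1 *\<^sub>R var_deriv (?B I J) u x + c2 *\<^sub>R var_deriv (?E I J) u x) u"
        by (rule has_variational_derivative_add[OF var_deriv_works[OF ex[OF that]] var_deriv_works[OF e]])
      show "var_deriv (?B I J) u \<in> test_functions" "var_deriv (?E I J) u \<in> test_functions"
        using var_deriv_test[OF ex[OF that]] var_deriv_test[OF e] by auto
    qed
    have B2: "?B (?Q I J) K u = c1 * ?B (?B I J) K u + c2 * ?B (?E I J) K u"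
      and E2: "?E (?Q I J) K u = c1 * ?E (?B I J) K u + c2 * ?E (?E I J) K u"
      if I: "smooth_functional U I" and J: "smooth_functional U J" and K: "smooth_functional U K" and u: "u \<in> fields U" for I J K u
    proof -
      note vv = v[OF I J u]
      have e: "var_deriv (?Q I J) u = (\<lambda>x. c1 *\<^sub>R var_deriv (?B I J) u x + c2 *\<^sub>R var_deriv (?E I J) u x)"
        by (rule var_deriv_eqI[OF vv(1)])
      have tK: "var_deriv K u \<in> test_functions" by (rule var_deriv_smooth_functional(2)[OF K u])
      have tQ: "var_deriv (?Q I J) u \<in> test_functions"
        unfolding e by (intro test_function_add test_function_scaleR vv)
      have "?B (?Q I J) K u = canon \<eta> L \<epsilon> F \<psi> u (\<lambda>x. c1 *\<^sub>R var_deriv (?B I J) u x + c2 *\<^sub>R var_deriv (?E I J) u x) (var_deriv K u)"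
        using Br[OF u tQ tK] by (simp only: e)
      also have "\<dots> = c1 * ?B (?B I J) K u + c2 * ?B (?E I J) K u"
        using canon_add_left[OF U F \<psi> u test_function_scaleR[OF vv(2)] test_function_scaleR[OF vv(3)] tK, where \<eta>=\<eta> and \<epsilon>=\<epsilon>]
        by (simp add: vv canon_scaleR_left Br[OF u vv(2) tK] Br[OF u vv(3) tK])
      finally show "?B (?Q I J) K u = c1 * ?B (?B I J) K u + c2 * ?B (?E I J) K u" .
      have c: "cont_cs (\<lambda>x. c1 * (var_deriv (?B I J) u x \<bullet> eta_dx \<eta> (var_deriv K u) x))"
         "cont_cs (\<lambda>x. c2 * (var_deriv (?E I J) u x \<bullet> eta_dx \<eta> (var_deriv K u) x))"
        by (rule cont_cs_cmult, rule test_function_cont_cs_inner, rule vv, rule test_function_continuous[OF test_function_eta_dx[OF tK]])+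
      show "?E (?Q I J) K u = c1 * ?E (?B I J) K u + c2 * ?E (?E I J) K u"
        unfolding constant_bracket_eq[of _ "?Q I J"] e inner_add_left inner_scaleR_left
        using integral_cs_add[OF c] by (simp add: constant_bracket_eq)
    qed
    show ?thesis
      unfolding poisson_bracket_def
    proof (intro conjI allI impI ballI)
      fix I J u assume IJ: "smooth_functional U I" "smooth_functional U J" and u: "u \<in> fields U"
      show "\<exists>\<xi>. has_variational_derivative (?Q I J) \<xi> u" using v(1)[OF IJ u] by blast
      have "?B I J u = - ?B J I u" using P IJ u unfolding poisson_bracket_def by blast
      moreover have "?E I J u = - ?E J I u"
        using integral_eta_dx_skew[OF \<eta> var_deriv_smooth_functional(2)[OF IJ(1) u] var_deriv_smooth_functional(2)[OF IJ(2) u]]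
        by (simp add: constant_bracket_eq inner_commute)
      ultimately show "?Q I J u = - ?Q J I u" by simp
    next
      fix I J K u assume I: "smooth_functional U I" and J: "smooth_functional U J" and K: "smooth_functional U K" and u: "u \<in> fields U"
      have 1: "?B (?B I J) K u + ?B (?B J K) I u + ?B (?B K I) J u = 0"
        using P I J K u unfolding poisson_bracket_def by blast
      have 2: "(?E (?B I J) K u + ?E (?B J K) I u + ?E (?B K I) J u) + (?B (?E I J) K u + ?B (?E J K) I u + ?B (?E K I) J u) = 0"
        by (rule mixed_jacobi[OF U F \<psi> \<eta> Br ex I J K u])
      have 3: "?E (?E I J) K u + ?E (?E J K) I u + ?E (?E K I) J u = 0"
        by (rule constant_bracket_jacobi[OF U \<eta> I J K u])
      have "?Q (?Q I J) K u + ?Q (?Q J K) I u + ?Q (?Q K I) J u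
        = c1 * c1 * (?B (?B I J) K u + ?B (?B J K) I u + ?B (?B K I) J u)
        + c1 * c2 * ((?E (?B I J) K u + ?E (?B J K) I u + ?E (?B K I) J u) + (?B (?E I J) K u + ?B (?E J K) I u + ?B (?E K I) J u))
        + c2 * c2 * (?E (?E I J) K u + ?E (?E J K) I u + ?E (?E K I) J u)"
        unfolding B2[OF I J K u] B2[OF J K I u] B2[OF K I J u] E2[OF I J K u] E2[OF J K I u] E2[OF K I J u]
        by (simp add: algebra_simps)
      then show "?Q (?Q I J) K u + ?Q (?Q J K) I u + ?Q (?Q K I) J u = 0"
        unfolding 1 2 3 by simp
    qed
  qed
  then show ?thesis by (simp add: compatible_def)
qed


section \<open>Closed skew forms\<close>

definition skew_form :: "(real^'n) set \<Rightarrow> ('n::finite field \<Rightarrow> 'n field \<Rightarrow> 'n field \<Rightarrow> real) \<Rightarrow> bool" where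
  "skew_form V B \<longleftrightarrow> (\<forall>u\<in>fields V. \<forall>f\<in>test_functions. \<forall>h\<in>test_functions. B u f h = - B u h f)"

text \<open>Closedness of a 2-form on covector fields that do not depend on u. The derivatives are
  quantified existentially because for \<open>bil\<close> differentiability is obtained from the
  variational derivative of the bracket, not from a formula.\<close>

definition closed_form :: "(real^'n) set \<Rightarrow> real^'n^'n \<Rightarrow> ('n::finite field \<Rightarrow> 'n field \<Rightarrow> 'n field \<Rightarrow> real) \<Rightarrow> bool" where
  "closed_form V \<eta> B \<longleftrightarrow> (\<forall>u\<in>fields V. \<forall>f\<in>test_functions. \<forall>h\<in>test_functions. \<forall>k\<in>test_functions.
     \<exists>D1 D2 D3. ((\<lambda>t. B (\<lambda>x. u x + t *\<^sub>R eta_dx \<eta> k x) f h) has_real_derivative D1) (at 0) \<and>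
       ((\<lambda>t. B (\<lambda>x. u x + t *\<^sub>R eta_dx \<eta> f x) h k) has_real_derivative D2) (at 0) \<and>
       ((\<lambda>t. B (\<lambda>x. u x + t *\<^sub>R eta_dx \<eta> h x) k f) has_real_derivative D3) (at 0) \<and> D1 + D2 + D3 = 0)"

text \<open>Evaluating the Jacobi identity of the pencil on linear functionals isolates the mixed terms.\<close>

lemma compatible_imp_closed:
  fixes U :: "(real^'n::finite) set"
  assumes U: "open U" and \<eta>: "transpose \<eta> = \<eta>"
    and P: "poisson_bracket U (nonlocal_bracket g b L \<epsilon> w)"
    and C: "compatible U (nonlocal_bracket g b L \<epsilon> w) (constant_bracket \<eta>)"
  shows "closed_form U \<eta> (bil g b L \<epsilon> w)" "skew_form U (bil g b L \<epsilon> w)"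
proof -
  let ?B = "nonlocal_bracket g b L \<epsilon> w" and ?E = "constant_bracket \<eta>"
  let ?l = "linear_functional :: 'n field \<Rightarrow> 'n functional"
  note sl = smooth_functional_linear[of _ U]
  have vl: "var_deriv (?l f) u = f" if "f \<in> test_functions" "u \<in> fields U" for f u
    by (rule var_deriv_linear_functional[OF that])
  show "skew_form U (bil g b L \<epsilon> w)"
    unfolding skew_form_def
  proof (intro ballI)
    fix u f h :: "'n field" assume u: "u \<in> fields U" and fh: "f \<in> test_functions" "h \<in> test_functions"
    have "?B (?l f) (?l h) u = - ?B (?l h) (?l f) u"
      using P sl[OF fh(1)] sl[OF fh(2)] u unfolding poisson_bracket_def by blast
    then show "bil g b L \<epsilon> w u f h = - bil g b L \<epsilon> w u h f"
      by (simp add: nonlocal_bracket_bil vl fh u)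
  qed
  show "closed_form U \<eta> (bil g b L \<epsilon> w)"
    unfolding closed_form_def
  proof (intro ballI)
    fix u f h k :: "'n field" assume u: "u \<in> fields U"
      and f: "f \<in> test_functions" and h: "h \<in> test_functions" and k: "k \<in> test_functions"
    let ?X = "\<lambda>f h. var_deriv (?B (?l f) (?l h)) u"
    have v: "has_variational_derivative (?B (?l f) (?l h)) (?X f h) u"
      if "f \<in> test_functions" "h \<in> test_functions" for f h
      using P sl[OF that(1)] sl[OF that(2)] u unfolding poisson_bracket_def by (intro var_deriv_works) blast
    let ?Q = "\<lambda>I J u. 1 * ?B I J u + 1 * ?E I J u"
    have vQ: "var_deriv (?Q (?l f) (?l h)) u = ?X f h" if fh: "f \<in> test_functions" "h \<in> test_functions" for f h
    proof -
      have z: "dvar (?l f) u v x = 0" if "v \<in> test_functions" "f \<in> test_functions" for f v x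
      proof -
        have "var_deriv (?l f) (\<lambda>y. u y + t *\<^sub>R v y) = f" for t
          by (intro var_deriv_eqI linear_functional_derivative that continuous_on_add continuous_on_scaleR
              continuous_on_const field_continuous[OF u] test_function_continuous)
        then show ?thesis by (simp add: dvar_def)
      qed
      \<comment> \<open>The constant bracket of two linear functionals has the same value at every
        field, so the variational derivative of the combination is that of the first bracket
        alone.\<close>
      have "has_variational_derivative (?E (?l f) (?l h)) (\<lambda>x. 0) u"
        using constant_bracket_variational_derivative[OF U \<eta> sl[OF fh(1)] sl[OF fh(2)] u]
        by (simp add: z vl fh u test_function_eta_dx)
      from has_variational_derivative_add[OF v[OF fh] this, of 1 1]
      show ?thesis by (intro var_deriv_eqI) simp
    qed
    have Q: "?Q (?Q (?l f) (?l h)) (?l k) u = ?B (?B (?l f) (?l h)) (?l k) u + integral UNIV (\<lambda>x. ?X f h x \<bullet> eta_dx \<eta> k x)"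
      if "f \<in> test_functions" "h \<in> test_functions" "k \<in> test_functions" for f h k
      unfolding nonlocal_bracket_bil[of _ _ _ _ _ "?Q (?l f) (?l h)"] constant_bracket_eq[of _ "?Q (?l f) (?l h)"] vQ[OF that(1,2)]
      by (simp add: nonlocal_bracket_bil vl that u)
    have "poisson_bracket U ?Q" using C unfolding compatible_def by blast
    then have "?Q (?Q (?l f) (?l h)) (?l k) u + ?Q (?Q (?l h) (?l k)) (?l f) u + ?Q (?Q (?l k) (?l f)) (?l h) u = 0"
      using sl[OF f] sl[OF h] sl[OF k] u unfolding poisson_bracket_def by blast
    moreover have "?B (?B (?l f) (?l h)) (?l k) u + ?B (?B (?l h) (?l k)) (?l f) u + ?B (?B (?l k) (?l f)) (?l h) u = 0"
      using P sl[OF f] sl[OF h] sl[OF k] u unfolding poisson_bracket_def by blast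
    \<comment> \<open>The Jacobi identity of \<open>?B\<close> is subtracted from that of the
      combination; only the derivatives in the directions \<eta> k_x are left.\<close>
    ultimately have s: "integral UNIV (\<lambda>x. ?X f h x \<bullet> eta_dx \<eta> k x) + integral UNIV (\<lambda>x. ?X h k x \<bullet> eta_dx \<eta> f x)
       + integral UNIV (\<lambda>x. ?X k f x \<bullet> eta_dx \<eta> h x) = 0"
      unfolding Q[OF f h k] Q[OF h k f] Q[OF k f h] by linarith
    have d: "((\<lambda>t. bil g b L \<epsilon> w (\<lambda>x. u x + t *\<^sub>R eta_dx \<eta> k x) f h) has_real_derivative
        integral UNIV (\<lambda>x. ?X f h x \<bullet> eta_dx \<eta> k x)) (at 0)"
      if f: "f \<in> test_functions" and h: "h \<in> test_functions" and k: "k \<in> test_functions" for f h k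
    proof -
      have c: "continuous_on UNIV (\<lambda>x. u x + t *\<^sub>R eta_dx \<eta> k x)" for t
        by (intro continuous_on_add continuous_on_scaleR continuous_on_const field_continuous[OF u]
            test_function_continuous test_function_eta_dx k)
      have e: "?B (?l f) (?l h) (\<lambda>x. u x + t *\<^sub>R eta_dx \<eta> k x) = bil g b L \<epsilon> w (\<lambda>x. u x + t *\<^sub>R eta_dx \<eta> k x) f h" for t
        unfolding nonlocal_bracket_bil var_deriv_eqI[OF linear_functional_derivative[OF f c]]
          var_deriv_eqI[OF linear_functional_derivative[OF h c]] ..
      have "((\<lambda>t. ?B (?l f) (?l h) (\<lambda>x. u x + t *\<^sub>R eta_dx \<eta> k x)) has_real_derivative
        integral UNIV (\<lambda>x. ?X f h x \<bullet> eta_dx \<eta> k x)) (at 0)"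
        using v[OF f h] test_function_eta_dx[OF k, of \<eta>] unfolding has_variational_derivative_def by blast
      then show ?thesis unfolding e .
    qed
    show "\<exists>D1 D2 D3. ((\<lambda>t. bil g b L \<epsilon> w (\<lambda>x. u x + t *\<^sub>R eta_dx \<eta> k x) f h) has_real_derivative D1) (at 0) \<and>
       ((\<lambda>t. bil g b L \<epsilon> w (\<lambda>x. u x + t *\<^sub>R eta_dx \<eta> f x) h k) has_real_derivative D2) (at 0) \<and>
       ((\<lambda>t. bil g b L \<epsilon> w (\<lambda>x. u x + t *\<^sub>R eta_dx \<eta> h x) k f) has_real_derivative D3) (at 0) \<and> D1 + D2 + D3 = 0"
      using d[OF f h k] d[OF h k f] d[OF k f h] s by blast
  qed
qed

lemma closed_form_mono: "closed_form U \<eta> B \<Longrightarrow> V \<subseteq> U \<Longrightarrow> closed_form V \<eta> B"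
  unfolding closed_form_def using fields_mono by blast

lemma skew_form_mono: "skew_form U B \<Longrightarrow> V \<subseteq> U \<Longrightarrow> skew_form V B"
  unfolding skew_form_def using fields_mono by blast

lemma field_variation1:
  fixes u :: "'n::finite field"
  assumes "open V" "u \<in> fields V" "v \<in> test_functions"
  obtains r where "r > 0" "\<And>t. \<bar>t\<bar> < r \<Longrightarrow> (\<lambda>x. u x + t *\<^sub>R v x) \<in> fields V"
proof -
  obtain r where r: "r > 0" "\<And>s t. \<bar>s\<bar> < r \<Longrightarrow> \<bar>t\<bar> < r \<Longrightarrow> (\<lambda>x. u x + s *\<^sub>R v x + t *\<^sub>R v x) \<in> fields V"
    by (rule field_variation[OF assms(1-3,3)], rule that; blast)
  show thesis using that[of r] r(1) r(2)[of _ 0] by simp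
qed

lemma canon_closed:
  fixes V :: "(real^'n::finite) set"
  assumes V: "open V" and F: "smooth_on V F" and \<psi>: "\<And>\<alpha>. \<alpha> \<in> {1..L} \<Longrightarrow> smooth_on V (\<psi> \<alpha>)"
  shows "closed_form V \<eta> (canon \<eta> L \<epsilon> F \<psi>)" "skew_form V (canon \<eta> L \<epsilon> F \<psi>)"
proof -
  show "skew_form V (canon \<eta> L \<epsilon> F \<psi>)"
    unfolding skew_form_def by (intro ballI) (rule canon_skew[OF V F \<psi>])
  show "closed_form V \<eta> (canon \<eta> L \<epsilon> F \<psi>)"
    unfolding closed_form_def
  proof (intro ballI)
    fix u f h k :: "'n field" assume u: "u \<in> fields V"
      and f: "f \<in> test_functions" and h: "h \<in> test_functions" and k: "k \<in> test_functions"
    have d: "((\<lambda>t. canon \<eta> L \<epsilon> F \<psi> (\<lambda>x. u x + t *\<^sub>R eta_dx \<eta> k x) f h) has_real_derivative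
        canon_var \<eta> L \<epsilon> F \<psi> u (eta_dx \<eta> k) f h) (at 0)"
      if f: "f \<in> test_functions" and h: "h \<in> test_functions" and k: "k \<in> test_functions" for f h k
    proof -
      obtain r where r: "r > 0" "\<And>t. \<bar>t\<bar> < r \<Longrightarrow> (\<lambda>x. u x + t *\<^sub>R eta_dx \<eta> k x) \<in> fields V"
        by (rule field_variation1[OF V u test_function_eta_dx[OF k]], rule that; blast)
      obtain R1 where R1: "\<And>x. \<bar>x\<bar> > R1 \<Longrightarrow> f x = 0" using test_functionE[OF f] by metis
      obtain R2 where R2: "\<And>x. \<bar>x\<bar> > R2 \<Longrightarrow> h x = 0" using test_functionE[OF h] by metis
      define T where "T = {-r<..<r}"
      have T: "open T" "0 \<in> T" using r by (auto simp: T_def)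
      have o: "open (T \<times> (UNIV::real set))" using T by (auto intro: open_Times)
      have sm: "smooth_on (T \<times> UNIV) (\<lambda>p::real\<times>real. a (snd p))" if "a \<in> test_functions" for a :: "'n field"
        by (rule smooth_on_compose[OF test_function_smooth[OF that]]) (auto intro!: smooth_on_snd smooth_on_id o)
      have dt0: "dt (\<lambda>p. a (snd p)) (0, x) = 0" if a: "a \<in> test_functions" for a :: "'n field" and x
        by (rule dt_eqI[OF sm[OF a]]) (use T in auto)
      have z: "canon \<eta> L \<epsilon> F \<psi> u (\<lambda>x. 0) h = 0"
        using canon_minus_left[OF V F \<psi> test_function_zero, where \<eta>=\<eta> and \<epsilon>=\<epsilon> and u=u and h=h] by simp
      have z': "canon \<eta> L \<epsilon> F \<psi> u f (\<lambda>x. 0) = 0"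
        using canon_skew[OF V F \<psi> u f test_function_zero, where \<eta>=\<eta> and \<epsilon>=\<epsilon>]
          canon_minus_left[OF V F \<psi> test_function_zero, where \<eta>=\<eta> and \<epsilon>=\<epsilon> and u=u and h=f] by simp
      have "((\<lambda>t. canon \<eta> L \<epsilon> F \<psi> (\<lambda>x. u x + t *\<^sub>R eta_dx \<eta> k x) (\<lambda>x. (\<lambda>p. f (snd p)) (t, x)) (\<lambda>x. (\<lambda>p. h (snd p)) (t, x))) has_real_derivative
        canon_var \<eta> L \<epsilon> F \<psi> u (eta_dx \<eta> k) (\<lambda>x. (\<lambda>p. f (snd p)) (0::real, x)) (\<lambda>x. (\<lambda>p. h (snd p)) (0::real, x))
        + canon \<eta> L \<epsilon> F \<psi> u (\<lambda>x. dt (\<lambda>p. f (snd p)) (0, x)) (\<lambda>x. (\<lambda>p. h (snd p)) (0::real, x))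
        + canon \<eta> L \<epsilon> F \<psi> u (\<lambda>x. (\<lambda>p. f (snd p)) (0::real, x)) (\<lambda>x. dt (\<lambda>p. h (snd p)) (0, x))) (at 0)"
      proof (rule canon_derivative[OF V F \<psi> T u test_function_eta_dx[OF k] _ sm[OF f] _ sm[OF h], where R="max R1 R2"])
        show "u x + t *\<^sub>R eta_dx \<eta> k x \<in> V" if "t \<in> T" for t x
          using field_in[OF r(2)[of t]] that by (auto simp: T_def)
      qed (simp_all add: R1 R2)
      then show ?thesis by (simp add: dt0 f h z z')
    qed
    have c: "canon_var \<eta> L \<epsilon> F \<psi> u (eta_dx \<eta> k) f h + canon_var \<eta> L \<epsilon> F \<psi> u (eta_dx \<eta> f) h k
      + canon_var \<eta> L \<epsilon> F \<psi> u (eta_dx \<eta> h) k f = 0"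
      by (rule canon_var_cyclic[OF V F \<psi> u f h k])
    show "\<exists>D1 D2 D3. ((\<lambda>t. canon \<eta> L \<epsilon> F \<psi> (\<lambda>x. u x + t *\<^sub>R eta_dx \<eta> k x) f h) has_real_derivative D1) (at 0) \<and>
       ((\<lambda>t. canon \<eta> L \<epsilon> F \<psi> (\<lambda>x. u x + t *\<^sub>R eta_dx \<eta> f x) h k) has_real_derivative D2) (at 0) \<and>
       ((\<lambda>t. canon \<eta> L \<epsilon> F \<psi> (\<lambda>x. u x + t *\<^sub>R eta_dx \<eta> h x) k f) has_real_derivative D3) (at 0) \<and> D1 + D2 + D3 = 0"
      using d[OF f h k] d[OF h k f] d[OF k f h] c by blast
  qed
qed

text \<open>The identity for C is available only at fields with values in V; small variations stay
  among these, so it may be differentiated at t = 0.\<close>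

lemma closed_form_diff:
  fixes V :: "(real^'n::finite) set"
  assumes V: "open V" and A: "closed_form V \<eta> A" and B: "closed_form V \<eta> B"
    and C: "\<And>u f h. u \<in> fields V \<Longrightarrow> f \<in> test_functions \<Longrightarrow> h \<in> test_functions \<Longrightarrow> C u f h = A u f h - B u f h"
  shows "closed_form V \<eta> C"
  unfolding closed_form_def
proof (intro ballI)
  fix u f h k :: "'n field" assume u: "u \<in> fields V"
    and f: "f \<in> test_functions" and h: "h \<in> test_functions" and k: "k \<in> test_functions"
  obtain a1 a2 a3 where a: "((\<lambda>t. A (\<lambda>x. u x + t *\<^sub>R eta_dx \<eta> k x) f h) has_real_derivative a1) (at 0)"
    "((\<lambda>t. A (\<lambda>x. u x + t *\<^sub>R eta_dx \<eta> f x) h k) has_real_derivative a2) (at 0)"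
    "((\<lambda>t. A (\<lambda>x. u x + t *\<^sub>R eta_dx \<eta> h x) k f) has_real_derivative a3) (at 0)" "a1 + a2 + a3 = 0"
    using A u f h k unfolding closed_form_def by blast
  obtain b1 b2 b3 where b: "((\<lambda>t. B (\<lambda>x. u x + t *\<^sub>R eta_dx \<eta> k x) f h) has_real_derivative b1) (at 0)"
    "((\<lambda>t. B (\<lambda>x. u x + t *\<^sub>R eta_dx \<eta> f x) h k) has_real_derivative b2) (at 0)"
    "((\<lambda>t. B (\<lambda>x. u x + t *\<^sub>R eta_dx \<eta> h x) k f) has_real_derivative b3) (at 0)" "b1 + b2 + b3 = 0"
    using B u f h k unfolding closed_form_def by blast
  have d: "((\<lambda>t. C (\<lambda>x. u x + t *\<^sub>R eta_dx \<eta> k x) f h) has_real_derivative a - b) (at 0)"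
    if "((\<lambda>t. A (\<lambda>x. u x + t *\<^sub>R eta_dx \<eta> k x) f h) has_real_derivative a) (at 0)"
      "((\<lambda>t. B (\<lambda>x. u x + t *\<^sub>R eta_dx \<eta> k x) f h) has_real_derivative b) (at 0)"
      and f: "f \<in> test_functions" and h: "h \<in> test_functions" and k: "k \<in> test_functions" for f h k a b
  proof -
    obtain r where r: "r > 0" "\<And>t. \<bar>t\<bar> < r \<Longrightarrow> (\<lambda>x. u x + t *\<^sub>R eta_dx \<eta> k x) \<in> fields V"
      by (rule field_variation1[OF V u test_function_eta_dx[OF k]], rule that; blast)
    show ?thesis
      by (rule has_field_derivative_transform_within_open[OF DERIV_diff[OF that(1,2)], where S="{-r<..<r}"])
         (use r in \<open>auto simp: abs_less_iff intro!: C[symmetric] f h\<close>)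
  qed
  show "\<exists>D1 D2 D3. ((\<lambda>t. C (\<lambda>x. u x + t *\<^sub>R eta_dx \<eta> k x) f h) has_real_derivative D1) (at 0) \<and>
       ((\<lambda>t. C (\<lambda>x. u x + t *\<^sub>R eta_dx \<eta> f x) h k) has_real_derivative D2) (at 0) \<and>
       ((\<lambda>t. C (\<lambda>x. u x + t *\<^sub>R eta_dx \<eta> h x) k f) has_real_derivative D3) (at 0) \<and> D1 + D2 + D3 = 0"
    using d[OF a(1) b(1) f h k] d[OF a(2) b(2) h k f] d[OF a(3) b(3) k f h] a(4) b(4)
    by (intro exI[of _ "a1 - b1"] exI[of _ "a2 - b2"] exI[of _ "a3 - b3"]) auto
qed

section \<open>Extracting coefficients\<close>

lemma xderiv_real: "smooth_on UNIV f \<Longrightarrow> (f has_real_derivative xderiv f x) (at x)" for f :: "real \<Rightarrow> real"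
  by (simp add: has_real_derivative_iff_has_vector_derivative xderiv_works)

lemma xderiv_cong_open:
  assumes "open S" "x \<in> S" "\<And>y. y \<in> S \<Longrightarrow> f y = g y" "smooth_on UNIV g"
  shows "xderiv f x = xderiv g x"
  by (rule xderiv_eqI, rule has_vector_derivative_transform_within_open[OF xderiv_works[OF assms(4)] assms(1,2)]) (simp add: assms(3))

text \<open>Multiplication by a plateau cuts off q without changing its 2-jet at 0. Polynomials then
  realise any prescribed jet by a test function supported in the unit interval.\<close>

lemma bump_jet:
  fixes q :: "real \<Rightarrow> real"
  assumes q: "smooth_on UNIV q"
  defines "\<kappa> \<equiv> \<lambda>x. plateau (4 * x) * q x"
  shows "smooth_on UNIV \<kappa>" "\<And>x. \<bar>x\<bar> > 1 / 2 \<Longrightarrow> \<kappa> x = 0" "\<And>x. \<bar>x\<bar> < 1 / 4 \<Longrightarrow> \<kappa> x = q x"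
    "xderiv \<kappa> 0 = xderiv q 0" "xderiv (xderiv \<kappa>) 0 = xderiv (xderiv q) 0"
proof -
  have "smooth_on UNIV (\<lambda>x. plateau (4 * x + 0))" by (rule smooth_on_affine_compose[OF plateau_smooth])
  then show "smooth_on UNIV \<kappa>" unfolding \<kappa>_def by (intro smooth_on_mult q open_UNIV) simp
  show "\<kappa> x = 0" if "\<bar>x\<bar> > 1 / 2" for x
    using plateau_0[of "4 * x"] that by (simp add: \<kappa>_def)
  show e: "\<kappa> x = q x" if "\<bar>x\<bar> < 1 / 4" for x
    using plateau_1[of "4 * x"] that by (simp add: \<kappa>_def)
  have d: "xderiv \<kappa> x = xderiv q x" if "x \<in> {-1/4<..<1/4}" for x
    by (rule xderiv_cong_open[OF open_greaterThanLessThan that e q]) auto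
  then show "xderiv \<kappa> 0 = xderiv q 0" by simp
  show "xderiv (xderiv \<kappa>) 0 = xderiv (xderiv q) 0"
    by (rule xderiv_cong_open[OF open_greaterThanLessThan[where a="-1/4" and b="1/4"] _ d smooth_on_xderiv[OF q]]) auto
qed

text \<open>Moving all derivatives from \<phi> to the other factors leaves \<phi> times an
  expression C that is linear in the 2-jet of \<kappa>. Since \<phi> is arbitrary, C vanishes at 0,
  and since the jet of \<kappa> is arbitrary, so does each of its three coefficients.\<close>

lemma extract_coefficients:
  fixes S0 S1 S2 b1 b2 G :: "real \<Rightarrow> real"
  assumes sm: "smooth_on UNIV S0" "smooth_on UNIV S1" "smooth_on UNIV S2" "smooth_on UNIV b1" "smooth_on UNIV b2" "smooth_on UNIV G"
    and i: "\<And>\<phi> \<kappa>. smooth_on UNIV \<phi> \<Longrightarrow> smooth_on UNIV \<kappa> \<Longrightarrow> (\<And>x. \<bar>x\<bar> > 1 \<Longrightarrow> \<phi> x = 0) \<Longrightarrow> (\<And>x. \<bar>x\<bar> > 1 \<Longrightarrow> \<kappa> x = 0) \<Longrightarrow>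
      integral UNIV (\<lambda>x. \<phi> x * xderiv \<kappa> x * S1 x + \<phi> x * xderiv (xderiv \<kappa>) x * b1 x + xderiv \<phi> x * xderiv \<kappa> x * G x
        + xderiv \<phi> x * \<kappa> x * S2 x + xderiv (xderiv \<phi>) x * \<kappa> x * b2 x + \<phi> x * \<kappa> x * S0 x) = 0"
  shows "b1 0 - G 0 + b2 0 = 0" "S1 0 - xderiv G 0 - S2 0 + 2 * xderiv b2 0 = 0" "S0 0 - xderiv S2 0 + xderiv (xderiv b2) 0 = 0"
proof -
  note D = sm[THEN xderiv_real] smooth_on_xderiv[OF sm(5), THEN xderiv_real]
  note cont = sm[THEN smooth_on_continuous] sm[THEN smooth_on_xderiv, THEN smooth_on_continuous]
     smooth_on_xderiv[OF smooth_on_xderiv[OF sm(5)], THEN smooth_on_continuous]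
  have main: "\<kappa> 0 * (S0 0 - xderiv S2 0 + xderiv (xderiv b2) 0) + xderiv \<kappa> 0 * (S1 0 - xderiv G 0 - S2 0 + 2 * xderiv b2 0)
      + xderiv (xderiv \<kappa>) 0 * (b1 0 - G 0 + b2 0) = 0"
    if \<kappa>: "smooth_on UNIV \<kappa>" and \<kappa>0: "\<And>x. \<bar>x\<bar> > 1 \<Longrightarrow> \<kappa> x = 0" for \<kappa>
  proof -
    note k1 = smooth_on_xderiv[OF \<kappa>]
    note k2 = smooth_on_xderiv[OF k1]
    define C where "C x = \<kappa> x * (S0 x - xderiv S2 x + xderiv (xderiv b2) x) + xderiv \<kappa> x * (S1 x - xderiv G x - S2 x + 2 * xderiv b2 x)
      + xderiv (xderiv \<kappa>) x * (b1 x - G x + b2 x)" for x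
    have Cc: "continuous_on UNIV C"
      unfolding C_def
      by (intro continuous_on_add continuous_on_mult continuous_on_diff continuous_on_const cont
          smooth_on_continuous[OF \<kappa>] smooth_on_continuous[OF k1] smooth_on_continuous[OF k2])
    have "C 0 = 0"
    proof (rule fundamental_lemma[OF _ Cc, where d=1])
      fix \<phi> :: "real \<Rightarrow> real" assume \<phi>: "smooth_on UNIV \<phi>" and "\<And>x. \<bar>x - 0\<bar> > 1 \<Longrightarrow> \<phi> x = 0"
      then have \<phi>0: "\<And>x. \<bar>x\<bar> > 1 \<Longrightarrow> \<phi> x = 0" by simp
      note p1 = smooth_on_xderiv[OF \<phi>]
      \<comment> \<open>The boundary expression of the integrations by parts: its derivative is the
        given integrand minus \<phi> C, and it has compact support.\<close>
      define W where "W x = \<phi> x * xderiv \<kappa> x * G x + \<phi> x * \<kappa> x * S2 x + xderiv \<phi> x * \<kappa> x * b2 x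
         - \<phi> x * (xderiv \<kappa> x * b2 x + \<kappa> x * xderiv b2 x)" for x
      define I where "I x = \<phi> x * xderiv \<kappa> x * S1 x + \<phi> x * xderiv (xderiv \<kappa>) x * b1 x + xderiv \<phi> x * xderiv \<kappa> x * G x
        + xderiv \<phi> x * \<kappa> x * S2 x + xderiv (xderiv \<phi>) x * \<kappa> x * b2 x + \<phi> x * \<kappa> x * S0 x" for x
      have dW: "(W has_real_derivative I x - \<phi> x * C x) (at x)" for x
        unfolding W_def
        by (rule derivative_eq_intros D xderiv_real[OF \<phi>] xderiv_real[OF \<kappa>] xderiv_real[OF p1] xderiv_real[OF k1] refl)+
           (simp add: I_def C_def algebra_simps)
      have "integral UNIV (\<lambda>x. I x - \<phi> x * C x) = 0"
        by (rule integral_of_derivative_0[OF dW, where R=1]) (simp add: W_def \<kappa>0 \<phi>0)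
      moreover have cp: "cont_cs (\<lambda>x. \<phi> x * c x)" if "continuous_on UNIV c" for c
        by (rule cont_cs_mult_right[OF that cont_csI[OF smooth_on_continuous[OF \<phi>] \<phi>0]])
      have "cont_cs I"
      proof (rule cont_csI[where R=1])
        show "continuous_on UNIV I"
          unfolding I_def
          by (intro continuous_on_add continuous_on_mult cont smooth_on_continuous \<kappa> k1 k2 \<phi> p1 smooth_on_xderiv[OF p1])
        show "I x = 0" if "\<bar>x\<bar> > 1" for x
          using that by (simp add: I_def \<phi>0 \<kappa>0 xderiv_zero_outside[where R=1 and f=\<kappa>])
      qed
      ultimately have "integral UNIV I - integral UNIV (\<lambda>x. \<phi> x * C x) = 0"
        using integral_cs_diff[OF _ cp[OF Cc], of I] by simp
      moreover have "integral UNIV I = 0"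
        unfolding I_def by (rule i[OF \<phi> \<kappa> \<phi>0 \<kappa>0])
      ultimately show "integral UNIV (\<lambda>x. \<phi> x * C x) = 0" by simp
    qed simp
    then show ?thesis by (simp add: C_def)
  qed
  \<comment> \<open>At 0 the polynomials 1, x and x^2 have a single nonzero entry among value, first
    and second derivative.\<close>
  have q: "smooth_on UNIV (\<lambda>x::real. 1::real)" "smooth_on UNIV (\<lambda>x::real. x)" "smooth_on UNIV (\<lambda>x::real. x * x)"
    by (intro smooth_on_mult smooth_on_const smooth_on_id open_UNIV)+
  have d0: "xderiv (\<lambda>x::real. c::real) = (\<lambda>x. 0)" for c
    by (rule ext, rule xderiv_eqI) simp
  have d1: "xderiv (\<lambda>x::real. x) = (\<lambda>x. 1)"
    by (rule ext, rule xderiv_eqI) (rule has_vector_derivative_id)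
  have d3: "xderiv (\<lambda>x::real. 2 * x) = (\<lambda>x. 2)"
    by (rule ext, rule xderiv_eqI) (auto intro!: derivative_eq_intros simp: has_real_derivative_iff_has_vector_derivative[symmetric])
  have d2: "xderiv (\<lambda>x::real. x * x) = (\<lambda>x. 2 * x)"
    by (rule ext, rule xderiv_eqI) (auto intro!: derivative_eq_intros simp: has_real_derivative_iff_has_vector_derivative[symmetric])
  have b: "\<bar>x\<bar> > 1 \<Longrightarrow> \<bar>x\<bar> > 1 / 2" for x :: real by simp
  show "b1 0 - G 0 + b2 0 = 0"
    using main[OF bump_jet(1)[OF q(3)] bump_jet(2)[OF q(3) b]] bump_jet(3-5)[OF q(3)] by (simp add: d2 d3)
  show "S1 0 - xderiv G 0 - S2 0 + 2 * xderiv b2 0 = 0"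
    using main[OF bump_jet(1)[OF q(2)] bump_jet(2)[OF q(2) b]] bump_jet(3-5)[OF q(2)] by (simp add: d0 d1 d2)
  show "S0 0 - xderiv S2 0 + xderiv (xderiv b2) 0 = 0"
    using main[OF bump_jet(1)[OF q(1)] bump_jet(2)[OF q(1) b]] bump_jet(3-5)[OF q(1)] plateau_1[of 0] by (simp add: d0)
qed


section \<open>Fields with prescribed jets and variations along coordinate axes\<close>

lemma xderiv_zero_on_open:
  assumes "open S" "x \<in> S" "\<And>y. y \<in> S \<Longrightarrow> f y = 0"
  shows "xderiv f x = 0"
  by (rule xderiv_eqI, rule has_vector_derivative_transform_within_open[OF has_vector_derivative_const assms(1,2)]) (simp add: assms(3))

text \<open>A path along the segment from p to q, to which short linear pieces at 0 and 10 are
  added. The slopes are prescribed only up to a common factor s, because a field with large slopes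
  might leave V; the conditions tested with such fields are homogeneous in the slopes. The points 0
  and 10 are far enough apart for bumps around them to have disjoint supports.\<close>

lemma field_with_jets:
  fixes V :: "(real^'n::finite) set"
  assumes V: "open V" "convex V" and pq: "p \<in> V" "q \<in> V"
  obtains u s where "u \<in> fields V" "s > 0" "u 0 = p" "xderiv u 0 = s *\<^sub>R a" "u 10 = q" "xderiv u 10 = s *\<^sub>R c"
proof -
  \<comment> \<open>The passage from p to q takes place between 4 and 6, so the path is constant
    near 0 and near 10.\<close>
  define \<tau> where "\<tau> x = smooth_step ((1/2) * x + (-2))" for x
  have \<tau>: "smooth_on UNIV \<tau>" unfolding \<tau>_def by (rule smooth_on_affine_compose[OF smooth_step_smooth])
  have \<tau>0: "\<tau> x = 0" if "x \<le> 4" for x using that by (simp add: \<tau>_def smooth_step_0)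
  have \<tau>1: "\<tau> x = 1" if "x \<ge> 6" for x using that by (simp add: \<tau>_def smooth_step_1)
  define u0 where "u0 x = p + \<tau> x *\<^sub>R (q - p)" for x
  have u0s: "smooth_on UNIV u0"
    unfolding u0_def by (intro smooth_on_add smooth_on_scaleR smooth_on_const \<tau> open_UNIV)
  have u0V: "u0 x \<in> V" for x
  proof -
    have "(1 - \<tau> x) *\<^sub>R p + \<tau> x *\<^sub>R q \<in> V"
      using V(2) pq smooth_step_bounds by (intro convexD) (auto simp: \<tau>_def)
    then show ?thesis by (simp add: u0_def algebra_simps)
  qed
  have "xderiv u0 x = 0" if "\<bar>x\<bar> > 7" for x
  proof (cases "x > 7")
    case True
    have "xderiv u0 x = xderiv (\<lambda>_. q) x"
      by (rule xderiv_cong_open[of "{7<..}"]) (use True in \<open>auto simp: u0_def \<tau>1 smooth_on_const\<close>)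
    then show ?thesis by (simp add: xderiv_eqI[OF has_vector_derivative_const])
  next
    case False
    then have x: "x < -7" using that by auto
    have "xderiv u0 x = xderiv (\<lambda>_. p) x"
      by (rule xderiv_cong_open[of "{..<-7}"]) (use x in \<open>auto simp: u0_def \<tau>0 smooth_on_const\<close>)
    then show ?thesis by (simp add: xderiv_eqI[OF has_vector_derivative_const])
  qed
  then have u0: "u0 \<in> fields V" using u0s u0V unfolding fields_def by blast
  \<comment> \<open>A perturbation supported within distance 2 of y that equals the linear function
    (x - y) e within distance 1.\<close>
  have vt: "(\<lambda>x. (plateau (x - y) * (x - y)) *\<^sub>R e) \<in> test_functions" for y and e :: "real^'n"
  proof (rule test_functionI[where R="\<bar>y\<bar> + 2"])
    have "smooth_on UNIV (\<lambda>x. plateau (1 * x + (- y)))" by (rule smooth_on_affine_compose[OF plateau_smooth])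
    then have "smooth_on UNIV (\<lambda>x. plateau (x - y))" by simp
    then show "smooth_on UNIV (\<lambda>x. (plateau (x - y) * (x - y)) *\<^sub>R e)"
      by (intro smooth_on_scaleR smooth_on_mult smooth_on_diff smooth_on_const smooth_on_id open_UNIV)
    show "(plateau (x - y) * (x - y)) *\<^sub>R e = 0" if "\<bar>y\<bar> + 2 < \<bar>x\<bar>" for x
    proof -
      have "\<bar>x - y\<bar> \<ge> 2" using that by arith
      then show ?thesis by (simp add: plateau_0)
    qed
  qed
  obtain r where r: "r > 0" "\<And>s t. \<bar>s\<bar> < r \<Longrightarrow> \<bar>t\<bar> < r \<Longrightarrow>
     (\<lambda>x. u0 x + s *\<^sub>R ((plateau (x - 0) * (x - 0)) *\<^sub>R a) + t *\<^sub>R ((plateau (x - 10) * (x - 10)) *\<^sub>R c)) \<in> fields V"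
    by (rule field_variation[OF V(1) u0 vt vt], rule that; blast)
  define s where "s = r / 2"
  define u where "u x = u0 x + s *\<^sub>R ((plateau (x - 0) * (x - 0)) *\<^sub>R a) + s *\<^sub>R ((plateau (x - 10) * (x - 10)) *\<^sub>R c)" for x
  have s: "s > 0" "\<bar>s\<bar> < r" using r(1) by (auto simp: s_def)
  have u: "u \<in> fields V" unfolding u_def by (rule r(2)[OF s(2) s(2)])
  have near0: "u x = p + (s * x) *\<^sub>R a" if "x \<in> {-1<..<1}" for x
    using that plateau_1[of x] by (simp add: u_def u0_def \<tau>0 plateau_0 abs_if)
  have near10: "u x = q + (s * (x - 10)) *\<^sub>R c" if "x \<in> {9<..<11}" for x
    using that plateau_1[of "x - 10"] by (simp add: u_def u0_def \<tau>1 plateau_0 abs_if)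
  have line: "xderiv (\<lambda>x. b + (s * (x - y)) *\<^sub>R e) y = s *\<^sub>R e" for b e :: "real^'n" and y
    by (rule xderiv_eqI) (auto intro!: derivative_eq_intros)
  have sl: "smooth_on UNIV (\<lambda>x. b + (s * (x - y)) *\<^sub>R e)" for b e :: "real^'n" and y
    by (intro smooth_on_add smooth_on_scaleR smooth_on_mult smooth_on_diff smooth_on_const smooth_on_id open_UNIV)
  have "xderiv u 0 = xderiv (\<lambda>x. p + (s * (x - 0)) *\<^sub>R a) 0"
    by (rule xderiv_cong_open[of "{-1<..<1}"]) (use near0 sl[of p 0 a] in auto)
  moreover have "xderiv u 10 = xderiv (\<lambda>x. q + (s * (x - 10)) *\<^sub>R c) 10"
    by (rule xderiv_cong_open[of "{9<..<11}"]) (use near10 sl[of q 10 c] in auto)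
  ultimately show thesis
    using that[OF u s(1)] near0[of 0] near10[of 10] unfolding line by simp
qed

lemma d1_axis: "d1 A z (c *\<^sub>R axis m 1) = c * pd m A z"
proof -
  have "d1 A z (c *\<^sub>R axis m 1) = (\<Sum>s\<in>UNIV. if s = m then c * pd m A z else 0)"
    unfolding d1_def by (rule sum.cong) (auto simp: axis_def)
  then show ?thesis by simp
qed

lemma line_derivative_d1:
  assumes "smooth_on V A" "z \<in> V"
  shows "((\<lambda>t. A (z + t *\<^sub>R w)) has_real_derivative d1 A z w) (at 0)"
proof -
  have "((\<lambda>t. z + t *\<^sub>R w) has_derivative (\<lambda>t. t *\<^sub>R w)) (at 0)"
    by (auto intro!: derivative_eq_intros)
  moreover have "(A has_derivative (\<lambda>v. \<Sum>k\<in>UNIV. pd k A z * v $ k)) (at (z + 0 *\<^sub>R w))"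
    using has_derivative_pd[OF assms] by simp
  ultimately have "((\<lambda>t. A (z + t *\<^sub>R w)) has_derivative (\<lambda>t. \<Sum>k\<in>UNIV. pd k A z * (t *\<^sub>R w) $ k)) (at 0)"
    by (rule has_derivative_compose)
  moreover have "(\<lambda>t. \<Sum>k\<in>UNIV. pd k A z * (t *\<^sub>R w) $ k) = (*) (d1 A z w)"
    by (simp add: d1_def fun_eq_iff sum_distrib_left sum_distrib_right mult_ac)
  ultimately show ?thesis by (simp only: has_field_derivative_def)
qed

lemma xderiv_variation:
  assumes "u \<in> fields V" "v \<in> test_functions"
  shows "xderiv (\<lambda>x. u x + t *\<^sub>R v x) x = xderiv u x + t *\<^sub>R xderiv v x"
  using xderiv_add[OF field_smooth[OF assms(1)] test_function_smooth[OF test_function_scaleR[OF assms(2)]]]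
  by (simp add: xderiv_scaleR test_function_smooth[OF assms(2)])

lemma axis_test_function:
  assumes "smooth_on UNIV \<sigma>" "\<And>x. \<bar>x\<bar> > R \<Longrightarrow> \<sigma> x = 0"
  shows "(\<lambda>x. \<sigma> x *\<^sub>R e) \<in> test_functions"
  by (rule test_functionI[where R=R]) (auto intro!: smooth_on_scaleR assms(1) smooth_on_const simp: assms(2))

lemma xderiv_scaleR_const: "smooth_on UNIV \<sigma> \<Longrightarrow> xderiv (\<lambda>x. \<sigma> x *\<^sub>R e) x = xderiv \<sigma> x *\<^sub>R e"
  by (rule xderiv_linear[OF bounded_linear_scaleR_left])

context
  fixes V :: "(real^'n::finite) set" and u :: "'n field" and \<phi> \<sigma> :: "real \<Rightarrow> real" and R :: real
  assumes V: "open V" and u: "u \<in> fields V" and \<phi>: "smooth_on UNIV \<phi>" "\<And>x. \<bar>x\<bar> > R \<Longrightarrow> \<phi> x = 0"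
    and \<sigma>: "smooth_on UNIV \<sigma>" "\<And>x. \<bar>x\<bar> > R \<Longrightarrow> \<sigma> x = 0"
begin

private lemma variation:
  obtains T where "open T" "0 \<in> T" "\<And>t x. t \<in> T \<Longrightarrow> u x + t *\<^sub>R (\<sigma> x *\<^sub>R axis m 1) \<in> V"
    "smooth_on (T \<times> UNIV) (\<lambda>p. u (snd p) + fst p *\<^sub>R (\<sigma> (snd p) *\<^sub>R axis m 1))"
proof -
  obtain r where r: "r > 0" "\<And>t. \<bar>t\<bar> < r \<Longrightarrow> (\<lambda>x. u x + t *\<^sub>R (\<sigma> x *\<^sub>R axis m 1)) \<in> fields V"
    by (rule field_variation1[OF V u axis_test_function[OF \<sigma>]], assumption, rule that; blast)
  have o: "open ({-r<..<r} \<times> (UNIV::real set))" by (intro open_Times) auto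
  have sm: "smooth_on ({-r<..<r} \<times> UNIV) (\<lambda>p::real\<times>real. a (snd p))" if "smooth_on UNIV a" for a :: "real \<Rightarrow> 'c::real_normed_vector"
    by (rule smooth_on_compose[OF that]) (auto intro!: smooth_on_snd smooth_on_id o)
  have "smooth_on ({-r<..<r} \<times> UNIV) (\<lambda>p. u (snd p) + fst p *\<^sub>R (\<sigma> (snd p) *\<^sub>R axis m 1))"
    by (intro smooth_on_add smooth_on_scaleR smooth_on_fst smooth_on_id smooth_on_const o sm field_smooth[OF u] \<sigma>)
  then show thesis
    using that[of "{-r<..<r}"] r field_in[OF r(2)] by (auto simp: abs_less_iff)
qed

lemma coefficient_derivative0:
  assumes A: "smooth_on V A"
  shows "((\<lambda>t. integral UNIV (\<lambda>x. \<phi> x * A (u x + t *\<^sub>R (\<sigma> x *\<^sub>R axis m 1)))) has_real_derivative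
    integral UNIV (\<lambda>x. \<phi> x * (\<sigma> x * pd m A (u x)))) (at 0)"
proof (rule variation[of m])
  fix T assume T: "open T" "0 \<in> T" and Tv: "\<And>t x. t \<in> T \<Longrightarrow> u x + t *\<^sub>R (\<sigma> x *\<^sub>R axis m 1) \<in> V"
    and Z: "smooth_on (T \<times> UNIV) (\<lambda>p. u (snd p) + fst p *\<^sub>R (\<sigma> (snd p) *\<^sub>R axis m 1))"
  have o: "open (T \<times> (UNIV::real set))" using T by (auto intro: open_Times)
  define H where "H p = \<phi> (snd p) * A (u (snd p) + fst p *\<^sub>R (\<sigma> (snd p) *\<^sub>R axis m 1))" for p :: "real \<times> real"
  have s\<phi>: "smooth_on (T \<times> UNIV) (\<lambda>p::real\<times>real. \<phi> (snd p))"
    by (rule smooth_on_compose[OF \<phi>(1)]) (auto intro!: smooth_on_snd smooth_on_id o)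
  have H: "smooth_on (T \<times> UNIV) H"
    unfolding H_def by (rule smooth_on_mult[OF o s\<phi> smooth_on_compose[OF A Z o V]]) (use Tv in auto)
  have dH: "dt H (0, x) = \<phi> x * (\<sigma> x * pd m A (u x))" for x
  proof (rule dt_eqI[OF H])
    show "((\<lambda>t. H (t, x)) has_vector_derivative \<phi> x * (\<sigma> x * pd m A (u x))) (at 0)"
      using DERIV_cmult[OF line_derivative_d1[OF A field_in[OF u, of x], of "\<sigma> x *\<^sub>R axis m 1"], of "\<phi> x"]
      by (simp add: H_def d1_axis has_real_derivative_iff_has_vector_derivative)
  qed (use T in auto)
  have "((\<lambda>t. integral UNIV (\<lambda>x. H (t, x))) has_real_derivative integral UNIV (\<lambda>x. dt H (0, x))) (at 0)"
    by (rule partial_integral[OF T(1) H T(2), where R=R]) (simp add: H_def \<phi>)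
  then show ?thesis by (simp add: dH H_def)
qed

text \<open>The density is linear in u_x, so varying u also varies this factor. This second
  contribution is the term with the derivative of \<sigma>, and it later becomes the second
  derivative of a test function.\<close>

lemma coefficient_derivative1:
  assumes A: "\<And>k. smooth_on V (A k)"
  shows "((\<lambda>t. integral UNIV (\<lambda>x. \<phi> x * (\<Sum>k\<in>UNIV. A k (u x + t *\<^sub>R (\<sigma> x *\<^sub>R axis m 1)) * xderiv (\<lambda>x. u x + t *\<^sub>R (\<sigma> x *\<^sub>R axis m 1)) x $ k)))
     has_real_derivative
    integral UNIV (\<lambda>x. \<phi> x * (\<sigma> x * (\<Sum>k\<in>UNIV. pd m (A k) (u x) * xderiv u x $ k) + xderiv \<sigma> x * A m (u x)))) (at 0)"
proof (rule variation[of m])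
  fix T assume T: "open T" "0 \<in> T" and Tv: "\<And>t x. t \<in> T \<Longrightarrow> u x + t *\<^sub>R (\<sigma> x *\<^sub>R axis m 1) \<in> V"
    and Z: "smooth_on (T \<times> UNIV) (\<lambda>p. u (snd p) + fst p *\<^sub>R (\<sigma> (snd p) *\<^sub>R axis m 1))"
  have o: "open (T \<times> (UNIV::real set))" using T by (auto intro: open_Times)
  note vt = axis_test_function[OF \<sigma>, where e="axis m 1 :: real^'n"]
  have xd: "xderiv (\<lambda>x. u x + t *\<^sub>R (\<sigma> x *\<^sub>R axis m 1)) x = xderiv u x + t *\<^sub>R (xderiv \<sigma> x *\<^sub>R axis m 1)" for t x
    using xderiv_variation[OF u vt] by (simp add: xderiv_scaleR_const[OF \<sigma>(1)])
  define H where "H p = \<phi> (snd p) * (\<Sum>k\<in>UNIV. A k (u (snd p) + fst p *\<^sub>R (\<sigma> (snd p) *\<^sub>R axis m 1))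
     * (xderiv u (snd p) + fst p *\<^sub>R (xderiv \<sigma> (snd p) *\<^sub>R axis m 1)) $ k)" for p :: "real \<times> real"
  have sm: "smooth_on (T \<times> UNIV) (\<lambda>p::real\<times>real. a (snd p))" if "smooth_on UNIV a" for a :: "real \<Rightarrow> 'c::real_normed_vector"
    by (rule smooth_on_compose[OF that]) (auto intro!: smooth_on_snd smooth_on_id o)
  have sx: "smooth_on (T \<times> UNIV) (\<lambda>p. xderiv u (snd p) + fst p *\<^sub>R (xderiv \<sigma> (snd p) *\<^sub>R axis m 1))"
    by (intro smooth_on_add smooth_on_scaleR smooth_on_fst smooth_on_id smooth_on_const o sm smooth_on_xderiv[OF field_smooth[OF u]] smooth_on_xderiv[OF \<sigma>(1)])
  have H: "smooth_on (T \<times> UNIV) H"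
    unfolding H_def
    by (rule smooth_on_mult[OF o sm[OF \<phi>(1)] smooth_on_sum[OF o smooth_on_mult[OF o smooth_on_compose[OF A Z o V] smooth_on_vec_nth[OF o sx]]]])
       (use Tv in auto)
  have dH: "dt H (0, x) = \<phi> x * (\<sigma> x * (\<Sum>k\<in>UNIV. pd m (A k) (u x) * xderiv u x $ k) + xderiv \<sigma> x * A m (u x))" for x
  proof (rule dt_eqI[OF H])
    have e: "((\<lambda>t. (xderiv u x + t *\<^sub>R (xderiv \<sigma> x *\<^sub>R axis m 1)) $ k) has_real_derivative (if k = m then xderiv \<sigma> x else 0)) (at 0)" for k
      by (auto intro!: derivative_eq_intros simp: axis_def)
    have k: "((\<lambda>t. A k (u x + t *\<^sub>R (\<sigma> x *\<^sub>R axis m 1)) * (xderiv u x + t *\<^sub>R (xderiv \<sigma> x *\<^sub>R axis m 1)) $ k) has_real_derivative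
       \<sigma> x * (pd m (A k) (u x) * xderiv u x $ k) + (if k = m then xderiv \<sigma> x * A m (u x) else 0)) (at 0)" for k
      using DERIV_mult[OF line_derivative_d1[OF A field_in[OF u, of x], of _ "\<sigma> x *\<^sub>R axis m 1"] e, of k k]
      by (cases "k = m") (simp_all add: d1_axis mult_ac)
    have "((\<lambda>t. \<phi> x * (\<Sum>k\<in>UNIV. A k (u x + t *\<^sub>R (\<sigma> x *\<^sub>R axis m 1)) * (xderiv u x + t *\<^sub>R (xderiv \<sigma> x *\<^sub>R axis m 1)) $ k)) has_real_derivative
       \<phi> x * (\<Sum>k\<in>UNIV. \<sigma> x * (pd m (A k) (u x) * xderiv u x $ k) + (if k = m then xderiv \<sigma> x * A m (u x) else 0))) (at 0)"
      by (rule DERIV_cmult[OF DERIV_sum[OF k]])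
    then show "((\<lambda>t. H (t, x)) has_vector_derivative \<phi> x * (\<sigma> x * (\<Sum>k\<in>UNIV. pd m (A k) (u x) * xderiv u x $ k) + xderiv \<sigma> x * A m (u x))) (at 0)"
      by (simp add: H_def sum.distrib sum_distrib_left has_real_derivative_iff_has_vector_derivative)
  qed (use T in auto)
  have "((\<lambda>t. integral UNIV (\<lambda>x. H (t, x))) has_real_derivative integral UNIV (\<lambda>x. dt H (0, x))) (at 0)"
    by (rule partial_integral[OF T(1) H T(2), where R=R]) (simp add: H_def \<phi>)
  then show ?thesis unfolding xd by (simp only: dH H_def fst_conv snd_conv)
qed

end

lemma smooth_along_field:
  "open V \<Longrightarrow> u \<in> fields V \<Longrightarrow> smooth_on V A \<Longrightarrow> smooth_on UNIV (\<lambda>x. A (u x))"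
  by (rule smooth_on_compose[OF _ field_smooth]) (auto intro: field_in)

lemma xderiv_along_field:
  assumes "u \<in> fields V" "smooth_on V A"
  shows "xderiv (\<lambda>x. A (u x)) x = (\<Sum>k\<in>UNIV. pd k A (u x) * xderiv u x $ k)"
proof (rule xderiv_eqI)
  have "((\<lambda>x. A (u x)) has_derivative (\<lambda>t. \<Sum>k\<in>UNIV. pd k A (u x) * (t *\<^sub>R xderiv u x) $ k)) (at x)"
    by (rule has_derivative_compose[OF xderiv_works[OF field_smooth[OF assms(1)], unfolded has_vector_derivative_def]
          has_derivative_pd[OF assms(2) field_in[OF assms(1)]]])
  then show "((\<lambda>x. A (u x)) has_vector_derivative (\<Sum>k\<in>UNIV. pd k A (u x) * xderiv u x $ k)) (at x)"
    by (simp add: has_vector_derivative_def sum_distrib_left mult_ac)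
qed


section \<open>Conditions on the nonlocal part\<close>

text \<open>The i-th column of the inverse matrix. The test function
  \<open>\<phi> x *\<^sub>R low_vec \<eta> i\<close> induces a variation along the i-th axis with
  profile the derivative of \<phi>; pairing with such vectors lowers an upper index.\<close>

definition low_vec :: "real^'n^'n \<Rightarrow> 'n::finite \<Rightarrow> real^'n" where
  "low_vec \<eta> i = matrix_inv \<eta> *v axis i 1"

lemma matrix_inv_det:
  fixes A :: "real^'n^'n::finite"
  assumes "det A \<noteq> 0"
  shows "A ** matrix_inv A = mat 1" "matrix_inv A ** A = mat 1"
proof -
  have "\<exists>B. A ** B = mat 1 \<and> B ** A = mat 1"
    using assms by (simp add: invertible_det_nz[symmetric] invertible_def)
  from someI_ex[OF this] show "A ** matrix_inv A = mat 1" "matrix_inv A ** A = mat 1"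
    by (simp_all add: matrix_inv_def)
qed

lemma eta_low_vec: "det \<eta> \<noteq> 0 \<Longrightarrow> \<eta> *v low_vec \<eta> i = axis i 1"
  by (simp add: low_vec_def matrix_vector_mul_assoc matrix_inv_det)

lemma low_vec_nth: "low_vec \<eta> i $ j = matrix_inv \<eta> $ j $ i"
  by (simp add: low_vec_def matrix_vector_mult_def axis_def if_distrib[of "\<lambda>x. _ * x"] cong: if_cong)

lemma eta_low_vec_sum:
  fixes \<eta> :: "real^'n^'n::finite"
  assumes "det \<eta> \<noteq> 0" "transpose \<eta> = \<eta>"
  shows "(\<Sum>m\<in>UNIV. \<eta> $ i $ m * low_vec \<eta> m $ j) = (if i = j then 1 else 0)"
proof -
  have "(matrix_inv \<eta> ** \<eta>) $ j $ i = mat 1 $ j $ i"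
    using assms(1) by (simp add: matrix_inv_det)
  then show ?thesis
    by (simp add: matrix_matrix_mult_def mat_def low_vec_nth symmetric_matrix_nth[OF assms(2), of i] mult.commute eq_commute)
qed

definition low_w :: "real^'n^'n \<Rightarrow> (real^'n \<Rightarrow> real^'n^'n) \<Rightarrow> 'n::finite \<Rightarrow> 'n \<Rightarrow> real^'n \<Rightarrow> real" where
  "low_w \<eta> w i k u = (\<Sum>j\<in>UNIV. low_vec \<eta> i $ j * w u $ j $ k)"

lemma raise_low_w:
  fixes \<eta> :: "real^'n^'n::finite"
  assumes "det \<eta> \<noteq> 0" "transpose \<eta> = \<eta>"
  shows "(\<Sum>m\<in>UNIV. \<eta> $ i $ m * low_w \<eta> w m k u) = w u $ i $ k"
proof -
  have "(\<Sum>m\<in>UNIV. \<eta> $ i $ m * low_w \<eta> w m k u) = (\<Sum>m\<in>UNIV. \<Sum>j\<in>UNIV. \<eta> $ i $ m * low_vec \<eta> m $ j * w u $ j $ k)"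
    by (simp add: low_w_def sum_distrib_left mult.assoc)
  also have "\<dots> = (\<Sum>j\<in>UNIV. (\<Sum>m\<in>UNIV. \<eta> $ i $ m * low_vec \<eta> m $ j) * w u $ j $ k)"
    by (subst sum.swap) (simp add: sum_distrib_right)
  also have "\<dots> = (\<Sum>j\<in>UNIV. if j = i then w u $ j $ k else 0)"
    unfolding eta_low_vec_sum[OF assms] by (rule sum.cong) auto
  finally show ?thesis by simp
qed

lemma smooth_on_low_w: "open V \<Longrightarrow> smooth_on V w \<Longrightarrow> smooth_on V (low_w \<eta> w i k)"
  unfolding low_w_def[abs_def]
  by (intro smooth_on_sum smooth_on_mult smooth_on_const smooth_on_vec_nth)

lemma pd_linear_combination:
  assumes "finite S" "\<And>a. a \<in> S \<Longrightarrow> smooth_on V (f a)" "u \<in> V"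
  shows "pd k (\<lambda>z. \<Sum>a\<in>S. c a * f a z) u = (\<Sum>a\<in>S. c a * pd k (f a) u)"
proof -
  have "((\<lambda>z. \<Sum>a\<in>S. c a * f a z) has_derivative (\<lambda>v. \<Sum>a\<in>S. c a * frechet_derivative (f a) (at u) v)) (at u)"
    by (intro has_derivative_sum has_derivative_mult_right smooth_on_has_derivative[OF assms(2,3)])
  from pd_eqI[OF this] show ?thesis by (simp add: pd_def)
qed

lemma eta_dx_low_vec:
  "det \<eta> \<noteq> 0 \<Longrightarrow> smooth_on UNIV \<phi> \<Longrightarrow> eta_dx \<eta> (\<lambda>x. \<phi> x *\<^sub>R low_vec \<eta> i) x = xderiv \<phi> x *\<^sub>R axis i 1"
  by (simp add: eta_dx_def xderiv_scaleR_const matrix_vector_mult_scaleR eta_low_vec)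

text \<open>When the supports of the two arguments are far apart, only the nonlocal tail contributes,
  and there \<open>dinv\<close> acts as a constant.\<close>

lemma bil_far:
  fixes u :: "'n::finite field" and e :: "real^'n"
  assumes \<phi>: "\<And>x. \<bar>x\<bar> > 1 \<Longrightarrow> \<phi> x = 0" and \<theta>: "\<And>x. \<bar>x - 10\<bar> > 1 \<Longrightarrow> \<theta> x = 0"
  shows "bil g b L \<epsilon> w u (\<lambda>x. \<phi> x *\<^sub>R e) (\<lambda>x. \<theta> x *\<^sub>R axis j 1) =
    - (1 / 2) * integral UNIV (\<lambda>x. \<phi> x * (\<Sum>k\<in>UNIV. (\<Sum>\<alpha>=1..L. \<epsilon> \<alpha> * integral UNIV (\<lambda>y. \<theta> y * (\<Sum>s\<in>UNIV. w \<alpha> (u y) $ j $ s * xderiv u y $ s))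
        * (\<Sum>i\<in>UNIV. e $ i * w \<alpha> (u x) $ i $ k)) * xderiv u x $ k))"
proof -
  let ?h = "\<lambda>x. \<theta> x *\<^sub>R axis j 1 :: real^'n"
  define c where "c \<alpha> = integral UNIV (\<lambda>y. \<theta> y * (\<Sum>s\<in>UNIV. w \<alpha> (u y) $ j $ s * xderiv u y $ s))" for \<alpha>
  let ?A = "\<lambda>x k. (\<Sum>\<alpha>=1..L. \<epsilon> \<alpha> * c \<alpha> * (\<Sum>i\<in>UNIV. e $ i * w \<alpha> (u x) $ i $ k))"
  have pt: "(\<phi> x *\<^sub>R e) \<bullet> nonlocal_operator g b L \<epsilon> w u ?h x = - (1 / 2) * (\<phi> x * (\<Sum>k\<in>UNIV. ?A x k * xderiv u x $ k))" for x
  proof (cases "\<bar>x\<bar> > 1")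
    case False
    have h0: "?h x = 0" using \<theta>[of x] False by simp
    have h1: "xderiv ?h x = 0"
      by (rule xderiv_zero_on_open[of "{..<9}"]) (use False \<theta> in auto)
    have d: "dinv (\<lambda>y. \<Sum>j'\<in>UNIV. \<Sum>s\<in>UNIV. w \<alpha> (u y) $ j' $ s * xderiv u y $ s * ?h y $ j') x = - c \<alpha> / 2" for \<alpha>
    proof -
      have "(\<Sum>j'\<in>UNIV. \<Sum>s\<in>UNIV. w \<alpha> (u y) $ j' $ s * xderiv u y $ s * ?h y $ j') = \<theta> y * (\<Sum>s\<in>UNIV. w \<alpha> (u y) $ j $ s * xderiv u y $ s)" for y
      proof -
        have "(\<Sum>j'\<in>UNIV. \<Sum>s\<in>UNIV. w \<alpha> (u y) $ j' $ s * xderiv u y $ s * ?h y $ j')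
          = (\<Sum>j'\<in>UNIV. if j' = j then \<theta> y * (\<Sum>s\<in>UNIV. w \<alpha> (u y) $ j $ s * xderiv u y $ s) else 0)"
          by (rule sum.cong) (auto simp: axis_def sum_distrib_left mult_ac)
        then show ?thesis by simp
      qed
      \<comment> \<open>The point x lies to the left of the support of \<theta>, whence the minus
        sign.\<close>
      moreover have "dinv (\<lambda>y. \<theta> y * (\<Sum>s\<in>UNIV. w \<alpha> (u y) $ j $ s * xderiv u y $ s)) x = - c \<alpha> / 2"
        unfolding c_def by (rule dinv_left) (use False \<theta> in auto)
      ultimately show ?thesis by (simp add: c_def)
    qed
    have "nonlocal_operator g b L \<epsilon> w u ?h x $ i = (\<Sum>\<alpha>=1..L. \<epsilon> \<alpha> * (\<Sum>k\<in>UNIV. w \<alpha> (u x) $ i $ k * xderiv u x $ k) * (- c \<alpha> / 2))" for i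
      unfolding nonlocal_operator_def vec_lambda_beta d h1 h0 by simp
    then have "e \<bullet> nonlocal_operator g b L \<epsilon> w u ?h x = (\<Sum>i\<in>UNIV. \<Sum>\<alpha>=1..L. \<Sum>k\<in>UNIV. - (1 / 2) * (\<epsilon> \<alpha> * c \<alpha> * (e $ i * w \<alpha> (u x) $ i $ k) * xderiv u x $ k))"
      by (simp add: inner_vec_def sum_distrib_left sum_distrib_right mult_ac sum_negf sum_divide_distrib)
    also have "\<dots> = (\<Sum>\<alpha>=1..L. \<Sum>i\<in>UNIV. \<Sum>k\<in>UNIV. - (1 / 2) * (\<epsilon> \<alpha> * c \<alpha> * (e $ i * w \<alpha> (u x) $ i $ k) * xderiv u x $ k))"
      by (rule sum.swap)
    also have "\<dots> = (\<Sum>\<alpha>=1..L. \<Sum>k\<in>UNIV. \<Sum>i\<in>UNIV. - (1 / 2) * (\<epsilon> \<alpha> * c \<alpha> * (e $ i * w \<alpha> (u x) $ i $ k) * xderiv u x $ k))"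
      by (rule sum.cong[OF refl], rule sum.swap)
    also have "\<dots> = (\<Sum>k\<in>UNIV. \<Sum>\<alpha>=1..L. \<Sum>i\<in>UNIV. - (1 / 2) * (\<epsilon> \<alpha> * c \<alpha> * (e $ i * w \<alpha> (u x) $ i $ k) * xderiv u x $ k))"
      by (rule sum.swap)
    also have "\<dots> = - (1 / 2) * (\<Sum>k\<in>UNIV. ?A x k * xderiv u x $ k)"
      by (simp only: sum_distrib_left sum_distrib_right)
    finally show ?thesis by simp
  qed (simp add: \<phi>)
  show ?thesis unfolding bil_def pt c_def by simp
qed

section \<open>Relations satisfied by the slices of the nonlocal kernel\<close>

context
  fixes V :: "(real^'n::finite) set" and \<eta> :: "real^'n^'n" and g b L \<epsilon> and w :: "nat \<Rightarrow> real^'n \<Rightarrow> real^'n^'n"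
  assumes V: "open V" and \<eta>: "transpose \<eta> = \<eta>" "det \<eta> \<noteq> 0"
    and w: "\<And>\<alpha>. \<alpha> \<in> {1..L} \<Longrightarrow> smooth_on V (w \<alpha>)"
    and closed: "closed_form V \<eta> (bil g b L \<epsilon> w)" and skew: "skew_form V (bil g b L \<epsilon> w)"
begin

text \<open>One argument is placed near 10 and two near 0. By \<open>bil_far\<close> the form then
  looks local near 0, with coefficients \<open>A\<close> that are combinations of the w with weights
  c. The two conclusions are the coefficients of the second and of the first derivative of \<kappa>
  in the closedness condition.\<close>

lemma nonlocal_pairing:
  fixes u :: "'n field" and \<theta> :: "real \<Rightarrow> real" and i m j :: 'n
  assumes u: "u \<in> fields V" and \<theta>: "smooth_on UNIV \<theta>" "\<And>x. \<bar>x - 10\<bar> > 1 \<Longrightarrow> \<theta> x = 0"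
  defines "c \<equiv> \<lambda>\<alpha>. integral UNIV (\<lambda>y. \<theta> y * (\<Sum>s\<in>UNIV. w \<alpha> (u y) $ j $ s * xderiv u y $ s))"
  shows "(\<Sum>\<alpha>=1..L. \<epsilon> \<alpha> * c \<alpha> * (low_w \<eta> (w \<alpha>) i m (u 0) - low_w \<eta> (w \<alpha>) m i (u 0))) = 0"
    and "(\<Sum>\<alpha>=1..L. \<epsilon> \<alpha> * c \<alpha> * (\<Sum>k\<in>UNIV. (pd m (low_w \<eta> (w \<alpha>) i k) (u 0) + pd i (low_w \<eta> (w \<alpha>) m k) (u 0)
       - 2 * pd k (low_w \<eta> (w \<alpha>) m i) (u 0)) * xderiv u 0 $ k)) = 0"
proof -
  define A where "A i k z = (\<Sum>\<alpha>=1..L. (\<epsilon> \<alpha> * c \<alpha>) * low_w \<eta> (w \<alpha>) i k z)" for i k z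
  have sA: "smooth_on V (A i k)" for i k
    unfolding A_def by (intro smooth_on_sum smooth_on_mult smooth_on_const smooth_on_low_w V w) auto
  define N where "N i m x = (\<Sum>k\<in>UNIV. pd m (A i k) (u x) * xderiv u x $ k)" for i m x
  have sN: "smooth_on UNIV (N i m)" for i m
    unfolding N_def
    by (intro smooth_on_sum smooth_on_mult open_UNIV smooth_along_field[OF V u pd_smooth_on[OF sA]]
        smooth_on_vec_nth smooth_on_xderiv field_smooth[OF u])
  have sAu: "smooth_on UNIV (\<lambda>x. A i k (u x))" for i k by (rule smooth_along_field[OF V u sA])
  let ?h = "\<lambda>x. \<theta> x *\<^sub>R axis j 1 :: real^'n"
  have \<theta>11: "\<theta> x = 0" if "\<bar>x\<bar> > 11" for x by (rule \<theta>(2)) (use that in arith)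
  have ht: "?h \<in> test_functions" by (rule axis_test_function[OF \<theta>(1) \<theta>11])
  have derivative: "((\<lambda>t. bil g b L \<epsilon> w (\<lambda>x. u x + t *\<^sub>R eta_dx \<eta> (\<lambda>x. \<kappa> x *\<^sub>R low_vec \<eta> m) x) (\<lambda>x. \<phi> x *\<^sub>R low_vec \<eta> i) ?h) has_real_derivative
      - (1 / 2) * integral UNIV (\<lambda>x. \<phi> x * (xderiv \<kappa> x * N i m x + xderiv (xderiv \<kappa>) x * A i m (u x)))) (at 0)"
    if \<phi>: "smooth_on UNIV \<phi>" "\<And>x. \<bar>x\<bar> > 1 \<Longrightarrow> \<phi> x = 0" and \<kappa>: "smooth_on UNIV \<kappa>" "\<And>x. \<bar>x\<bar> > 1 \<Longrightarrow> \<kappa> x = 0" for \<phi> \<kappa> i m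
  proof -
    have \<sigma>2: "\<And>x. \<bar>x\<bar> > 1 \<Longrightarrow> xderiv \<kappa> x = 0"
      by (rule xderiv_zero_outside[where R=1]) (use \<kappa>(2) in auto)
    note \<sigma> = smooth_on_xderiv[OF \<kappa>(1)] \<sigma>2
    have vt: "(\<lambda>x. xderiv \<kappa> x *\<^sub>R axis m 1 :: real^'n) \<in> test_functions"
      by (rule axis_test_function[where R=1, OF \<sigma>(1)]) (rule \<sigma>2)
    have e: "bil g b L \<epsilon> w (\<lambda>x. u x + t *\<^sub>R (xderiv \<kappa> x *\<^sub>R axis m 1)) (\<lambda>x. \<phi> x *\<^sub>R low_vec \<eta> i) ?h
      = - (1 / 2) * integral UNIV (\<lambda>x. \<phi> x * (\<Sum>k\<in>UNIV. A i k (u x + t *\<^sub>R (xderiv \<kappa> x *\<^sub>R axis m 1)) * xderiv (\<lambda>x. u x + t *\<^sub>R (xderiv \<kappa> x *\<^sub>R axis m 1)) x $ k))" for t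
    proof -
      \<comment> \<open>The weights are integrals over the support of \<theta> near 10, where a
        variation supported near 0 changes nothing.\<close>
      have ce: "integral UNIV (\<lambda>y. \<theta> y * (\<Sum>s\<in>UNIV. w \<alpha> (u y + t *\<^sub>R (xderiv \<kappa> y *\<^sub>R axis m 1)) $ j $ s * xderiv (\<lambda>x. u x + t *\<^sub>R (xderiv \<kappa> x *\<^sub>R axis m 1)) y $ s)) = c \<alpha>" for \<alpha>
        unfolding c_def
      proof (rule integral_cong)
        fix y
        show "\<theta> y * (\<Sum>s\<in>UNIV. w \<alpha> (u y + t *\<^sub>R (xderiv \<kappa> y *\<^sub>R axis m 1)) $ j $ s * xderiv (\<lambda>x. u x + t *\<^sub>R (xderiv \<kappa> x *\<^sub>R axis m 1)) y $ s)
          = \<theta> y * (\<Sum>s\<in>UNIV. w \<alpha> (u y) $ j $ s * xderiv u y $ s)"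
        proof (cases "\<bar>y - 10\<bar> > 1")
          case False
          then have y: "\<bar>y\<bar> > 1" by arith
          have xd0: "xderiv (\<lambda>x. xderiv \<kappa> x *\<^sub>R axis m 1 :: real^'n) y = 0"
            by (rule xderiv_zero_outside[where R=1]) (use y \<sigma>(2) in auto)
          show ?thesis unfolding xderiv_variation[OF u vt] xd0 \<sigma>(2)[OF y] by simp
        qed (simp add: \<theta>)
      qed
      show ?thesis unfolding A_def low_w_def ce[symmetric] by (rule bil_far) (use \<phi>(2) \<theta>(2) in auto)
    qed
    show ?thesis
      unfolding eta_dx_low_vec[OF \<eta>(2) \<kappa>(1)] e N_def
      by (rule DERIV_cmult[OF coefficient_derivative1[OF V u \<phi> \<sigma> sA]])
  qed
  have X: "A i m (u 0) - 0 + - A m i (u 0) = 0" "N i m 0 - xderiv (\<lambda>x. 0) 0 - - N m i 0 + 2 * xderiv (\<lambda>x. - A m i (u x)) 0 = 0" for i m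
  proof -
    have main: "integral UNIV (\<lambda>x. \<phi> x * xderiv \<kappa> x * N i m x + \<phi> x * xderiv (xderiv \<kappa>) x * A i m (u x) + xderiv \<phi> x * xderiv \<kappa> x * 0
        + xderiv \<phi> x * \<kappa> x * (- N m i x) + xderiv (xderiv \<phi>) x * \<kappa> x * (- A m i (u x)) + \<phi> x * \<kappa> x * 0) = 0"
      if \<phi>: "smooth_on UNIV \<phi>" and \<kappa>: "smooth_on UNIV \<kappa>" and \<phi>0: "\<And>x. \<bar>x\<bar> > 1 \<Longrightarrow> \<phi> x = 0" and \<kappa>0: "\<And>x. \<bar>x\<bar> > 1 \<Longrightarrow> \<kappa> x = 0" for \<phi> \<kappa>
    proof -
      let ?f = "\<lambda>x. \<phi> x *\<^sub>R low_vec \<eta> i" and ?k = "\<lambda>x. \<kappa> x *\<^sub>R low_vec \<eta> m"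
      let ?P = "\<lambda>\<phi> \<kappa> i m. integral UNIV (\<lambda>x. \<phi> x * (xderiv \<kappa> x * N i m x + xderiv (xderiv \<kappa>) x * A i m (u x)))"
      have ft: "?f \<in> test_functions" "?k \<in> test_functions"
        by (rule axis_test_function[OF \<phi> \<phi>0], assumption, rule axis_test_function[OF \<kappa> \<kappa>0])
      obtain D1 D2 D3 where D:
        "((\<lambda>t. bil g b L \<epsilon> w (\<lambda>x. u x + t *\<^sub>R eta_dx \<eta> ?k x) ?f ?h) has_real_derivative D1) (at 0)"
        "((\<lambda>t. bil g b L \<epsilon> w (\<lambda>x. u x + t *\<^sub>R eta_dx \<eta> ?f x) ?h ?k) has_real_derivative D2) (at 0)"
        "((\<lambda>t. bil g b L \<epsilon> w (\<lambda>x. u x + t *\<^sub>R eta_dx \<eta> ?h x) ?k ?f) has_real_derivative D3) (at 0)" "D1 + D2 + D3 = 0"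
        using closed u ft ht unfolding closed_form_def by blast
      have D1: "D1 = - (1 / 2) * ?P \<phi> \<kappa> i m"
        by (rule DERIV_unique[OF D(1) derivative[OF \<phi> \<phi>0 \<kappa> \<kappa>0]])
      \<comment> \<open>Skewness brings the argument near 0 to the front, where
        \<open>derivative\<close> applies with the roles of \<phi> and \<kappa> exchanged; it holds
        at fields in V, hence for small t.\<close>
      have D2: "D2 = (1 / 2) * ?P \<kappa> \<phi> m i"
      proof -
        obtain r where r: "r > 0" "\<And>t. \<bar>t\<bar> < r \<Longrightarrow> (\<lambda>x. u x + t *\<^sub>R eta_dx \<eta> ?f x) \<in> fields V"
          by (rule field_variation1[OF V u test_function_eta_dx[OF ft(1)]], rule that; blast)
        have "((\<lambda>t. - bil g b L \<epsilon> w (\<lambda>x. u x + t *\<^sub>R eta_dx \<eta> ?f x) ?k ?h) has_real_derivative - (- (1 / 2) * ?P \<kappa> \<phi> m i)) (at 0)"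
          by (rule DERIV_minus[OF derivative[OF \<kappa> \<kappa>0 \<phi> \<phi>0]])
        then have "((\<lambda>t. bil g b L \<epsilon> w (\<lambda>x. u x + t *\<^sub>R eta_dx \<eta> ?f x) ?h ?k) has_real_derivative - (- (1 / 2) * ?P \<kappa> \<phi> m i)) (at 0)"
        proof (rule has_field_derivative_transform_within_open[where S="{-r<..<r}"])
          fix t assume "t \<in> {-r<..<r}"
          then have "(\<lambda>x. u x + t *\<^sub>R eta_dx \<eta> ?f x) \<in> fields V" by (intro r(2)) auto
          then have "bil g b L \<epsilon> w (\<lambda>x. u x + t *\<^sub>R eta_dx \<eta> ?f x) ?h ?k = - bil g b L \<epsilon> w (\<lambda>x. u x + t *\<^sub>R eta_dx \<eta> ?f x) ?k ?h"
            using skew ht ft unfolding skew_form_def by blast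
          then show "- bil g b L \<epsilon> w (\<lambda>x. u x + t *\<^sub>R eta_dx \<eta> ?f x) ?k ?h = bil g b L \<epsilon> w (\<lambda>x. u x + t *\<^sub>R eta_dx \<eta> ?f x) ?h ?k" by simp
        qed (use r in auto)
        then show ?thesis using DERIV_unique[OF D(2)] by simp
      qed
      \<comment> \<open>The third variation changes the field only near 10, while both arguments
        live near 0, and even inside \<open>dinv\<close> the field enters only multiplied by such an
        argument.\<close>
      have D3: "D3 = 0"
      proof -
        have P0: "eta_dx \<eta> ?h x = 0" if "x < 9" for x
        proof -
          have "xderiv ?h x = 0" by (rule xderiv_zero_on_open[of "{..<9}"]) (use that \<theta>(2) in auto)
          then show ?thesis by (simp add: eta_dx_def)
        qed
        have x0: "xderiv (\<lambda>x. u x + t *\<^sub>R eta_dx \<eta> ?h x) x = xderiv u x" if "x < 9" for t x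
          by (rule xderiv_cong_open[of "{..<9}"]) (use that P0 field_smooth[OF u] in auto)
        have "bil g b L \<epsilon> w (\<lambda>x. u x + t *\<^sub>R eta_dx \<eta> ?h x) ?k ?f = bil g b L \<epsilon> w u ?k ?f" for t
          unfolding bil_def
        proof (rule integral_cong)
          fix x
          show "?k x \<bullet> nonlocal_operator g b L \<epsilon> w (\<lambda>x. u x + t *\<^sub>R eta_dx \<eta> ?h x) ?f x = ?k x \<bullet> nonlocal_operator g b L \<epsilon> w u ?f x"
          proof (cases "\<bar>x\<bar> > 1")
            case False
            have y: "(\<Sum>j\<in>UNIV. \<Sum>s\<in>UNIV. w \<alpha> (u y + t *\<^sub>R eta_dx \<eta> ?h y) $ j $ s * xderiv (\<lambda>x. u x + t *\<^sub>R eta_dx \<eta> ?h x) y $ s * ?f y $ j)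
                = (\<Sum>j\<in>UNIV. \<Sum>s\<in>UNIV. w \<alpha> (u y) $ j $ s * xderiv u y $ s * ?f y $ j)" for \<alpha> y
              by (cases "y < 9") (simp_all add: P0 x0 \<phi>0)
            have "nonlocal_operator g b L \<epsilon> w (\<lambda>x. u x + t *\<^sub>R eta_dx \<eta> ?h x) ?f x = nonlocal_operator g b L \<epsilon> w u ?f x"
              unfolding nonlocal_operator_def y using False by (simp add: P0 x0)
            then show ?thesis by simp
          qed (simp add: \<kappa>0)
        qed
        then have "((\<lambda>t. bil g b L \<epsilon> w (\<lambda>x. u x + t *\<^sub>R eta_dx \<eta> ?h x) ?k ?f) has_real_derivative 0) (at 0)" by simp
        then show ?thesis using DERIV_unique[OF D(3)] by simp
      qed
      have cP: "cont_cs (\<lambda>x. \<phi> x * (xderiv \<kappa> x * N i m x + xderiv (xderiv \<kappa>) x * A i m (u x)))"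
        if "smooth_on UNIV \<phi>" "smooth_on UNIV \<kappa>" "\<And>x. \<bar>x\<bar> > 1 \<Longrightarrow> \<phi> x = 0" for \<phi> \<kappa> i m
        by (rule cont_cs_mult_right[OF smooth_on_continuous cont_csI[OF smooth_on_continuous[OF that(1)] that(3)]])
           (intro smooth_on_add smooth_on_mult open_UNIV smooth_on_xderiv that sN sAu)
      have "?P \<phi> \<kappa> i m - ?P \<kappa> \<phi> m i = 0" using D(4) unfolding D1 D2 D3 by simp
      moreover have "cont_cs (\<lambda>x. \<phi> x * (xderiv \<kappa> x * N i m x + xderiv (xderiv \<kappa>) x * A i m (u x)))"
        by (rule cP[OF \<phi> \<kappa>]) (rule \<phi>0)
      moreover have "cont_cs (\<lambda>x. \<kappa> x * (xderiv \<phi> x * N m i x + xderiv (xderiv \<phi>) x * A m i (u x)))"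
        by (rule cP[OF \<kappa> \<phi>]) (rule \<kappa>0)
      ultimately have "integral UNIV (\<lambda>x. \<phi> x * (xderiv \<kappa> x * N i m x + xderiv (xderiv \<kappa>) x * A i m (u x))
         - \<kappa> x * (xderiv \<phi> x * N m i x + xderiv (xderiv \<phi>) x * A m i (u x))) = 0"
        by (simp only: integral_cs_diff)
      moreover have "integral UNIV (\<lambda>x. \<phi> x * xderiv \<kappa> x * N i m x + \<phi> x * xderiv (xderiv \<kappa>) x * A i m (u x) + xderiv \<phi> x * xderiv \<kappa> x * 0
        + xderiv \<phi> x * \<kappa> x * (- N m i x) + xderiv (xderiv \<phi>) x * \<kappa> x * (- A m i (u x)) + \<phi> x * \<kappa> x * 0)
        = integral UNIV (\<lambda>x. \<phi> x * (xderiv \<kappa> x * N i m x + xderiv (xderiv \<kappa>) x * A i m (u x))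
         - \<kappa> x * (xderiv \<phi> x * N m i x + xderiv (xderiv \<phi>) x * A m i (u x)))"
        by (rule integral_cong) (simp add: algebra_simps)
      ultimately show ?thesis by simp
    qed
    note s = smooth_on_const[OF open_UNIV, of "0::real"] sN[of i m] smooth_on_minus[OF open_UNIV sN[of m i]] sAu[of i m]
      smooth_on_minus[OF open_UNIV sAu[of m i]] smooth_on_const[OF open_UNIV, of "0::real"]
    show "A i m (u 0) - 0 + - A m i (u 0) = 0" by (rule extract_coefficients(1)[OF s main])
    show "N i m 0 - xderiv (\<lambda>x. 0) 0 - - N m i 0 + 2 * xderiv (\<lambda>x. - A m i (u x)) 0 = 0"
      by (rule extract_coefficients(2)[OF s main])
  qed
  show "(\<Sum>\<alpha>=1..L. \<epsilon> \<alpha> * c \<alpha> * (low_w \<eta> (w \<alpha>) i m (u 0) - low_w \<eta> (w \<alpha>) m i (u 0))) = 0"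
    using X(1)[of i m] by (simp add: A_def right_diff_distrib sum_subtractf)
  have pdA: "pd m (A i k) (u 0) = (\<Sum>\<alpha>=1..L. (\<epsilon> \<alpha> * c \<alpha>) * pd m (low_w \<eta> (w \<alpha>) i k) (u 0))" for i k m
    unfolding A_def by (rule pd_linear_combination[OF finite_atLeastAtMost smooth_on_low_w[OF V w] field_in[OF u]])
  have x0: "xderiv (\<lambda>x. 0::real) 0 = 0" by (rule xderiv_eqI) simp
  have xA: "xderiv (\<lambda>x. - A m i (u x)) 0 = - (\<Sum>k\<in>UNIV. pd k (A m i) (u 0) * xderiv u 0 $ k)"
    using xderiv_linear[OF bounded_linear_minus[OF bounded_linear_ident] sAu] xderiv_along_field[OF u sA] by simp
  have "(\<Sum>k\<in>UNIV. (pd m (A i k) (u 0) + pd i (A m k) (u 0) - 2 * pd k (A m i) (u 0)) * xderiv u 0 $ k) = 0"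
    using X(2)[of i m] unfolding x0 xA N_def by (simp add: algebra_simps sum.distrib sum_subtractf sum_distrib_left)
  moreover have "pd m (A i k) (u 0) + pd i (A m k) (u 0) - 2 * pd k (A m i) (u 0) =
     (\<Sum>\<alpha>=1..L. (\<epsilon> \<alpha> * c \<alpha>) * (pd m (low_w \<eta> (w \<alpha>) i k) (u 0) + pd i (low_w \<eta> (w \<alpha>) m k) (u 0) - 2 * pd k (low_w \<eta> (w \<alpha>) m i) (u 0)))" for k
    unfolding pdA by (simp add: algebra_simps sum.distrib sum_subtractf sum_distrib_left)
  ultimately have z: "(\<Sum>k\<in>UNIV. \<Sum>\<alpha>=1..L. (\<epsilon> \<alpha> * c \<alpha>) * ((pd m (low_w \<eta> (w \<alpha>) i k) (u 0) + pd i (low_w \<eta> (w \<alpha>) m k) (u 0) - 2 * pd k (low_w \<eta> (w \<alpha>) m i) (u 0)) * xderiv u 0 $ k)) = 0"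
    by (simp only: sum_distrib_right mult.assoc)
  show "(\<Sum>\<alpha>=1..L. \<epsilon> \<alpha> * c \<alpha> * (\<Sum>k\<in>UNIV. (pd m (low_w \<eta> (w \<alpha>) i k) (u 0) + pd i (low_w \<eta> (w \<alpha>) m k) (u 0)
       - 2 * pd k (low_w \<eta> (w \<alpha>) m i) (u 0)) * xderiv u 0 $ k)) = 0"
    using z by (subst (asm) sum.swap) (simp only: sum_distrib_left)
qed

text \<open>The weights in \<open>nonlocal_pairing\<close> are integrals against an arbitrary
  \<theta> near 10. Localising them at 10 puts the entries of w at q in their place, because the
  field passes through q along the s-th axis. The relations are thus obtained only after contraction
  with a second factor w, which is all that a bracket can reveal.\<close>

lemma nonlocal_slices:
  assumes conv: "convex V" and pq: "p \<in> V" "q \<in> V"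
  shows "(\<Sum>\<alpha>=1..L. \<epsilon> \<alpha> * (low_w \<eta> (w \<alpha>) i m p - low_w \<eta> (w \<alpha>) m i p) * w \<alpha> q $ j $ s) = 0"
    and "(\<Sum>\<alpha>=1..L. \<epsilon> \<alpha> * (pd m (low_w \<eta> (w \<alpha>) i k) p + pd i (low_w \<eta> (w \<alpha>) m k) p
       - 2 * pd k (low_w \<eta> (w \<alpha>) m i) p) * w \<alpha> q $ j $ s) = 0"
proof -
  obtain u r where u: "u \<in> fields V" "r > 0" "u 0 = p" "xderiv u 0 = r *\<^sub>R axis k 1" "u 10 = q" "xderiv u 10 = r *\<^sub>R axis s 1"
    by (rule field_with_jets[OF V conv pq])
  define W where "W \<alpha> y = (\<Sum>s\<in>UNIV. w \<alpha> (u y) $ j $ s * xderiv u y $ s)" for \<alpha> y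
  have sum_axis: "(\<Sum>s'\<in>UNIV. a s' * (r *\<^sub>R axis s 1 :: real^'n) $ s') = r * a s" for a and s :: 'n
  proof -
    have "(\<Sum>s'\<in>UNIV. a s' * (r *\<^sub>R axis s 1 :: real^'n) $ s') = (\<Sum>s'\<in>UNIV. if s' = s then r * a s else 0)"
      by (rule sum.cong) (auto simp: axis_def)
    then show ?thesis by simp
  qed
  have W10: "W \<alpha> 10 = r * w \<alpha> q $ j $ s" for \<alpha>
    unfolding W_def u(5,6) by (rule sum_axis)
  have Wc: "continuous_on UNIV (W \<alpha>)" if "\<alpha> \<in> {1..L}" for \<alpha>
  proof -
    have sw: "smooth_on V (\<lambda>z. w \<alpha> z $ j $ s)" for s by (intro smooth_on_vec_nth V w that)
    show ?thesis
      unfolding W_def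
      by (intro smooth_on_continuous smooth_on_sum smooth_on_mult open_UNIV smooth_along_field[OF V u(1) sw]
        smooth_on_vec_nth smooth_on_xderiv field_smooth[OF u(1)])
  qed
  \<comment> \<open>A relation that is linear in the weights and valid for every \<theta> is a
    vanishing integral against \<theta>; the fundamental lemma evaluates it at 10, and the scale r
    of the slope is divided out.\<close>
  have key: "(\<Sum>\<alpha>=1..L. \<epsilon> \<alpha> * l \<alpha> * w \<alpha> q $ j $ s) = 0"
    if l: "\<And>\<theta>. smooth_on UNIV \<theta> \<Longrightarrow> (\<And>x. \<bar>x - 10\<bar> > 1 \<Longrightarrow> \<theta> x = 0) \<Longrightarrow> (\<Sum>\<alpha>=1..L. \<epsilon> \<alpha> * integral UNIV (\<lambda>y. \<theta> y * W \<alpha> y) * l \<alpha>) = 0" for l :: "nat \<Rightarrow> real"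
  proof -
    have "(\<lambda>y. \<Sum>\<alpha>=1..L. \<epsilon> \<alpha> * l \<alpha> * W \<alpha> y) 10 = 0"
    proof (rule fundamental_lemma[where d=1 and ?x0.0=10 and C="\<lambda>y. \<Sum>\<alpha>=1..L. \<epsilon> \<alpha> * l \<alpha> * W \<alpha> y"])
      show "continuous_on UNIV (\<lambda>y. \<Sum>\<alpha>=1..L. \<epsilon> \<alpha> * l \<alpha> * W \<alpha> y)"
        by (intro continuous_on_sum continuous_on_mult continuous_on_const Wc)
      fix \<theta> :: "real \<Rightarrow> real" assume \<theta>: "smooth_on UNIV \<theta>" "\<And>x. \<bar>x - 10\<bar> > 1 \<Longrightarrow> \<theta> x = 0"
      have \<theta>11: "\<theta> x = 0" if "\<bar>x\<bar> > 11" for x by (rule \<theta>(2)) (use that in arith)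
      have c: "cont_cs (\<lambda>y. \<theta> y * W \<alpha> y)" if "\<alpha> \<in> {1..L}" for \<alpha>
        by (rule cont_cs_mult_right[OF Wc[OF that] cont_csI[OF smooth_on_continuous[OF \<theta>(1)] \<theta>11]])
      have "integral UNIV (\<lambda>y. \<theta> y * (\<Sum>\<alpha>=1..L. \<epsilon> \<alpha> * l \<alpha> * W \<alpha> y)) = integral UNIV (\<lambda>y. \<Sum>\<alpha>=1..L. \<epsilon> \<alpha> * l \<alpha> * (\<theta> y * W \<alpha> y))"
        by (simp add: sum_distrib_left mult_ac)
      also have "\<dots> = (\<Sum>\<alpha>=1..L. integral UNIV (\<lambda>y. \<epsilon> \<alpha> * l \<alpha> * (\<theta> y * W \<alpha> y)))"
        by (rule integral_cs_sum[OF finite_atLeastAtMost cont_cs_cmult[OF c]])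
      also have "\<dots> = (\<Sum>\<alpha>=1..L. \<epsilon> \<alpha> * integral UNIV (\<lambda>y. \<theta> y * W \<alpha> y) * l \<alpha>)"
        by (rule sum.cong) simp_all
      finally show "integral UNIV (\<lambda>y. \<theta> y * (\<Sum>\<alpha>=1..L. \<epsilon> \<alpha> * l \<alpha> * W \<alpha> y)) = 0"
        using l[OF \<theta>] by simp
    qed simp
    then have "r * (\<Sum>\<alpha>=1..L. \<epsilon> \<alpha> * l \<alpha> * w \<alpha> q $ j $ s) = 0"
      unfolding W10 by (simp add: sum_distrib_left mult_ac)
    then show ?thesis using u(2) by simp
  qed
  show "(\<Sum>\<alpha>=1..L. \<epsilon> \<alpha> * (low_w \<eta> (w \<alpha>) i m p - low_w \<eta> (w \<alpha>) m i p) * w \<alpha> q $ j $ s) = 0"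
    by (rule key) (unfold W_def, rule nonlocal_pairing(1)[OF u(1), unfolded u(3)])
  have "(\<Sum>\<alpha>=1..L. \<epsilon> \<alpha> * (r * (pd m (low_w \<eta> (w \<alpha>) i k) p + pd i (low_w \<eta> (w \<alpha>) m k) p
       - 2 * pd k (low_w \<eta> (w \<alpha>) m i) p)) * w \<alpha> q $ j $ s) = 0"
    by (rule key) (unfold W_def, rule nonlocal_pairing(2)[OF u(1), unfolded u(3,4) sum_axis])
  then have "r * (\<Sum>\<alpha>=1..L. \<epsilon> \<alpha> * (pd m (low_w \<eta> (w \<alpha>) i k) p + pd i (low_w \<eta> (w \<alpha>) m k) p
       - 2 * pd k (low_w \<eta> (w \<alpha>) m i) p) * w \<alpha> q $ j $ s) = 0"
    by (simp add: sum_distrib_left mult_ac)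
  then show "(\<Sum>\<alpha>=1..L. \<epsilon> \<alpha> * (pd m (low_w \<eta> (w \<alpha>) i k) p + pd i (low_w \<eta> (w \<alpha>) m k) p
       - 2 * pd k (low_w \<eta> (w \<alpha>) m i) p) * w \<alpha> q $ j $ s) = 0" using u(2) by simp
qed

end


section \<open>Representing a kernel of finite rank by its slices\<close>

text \<open>The linear span of the point evaluations, acting on all real functions of an arbitrary
  type. It stands in for the dual of the finite-dimensional spaces of functions below, and its
  inductive generation gives linearity by rule induction.\<close>

inductive_set evaluations :: "(('x \<Rightarrow> real) \<Rightarrow> real) set" where
  zero: "(\<lambda>f. 0) \<in> evaluations"
| eval: "(\<lambda>f. f y) \<in> evaluations"
| add: "\<mu> \<in> evaluations \<Longrightarrow> \<nu> \<in> evaluations \<Longrightarrow> (\<lambda>f. \<mu> f + \<nu> f) \<in> evaluations"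
| scale: "\<mu> \<in> evaluations \<Longrightarrow> (\<lambda>f. c * \<mu> f) \<in> evaluations"

lemma evaluations_add: "\<mu> \<in> evaluations \<Longrightarrow> \<mu> (\<lambda>x. f x + g x) = \<mu> f + \<mu> g"
  by (induction rule: evaluations.induct) (auto simp: algebra_simps)

lemma evaluations_scale: "\<mu> \<in> evaluations \<Longrightarrow> \<mu> (\<lambda>x. c * f x) = c * \<mu> f"
  by (induction rule: evaluations.induct) (auto simp: algebra_simps)

lemma evaluations_zero: "\<mu> \<in> evaluations \<Longrightarrow> \<mu> (\<lambda>x. 0) = 0"
  using evaluations_scale[of \<mu> 0 "\<lambda>x. 0"] by simp

lemma evaluations_sum: "\<mu> \<in> evaluations \<Longrightarrow> \<mu> (\<lambda>x. \<Sum>a\<in>A. c a * f a x) = (\<Sum>a\<in>A. c a * \<mu> (f a))"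
proof (induction A rule: infinite_finite_induct)
  case (insert a A)
  then show ?case
    using evaluations_add[of \<mu> "\<lambda>x. c a * f a x" "\<lambda>x. \<Sum>a\<in>A. c a * f a x"]
    by (simp add: evaluations_scale)
qed (simp_all add: evaluations_zero)

text \<open>Gaussian elimination without a basis. Choose t in T and a point y with t(y) = 1. The
  functions of T that vanish at y need one generator fewer, and g minus g(y) t is not among them. A
  functional found for this smaller problem is corrected by a multiple of the evaluation at
  y.\<close>

lemma separating_evaluation:
  fixes T :: "('x \<Rightarrow> real) set"
  assumes "finite A" and T0: "(\<lambda>x. 0) \<in> T" and Ta: "\<And>f g. f \<in> T \<Longrightarrow> g \<in> T \<Longrightarrow> (\<lambda>x. f x + g x) \<in> T"
    and Ts: "\<And>f c. f \<in> T \<Longrightarrow> (\<lambda>x. c * f x) \<in> T"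
    and span: "\<And>f. f \<in> T \<Longrightarrow> \<exists>c. f = (\<lambda>x. \<Sum>a\<in>A. c a * e a x)" and g: "g \<notin> T"
  shows "\<exists>\<mu>\<in>evaluations. (\<forall>f\<in>T. \<mu> f = 0) \<and> \<mu> g \<noteq> 0"
  using assms
proof (induction "card A" arbitrary: A T e g rule: less_induct)
  case less
  note T0 = less.prems(2) and Ta = less.prems(3) and Ts = less.prems(4) and span = less.prems(5) and g = less.prems(6)
  show ?case
  proof (cases "\<forall>f\<in>T. f = (\<lambda>x. 0)")
    case True
    have "g \<noteq> (\<lambda>x. 0)" using g T0 by blast
    then obtain x where "g x \<noteq> 0" by auto
    then show ?thesis using True by (intro bexI[of _ "\<lambda>f. f x"] evaluations.eval) auto
  next
    case False
    then obtain t0 y where t0: "t0 \<in> T" "t0 y \<noteq> 0" by fastforce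
    define t where "t x = (1 / t0 y) * t0 x" for x
    have t: "t \<in> T" "t y = 1" using Ts[OF t0(1), of "1 / t0 y"] t0(2) by (auto simp: t_def[abs_def])
    obtain c0 where "t0 = (\<lambda>x. \<Sum>a\<in>A. c0 a * e a x)" using span[OF t0(1)] by blast
    then obtain \<beta> where \<beta>: "\<beta> \<in> A" "e \<beta> y \<noteq> 0"
      using t0(2) by (metis (mono_tags, lifting) mult_zero_right sum.neutral)
    define S where "S = {f \<in> T. f y = 0}"
    \<comment> \<open>Elimination at y with pivot \<beta>: every new generator vanishes at y, and
      the one with index \<beta> becomes zero.\<close>
    define e' where "e' a x = e a x - e a y / e \<beta> y * e \<beta> x" for a x
    define g' where "g' x = g x + (- g y) * t x" for x
    have sub: "f \<in> S \<Longrightarrow> \<exists>c. f = (\<lambda>x. \<Sum>a\<in>A - {\<beta>}. c a * e' a x)" for f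
    proof -
      assume f: "f \<in> S"
      then obtain c where c: "f = (\<lambda>x. \<Sum>a\<in>A. c a * e a x)" using span by (auto simp: S_def)
      have split: "(\<Sum>a\<in>A. c a * e a x) = c \<beta> * e \<beta> x + (\<Sum>a\<in>A - {\<beta>}. c a * e a x)" for x
        by (rule sum.remove[OF less.prems(1) \<beta>(1)])
      have "f y = 0" using f by (simp add: S_def)
      then have z: "(\<Sum>a\<in>A - {\<beta>}. c a * e a y) = - c \<beta> * e \<beta> y" using split[of y] by (simp add: c)
      have "(\<Sum>a\<in>A - {\<beta>}. c a * e' a x) = f x" for x
      proof -
        have "(\<Sum>a\<in>A - {\<beta>}. c a * e' a x) = (\<Sum>a\<in>A - {\<beta>}. c a * e a x) - (\<Sum>a\<in>A - {\<beta>}. c a * e a y) / e \<beta> y * e \<beta> x"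
          by (simp add: e'_def right_diff_distrib sum_subtractf sum_divide_distrib sum_distrib_right mult.assoc)
        then show ?thesis using \<beta>(2) by (simp add: z c split)
      qed
      then show ?thesis by (metis ext)
    qed
    have "g' \<notin> S"
    proof
      assume "g' \<in> S"
      then have "(\<lambda>x. g' x + g y * t x) \<in> T" using Ta Ts t(1) by (auto simp: S_def)
      then show False using g by (simp add: g'_def)
    qed
    moreover have "card (A - {\<beta>}) < card A" using less.prems(1) \<beta>(1) by (rule card_Diff1_less)
    ultimately obtain \<mu> where \<mu>: "\<mu> \<in> evaluations" "\<forall>f\<in>S. \<mu> f = 0" "\<mu> g' \<noteq> 0"
      using less.hyps[of "A - {\<beta>}" S e' g'] less.prems(1) T0 Ta Ts sub by (auto simp: S_def)
    \<comment> \<open>The correction makes the functional vanish on t as well, hence on all of T,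
      and its value at g is that of the old functional at \<open>g'\<close>.\<close>
    define \<nu> where "\<nu> f = \<mu> f + (- \<mu> t) * f y" for f
    have \<nu>: "\<nu> \<in> evaluations"
      unfolding \<nu>_def by (intro evaluations.add evaluations.scale \<mu> evaluations.eval)
    have "\<nu> f = 0" if f: "f \<in> T" for f
    proof -
      have "(\<lambda>x. f x + (- f y) * t x) \<in> S" using Ta[OF f Ts[OF t(1), of "- f y"]] t(2) by (simp add: S_def)
      then have "\<mu> (\<lambda>x. f x + (- f y) * t x) = 0" using \<mu>(2) by blast
      then show ?thesis
        unfolding evaluations_add[OF \<mu>(1)] evaluations_scale[OF \<mu>(1)] \<nu>_def by (simp add: mult.commute)
    qed
    moreover have "\<nu> g \<noteq> 0"
      using \<mu>(3) unfolding g'_def[abs_def] evaluations_add[OF \<mu>(1)] evaluations_scale[OF \<mu>(1)] \<nu>_def by (simp add: mult.commute)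
    ultimately show ?thesis using \<nu> by blast
  qed
qed

text \<open>The vectors \<open>(\<mu> (e \<alpha>))\<^sub>\<alpha>\<close> span a subspace of \<open>\<real>\<^sup>L\<close> on which the form \<open>\<Sum> \<epsilon>\<^sub>\<alpha> x\<^sub>\<alpha> y\<^sub>\<alpha>\<close> may be degenerate;
  subtracting a radical vector makes one more of the functions \<open>e \<beta>\<close> vanish.\<close>

lemma kernel_by_slices:
  fixes e :: "nat \<Rightarrow> 'x \<Rightarrow> real"
  assumes "finite A" "\<And>x y. (\<Sum>\<alpha>\<in>A. \<epsilon> \<alpha> * e \<alpha> x * e \<alpha> y) = W x y"
  shows "\<exists>e' \<mu>. (\<forall>x y. (\<Sum>\<alpha>\<in>A. \<epsilon> \<alpha> * e' \<alpha> x * e' \<alpha> y) = W x y) \<and>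
     (\<forall>\<beta>\<in>A. \<mu> \<beta> \<in> evaluations \<and> e' \<beta> = (\<lambda>x. \<mu> \<beta> (\<lambda>y. W x y)))"
  using assms
proof (induction "card {\<beta>\<in>A. e \<beta> \<noteq> (\<lambda>x. 0)}" arbitrary: e rule: less_induct)
  case less
  note W = less.prems(2)
  \<comment> \<open>All slices of the kernel and their linear combinations, a subspace of the span
    of the functions e.\<close>
  define S where "S = {(\<lambda>x. \<mu> (\<lambda>y. W x y)) |\<mu>. \<mu> \<in> evaluations}"
  show ?case
  proof (cases "\<forall>\<beta>\<in>A. e \<beta> \<in> S")
    case True
    then have "\<forall>\<beta>\<in>A. \<exists>\<mu>. \<mu> \<in> evaluations \<and> e \<beta> = (\<lambda>x. \<mu> (\<lambda>y. W x y))" by (auto simp: S_def)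
    then obtain \<mu> where "\<forall>\<beta>\<in>A. \<mu> \<beta> \<in> evaluations \<and> e \<beta> = (\<lambda>x. \<mu> \<beta> (\<lambda>y. W x y))" by metis
    then show ?thesis using W by blast
  next
    case False
    then obtain \<beta> where \<beta>: "\<beta> \<in> A" "e \<beta> \<notin> S" by blast
    have slice: "\<mu> (\<lambda>y. W x y) = (\<Sum>\<alpha>\<in>A. (\<epsilon> \<alpha> * \<mu> (e \<alpha>)) * e \<alpha> x)" if "\<mu> \<in> evaluations" for \<mu> x
    proof -
      have "(\<lambda>y. W x y) = (\<lambda>y. \<Sum>\<alpha>\<in>A. (\<epsilon> \<alpha> * e \<alpha> x) * e \<alpha> y)" using W by (simp add: fun_eq_iff)
      then have "\<mu> (\<lambda>y. W x y) = (\<Sum>\<alpha>\<in>A. (\<epsilon> \<alpha> * e \<alpha> x) * \<mu> (e \<alpha>))"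
        using evaluations_sum[OF that, of "\<lambda>\<alpha>. \<epsilon> \<alpha> * e \<alpha> x" e A] by (rule trans[OF arg_cong[of _ _ \<mu>]])
      also have "\<dots> = (\<Sum>\<alpha>\<in>A. (\<epsilon> \<alpha> * \<mu> (e \<alpha>)) * e \<alpha> x)"
        by (rule sum.cong[OF refl]) (simp only: mult_ac)
      finally show ?thesis .
    qed
    have SI: "(\<lambda>x. \<mu> (\<lambda>y. W x y)) \<in> S" if "\<mu> \<in> evaluations" for \<mu>
      unfolding S_def using that by (intro CollectI exI[of _ \<mu>] conjI refl)
    have SE: "\<exists>\<mu>\<in>evaluations. f = (\<lambda>x. \<mu> (\<lambda>y. W x y))" if "f \<in> S" for f
      using that unfolding S_def by (elim CollectE exE conjE) (rule bexI)
    have S0: "(\<lambda>x. 0) \<in> S" using SI[OF evaluations.zero] .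
    have Sa: "(\<lambda>x. f x + g x) \<in> S" if fg: "f \<in> S" "g \<in> S" for f g
    proof -
      obtain \<mu> \<nu> where "\<mu> \<in> evaluations" "f = (\<lambda>x. \<mu> (\<lambda>y. W x y))" "\<nu> \<in> evaluations" "g = (\<lambda>x. \<nu> (\<lambda>y. W x y))"
        using SE[OF fg(1)] SE[OF fg(2)] by (elim bexE)
      then show ?thesis using SI[OF evaluations.add] by simp
    qed
    have Ss: "(\<lambda>x. c * f x) \<in> S" if f: "f \<in> S" for f c
    proof -
      obtain \<mu> where "\<mu> \<in> evaluations" "f = (\<lambda>x. \<mu> (\<lambda>y. W x y))"
        using SE[OF f] by (elim bexE)
      then show ?thesis using SI[OF evaluations.scale] by simp
    qed
    have Sp: "\<exists>c. f = (\<lambda>x. \<Sum>a\<in>A. c a * e a x)" if f: "f \<in> S" for f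
    proof -
      obtain \<mu> where "\<mu> \<in> evaluations" "f = (\<lambda>x. \<mu> (\<lambda>y. W x y))"
        using SE[OF f] by (elim bexE)
      then show ?thesis using slice by (intro exI[of _ "\<lambda>\<alpha>. \<epsilon> \<alpha> * \<mu> (e \<alpha>)"]) simp
    qed
    \<comment> \<open>A combination of evaluations that kills every slice but not the offending
      function \<open>e \<beta>\<close>.\<close>
    obtain \<mu> where \<mu>: "\<mu> \<in> evaluations" "\<forall>f\<in>S. \<mu> f = 0" "\<mu> (e \<beta>) \<noteq> 0"
      using separating_evaluation[OF less.prems(1) S0 Sa Ss Sp \<beta>(2)] by blast
    define r where "r \<alpha> = \<mu> (e \<alpha>)" for \<alpha>
    have Wsym: "W x y = W y x" for x y using W[of x y] W[of y x] by (simp add: mult_ac)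
    have re: "(\<Sum>\<alpha>\<in>A. \<epsilon> \<alpha> * r \<alpha> * e \<alpha> y) = 0" for y
    proof -
      have "(\<lambda>x. W x y) \<in> S" using SI[OF evaluations.eval] .
      then have "\<mu> (\<lambda>x. W y x) = 0" using \<mu>(2) Wsym[of _ y] by simp
      then show ?thesis by (simp add: slice[OF \<mu>(1)] r_def)
    qed
    \<comment> \<open>The vector r is orthogonal to all vectors of values of e by \<open>re\<close>;
      being itself obtained from such vectors by \<mu>, it is also orthogonal to itself.\<close>
    have rr: "(\<Sum>\<alpha>\<in>A. \<epsilon> \<alpha> * r \<alpha> * r \<alpha>) = 0"
    proof -
      have "\<mu> (\<lambda>y. \<Sum>\<alpha>\<in>A. (\<epsilon> \<alpha> * r \<alpha>) * e \<alpha> y) = 0" using re evaluations_zero[OF \<mu>(1)] by simp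
      then show ?thesis by (simp add: evaluations_sum[OF \<mu>(1)] r_def)
    qed
    \<comment> \<open>By \<open>re\<close> and \<open>rr\<close>, subtracting multiples of r from
      the vector of values leaves the kernel unchanged. The multiple is chosen so that the function
      with index \<beta> vanishes; functions that are already zero stay so, because r is zero at
      their index.\<close>
    define e' where "e' \<alpha> x = e \<alpha> x - r \<alpha> / r \<beta> * e \<beta> x" for \<alpha> x
    have r\<beta>: "r \<beta> \<noteq> 0" using \<mu>(3) by (simp add: r_def)
    have W': "(\<Sum>\<alpha>\<in>A. \<epsilon> \<alpha> * e' \<alpha> x * e' \<alpha> y) = W x y" for x y
    proof -
      have "(\<Sum>\<alpha>\<in>A. \<epsilon> \<alpha> * e' \<alpha> x * e' \<alpha> y) = (\<Sum>\<alpha>\<in>A. \<epsilon> \<alpha> * e \<alpha> x * e \<alpha> y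
         - (e \<beta> x / r \<beta>) * (\<epsilon> \<alpha> * r \<alpha> * e \<alpha> y) - (e \<beta> y / r \<beta>) * (\<epsilon> \<alpha> * r \<alpha> * e \<alpha> x)
         + (e \<beta> x / r \<beta>) * (e \<beta> y / r \<beta>) * (\<epsilon> \<alpha> * r \<alpha> * r \<alpha>))"
        by (rule sum.cong[OF refl]) (simp add: e'_def algebra_simps)
      also have "\<dots> = (\<Sum>\<alpha>\<in>A. \<epsilon> \<alpha> * e \<alpha> x * e \<alpha> y) - (e \<beta> x / r \<beta>) * (\<Sum>\<alpha>\<in>A. \<epsilon> \<alpha> * r \<alpha> * e \<alpha> y)
         - (e \<beta> y / r \<beta>) * (\<Sum>\<alpha>\<in>A. \<epsilon> \<alpha> * r \<alpha> * e \<alpha> x) + (e \<beta> x / r \<beta>) * (e \<beta> y / r \<beta>) * (\<Sum>\<alpha>\<in>A. \<epsilon> \<alpha> * r \<alpha> * r \<alpha>)"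
        by (simp only: sum.distrib sum_subtractf sum_distrib_left)
      finally show ?thesis by (simp add: re rr W)
    qed
    have "{\<alpha>\<in>A. e' \<alpha> \<noteq> (\<lambda>x. 0)} \<subset> {\<alpha>\<in>A. e \<alpha> \<noteq> (\<lambda>x. 0)}"
    proof
      have "e' \<alpha> = (\<lambda>x. 0)" if "e \<alpha> = (\<lambda>x. 0)" for \<alpha>
        using that evaluations_zero[OF \<mu>(1)] by (simp add: e'_def[abs_def] r_def)
      then show "{\<alpha>\<in>A. e' \<alpha> \<noteq> (\<lambda>x. 0)} \<subseteq> {\<alpha>\<in>A. e \<alpha> \<noteq> (\<lambda>x. 0)}" by blast
      have "e' \<beta> = (\<lambda>x. 0)" using r\<beta> by (simp add: e'_def[abs_def])
      moreover have "e \<beta> \<noteq> (\<lambda>x. 0)" using \<beta>(2) S0 by metis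
      ultimately show "{\<alpha>\<in>A. e' \<alpha> \<noteq> (\<lambda>x. 0)} \<noteq> {\<alpha>\<in>A. e \<alpha> \<noteq> (\<lambda>x. 0)}" using \<beta>(1) by blast
    qed
    then have "card {\<alpha>\<in>A. e' \<alpha> \<noteq> (\<lambda>x. 0)} < card {\<alpha>\<in>A. e \<alpha> \<noteq> (\<lambda>x. 0)}"
      using less.prems(1) by (intro psubset_card_mono) auto
    from less.hyps[OF this less.prems(1) W'] show ?thesis .
  qed
qed


section \<open>Potentials of closed forms\<close>

text \<open>Integration of the 1-form along segments from a base point. Curl-freeness turns the
  derivative of the radial integrand into a derivative along the segment.\<close>

lemma poincare_lemma:
  fixes V :: "(real^'n::finite) set" and a :: "'n \<Rightarrow> real^'n \<Rightarrow> real"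
  assumes V: "open V" "convex V" and a: "\<And>k. smooth_on V (a k)"
    and cl: "\<And>k l p. p \<in> V \<Longrightarrow> pd l (a k) p = pd k (a l) p"
  shows "\<exists>\<phi>. smooth_on V \<phi> \<and> (\<forall>p\<in>V. \<forall>k. pd k \<phi> p = a k p)"
proof (cases "V = {}")
  case True
  then show ?thesis by (intro exI[of _ "\<lambda>_. 0"]) (auto intro: smooth_on_const)
next
  case False
  then obtain p0 where p0: "p0 \<in> V" by blast
  define Y where "Y q = p0 + snd q *\<^sub>R (fst q - p0)" for q :: "(real^'n) \<times> real"
  \<comment> \<open>Parameter integrals are differentiated on an open set of pairs; the preimage of
    V is one, and by convexity it contains V times the unit interval.\<close>
  define D where "D = Y -` V"
  have D: "open D"
    unfolding D_def Y_def by (intro open_vimage V continuous_intros)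
  have VD: "V \<times> {0..1} \<subseteq> D"
  proof
    fix q assume q: "q \<in> V \<times> {0..1::real}"
    then have "(1 - snd q) *\<^sub>R p0 + snd q *\<^sub>R fst q \<in> V"
      using V(2) p0 by (intro convexD) auto
    then show "q \<in> D" by (simp add: D_def Y_def algebra_simps)
  qed
  define H where "H q = (\<Sum>k\<in>UNIV. a k (Y q) * (fst q - p0) $ k)" for q
  have Y: "smooth_on D Y"
    unfolding Y_def by (intro smooth_on_add smooth_on_scaleR smooth_on_diff smooth_on_const smooth_on_fst smooth_on_snd smooth_on_id D)
  have H: "smooth_on D H"
    unfolding H_def
    by (rule smooth_on_sum[OF D], rule smooth_on_mult[OF D], rule smooth_on_compose[OF a Y D V(1)])
       (auto simp: D_def intro!: smooth_on_vec_nth smooth_on_diff smooth_on_const smooth_on_fst smooth_on_id D[unfolded D_def])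
  define \<phi> where "\<phi> x = integral {0..1} (\<lambda>s. H (x, s))" for x
  have s\<phi>: "smooth_on V \<phi>" unfolding \<phi>_def by (rule smooth_on_parameter_integral[OF V(1) D VD H])
  have "pd m \<phi> x = a m x" if x: "x \<in> V" for x m
  proof -
    have dH: "frechet_derivative H (at (x, s)) (axis m 1, 0) = a m (Y (x, s)) + s * (\<Sum>k\<in>UNIV. pd k (a m) (Y (x, s)) * (x - p0) $ k)"
      if s: "s \<in> {0..1}" for s
    proof -
      have q: "(x, s) \<in> D" using VD x s by auto
      then have YV: "Y (x, s) \<in> V" by (simp add: D_def)
      have 1: "((\<lambda>\<tau>. H ((x, s) + \<tau> *\<^sub>R (axis m 1, 0))) has_real_derivative frechet_derivative H (at (x, s)) (axis m 1, 0)) (at 0)"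
        using smooth_on_line_derivative[OF H, of "(x, s)" 0 "(axis m 1, 0)"] q by simp
      have e: "((\<lambda>\<tau>. (x - p0) $ k + \<tau> * axis m 1 $ k) has_real_derivative (if k = m then 1 else 0)) (at 0)" for k
        by (auto intro!: derivative_eq_intros simp: axis_def)
      have k: "((\<lambda>\<tau>. a k (Y (x, s) + \<tau> *\<^sub>R (s *\<^sub>R axis m 1)) * ((x - p0) $ k + \<tau> * axis m 1 $ k)) has_real_derivative
         s * (pd m (a k) (Y (x, s)) * (x - p0) $ k) + (if k = m then a m (Y (x, s)) else 0)) (at 0)" for k
        using DERIV_mult[OF line_derivative_d1[OF a[of k] YV, of "s *\<^sub>R axis m 1"] e[of k]]
        by (cases "k = m") (simp_all add: d1_axis mult_ac)
      have "((\<lambda>\<tau>. \<Sum>k\<in>UNIV. a k (Y (x, s) + \<tau> *\<^sub>R (s *\<^sub>R axis m 1)) * ((x - p0) $ k + \<tau> * axis m 1 $ k)) has_real_derivative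
         (\<Sum>k\<in>UNIV. s * (pd m (a k) (Y (x, s)) * (x - p0) $ k) + (if k = m then a m (Y (x, s)) else 0))) (at 0)"
        by (rule DERIV_sum[OF k])
      moreover have "H ((x, s) + \<tau> *\<^sub>R (axis m 1, 0)) = (\<Sum>k\<in>UNIV. a k (Y (x, s) + \<tau> *\<^sub>R (s *\<^sub>R axis m 1)) * ((x - p0) $ k + \<tau> * axis m 1 $ k))" for \<tau>
      proof -
        have "Y ((x, s) + \<tau> *\<^sub>R (axis m 1, 0)) = Y (x, s) + \<tau> *\<^sub>R (s *\<^sub>R axis m 1)"
          by (simp add: Y_def algebra_simps)
        then show ?thesis unfolding H_def by (simp add: algebra_simps)
      qed
      ultimately have "((\<lambda>\<tau>. H ((x, s) + \<tau> *\<^sub>R (axis m 1, 0))) has_real_derivative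
         (\<Sum>k\<in>UNIV. s * (pd m (a k) (Y (x, s)) * (x - p0) $ k) + (if k = m then a m (Y (x, s)) else 0))) (at 0)" by simp
      from DERIV_unique[OF 1 this] show ?thesis
        by (simp add: sum.distrib sum_distrib_left cl[OF YV, of m])
    qed
    have Ys: "((\<lambda>s. a m (Y (x, s))) has_vector_derivative (\<Sum>k\<in>UNIV. pd k (a m) (Y (x, s)) * (x - p0) $ k)) (at s)" if s: "s \<in> {0..1}" for s
    proof -
      have YV: "Y (x, s) \<in> V" using subsetD[OF VD, of "(x, s)"] x s by (simp add: D_def)
      have "((\<lambda>s. Y (x, s)) has_derivative (\<lambda>t. t *\<^sub>R (x - p0))) (at s)"
        unfolding Y_def by (auto intro!: derivative_eq_intros)
      from has_derivative_compose[OF this has_derivative_pd[OF a YV]] show ?thesis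
        by (simp add: has_vector_derivative_def sum_distrib_left mult_ac)
    qed
    \<comment> \<open>By \<open>dH\<close>, where the curl condition has been used, the integrand is
      the s-derivative of s times a_m along the segment.\<close>
    have "((\<lambda>s. frechet_derivative H (at (x, s)) (axis m 1, 0)) has_integral 1 * a m (Y (x, 1)) - 0 * a m (Y (x, 0))) {0..1}"
    proof (rule fundamental_theorem_of_calculus[where f="\<lambda>s. s * a m (Y (x, s))"])
      fix s :: real assume s: "s \<in> {0..1}"
      have "((\<lambda>s. s * a m (Y (x, s))) has_real_derivative 1 * a m (Y (x, s)) + (\<Sum>k\<in>UNIV. pd k (a m) (Y (x, s)) * (x - p0) $ k) * s) (at s)"
        by (rule DERIV_mult[OF DERIV_ident Ys[OF s, folded has_real_derivative_iff_has_vector_derivative]])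
      then show "((\<lambda>s. s * a m (Y (x, s))) has_vector_derivative frechet_derivative H (at (x, s)) (axis m 1, 0)) (at s within {0..1})"
        unfolding dH[OF s] has_real_derivative_iff_has_vector_derivative
        by (simp add: has_vector_derivative_at_within mult.commute)
    qed simp
    then have "integral {0..1} (\<lambda>s. frechet_derivative H (at (x, s)) (axis m 1, 0)) = a m x"
      by (auto dest!: integral_unique simp: Y_def)
    moreover have "pd m \<phi> x = integral {0..1} (\<lambda>s. frechet_derivative H (at (x, s)) (axis m 1, 0))"
      unfolding \<phi>_def by (rule pd_eqI[OF parameter_integral_has_derivative[OF V(1) D VD H x]])
    ultimately show ?thesis by simp
  qed
  then show ?thesis using s\<phi> by blast
qed

text \<open>The Poincare lemma twice: for fixed i the row H i is a gradient, and symmetry of H says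
  that the resulting row potentials are curl free themselves.\<close>

lemma hessian_potential:
  fixes V :: "(real^'n::finite) set" and H :: "'n \<Rightarrow> 'n \<Rightarrow> real^'n \<Rightarrow> real"
  assumes V: "open V" "convex V" and H: "\<And>i k. smooth_on V (H i k)"
    and sym: "\<And>i k p. p \<in> V \<Longrightarrow> H i k p = H k i p"
    and cl: "\<And>i k l p. p \<in> V \<Longrightarrow> pd l (H i k) p = pd k (H i l) p"
  shows "\<exists>\<phi>. smooth_on V \<phi> \<and> (\<forall>p\<in>V. \<forall>i k. pd i (pd k \<phi>) p = H i k p)"
proof -
  have "\<forall>i. \<exists>\<theta>. smooth_on V \<theta> \<and> (\<forall>p\<in>V. \<forall>k. pd k \<theta> p = H i k p)"
    using poincare_lemma[OF V H cl] by blast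
  then obtain \<theta> where \<theta>: "\<And>i. smooth_on V (\<theta> i)" "\<And>i k p. p \<in> V \<Longrightarrow> pd k (\<theta> i) p = H i k p" by metis
  obtain \<phi> where \<phi>: "smooth_on V \<phi>" "\<And>p k. p \<in> V \<Longrightarrow> pd k \<phi> p = \<theta> k p"
  proof -
    have "pd l (\<theta> k) p = pd k (\<theta> l) p" if "p \<in> V" for k l p
      using \<theta>(2)[OF that] sym[OF that] by simp
    then have "\<exists>\<phi>. smooth_on V \<phi> \<and> (\<forall>p\<in>V. \<forall>k. pd k \<phi> p = \<theta> k p)" by (rule poincare_lemma[OF V \<theta>(1)])
    then show ?thesis using that by blast
  qed
  have "pd i (pd k \<phi>) p = H i k p" if p: "p \<in> V" for i k p
    using pd_cong[OF V(1) p, of "pd k \<phi>" "\<theta> k" i] \<phi>(2) \<theta>(2)[OF p] sym[OF p] by simp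
  then show ?thesis using \<phi>(1) by blast
qed

text \<open>The relations in \<open>nonlocal_slices\<close> are linear in the coefficients at p once
  the second factor is fixed. They therefore become true identities for the combinations of the w
  that \<open>kernel_by_slices\<close> produces, although the individual w need not satisfy
  them.\<close>

lemma nonlocal_potentials:
  fixes V :: "(real^'n::finite) set" and w :: "nat \<Rightarrow> real^'n \<Rightarrow> real^'n^'n"
  assumes V: "open V" "convex V" and \<eta>: "transpose \<eta> = \<eta>" "det \<eta> \<noteq> 0"
    and w: "\<And>\<alpha>. \<alpha> \<in> {1..L} \<Longrightarrow> smooth_on V (w \<alpha>)"
    and closed: "closed_form V \<eta> (bil g b L \<epsilon> w)" and skew: "skew_form V (bil g b L \<epsilon> w)"
  shows "\<exists>\<psi>. (\<forall>\<alpha>\<in>{1..L}. smooth_on V (\<psi> \<alpha>)) \<and> (\<forall>p\<in>V. \<forall>q\<in>V. \<forall>i k j s.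
    (\<Sum>\<alpha>=1..L. \<epsilon> \<alpha> * w \<alpha> p $ i $ k * w \<alpha> q $ j $ s)
    = (\<Sum>\<alpha>=1..L. \<epsilon> \<alpha> * w_form \<eta> \<psi> \<alpha> p $ i $ k * w_form \<eta> \<psi> \<alpha> q $ j $ s))"
proof -
  \<comment> \<open>Point and indices are fused into one argument, so that w becomes a family of
    scalar functions. Extension by zero makes evaluations outside V harmless.\<close>
  define e where "e \<alpha> = (\<lambda>(p, i, k). if p \<in> V then w \<alpha> p $ i $ k else 0)" for \<alpha>
  define W where "W x y = (\<Sum>\<alpha>=1..L. \<epsilon> \<alpha> * e \<alpha> x * e \<alpha> y)" for x y
  obtain e' \<mu> where e': "\<forall>x y. (\<Sum>\<alpha>=1..L. \<epsilon> \<alpha> * e' \<alpha> x * e' \<alpha> y) = W x y"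
    and \<mu>': "\<forall>\<beta>\<in>{1..L}. \<mu> \<beta> \<in> evaluations \<and> e' \<beta> = (\<lambda>x. \<mu> \<beta> (\<lambda>y. W x y))"
    using kernel_by_slices[of "{1..L}" \<epsilon> e W, OF finite_atLeastAtMost W_def[symmetric]] by blast
  have \<mu>: "\<mu> \<beta> \<in> evaluations" "e' \<beta> = (\<lambda>x. \<mu> \<beta> (\<lambda>y. W x y))" if "\<beta> \<in> {1..L}" for \<beta>
    using \<mu>' that by blast+
  define a where "a \<beta> \<alpha> = \<epsilon> \<alpha> * \<mu> \<beta> (e \<alpha>)" for \<beta> \<alpha>
  have e'_eq: "e' \<beta> x = (\<Sum>\<alpha>=1..L. a \<beta> \<alpha> * e \<alpha> x)" if "\<beta> \<in> {1..L}" for \<beta> x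
  proof -
    have "(\<lambda>y. W x y) = (\<lambda>y. \<Sum>\<alpha>=1..L. (\<epsilon> \<alpha> * e \<alpha> x) * e \<alpha> y)" by (simp add: W_def)
    then have "e' \<beta> x = (\<Sum>\<alpha>=1..L. (\<epsilon> \<alpha> * e \<alpha> x) * \<mu> \<beta> (e \<alpha>))"
      using evaluations_sum[OF \<mu>(1)[OF that], of "\<lambda>\<alpha>. \<epsilon> \<alpha> * e \<alpha> x" e "{1..L}"] fun_cong[OF \<mu>(2)[OF that], of x] by metis
    also have "\<dots> = (\<Sum>\<alpha>=1..L. a \<beta> \<alpha> * e \<alpha> x)"
      by (rule sum.cong[OF refl]) (simp only: mult_ac a_def)
    finally show ?thesis .
  qed
  \<comment> \<open>If l is orthogonal to all values of w in the form given by \<epsilon>, then it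
    is orthogonal to everything obtained from them by evaluations, in particular to the coefficients
    a of the new family.\<close>
  have annihilate: "(\<Sum>\<alpha>=1..L. a \<beta> \<alpha> * l \<alpha>) = 0"
    if \<beta>: "\<beta> \<in> {1..L}" and l: "\<And>q j s. q \<in> V \<Longrightarrow> (\<Sum>\<alpha>=1..L. \<epsilon> \<alpha> * l \<alpha> * w \<alpha> q $ j $ s) = 0" for \<beta> l
  proof -
    have "(\<Sum>\<alpha>=1..L. \<epsilon> \<alpha> * l \<alpha> * e \<alpha> y) = 0" for y
    proof (cases "fst y \<in> V")
      case True
      then show ?thesis using l[OF True, of "fst (snd y)" "snd (snd y)"] by (simp add: e_def split_beta)
    qed (simp add: e_def split_beta)
    then have "\<mu> \<beta> (\<lambda>y. \<Sum>\<alpha>=1..L. (\<epsilon> \<alpha> * l \<alpha>) * e \<alpha> y) = 0" using evaluations_zero[OF \<mu>(1)[OF \<beta>]] by simp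
    then have "(\<Sum>\<alpha>=1..L. (\<epsilon> \<alpha> * l \<alpha>) * \<mu> \<beta> (e \<alpha>)) = 0"
      using evaluations_sum[OF \<mu>(1)[OF \<beta>], of "\<lambda>\<alpha>. \<epsilon> \<alpha> * l \<alpha>" e "{1..L}"] by metis
    moreover have "(\<Sum>\<alpha>=1..L. a \<beta> \<alpha> * l \<alpha>) = (\<Sum>\<alpha>=1..L. (\<epsilon> \<alpha> * l \<alpha>) * \<mu> \<beta> (e \<alpha>))"
      by (rule sum.cong[OF refl]) (simp only: mult_ac a_def)
    ultimately show ?thesis by simp
  qed
  define H where "H \<beta> i k p = (\<Sum>\<alpha>=1..L. a \<beta> \<alpha> * low_w \<eta> (w \<alpha>) i k p)" for \<beta> i k p
  note sl = smooth_on_low_w[OF V(1) w]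
  have "\<exists>\<psi>. smooth_on V \<psi> \<and> (\<forall>p\<in>V. \<forall>i k. pd i (pd k \<psi>) p = H \<beta> i k p)" if \<beta>: "\<beta> \<in> {1..L}" for \<beta>
  proof (rule hessian_potential[OF V])
    show "smooth_on V (H \<beta> i k)" for i k
      unfolding H_def by (intro smooth_on_sum smooth_on_mult smooth_on_const V sl)
    fix p assume p: "p \<in> V"
    show sym: "H \<beta> i k p = H \<beta> k i p" if p: "p \<in> V" for i k p
    proof -
      have "(\<Sum>\<alpha>=1..L. a \<beta> \<alpha> * (low_w \<eta> (w \<alpha>) i k p - low_w \<eta> (w \<alpha>) k i p)) = 0"
        by (rule annihilate[OF \<beta> nonlocal_slices(1)[OF V(1) \<eta> w closed skew V(2) p]])
      then show ?thesis by (simp add: H_def right_diff_distrib sum_subtractf)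
    qed
    have pdH: "pd l (H \<beta> i k) p = (\<Sum>\<alpha>=1..L. a \<beta> \<alpha> * pd l (low_w \<eta> (w \<alpha>) i k) p)" for l i k
      unfolding H_def by (rule pd_linear_combination[OF finite_atLeastAtMost sl p])
    have sp: "pd l (H \<beta> i k) p = pd l (H \<beta> k i) p" for l i k
      by (rule pd_cong[OF V(1) p sym])
    have c: "pd m (H \<beta> i k) p + pd i (H \<beta> m k) p = 2 * pd k (H \<beta> m i) p" for i k m
    proof -
      have "(\<Sum>\<alpha>=1..L. a \<beta> \<alpha> * (pd m (low_w \<eta> (w \<alpha>) i k) p + pd i (low_w \<eta> (w \<alpha>) m k) p - 2 * pd k (low_w \<eta> (w \<alpha>) m i) p)) = 0"
        by (rule annihilate[OF \<beta> nonlocal_slices(2)[OF V(1) \<eta> w closed skew V(2) p]])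
      then show ?thesis unfolding pdH by (simp add: algebra_simps sum.distrib sum_subtractf sum_distrib_left)
    qed
    \<comment> \<open>By \<open>c\<close> and the symmetry of H, each of the three derivatives with
      indices i, k, l distributed in different ways is the mean of the other two; so they are all
      equal.\<close>
    show "pd l (H \<beta> i k) p = pd k (H \<beta> i l) p" for i k l
      using c[of l i k] c[of k l i] c[of i k l] sp[of l i k] sp[of i l k] sp[of k l i] by linarith
  qed
  then have "\<forall>\<beta>\<in>{1..L}. \<exists>\<psi>. smooth_on V \<psi> \<and> (\<forall>p\<in>V. \<forall>i k. pd i (pd k \<psi>) p = H \<beta> i k p)" by blast
  then obtain \<psi> where \<psi>: "\<And>\<beta>. \<beta> \<in> {1..L} \<Longrightarrow> smooth_on V (\<psi> \<beta>)" "\<And>\<beta> p i k. \<beta> \<in> {1..L} \<Longrightarrow> p \<in> V \<Longrightarrow> pd i (pd k (\<psi> \<beta>)) p = H \<beta> i k p"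
    by metis
  have wf: "w_form \<eta> \<psi> \<beta> p $ i $ k = e' \<beta> (p, i, k)" if \<beta>: "\<beta> \<in> {1..L}" and p: "p \<in> V" for \<beta> p i k
  proof -
    have "w_form \<eta> \<psi> \<beta> p $ i $ k = (\<Sum>m\<in>UNIV. \<eta> $ i $ m * (\<Sum>\<alpha>=1..L. a \<beta> \<alpha> * low_w \<eta> (w \<alpha>) m k p))"
      by (simp add: w_form_def \<psi>(2)[OF that] H_def)
    also have "\<dots> = (\<Sum>\<alpha>=1..L. a \<beta> \<alpha> * (\<Sum>m\<in>UNIV. \<eta> $ i $ m * low_w \<eta> (w \<alpha>) m k p))"
      unfolding sum_distrib_left by (subst sum.swap) (simp add: mult_ac)
    finally show ?thesis using p by (simp add: raise_low_w[OF \<eta>(2,1)] e'_eq[OF \<beta>] e_def)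
  qed
  have "(\<Sum>\<alpha>=1..L. \<epsilon> \<alpha> * w \<alpha> p $ i $ k * w \<alpha> q $ j $ s)
    = (\<Sum>\<alpha>=1..L. \<epsilon> \<alpha> * w_form \<eta> \<psi> \<alpha> p $ i $ k * w_form \<eta> \<psi> \<alpha> q $ j $ s)" if pq: "p \<in> V" "q \<in> V" for p q i k j s
  proof -
    have "(\<Sum>\<alpha>=1..L. \<epsilon> \<alpha> * w_form \<eta> \<psi> \<alpha> p $ i $ k * w_form \<eta> \<psi> \<alpha> q $ j $ s) = (\<Sum>\<alpha>=1..L. \<epsilon> \<alpha> * e' \<alpha> (p, i, k) * e' \<alpha> (q, j, s))"
      by (rule sum.cong[OF refl]) (simp only: wf pq)
    also have "\<dots> = W (p, i, k) (q, j, s)" using e' by blast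
    finally show ?thesis using pq by (simp add: W_def e_def)
  qed
  then show ?thesis using \<psi>(1) by blast
qed


section \<open>Local brackets\<close>

lemma raise_low:
  fixes \<eta> :: "real^'n^'n::finite"
  assumes "det \<eta> \<noteq> 0" "transpose \<eta> = \<eta>"
  shows "(\<Sum>m\<in>UNIV. \<eta> $ i $ m * (\<Sum>a\<in>UNIV. low_vec \<eta> m $ a * f a)) = f i"
  using raise_low_w[OF assms, of i "\<lambda>_. \<chi> a k. f a" k for k] by (simp add: low_w_def)

lemma raise_low2:
  fixes \<eta> :: "real^'n^'n::finite"
  assumes "det \<eta> \<noteq> 0" "transpose \<eta> = \<eta>"
  shows "(\<Sum>m\<in>UNIV. \<Sum>l\<in>UNIV. \<eta> $ i $ m * \<eta> $ j $ l * (\<Sum>a\<in>UNIV. \<Sum>b\<in>UNIV. low_vec \<eta> m $ a * low_vec \<eta> l $ b * f a b)) = f i j"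
proof -
  have "(\<Sum>l\<in>UNIV. \<eta> $ i $ m * \<eta> $ j $ l * (\<Sum>a\<in>UNIV. \<Sum>b\<in>UNIV. low_vec \<eta> m $ a * low_vec \<eta> l $ b * f a b))
     = \<eta> $ i $ m * (\<Sum>a\<in>UNIV. low_vec \<eta> m $ a * f a j)" for m
  proof -
    have "(\<Sum>l\<in>UNIV. \<eta> $ i $ m * \<eta> $ j $ l * (\<Sum>a\<in>UNIV. \<Sum>b\<in>UNIV. low_vec \<eta> m $ a * low_vec \<eta> l $ b * f a b))
      = (\<Sum>l\<in>UNIV. \<Sum>a\<in>UNIV. \<eta> $ i $ m * (low_vec \<eta> m $ a * (\<eta> $ j $ l * (\<Sum>b\<in>UNIV. low_vec \<eta> l $ b * f a b))))"
      by (simp add: sum_distrib_left mult_ac)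
    also have "\<dots> = (\<Sum>a\<in>UNIV. \<Sum>l\<in>UNIV. \<eta> $ i $ m * (low_vec \<eta> m $ a * (\<eta> $ j $ l * (\<Sum>b\<in>UNIV. low_vec \<eta> l $ b * f a b))))"
      by (rule sum.swap)
    also have "\<dots> = \<eta> $ i $ m * (\<Sum>a\<in>UNIV. low_vec \<eta> m $ a * (\<Sum>l\<in>UNIV. \<eta> $ j $ l * (\<Sum>b\<in>UNIV. low_vec \<eta> l $ b * f a b)))"
      by (simp only: sum_distrib_left)
    finally show ?thesis by (simp only: raise_low[OF assms])
  qed
  then show ?thesis by (simp only: raise_low[OF assms])
qed

lemma pd_add:
  assumes "smooth_on V f" "smooth_on V g" "u \<in> V"
  shows "pd k (\<lambda>z. f z + g z) u = pd k f u + pd k g u"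
proof -
  have "((\<lambda>z. f z + g z) has_derivative (\<lambda>v. frechet_derivative f (at u) v + frechet_derivative g (at u) v)) (at u)"
    by (intro has_derivative_add smooth_on_has_derivative[OF assms(1,3)] smooth_on_has_derivative[OF assms(2,3)])
  from pd_eqI[OF this] show ?thesis by (simp add: pd_def)
qed

definition low_g :: "real^'n^'n \<Rightarrow> (real^'n \<Rightarrow> real^'n^'n) \<Rightarrow> 'n::finite \<Rightarrow> 'n \<Rightarrow> real^'n \<Rightarrow> real" where
  "low_g \<eta> g i j z = (\<Sum>a\<in>UNIV. \<Sum>c\<in>UNIV. low_vec \<eta> i $ a * low_vec \<eta> j $ c * g z $ a $ c)"

definition low_b :: "real^'n^'n \<Rightarrow> (real^'n \<Rightarrow> real^'n^'n^'n) \<Rightarrow> 'n::finite \<Rightarrow> 'n \<Rightarrow> 'n \<Rightarrow> real^'n \<Rightarrow> real" where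
  "low_b \<eta> b i j k z = (\<Sum>a\<in>UNIV. \<Sum>c\<in>UNIV. low_vec \<eta> i $ a * low_vec \<eta> j $ c * b z $ a $ c $ k)"

lemma bil_local:
  fixes \<theta> :: "real \<Rightarrow> real"
  assumes "smooth_on UNIV \<theta>"
  shows "bil g b 0 \<epsilon> w u (\<lambda>x. \<phi> x *\<^sub>R low_vec \<eta> i) (\<lambda>x. \<theta> x *\<^sub>R low_vec \<eta> j) =
    integral UNIV (\<lambda>x. \<phi> x * xderiv \<theta> x * low_g \<eta> g i j (u x) + \<phi> x * \<theta> x * (\<Sum>k\<in>UNIV. low_b \<eta> b i j k (u x) * xderiv u x $ k))"
  unfolding bil_def
proof (rule integral_cong)
  fix x
  let ?a = "low_vec \<eta> i" and ?c = "low_vec \<eta> j"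
  have "nonlocal_operator g b 0 \<epsilon> w u (\<lambda>x. \<theta> x *\<^sub>R ?c) x $ a = (\<Sum>c\<in>UNIV. g (u x) $ a $ c * (xderiv \<theta> x * ?c $ c)
      + (\<Sum>k\<in>UNIV. b (u x) $ a $ c $ k * xderiv u x $ k) * (\<theta> x * ?c $ c))" for a
    by (simp add: nonlocal_operator_def xderiv_scaleR_const[OF assms])
  then have "(\<phi> x *\<^sub>R ?a) \<bullet> nonlocal_operator g b 0 \<epsilon> w u (\<lambda>x. \<theta> x *\<^sub>R ?c) x
     = (\<Sum>a\<in>UNIV. \<phi> x * ?a $ a * (\<Sum>c\<in>UNIV. g (u x) $ a $ c * (xderiv \<theta> x * ?c $ c)
      + (\<Sum>k\<in>UNIV. b (u x) $ a $ c $ k * xderiv u x $ k) * (\<theta> x * ?c $ c)))"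
    by (simp add: inner_vec_def)
  also have "\<dots> = \<phi> x * xderiv \<theta> x * low_g \<eta> g i j (u x) + \<phi> x * \<theta> x * (\<Sum>a\<in>UNIV. \<Sum>c\<in>UNIV. \<Sum>k\<in>UNIV. ?a $ a * ?c $ c * b (u x) $ a $ c $ k * xderiv u x $ k)"
    by (simp add: low_g_def sum_distrib_left sum_distrib_right distrib_left sum.distrib mult_ac)
  also have "(\<Sum>a\<in>UNIV. \<Sum>c\<in>UNIV. \<Sum>k\<in>UNIV. ?a $ a * ?c $ c * b (u x) $ a $ c $ k * xderiv u x $ k)
     = (\<Sum>a\<in>UNIV. \<Sum>k\<in>UNIV. \<Sum>c\<in>UNIV. ?a $ a * ?c $ c * b (u x) $ a $ c $ k * xderiv u x $ k)"
    by (rule sum.cong[OF refl], rule sum.swap)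
  also have "\<dots> = (\<Sum>k\<in>UNIV. \<Sum>a\<in>UNIV. \<Sum>c\<in>UNIV. ?a $ a * ?c $ c * b (u x) $ a $ c $ k * xderiv u x $ k)"
    by (rule sum.swap)
  also have "\<dots> = (\<Sum>k\<in>UNIV. low_b \<eta> b i j k (u x) * xderiv u x $ k)"
    by (simp only: low_b_def sum_distrib_right)
  finally show "(\<phi> x *\<^sub>R ?a) \<bullet> nonlocal_operator g b 0 \<epsilon> w u (\<lambda>x. \<theta> x *\<^sub>R ?c) x
    = \<phi> x * xderiv \<theta> x * low_g \<eta> g i j (u x) + \<phi> x * \<theta> x * (\<Sum>k\<in>UNIV. low_b \<eta> b i j k (u x) * xderiv u x $ k)" .
qed

section \<open>Skewness and closedness of a local form\<close>

context
  fixes V :: "(real^'n::finite) set" and \<eta> :: "real^'n^'n" and g and b and \<epsilon> and w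
  assumes V: "open V" "convex V" and \<eta>: "transpose \<eta> = \<eta>" "det \<eta> \<noteq> 0"
    and g: "smooth_on V g" and b: "smooth_on V b"
    and closed: "closed_form V \<eta> (bil g b 0 \<epsilon> w)" and skew: "skew_form V (bil g b 0 \<epsilon> w)"
begin

private abbreviation "gl \<equiv> low_g \<eta> g"
private abbreviation "bl \<equiv> low_b \<eta> b"

private lemma smooth_gl: "smooth_on V (gl i j)"
  unfolding low_g_def[abs_def] by (intro smooth_on_sum smooth_on_mult smooth_on_const smooth_on_vec_nth V(1) g)

private lemma smooth_bl: "smooth_on V (bl i j k)"
  unfolding low_b_def[abs_def] by (intro smooth_on_sum smooth_on_mult smooth_on_const smooth_on_vec_nth V(1) b)

private lemma sum_axis: "(\<Sum>k\<in>UNIV. a k * (r *\<^sub>R axis m 1 :: real^'n) $ k) = r * a m"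
proof -
  have "(\<Sum>k\<in>UNIV. a k * (r *\<^sub>R axis m 1 :: real^'n) $ k) = (\<Sum>k\<in>UNIV. if k = m then r * a m else 0)"
    by (rule sum.cong) (auto simp: axis_def)
  then show ?thesis by simp
qed

private lemma jet:
  assumes "p \<in> V"
  obtains u r where "u \<in> fields V" "r > 0" "u 0 = p" "xderiv u 0 = r *\<^sub>R axis k 1"
  by (rule field_with_jets[OF V assms assms], rule that)

private lemma smooth_linear_along:
  "u \<in> fields V \<Longrightarrow> (\<And>k. smooth_on V (A k)) \<Longrightarrow> smooth_on UNIV (\<lambda>x. \<Sum>k\<in>UNIV. A k (u x) * xderiv u x $ k)"
  by (intro smooth_on_sum smooth_on_mult open_UNIV smooth_along_field[OF V(1)] smooth_on_vec_nth smooth_on_xderiv field_smooth)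

text \<open>These are the coefficients of the first derivative and of the value of \<kappa> in B(f,
  k) + B(k, f) = 0. In the usual language they say that g is a symmetric metric with which b is
  compatible.\<close>

lemma local_skew:
  assumes p: "p \<in> V"
  shows "gl i j p = gl j i p" "pd k (gl i j) p = bl i j k p + bl j i k p"
proof -
  have X: "gl i j p = gl j i p" "pd k (gl j i) p = bl i j k p + bl j i k p" for i j
  proof -
    obtain u r where u: "u \<in> fields V" "r > 0" "u 0 = p" "xderiv u 0 = r *\<^sub>R axis k 1" by (rule jet[OF p])
    define B where "B i j x = (\<Sum>k\<in>UNIV. bl i j k (u x) * xderiv u x $ k)" for i j x
    have sB: "smooth_on UNIV (B i j)" for i j unfolding B_def by (rule smooth_linear_along[OF u(1) smooth_bl])
    have sg: "smooth_on UNIV (\<lambda>x. gl i j (u x))" for i j by (rule smooth_along_field[OF V(1) u(1) smooth_gl])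
    have main: "integral UNIV (\<lambda>x. \<phi> x * xderiv \<kappa> x * gl i j (u x) + \<phi> x * xderiv (xderiv \<kappa>) x * 0 + xderiv \<phi> x * xderiv \<kappa> x * 0
        + xderiv \<phi> x * \<kappa> x * gl j i (u x) + xderiv (xderiv \<phi>) x * \<kappa> x * 0 + \<phi> x * \<kappa> x * (B i j x + B j i x)) = 0"
      if \<phi>: "smooth_on UNIV \<phi>" and \<kappa>: "smooth_on UNIV \<kappa>" and \<phi>0: "\<And>x. \<bar>x\<bar> > 1 \<Longrightarrow> \<phi> x = 0" and \<kappa>0: "\<And>x. \<bar>x\<bar> > 1 \<Longrightarrow> \<kappa> x = 0" for \<phi> \<kappa>
    proof -
      let ?f = "\<lambda>x. \<phi> x *\<^sub>R low_vec \<eta> i" and ?k = "\<lambda>x. \<kappa> x *\<^sub>R low_vec \<eta> j"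
      have ft: "?f \<in> test_functions" "?k \<in> test_functions"
        by (rule axis_test_function[OF \<phi> \<phi>0], assumption, rule axis_test_function[OF \<kappa> \<kappa>0])
      let ?P = "\<lambda>\<phi> \<kappa> i j x. \<phi> x * xderiv \<kappa> x * gl i j (u x) + \<phi> x * \<kappa> x * B i j x"
      have cP: "cont_cs (?P \<phi> \<kappa> i j)"
        if "smooth_on UNIV \<phi>" "smooth_on UNIV \<kappa>" "\<And>x. \<bar>x\<bar> > 1 \<Longrightarrow> \<phi> x = 0" for \<phi> \<kappa> i j
      proof (rule cont_csI[where R=1])
        show "continuous_on UNIV (?P \<phi> \<kappa> i j)"
          by (intro smooth_on_continuous smooth_on_add smooth_on_mult open_UNIV smooth_on_xderiv that sB sg)
      qed (simp add: that(3))
      have "bil g b 0 \<epsilon> w u ?f ?k = - bil g b 0 \<epsilon> w u ?k ?f"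
        using skew u(1) ft unfolding skew_form_def by blast
      then have "bil g b 0 \<epsilon> w u ?f ?k + bil g b 0 \<epsilon> w u ?k ?f = 0" by linarith
      then have e1: "integral UNIV (?P \<phi> \<kappa> i j) + integral UNIV (?P \<kappa> \<phi> j i) = 0"
        by (simp only: bil_local[OF \<phi>] bil_local[OF \<kappa>] B_def)
      have e2: "integral UNIV (\<lambda>x. ?P \<phi> \<kappa> i j x + ?P \<kappa> \<phi> j i x) = integral UNIV (?P \<phi> \<kappa> i j) + integral UNIV (?P \<kappa> \<phi> j i)"
        by (rule integral_cs_add[OF cP[OF \<phi> \<kappa> \<phi>0] cP[OF \<kappa> \<phi> \<kappa>0]])
      have "integral UNIV (\<lambda>x. \<phi> x * xderiv \<kappa> x * gl i j (u x) + \<phi> x * xderiv (xderiv \<kappa>) x * 0 + xderiv \<phi> x * xderiv \<kappa> x * 0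
        + xderiv \<phi> x * \<kappa> x * gl j i (u x) + xderiv (xderiv \<phi>) x * \<kappa> x * 0 + \<phi> x * \<kappa> x * (B i j x + B j i x))
        = integral UNIV (\<lambda>x. ?P \<phi> \<kappa> i j x + ?P \<kappa> \<phi> j i x)"
        by (rule integral_cong) (simp add: algebra_simps)
      from trans[OF this trans[OF e2 e1]] show ?thesis .
    qed
    note s0 = smooth_on_const[OF open_UNIV, of "0::real"]
    note s = smooth_on_add[OF open_UNIV sB[of i j] sB[of j i]] sg[of i j] sg[of j i] s0 s0 s0
    have x0: "xderiv (\<lambda>x. 0::real) = (\<lambda>x. 0)" by (rule ext, rule xderiv_eqI) simp
    have "gl i j (u 0) - xderiv (\<lambda>x. 0) 0 - gl j i (u 0) + 2 * xderiv (\<lambda>x. 0) 0 = 0"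
      by (rule extract_coefficients(2)[OF s main])
    then show "gl i j p = gl j i p" by (simp add: x0 u(3))
    have "B i j 0 + B j i 0 - xderiv (\<lambda>x. gl j i (u x)) 0 + xderiv (xderiv (\<lambda>x. 0)) 0 = 0"
      by (rule extract_coefficients(3)[OF s main])
    then have "B i j 0 + B j i 0 - xderiv (\<lambda>x. gl j i (u x)) 0 = 0" by (simp add: x0)
    then have "r * (bl i j k p + bl j i k p - pd k (gl j i) p) = 0"
      unfolding xderiv_along_field[OF u(1) smooth_gl] B_def u(3,4) sum_axis by (simp add: algebra_simps)
    then show "pd k (gl j i) p = bl i j k p + bl j i k p" using u(2) by simp
  qed
  show "gl i j p = gl j i p" by (rule X(1))
  show "pd k (gl i j) p = bl i j k p + bl j i k p" using X(2)[where i=j and j=i] by (simp add: add.commute)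
qed

private lemma bil_derivative:
  assumes u: "u \<in> fields V"
    and \<phi>: "smooth_on UNIV \<phi>" and \<phi>0: "\<And>x. \<bar>x\<bar> > R \<Longrightarrow> \<phi> x = 0" and \<theta>: "smooth_on UNIV \<theta>"
    and \<kappa>: "smooth_on UNIV \<kappa>" and \<kappa>0: "\<And>x. \<bar>x\<bar> > R \<Longrightarrow> \<kappa> x = 0"
  shows "((\<lambda>t. bil g b 0 \<epsilon> w (\<lambda>x. u x + t *\<^sub>R eta_dx \<eta> (\<lambda>x. \<kappa> x *\<^sub>R low_vec \<eta> m) x) (\<lambda>x. \<phi> x *\<^sub>R low_vec \<eta> i) (\<lambda>x. \<theta> x *\<^sub>R low_vec \<eta> j))
    has_real_derivative integral UNIV (\<lambda>x. \<phi> x * xderiv \<theta> x * (xderiv \<kappa> x * pd m (gl i j) (u x))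
      + \<phi> x * \<theta> x * (xderiv \<kappa> x * (\<Sum>k\<in>UNIV. pd m (bl i j k) (u x) * xderiv u x $ k) + xderiv (xderiv \<kappa>) x * bl i j m (u x)))) (at 0)"
proof -
  have \<sigma>: "smooth_on UNIV (xderiv \<kappa>)" by (rule smooth_on_xderiv[OF \<kappa>])
  have \<sigma>0: "xderiv \<kappa> x = 0" if "\<bar>x\<bar> > R" for x by (rule xderiv_zero_outside[OF \<kappa>0 that])
  define v where "v = (\<lambda>x. xderiv \<kappa> x *\<^sub>R axis m 1 :: real^'n)"
  have vt: "v \<in> test_functions" unfolding v_def by (rule axis_test_function[OF \<sigma> \<sigma>0])
  obtain r where r: "r > 0" "\<And>t. \<bar>t\<bar> < r \<Longrightarrow> (\<lambda>x. u x + t *\<^sub>R v x) \<in> fields V"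
    by (rule field_variation1[OF V(1) u vt], rule that; blast)
  have a: "smooth_on UNIV (\<lambda>x. \<phi> x * xderiv \<theta> x)" "smooth_on UNIV (\<lambda>x. \<phi> x * \<theta> x)"
    by (intro smooth_on_mult open_UNIV \<phi> \<theta> smooth_on_xderiv)+
  have a0: "\<phi> x * xderiv \<theta> x = 0" "\<phi> x * \<theta> x = 0" if "\<bar>x\<bar> > R" for x using \<phi>0[OF that] by simp_all
  let ?A = "\<lambda>u x. \<phi> x * xderiv \<theta> x * gl i j (u x)"
  let ?B = "\<lambda>u x. \<phi> x * \<theta> x * (\<Sum>k\<in>UNIV. bl i j k (u x) * xderiv u x $ k)"
  have cs: "cont_cs (\<lambda>x. \<phi> x * xderiv \<theta> x * G x)" "cont_cs (\<lambda>x. \<phi> x * \<theta> x * G x)" if "smooth_on UNIV G" for G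
    by (rule cont_csI[where R=R], intro smooth_on_continuous smooth_on_mult open_UNIV that a, simp add: a0)+
  have split: "bil g b 0 \<epsilon> w u (\<lambda>x. \<phi> x *\<^sub>R low_vec \<eta> i) (\<lambda>x. \<theta> x *\<^sub>R low_vec \<eta> j) = integral UNIV (?A u) + integral UNIV (?B u)"
    if u: "u \<in> fields V" for u
    unfolding bil_local[OF \<theta>]
    by (rule integral_cs_add[OF cs(1)[OF smooth_along_field[OF V(1) u smooth_gl]] cs(2)[OF smooth_linear_along[OF u smooth_bl]]])
  note d = coefficient_derivative0[OF V(1) u a(1) a0(1) \<sigma> \<sigma>0 smooth_gl, where m=m]
    coefficient_derivative1[OF V(1) u a(2) a0(2) \<sigma> \<sigma>0 smooth_bl, where m=m]
  have "((\<lambda>t. integral UNIV (?A (\<lambda>x. u x + t *\<^sub>R v x)) + integral UNIV (?B (\<lambda>x. u x + t *\<^sub>R v x))) has_real_derivative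
     integral UNIV (\<lambda>x. \<phi> x * xderiv \<theta> x * (xderiv \<kappa> x * pd m (gl i j) (u x)))
     + integral UNIV (\<lambda>x. \<phi> x * \<theta> x * (xderiv \<kappa> x * (\<Sum>k\<in>UNIV. pd m (bl i j k) (u x) * xderiv u x $ k) + xderiv (xderiv \<kappa>) x * bl i j m (u x)))) (at 0)"
    unfolding v_def by (rule DERIV_add[OF d])
  then have "((\<lambda>t. bil g b 0 \<epsilon> w (\<lambda>x. u x + t *\<^sub>R v x) (\<lambda>x. \<phi> x *\<^sub>R low_vec \<eta> i) (\<lambda>x. \<theta> x *\<^sub>R low_vec \<eta> j)) has_real_derivative
     integral UNIV (\<lambda>x. \<phi> x * xderiv \<theta> x * (xderiv \<kappa> x * pd m (gl i j) (u x)))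
     + integral UNIV (\<lambda>x. \<phi> x * \<theta> x * (xderiv \<kappa> x * (\<Sum>k\<in>UNIV. pd m (bl i j k) (u x) * xderiv u x $ k) + xderiv (xderiv \<kappa>) x * bl i j m (u x)))) (at 0)"
  proof (rule has_field_derivative_transform_within_open[where S="{-r<..<r}"])
    fix t assume "t \<in> {-r<..<r}"
    then show "integral UNIV (?A (\<lambda>x. u x + t *\<^sub>R v x)) + integral UNIV (?B (\<lambda>x. u x + t *\<^sub>R v x))
      = bil g b 0 \<epsilon> w (\<lambda>x. u x + t *\<^sub>R v x) (\<lambda>x. \<phi> x *\<^sub>R low_vec \<eta> i) (\<lambda>x. \<theta> x *\<^sub>R low_vec \<eta> j)"
      by (intro split[symmetric] r(2)) auto
  qed (use r in auto)
  moreover have "integral UNIV (\<lambda>x. \<phi> x * xderiv \<theta> x * (xderiv \<kappa> x * pd m (gl i j) (u x))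
      + \<phi> x * \<theta> x * (xderiv \<kappa> x * (\<Sum>k\<in>UNIV. pd m (bl i j k) (u x) * xderiv u x $ k) + xderiv (xderiv \<kappa>) x * bl i j m (u x)))
    = integral UNIV (\<lambda>x. \<phi> x * xderiv \<theta> x * (xderiv \<kappa> x * pd m (gl i j) (u x)))
     + integral UNIV (\<lambda>x. \<phi> x * \<theta> x * (xderiv \<kappa> x * (\<Sum>k\<in>UNIV. pd m (bl i j k) (u x) * xderiv u x $ k) + xderiv (xderiv \<kappa>) x * bl i j m (u x)))"
    by (rule integral_cs_add)
       (intro cs smooth_on_add smooth_on_mult open_UNIV \<sigma> smooth_on_xderiv[OF \<sigma>] smooth_along_field[OF V(1) u] pd_smooth_on smooth_gl smooth_bl smooth_linear_along[OF u])+
  ultimately show ?thesis by (simp only: eta_dx_low_vec[OF \<eta>(2) \<kappa>] v_def)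
qed

text \<open>Of the three arguments in the closedness condition, the one in the middle is taken
  constant on the supports of the other two. Its induced variation vanishes there, and what remains
  is bilinear in \<phi> and \<kappa>, the shape that \<open>extract_coefficients\<close>
  handles.\<close>

lemma local_closed:
  assumes p: "p \<in> V"
  shows "bl i j m p - pd i (gl j m) p + bl j m i p = 0"
    "pd m (bl i j k) p - pd k (pd i (gl j m)) p - pd i (bl j m k) p + 2 * pd k (bl j m i) p = 0"
proof -
  obtain u r where u: "u \<in> fields V" "r > 0" "u 0 = p" "xderiv u 0 = r *\<^sub>R axis k 1" by (rule jet[OF p])
  define N where "N i j m x = (\<Sum>k\<in>UNIV. pd m (bl i j k) (u x) * xderiv u x $ k)" for i j m x
  have sN: "smooth_on UNIV (N i j m)" for i j m unfolding N_def by (rule smooth_linear_along[OF u(1) pd_smooth_on[OF smooth_bl]])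
  have sb: "smooth_on UNIV (\<lambda>x. bl i j k (u x))" for i j k by (rule smooth_along_field[OF V(1) u(1) smooth_bl])
  have sg: "smooth_on UNIV (\<lambda>x. pd m (gl i j) (u x))" for i j m by (rule smooth_along_field[OF V(1) u(1) pd_smooth_on[OF smooth_gl]])
  \<comment> \<open>The rescaled plateau equals 1 up to distance 2, which covers the supports of
    \<phi> and \<kappa> in the unit interval with some room for derivatives.\<close>
  define \<theta> where "\<theta> x = plateau (1 / 2 * x + 0)" for x
  have \<theta>: "smooth_on UNIV \<theta>" unfolding \<theta>_def by (rule smooth_on_affine_compose[OF plateau_smooth])
  have \<theta>0: "\<theta> x = 0" if "\<bar>x\<bar> > 4" for x unfolding \<theta>_def by (rule plateau_0) (use that in arith)
  have \<theta>1: "\<theta> x = 1" if "\<bar>x\<bar> < 2" for x unfolding \<theta>_def by (rule plateau_1) (use that in arith)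
  have c0: "xderiv (\<lambda>x. c::real) = (\<lambda>x. 0)" for c by (rule ext, rule xderiv_eqI) simp
  have \<theta>': "xderiv \<theta> x = 0" if "\<bar>x\<bar> < 2" for x
    using xderiv_cong_open[of "{-2<..<2}" x \<theta> "\<lambda>x. 1"] that \<theta>1 by (simp add: c0 abs_less_iff smooth_on_const)
  have main: "integral UNIV (\<lambda>x. \<phi> x * xderiv \<kappa> x * N i j m x + \<phi> x * xderiv (xderiv \<kappa>) x * bl i j m (u x) + xderiv \<phi> x * xderiv \<kappa> x * pd i (gl j m) (u x)
        + xderiv \<phi> x * \<kappa> x * N j m i x + xderiv (xderiv \<phi>) x * \<kappa> x * bl j m i (u x) + \<phi> x * \<kappa> x * 0) = 0"
    if \<phi>: "smooth_on UNIV \<phi>" and \<kappa>: "smooth_on UNIV \<kappa>" and \<phi>1: "\<And>x. \<bar>x\<bar> > 1 \<Longrightarrow> \<phi> x = 0" and \<kappa>1: "\<And>x. \<bar>x\<bar> > 1 \<Longrightarrow> \<kappa> x = 0" for \<phi> \<kappa>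
  proof -
    have \<phi>0: "\<phi> x = 0" and \<kappa>0: "\<kappa> x = 0" if "\<bar>x\<bar> > 4" for x using that by (auto intro: \<phi>1 \<kappa>1)
    let ?f = "\<lambda>x. \<phi> x *\<^sub>R low_vec \<eta> i" and ?h = "\<lambda>x. \<theta> x *\<^sub>R low_vec \<eta> j" and ?k = "\<lambda>x. \<kappa> x *\<^sub>R low_vec \<eta> m"
    have f: "?f \<in> test_functions" by (rule axis_test_function[OF \<phi> \<phi>0])
    have h: "?h \<in> test_functions" by (rule axis_test_function[OF \<theta> \<theta>0])
    have k: "?k \<in> test_functions" by (rule axis_test_function[OF \<kappa> \<kappa>0])
    obtain D1 D2 D3 where D:
        "((\<lambda>t. bil g b 0 \<epsilon> w (\<lambda>x. u x + t *\<^sub>R eta_dx \<eta> ?k x) ?f ?h) has_real_derivative D1) (at 0)"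
        "((\<lambda>t. bil g b 0 \<epsilon> w (\<lambda>x. u x + t *\<^sub>R eta_dx \<eta> ?f x) ?h ?k) has_real_derivative D2) (at 0)"
        "((\<lambda>t. bil g b 0 \<epsilon> w (\<lambda>x. u x + t *\<^sub>R eta_dx \<eta> ?h x) ?k ?f) has_real_derivative D3) (at 0)" "D1 + D2 + D3 = 0"
        using closed u(1) f h k unfolding closed_form_def by blast
    define P where "P \<phi> \<theta> \<kappa> i j m x = \<phi> x * xderiv \<theta> x * (xderiv \<kappa> x * pd m (gl i j) (u x))
      + \<phi> x * \<theta> x * (xderiv \<kappa> x * N i j m x + xderiv (xderiv \<kappa>) x * bl i j m (u x))" for \<phi> \<theta> \<kappa> i j m x
    have cP: "cont_cs (P \<phi> \<theta> \<kappa> i j m)" if "smooth_on UNIV \<phi>" "smooth_on UNIV \<theta>" "smooth_on UNIV \<kappa>" "\<And>x. \<bar>x\<bar> > 4 \<Longrightarrow> \<phi> x = 0" for \<phi> \<theta> \<kappa> i j m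
    proof (rule cont_csI[where R=4])
      show "continuous_on UNIV (P \<phi> \<theta> \<kappa> i j m)"
        unfolding P_def
        by (intro smooth_on_continuous smooth_on_add smooth_on_mult open_UNIV smooth_on_xderiv that sg sN sb)
    qed (simp add: P_def that(4))
    have D': "D1 = integral UNIV (P \<phi> \<theta> \<kappa> i j m)" "D2 = integral UNIV (P \<theta> \<kappa> \<phi> j m i)" "D3 = integral UNIV (P \<kappa> \<phi> \<theta> m i j)"
      using DERIV_unique[OF D(1) bil_derivative[OF u(1) \<phi> \<phi>0 \<theta> \<kappa> \<kappa>0]]
        DERIV_unique[OF D(2) bil_derivative[OF u(1) \<theta> \<theta>0 \<kappa> \<phi> \<phi>0]]
        DERIV_unique[OF D(3) bil_derivative[OF u(1) \<kappa> \<kappa>0 \<phi> \<theta> \<theta>0]]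
      by (simp_all add: P_def[abs_def] N_def)
    have "integral UNIV (\<lambda>x. P \<phi> \<theta> \<kappa> i j m x + P \<theta> \<kappa> \<phi> j m i x + P \<kappa> \<phi> \<theta> m i j x) = 0"
      using D(4) integral_cs_add[OF cont_cs_add[OF cP[OF \<phi> \<theta> \<kappa>] cP[OF \<theta> \<kappa> \<phi>]] cP[OF \<kappa> \<phi> \<theta>], of i j m j m i m i j]
        integral_cs_add[OF cP[OF \<phi> \<theta> \<kappa>] cP[OF \<theta> \<kappa> \<phi>], of i j m j m i]
      by (simp add: D' \<phi>0 \<theta>0 \<kappa>0)
    moreover have "P \<phi> \<theta> \<kappa> i j m x + P \<theta> \<kappa> \<phi> j m i x + P \<kappa> \<phi> \<theta> m i j x
      = \<phi> x * xderiv \<kappa> x * N i j m x + \<phi> x * xderiv (xderiv \<kappa>) x * bl i j m (u x) + xderiv \<phi> x * xderiv \<kappa> x * pd i (gl j m) (u x)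
        + xderiv \<phi> x * \<kappa> x * N j m i x + xderiv (xderiv \<phi>) x * \<kappa> x * bl j m i (u x) + \<phi> x * \<kappa> x * 0" for x
    proof (cases "\<bar>x\<bar> > 1")
      case True
      have "xderiv \<phi> x = 0" by (rule xderiv_zero_outside[OF \<phi>1 True])
      then show ?thesis using True by (simp add: P_def \<phi>1 \<kappa>1)
    next
      case False
      have "xderiv (xderiv \<theta>) x = 0"
      proof -
        have "xderiv (xderiv \<theta>) x = xderiv (\<lambda>x. 0) x"
          by (rule xderiv_cong_open[of "{-2<..<2}"]) (use False in \<open>auto simp: smooth_on_const intro!: \<theta>'\<close>)
        then show ?thesis by (simp add: c0)
      qed
      then show ?thesis using False by (simp add: P_def \<theta>1 \<theta>' algebra_simps)
    qed
    ultimately show ?thesis by simp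
  qed
  note s = smooth_on_const[OF open_UNIV, of "0::real"] sN[of i j m] sN[of j m i] sb[of i j m] sb[of j m i] sg[of i j m]
  have "bl i j m (u 0) - pd i (gl j m) (u 0) + bl j m i (u 0) = 0"
    by (rule extract_coefficients(1)[OF s main])
  then show "bl i j m p - pd i (gl j m) p + bl j m i p = 0" by (simp only: u(3))
  have "r * (pd m (bl i j k) p - pd k (pd i (gl j m)) p - pd i (bl j m k) p + 2 * pd k (bl j m i) p) = 0"
  proof -
    have "N i j m 0 - xderiv (\<lambda>x. pd i (gl j m) (u x)) 0 - N j m i 0 + 2 * xderiv (\<lambda>x. bl j m i (u x)) 0 = 0"
      by (rule extract_coefficients(2)[OF s main])
    moreover have "N i j m 0 = r * pd m (bl i j k) p" for i j m by (simp only: N_def u(3,4) sum_axis)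
    moreover have "xderiv (\<lambda>x. pd i (gl j m) (u x)) 0 = r * pd k (pd i (gl j m)) p"
      by (simp only: xderiv_along_field[OF u(1) pd_smooth_on[OF smooth_gl]] u(3,4) sum_axis)
    moreover have "xderiv (\<lambda>x. bl j m i (u x)) 0 = r * pd k (bl j m i) p"
      by (simp only: xderiv_along_field[OF u(1) smooth_bl] u(3,4) sum_axis)
    ultimately show ?thesis by (simp only: right_diff_distrib distrib_left mult.left_commute)
  qed
  then show "pd m (bl i j k) p - pd k (pd i (gl j m)) p - pd i (bl j m k) p + 2 * pd k (bl j m i) p = 0" using u(2) by simp
qed

text \<open>Skewness and closedness both express \<open>pd k (gl j i) p\<close> as a sum of two
  coefficients, and the two sums share \<open>bl j i k p\<close>.\<close>

lemma local_symmetric: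
  assumes p: "p \<in> V"
  shows "bl i j k p = bl k j i p"
  using local_closed(1)[OF p, of k j i] local_skew(2)[OF p, of k j i] by simp

text \<open>The curvature-like defect \<open>R\<close> is totally skew in its four indices, so the Bianchi identity kills it.\<close>

lemma local_curl_free:
  assumes p: "p \<in> V"
  shows "pd m (bl i j k) p = pd k (bl i j m) p"
proof -
  define R where "R i j m k = pd m (bl i j k) p - pd k (bl i j m) p" for i j m k
  have sym: "pd l (bl i j k) p = pd l (bl k j i) p" for i j k l
    by (rule pd_cong[OF V(1) p]) (rule local_symmetric)
  have gb: "pd l (pd k (gl i j)) p = pd l (bl i j k) p + pd l (bl j i k) p" for i j k l
  proof -
    have "pd l (pd k (gl i j)) p = pd l (\<lambda>z. bl i j k z + bl j i k z) p"
      by (rule pd_cong[OF V(1) p local_skew(2)])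
    then show ?thesis by (simp only: pd_add[OF smooth_bl smooth_bl p])
  qed
  \<comment> \<open>The second closedness condition, with second derivatives of the metric
    eliminated by \<open>gb\<close>, is invariance of R under cyclic permutation of its first three
    indices.\<close>
  have cyc: "R i j m k = R j m i k" for i j m k
    using local_closed(2)[OF p, of m i j k] sym[of k m j i] unfolding R_def gb by linarith
  have s1: "R i j m k = - R i j k m" for i j m k by (simp add: R_def)
  have s2: "R i j m k = - R j i m k" for i j m k
    using pd_commute[OF V(1) smooth_gl p, of m k i j] unfolding gb by (simp add: R_def)
  have bianchi: "R i j m k + R m j k i + R k j i m = 0"
    unfolding R_def using sym[of m i j k] sym[of k i j m] sym[of i m j k] by simp
  \<comment> \<open>By the symmetries of R the three summands of \<open>bianchi\<close> coincide, so
    three times R is zero.\<close>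
  have "R m j k i = R i j m k" "R k j i m = R i j m k"
    using cyc s1 s2 by metis+
  then show ?thesis using bianchi by (simp add: R_def)
qed

lemma local_potentials:
  "\<exists>\<Phi>. (\<forall>j. smooth_on V (\<Phi> j)) \<and> (\<forall>p\<in>V. \<forall>i j k. gl i j p = pd i (\<Phi> j) p + pd j (\<Phi> i) p \<and> bl i j k p = pd i (pd k (\<Phi> j)) p)"
proof -
  have "\<exists>\<Phi>. smooth_on V \<Phi> \<and> (\<forall>p\<in>V. \<forall>i k. pd i (pd k \<Phi>) p = bl i j k p)" for j
    by (rule hessian_potential[OF V smooth_bl local_symmetric local_curl_free])
  then have "\<forall>j. \<exists>\<Phi>. smooth_on V \<Phi> \<and> (\<forall>p\<in>V. \<forall>i k. pd i (pd k \<Phi>) p = bl i j k p)" ..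
  then obtain \<Phi> where \<Phi>: "\<And>j. smooth_on V (\<Phi> j)" "\<And>j p i k. p \<in> V \<Longrightarrow> pd i (pd k (\<Phi> j)) p = bl i j k p"
    by metis
  \<comment> \<open>The defect of the potentials as a representation of the metric. Its gradient
    vanishes because the metric derivative is a sum of two coefficients b, each already a Hessian
    entry.\<close>
  define C where "C i j p = gl i j p + (- 1) * (pd i (\<Phi> j) p + pd j (\<Phi> i) p)" for i j p
  have sC: "smooth_on V (C i j)" for i j
    unfolding C_def by (intro smooth_on_add smooth_on_mult smooth_on_const smooth_gl pd_smooth_on \<Phi> V(1))
  have "pd k (C i j) p = 0" if p: "p \<in> V" for i j k p
  proof -
    have s: "smooth_on V (\<lambda>p. pd i (\<Phi> j) p + pd j (\<Phi> i) p)" by (intro smooth_on_add pd_smooth_on \<Phi> V(1))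
    have "pd k (C i j) p = pd k (gl i j) p + pd k (\<lambda>p. (- 1) * (pd i (\<Phi> j) p + pd j (\<Phi> i) p)) p"
      unfolding C_def[abs_def] by (rule pd_add[OF smooth_gl smooth_on_mult[OF V(1) smooth_on_const[OF V(1)] s] p])
    also have "pd k (\<lambda>p. (- 1) * (pd i (\<Phi> j) p + pd j (\<Phi> i) p)) p = (- 1) * pd k (\<lambda>p. pd i (\<Phi> j) p + pd j (\<Phi> i) p) p"
      using pd_linear_combination[of "{()}" V "\<lambda>_ p. pd i (\<Phi> j) p + pd j (\<Phi> i) p" p k "\<lambda>_. - 1"] s p by simp
    also have "pd k (\<lambda>p. pd i (\<Phi> j) p + pd j (\<Phi> i) p) p = bl k j i p + bl k i j p"
      by (simp add: pd_add[OF pd_smooth_on[OF \<Phi>(1)] pd_smooth_on[OF \<Phi>(1)] p] \<Phi>(2)[OF p])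
    also have "\<dots> = bl i j k p + bl j i k p" using local_symmetric[OF p] by simp
    finally show ?thesis by (simp add: local_skew(2)[OF p])
  qed
  then have "(C i j has_derivative (\<lambda>v. 0)) (at p)" if "p \<in> V" for i j p
    using has_derivative_pd[OF sC that, of i j] that by simp
  then have "\<exists>c. \<forall>p\<in>V. C i j p = c" for i j
    using has_derivative_zero_constant[OF V(2), of "C i j"] by (metis has_derivative_at_withinI)
  then obtain c where c: "\<And>i j p. p \<in> V \<Longrightarrow> C i j p = c i j" by metis
  \<comment> \<open>A linear correction with half of the constant defect as gradient; as the defect
    is symmetric, the two orders of the indices together restore all of it, and Hessians are
    unaffected.\<close>
  define l where "l j z = (\<Sum>a\<in>UNIV. (c a j / 2) * z $ a)" for j and z :: "real^'n"
  have sl: "smooth_on V (l j)" for j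
    unfolding l_def by (intro smooth_on_sum smooth_on_mult smooth_on_const smooth_on_vec_nth smooth_on_id V(1))
  have pl: "pd i (l j) p = c i j / 2" for i j p
  proof -
    have "(l j has_derivative (\<lambda>z. l j z)) (at p)"
      unfolding l_def by (rule bounded_linear_imp_has_derivative)
        (intro bounded_linear_sum bounded_linear_const_mult bounded_linear_vec_nth)
    from pd_eqI[OF this, of i] have "pd i (l j) p = (\<Sum>a\<in>UNIV. if a = i then c i j / 2 else 0)"
      unfolding l_def by (simp add: axis_def if_distrib[of "\<lambda>x. _ * x"] cong: if_cong)
    then show ?thesis by simp
  qed
  define \<Psi> where "\<Psi> j z = \<Phi> j z + l j z" for j z
  have s\<Psi>: "smooth_on V (\<Psi> j)" for j unfolding \<Psi>_def by (intro smooth_on_add V(1) \<Phi> sl)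
  have p\<Psi>: "pd k (\<Psi> j) p = pd k (\<Phi> j) p + c k j / 2" if "p \<in> V" for j k p
    unfolding \<Psi>_def[abs_def] pd_add[OF \<Phi>(1) sl that] pl ..
  have pp\<Psi>: "pd i (pd k (\<Psi> j)) p = bl i j k p" if p: "p \<in> V" for i j k p
  proof -
    have "pd i (pd k (\<Psi> j)) p = pd i (\<lambda>z. pd k (\<Phi> j) z + c k j / 2) p"
      by (rule pd_cong[OF V(1) p p\<Psi>])
    also have "\<dots> = pd i (pd k (\<Phi> j)) p + pd i (\<lambda>z. c k j / 2) p"
      by (rule pd_add[OF pd_smooth_on[OF \<Phi>(1)] smooth_on_const[OF V(1)] p])
    also have "pd i (\<lambda>z. c k j / 2) p = 0" using pd_eqI[OF has_derivative_const[of "c k j / 2" "at p"], of i] by simp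
    finally show ?thesis by (simp add: \<Phi>(2)[OF p])
  qed
  have "gl i j p = pd i (\<Psi> j) p + pd j (\<Psi> i) p" if p: "p \<in> V" for i j p
  proof -
    have "C i j p = C j i p" unfolding C_def using local_skew(1)[OF p, of i j] by simp
    then show ?thesis using c[OF p, of i j] c[OF p, of j i] by (simp add: p\<Psi>[OF p] C_def)
  qed
  then show ?thesis using s\<Psi> pp\<Psi> by (intro exI[of _ \<Psi>]) simp
qed

end


section \<open>The bracket as a bilinear form\<close>

text \<open>Displays the nonlocal term as a contraction with the kernel, the only way in which the
  two factors w enter together.\<close>

lemma contract_kernel:
  fixes P :: "'i \<Rightarrow> 'k \<Rightarrow> real"
  shows "(\<Sum>\<alpha>\<in>A. e \<alpha> * (\<Sum>k\<in>K. P \<alpha> k * a k) * (\<Sum>j\<in>J. \<Sum>s\<in>S. Q \<alpha> j s * c j s))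
    = (\<Sum>k\<in>K. \<Sum>j\<in>J. \<Sum>s\<in>S. (\<Sum>\<alpha>\<in>A. e \<alpha> * P \<alpha> k * Q \<alpha> j s) * (a k * c j s))"
proof -
  let ?t = "\<lambda>\<alpha> k j s. e \<alpha> * P \<alpha> k * Q \<alpha> j s * (a k * c j s)"
  have "(\<Sum>\<alpha>\<in>A. e \<alpha> * (\<Sum>k\<in>K. P \<alpha> k * a k) * (\<Sum>j\<in>J. \<Sum>s\<in>S. Q \<alpha> j s * c j s)) = (\<Sum>\<alpha>\<in>A. \<Sum>k\<in>K. \<Sum>j\<in>J. \<Sum>s\<in>S. ?t \<alpha> k j s)"
  proof (rule sum.cong[OF refl])
    fix \<alpha>
    have "e \<alpha> * (\<Sum>k\<in>K. P \<alpha> k * a k) * X = (\<Sum>k\<in>K. e \<alpha> * P \<alpha> k * a k * X)" for X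
      by (simp add: sum_distrib_left sum_distrib_right mult_ac)
    from this[of "\<Sum>j\<in>J. \<Sum>s\<in>S. Q \<alpha> j s * c j s"] show "e \<alpha> * (\<Sum>k\<in>K. P \<alpha> k * a k) * (\<Sum>j\<in>J. \<Sum>s\<in>S. Q \<alpha> j s * c j s) = (\<Sum>k\<in>K. \<Sum>j\<in>J. \<Sum>s\<in>S. ?t \<alpha> k j s)"
      by (rule trans) (simp add: sum_distrib_left mult_ac)
  qed
  also have "\<dots> = (\<Sum>k\<in>K. \<Sum>\<alpha>\<in>A. \<Sum>j\<in>J. \<Sum>s\<in>S. ?t \<alpha> k j s)" by (rule sum.swap)
  also have "\<dots> = (\<Sum>k\<in>K. \<Sum>j\<in>J. \<Sum>\<alpha>\<in>A. \<Sum>s\<in>S. ?t \<alpha> k j s)" by (rule sum.cong[OF refl], rule sum.swap)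
  also have "\<dots> = (\<Sum>k\<in>K. \<Sum>j\<in>J. \<Sum>s\<in>S. \<Sum>\<alpha>\<in>A. ?t \<alpha> k j s)"
    by (rule sum.cong[OF refl], rule sum.cong[OF refl], rule sum.swap)
  finally show ?thesis by (simp only: sum_distrib_right)
qed

context
  fixes V :: "(real^'n::finite) set" and u h :: "'n field"
  assumes V: "open V" and u: "u \<in> fields V" and h: "h \<in> test_functions"
begin

private lemma u_continuous: "continuous_on UNIV (\<lambda>y. xderiv u y $ s)"
  by (intro smooth_on_continuous smooth_on_vec_nth smooth_on_xderiv field_smooth[OF u] open_UNIV)

private lemma h_continuous: "continuous_on UNIV (\<lambda>y. h y $ j)" "continuous_on UNIV (\<lambda>y. xderiv h y $ j)"
  by (intro smooth_on_continuous smooth_on_vec_nth smooth_on_xderiv test_function_smooth[OF h] open_UNIV)+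

private lemma along: "smooth_on V A \<Longrightarrow> continuous_on UNIV (\<lambda>x. A (u x))" for A :: "real^'n \<Rightarrow> real"
  by (rule smooth_on_continuous[OF smooth_along_field[OF V u]])

private lemma nonlocal_density_cont_cs:
  assumes "\<And>j s. smooth_on V (\<lambda>z. w z $ j $ s)"
  shows "cont_cs (\<lambda>y. \<Sum>j\<in>UNIV. \<Sum>s\<in>UNIV. w (u y) $ j $ s * xderiv u y $ s * h y $ j)"
proof -
  obtain R where R: "\<And>x. \<bar>x\<bar> > R \<Longrightarrow> h x = 0" using test_functionE[OF h] by metis
  show ?thesis
    by (rule cont_csI[where R=R], intro continuous_on_sum continuous_on_mult along assms u_continuous h_continuous)
       (simp add: R)
qed

text \<open>For fixed x the outer factor is a constant that can be moved under \<open>dinv\<close>.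
  The operator then depends on w only through the two-point kernel at u(x) and u(y), so families
  with the same kernel give the same operator.\<close>

lemma nonlocal_operator_kernel:
  assumes w: "\<And>\<alpha> j s. \<alpha> \<in> {1..L} \<Longrightarrow> smooth_on V (\<lambda>z. w \<alpha> z $ j $ s)"
    and w': "\<And>\<alpha> j s. \<alpha> \<in> {1..L} \<Longrightarrow> smooth_on V (\<lambda>z. w' \<alpha> z $ j $ s)"
    and eq: "\<And>p q i k j s. p \<in> V \<Longrightarrow> q \<in> V \<Longrightarrow> (\<Sum>\<alpha>=1..L. \<epsilon> \<alpha> * w \<alpha> p $ i $ k * w \<alpha> q $ j $ s)
      = (\<Sum>\<alpha>=1..L. \<epsilon> \<alpha> * w' \<alpha> p $ i $ k * w' \<alpha> q $ j $ s)"
  shows "nonlocal_operator g b L \<epsilon> w u h x = nonlocal_operator g b L \<epsilon> w' u h x"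
proof -
  define K where "K w i y = (\<Sum>k\<in>UNIV. \<Sum>j\<in>UNIV. \<Sum>s\<in>UNIV. (\<Sum>\<alpha>=1..L. \<epsilon> \<alpha> * w \<alpha> (u x) $ i $ k * w \<alpha> (u y) $ j $ s)
     * (xderiv u x $ k * (xderiv u y $ s * h y $ j)))" for w :: "nat \<Rightarrow> real^'n \<Rightarrow> real^'n^'n" and i y
  have T: "(\<Sum>\<alpha>=1..L. \<epsilon> \<alpha> * (\<Sum>k\<in>UNIV. w \<alpha> (u x) $ i $ k * xderiv u x $ k)
         * dinv (\<lambda>y. \<Sum>j\<in>UNIV. \<Sum>s\<in>UNIV. w \<alpha> (u y) $ j $ s * xderiv u y $ s * h y $ j) x) = dinv (K w i) x"
    if w: "\<And>\<alpha> j s. \<alpha> \<in> {1..L} \<Longrightarrow> smooth_on V (\<lambda>z. w \<alpha> z $ j $ s)" for w i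
  proof -
    have "K w i y = (\<Sum>\<alpha>=1..L. (\<epsilon> \<alpha> * (\<Sum>k\<in>UNIV. w \<alpha> (u x) $ i $ k * xderiv u x $ k))
         * (\<Sum>j\<in>UNIV. \<Sum>s\<in>UNIV. w \<alpha> (u y) $ j $ s * xderiv u y $ s * h y $ j))" for y
      unfolding K_def contract_kernel[symmetric] by (simp only: mult.assoc)
    then have "dinv (K w i) x = dinv (\<lambda>y. \<Sum>\<alpha>=1..L. (\<epsilon> \<alpha> * (\<Sum>k\<in>UNIV. w \<alpha> (u x) $ i $ k * xderiv u x $ k))
         * (\<Sum>j\<in>UNIV. \<Sum>s\<in>UNIV. w \<alpha> (u y) $ j $ s * xderiv u y $ s * h y $ j)) x" by presburger
    also have "\<dots> = (\<Sum>\<alpha>=1..L. dinv (\<lambda>y. (\<epsilon> \<alpha> * (\<Sum>k\<in>UNIV. w \<alpha> (u x) $ i $ k * xderiv u x $ k))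
         * (\<Sum>j\<in>UNIV. \<Sum>s\<in>UNIV. w \<alpha> (u y) $ j $ s * xderiv u y $ s * h y $ j)) x)"
      by (intro dinv_sum finite_atLeastAtMost cont_cs_cmult nonlocal_density_cont_cs w)
    finally show ?thesis by (simp only: dinv_cmult)
  qed
  have "K w i y = K w' i y" for i y
    unfolding K_def by (simp only: eq[OF field_in[OF u] field_in[OF u]])
  then have "K w i = K w' i" for i by blast
  then show ?thesis by (simp only: nonlocal_operator_def T[OF w] T[OF w'])
qed

lemma bil_cont_cs:
  assumes f: "f \<in> test_functions"
    and g: "\<And>i j. smooth_on V (\<lambda>z. g z $ i $ j)" and b: "\<And>i j k. smooth_on V (\<lambda>z. b z $ i $ j $ k)"
    and w: "\<And>\<alpha> j s. \<alpha> \<in> {1..L} \<Longrightarrow> smooth_on V (\<lambda>z. w \<alpha> z $ j $ s)"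
  shows "cont_cs (\<lambda>x. f x \<bullet> nonlocal_operator g b L \<epsilon> w u h x)"
proof -
  obtain R where R: "\<And>x. \<bar>x\<bar> > R \<Longrightarrow> f x = 0" using test_functionE[OF f] by metis
  have fc: "continuous_on UNIV (\<lambda>x. f x $ i)" for i
    by (intro smooth_on_continuous smooth_on_vec_nth test_function_smooth[OF f] open_UNIV)
  show ?thesis
  proof (rule cont_csI[where R=R])
    show "continuous_on UNIV (\<lambda>x. f x \<bullet> nonlocal_operator g b L \<epsilon> w u h x)"
      unfolding inner_vec_def inner_real_def nonlocal_operator_def vec_lambda_beta
      by (intro continuous_on_sum continuous_on_add continuous_on_mult continuous_on_const fc along g b u_continuous h_continuous
          dinv_continuous nonlocal_density_cont_cs w)
  qed (simp add: R)
qed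

text \<open>The two forms have the same nonlocal tail, which drops out of the difference; hence the
  bound 0 in place of \<open>L\<close> on the left.\<close>

lemma bil_diff:
  assumes f: "f \<in> test_functions"
    and g: "\<And>i j. smooth_on V (\<lambda>z. g z $ i $ j)" "\<And>i j. smooth_on V (\<lambda>z. g' z $ i $ j)"
    and b: "\<And>i j k. smooth_on V (\<lambda>z. b z $ i $ j $ k)" "\<And>i j k. smooth_on V (\<lambda>z. b' z $ i $ j $ k)"
    and w: "\<And>\<alpha> j s. \<alpha> \<in> {1..L} \<Longrightarrow> smooth_on V (\<lambda>z. w \<alpha> z $ j $ s)"
  shows "bil (\<lambda>z. g z - g' z) (\<lambda>z. b z - b' z) 0 \<epsilon> w u f h = bil g b L \<epsilon> w u f h - bil g' b' L \<epsilon> w u f h"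
proof -
  have "nonlocal_operator (\<lambda>z. g z - g' z) (\<lambda>z. b z - b' z) 0 \<epsilon> w u h x = nonlocal_operator g b L \<epsilon> w u h x - nonlocal_operator g' b' L \<epsilon> w u h x" for x
    by (simp add: nonlocal_operator_def vec_eq_iff left_diff_distrib sum_subtractf sum.distrib)
  then have "f x \<bullet> nonlocal_operator (\<lambda>z. g z - g' z) (\<lambda>z. b z - b' z) 0 \<epsilon> w u h x
     = f x \<bullet> nonlocal_operator g b L \<epsilon> w u h x - f x \<bullet> nonlocal_operator g' b' L \<epsilon> w u h x" for x
    by (simp only: inner_diff_right)
  then show ?thesis
    unfolding bil_def by (simp only: integral_cs_diff[OF bil_cont_cs[OF f g(1) b(1) w] bil_cont_cs[OF f g(2) b(2) w]])
qed

end

section \<open>Compatible brackets are canonical\<close>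

lemma closed_skew_imp_canonical:
  fixes V :: "(real^'n::finite) set"
  assumes V: "open V" "convex V" and \<eta>: "transpose \<eta> = \<eta>" "det \<eta> \<noteq> 0"
    and g: "smooth_on V g" and b: "smooth_on V b" and w: "\<And>\<alpha>. \<alpha> \<in> {1..L} \<Longrightarrow> smooth_on V (w \<alpha>)"
    and closed: "closed_form V \<eta> (bil g b L \<epsilon> w)" and skew: "skew_form V (bil g b L \<epsilon> w)"
  shows "has_canonical_form V \<eta> L \<epsilon> (nonlocal_bracket g b L \<epsilon> w)"
proof -
  have "\<exists>\<psi>. (\<forall>\<alpha>\<in>{1..L}. smooth_on V (\<psi> \<alpha>)) \<and> (\<forall>p\<in>V. \<forall>q\<in>V. \<forall>i k j s.
    (\<Sum>\<alpha>=1..L. \<epsilon> \<alpha> * w \<alpha> p $ i $ k * w \<alpha> q $ j $ s)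
    = (\<Sum>\<alpha>=1..L. \<epsilon> \<alpha> * w_form \<eta> \<psi> \<alpha> p $ i $ k * w_form \<eta> \<psi> \<alpha> q $ j $ s))"
    by (rule nonlocal_potentials[OF V \<eta> w closed skew])
  then obtain \<psi> where \<psi>: "\<And>\<alpha>. \<alpha> \<in> {1..L} \<Longrightarrow> smooth_on V (\<psi> \<alpha>)"
    and eq: "\<And>p q i k j s. p \<in> V \<Longrightarrow> q \<in> V \<Longrightarrow> (\<Sum>\<alpha>=1..L. \<epsilon> \<alpha> * w \<alpha> p $ i $ k * w \<alpha> q $ j $ s)
      = (\<Sum>\<alpha>=1..L. \<epsilon> \<alpha> * w_form \<eta> \<psi> \<alpha> p $ i $ k * w_form \<eta> \<psi> \<alpha> q $ j $ s)"
    by blast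
  let ?w = "w_form \<eta> \<psi>" and ?z = "\<lambda>_. 0 :: real^'n"
  \<comment> \<open>The local coefficients that \<psi> alone would produce, with F = 0; subtracting
    them leaves a local form in which only F is unknown.\<close>
  define g0 where "g0 = g_form \<eta> L \<epsilon> ?z \<psi>"
  define b0 where "b0 = b_form \<eta> L \<epsilon> ?z \<psi>"
  have s0: "smooth_on V ?z" by (rule smooth_on_const[OF V(1)])
  have sw: "smooth_on V (\<lambda>z. w \<alpha> z $ j $ s)" "smooth_on V (\<lambda>z. ?w \<alpha> z $ j $ s)" if "\<alpha> \<in> {1..L}" for \<alpha> j s
    using that unfolding w_form_def vec_lambda_beta
    by (intro smooth_on_sum smooth_on_mult smooth_on_const smooth_on_vec_nth pd_smooth_on V(1) \<psi> w | assumption)+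
  have sg: "smooth_on V (\<lambda>z. g z $ i $ j)" "smooth_on V (\<lambda>z. g0 z $ i $ j)" for i j
    unfolding g0_def g_form_def vec_lambda_beta
    by (intro smooth_on_sum smooth_on_add smooth_on_diff smooth_on_mult smooth_on_const smooth_on_vec_nth pd_smooth_on V(1) \<psi> g | assumption)+
  have sb: "smooth_on V (\<lambda>z. b z $ i $ j $ k)" "smooth_on V (\<lambda>z. b0 z $ i $ j $ k)" for i j k
    unfolding b0_def b_form_def vec_lambda_beta
    by (intro smooth_on_sum smooth_on_add smooth_on_diff smooth_on_mult smooth_on_const smooth_on_vec_nth pd_smooth_on V(1) \<psi> b | assumption)+
  have kernel: "bil g b L \<epsilon> w u f h = bil g b L \<epsilon> ?w u f h" if "u \<in> fields V" "h \<in> test_functions" for u f h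
  proof -
    have "nonlocal_operator g b L \<epsilon> w u h x = nonlocal_operator g b L \<epsilon> ?w u h x" for x
      by (rule nonlocal_operator_kernel[OF V(1) that sw eq])
    then show ?thesis by (simp only: bil_def)
  qed
  define g' where "g' = (\<lambda>z. g z - g0 z)"
  define b' where "b' = (\<lambda>z. b z - b0 z)"
  have local: "bil g' b' 0 \<epsilon> ?w u f h = bil g b L \<epsilon> w u f h - canon \<eta> L \<epsilon> ?z \<psi> u f h"
    if "u \<in> fields V" "f \<in> test_functions" "h \<in> test_functions" for u f h
  proof -
    have "bil g' b' 0 \<epsilon> ?w u f h = bil g b L \<epsilon> ?w u f h - bil g0 b0 L \<epsilon> ?w u f h"
      unfolding g'_def b'_def by (rule bil_diff[OF V(1) that(1,3,2) sg sb sw(2)])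
    also have "bil g0 b0 L \<epsilon> ?w u f h = canon \<eta> L \<epsilon> ?z \<psi> u f h"
      unfolding g0_def b0_def by (rule bil_canonical[OF V(1) s0 \<psi> \<eta>(1) that])
    finally show ?thesis by (simp only: kernel[OF that(1,3)])
  qed
  have g's: "smooth_on V g'" "smooth_on V b'"
    unfolding g'_def b'_def by (intro smooth_on_diff V(1) g b smooth_on_vecI sg sb)+
  have lc: "closed_form V \<eta> (bil g' b' 0 \<epsilon> ?w)"
    by (rule closed_form_diff[OF V(1) closed canon_closed(1)[OF V(1) s0 \<psi>]]) (assumption, rule local)
  have ls: "skew_form V (bil g' b' 0 \<epsilon> ?w)"
    unfolding skew_form_def
  proof (intro ballI)
    fix u f h :: "'n field" assume a: "u \<in> fields V" "f \<in> test_functions" "h \<in> test_functions"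
    have "bil g b L \<epsilon> w u f h = - bil g b L \<epsilon> w u h f" using skew a unfolding skew_form_def by blast
    moreover have "canon \<eta> L \<epsilon> ?z \<psi> u f h = - canon \<eta> L \<epsilon> ?z \<psi> u h f"
      by (rule canon_skew[OF V(1) s0 \<psi> a])
    ultimately show "bil g' b' 0 \<epsilon> ?w u f h = - bil g' b' 0 \<epsilon> ?w u h f" by (simp add: local a)
  qed
  obtain \<Phi> where \<Phi>: "\<And>j. smooth_on V (\<Phi> j)"
    and gl: "\<And>p i j. p \<in> V \<Longrightarrow> low_g \<eta> g' i j p = pd i (\<Phi> j) p + pd j (\<Phi> i) p"
    and bl: "\<And>p i j k. p \<in> V \<Longrightarrow> low_b \<eta> b' i j k p = pd i (pd k (\<Phi> j)) p"
    using local_potentials[OF V \<eta> g's lc ls] by blast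
  \<comment> \<open>The potentials found for the lowered coefficients carry a lower index; raising
    it with \<eta> gives F.\<close>
  define F where "F z = (\<chi> j. \<Sum>l\<in>UNIV. \<eta> $ j $ l * \<Phi> l z)" for z
  have F: "smooth_on V F"
    by (rule smooth_on_vecI[OF V(1)]) (simp add: F_def smooth_on_sum smooth_on_mult smooth_on_const V(1) \<Phi>)
  have pF: "pd s (\<lambda>v. F v $ j) p = (\<Sum>l\<in>UNIV. \<eta> $ j $ l * pd s (\<Phi> l) p)" if "p \<in> V" for p s j
    unfolding F_def vec_lambda_beta by (rule pd_linear_combination[OF finite_class.finite_UNIV \<Phi> that])
  have ppF: "pd s (pd k (\<lambda>v. F v $ j)) p = (\<Sum>l\<in>UNIV. \<eta> $ j $ l * pd s (pd k (\<Phi> l)) p)" if p: "p \<in> V" for p s k j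
  proof -
    have "pd s (pd k (\<lambda>v. F v $ j)) p = pd s (\<lambda>p. \<Sum>l\<in>UNIV. \<eta> $ j $ l * pd k (\<Phi> l) p) p"
      by (rule pd_cong[OF V(1) p pF])
    also have "\<dots> = (\<Sum>l\<in>UNIV. \<eta> $ j $ l * pd s (pd k (\<Phi> l)) p)"
      by (rule pd_linear_combination[OF finite_class.finite_UNIV pd_smooth_on[OF \<Phi>] p])
    finally show ?thesis .
  qed
  have pd0: "pd s (\<lambda>_. 0) = (\<lambda>_. 0)" for s :: 'n
    by (rule ext) (simp add: pd_eqI[OF has_derivative_const])
  have gF: "g_form \<eta> L \<epsilon> F \<psi> p = g p" if p: "p \<in> V" for p
  proof -
    have "g_form \<eta> L \<epsilon> F \<psi> p $ i $ j = g p $ i $ j" for i j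
    proof -
      have "g_form \<eta> L \<epsilon> F \<psi> p $ i $ j = g0 p $ i $ j + ((\<Sum>s\<in>UNIV. \<eta> $ i $ s * pd s (\<lambda>v. F v $ j) p) + (\<Sum>s\<in>UNIV. \<eta> $ j $ s * pd s (\<lambda>v. F v $ i) p))"
        by (simp add: g0_def g_form_def pd0)
      also have "(\<Sum>s\<in>UNIV. \<eta> $ j $ s * pd s (\<lambda>v. F v $ i) p) = (\<Sum>l\<in>UNIV. \<Sum>s\<in>UNIV. \<eta> $ i $ s * \<eta> $ j $ l * pd l (\<Phi> s) p)"
        by (simp add: pF[OF p] sum_distrib_left mult_ac)
      also have "\<dots> = (\<Sum>s\<in>UNIV. \<Sum>l\<in>UNIV. \<eta> $ i $ s * \<eta> $ j $ l * pd l (\<Phi> s) p)" by (rule sum.swap)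
      also have "(\<Sum>s\<in>UNIV. \<eta> $ i $ s * pd s (\<lambda>v. F v $ j) p) + (\<Sum>s\<in>UNIV. \<Sum>l\<in>UNIV. \<eta> $ i $ s * \<eta> $ j $ l * pd l (\<Phi> s) p)
         = (\<Sum>s\<in>UNIV. \<Sum>l\<in>UNIV. \<eta> $ i $ s * \<eta> $ j $ l * low_g \<eta> g' s l p)"
        by (simp add: pF[OF p] gl[OF p] sum_distrib_left sum.distrib[symmetric] algebra_simps)
      also have "\<dots> = g' p $ i $ j" unfolding low_g_def by (rule raise_low2[OF \<eta>(2,1)])
      finally show ?thesis by (simp add: g'_def)
    qed
    then show ?thesis by (simp add: vec_eq_iff)
  qed
  have bF: "b_form \<eta> L \<epsilon> F \<psi> p = b p" if p: "p \<in> V" for p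
  proof -
    have "b_form \<eta> L \<epsilon> F \<psi> p $ i $ j $ k = b p $ i $ j $ k" for i j k
    proof -
      have "b_form \<eta> L \<epsilon> F \<psi> p $ i $ j $ k = b0 p $ i $ j $ k + (\<Sum>s\<in>UNIV. \<eta> $ i $ s * pd s (pd k (\<lambda>v. F v $ j)) p)"
        by (simp add: b0_def b_form_def pd0)
      also have "(\<Sum>s\<in>UNIV. \<eta> $ i $ s * pd s (pd k (\<lambda>v. F v $ j)) p) = (\<Sum>s\<in>UNIV. \<Sum>l\<in>UNIV. \<eta> $ i $ s * \<eta> $ j $ l * low_b \<eta> b' s l k p)"
        by (simp add: ppF[OF p] bl[OF p] sum_distrib_left mult_ac)
      also have "\<dots> = b' p $ i $ j $ k" unfolding low_b_def by (rule raise_low2[OF \<eta>(2,1)])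
      finally show ?thesis by (simp add: b'_def)
    qed
    then show ?thesis by (simp add: vec_eq_iff)
  qed
  \<comment> \<open>The coefficients g and b are recovered exactly on V, whereas w is replaced by
    another family with the same kernel; the equality is one of forms.\<close>
  have "bil g b L \<epsilon> w u f h = bil (g_form \<eta> L \<epsilon> F \<psi>) (b_form \<eta> L \<epsilon> F \<psi>) L \<epsilon> ?w u f h"
    if "u \<in> fields V" "h \<in> test_functions" for u f h
    by (simp only: kernel[OF that]) (simp only: bil_def nonlocal_operator_def gF[OF field_in[OF that(1)]] bF[OF field_in[OF that(1)]])
  then show ?thesis
    unfolding has_canonical_form_def nonlocal_bracket_bil
    using F \<psi> var_deriv_smooth_functional(2) by blast
qed

text \<open>Potentials exist on convex domains, so in general compatibility yields the canonical
  form only near each point, while the converse starts from a form on all of U. On a convex domain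
  the two statements meet in an equivalence.\<close>

theorem theorem3p1:
  fixes U :: "(real^'n::finite) set"
    and \<eta> :: "real^'n^'n"
    and g :: "real^'n \<Rightarrow> real^'n^'n"
    and b :: "real^'n \<Rightarrow> real^'n^'n^'n"
    and L :: nat
    and \<epsilon> :: "nat \<Rightarrow> real"
    and w :: "nat \<Rightarrow> real^'n \<Rightarrow> real^'n^'n"
  assumes "open U"
    and "transpose \<eta> = \<eta>" and "det \<eta> \<noteq> 0"
    and "smooth_on U g" and "smooth_on U b" and "\<And>\<alpha>. \<alpha> \<in> {1..L} \<Longrightarrow> smooth_on U (w \<alpha>)"
    and "\<exists>u\<in>U. det (g u) \<noteq> 0"
    and "poisson_bracket U (nonlocal_bracket g b L \<epsilon> w)"
  shows "(compatible U (nonlocal_bracket g b L \<epsilon> w) (constant_bracket \<eta>) \<longrightarrow>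
            (\<forall>p\<in>U. \<exists>V. open V \<and> p \<in> V \<and> V \<subseteq> U \<and>
               has_canonical_form V \<eta> L \<epsilon> (nonlocal_bracket g b L \<epsilon> w))) \<and>
         (has_canonical_form U \<eta> L \<epsilon> (nonlocal_bracket g b L \<epsilon> w) \<longrightarrow>
            compatible U (nonlocal_bracket g b L \<epsilon> w) (constant_bracket \<eta>)) \<and>
         (convex U \<longrightarrow>
            (compatible U (nonlocal_bracket g b L \<epsilon> w) (constant_bracket \<eta>) \<longleftrightarrow>
             has_canonical_form U \<eta> L \<epsilon> (nonlocal_bracket g b L \<epsilon> w)))"
proof -
  let ?B = "nonlocal_bracket g b L \<epsilon> w"
  \<comment> \<open>Stated for every open convex part of U: balls give the local claim, and U itself
    gives the equivalence when it is convex.\<close>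
  have canonical: "has_canonical_form V \<eta> L \<epsilon> ?B"
    if C: "compatible U ?B (constant_bracket \<eta>)" and V: "open V" "convex V" "V \<subseteq> U" for V
  proof (rule closed_skew_imp_canonical[OF V(1,2) assms(2,3)])
    show "smooth_on V g" "smooth_on V b" using assms(4,5) V(3) by (auto intro: smooth_on_subset)
    show "smooth_on V (w \<alpha>)" if "\<alpha> \<in> {1..L}" for \<alpha> using assms(6)[OF that] V(3) by (rule smooth_on_subset)
    show "closed_form V \<eta> (bil g b L \<epsilon> w)" "skew_form V (bil g b L \<epsilon> w)"
      using compatible_imp_closed[OF assms(1,2,8) C] V(3) by (auto intro: closed_form_mono skew_form_mono)
  qed
  have "\<exists>V. open V \<and> p \<in> V \<and> V \<subseteq> U \<and> has_canonical_form V \<eta> L \<epsilon> ?B"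
    if C: "compatible U ?B (constant_bracket \<eta>)" and "p \<in> U" for p
  proof -
    obtain e where "e > 0" "ball p e \<subseteq> U" using assms(1) \<open>p \<in> U\<close> by (auto simp: open_contains_ball)
    then show ?thesis using canonical[OF C, of "ball p e"] by (intro exI[of _ "ball p e"]) auto
  qed
  moreover have "compatible U ?B (constant_bracket \<eta>)" if "has_canonical_form U \<eta> L \<epsilon> ?B"
    by (rule canonical_form_compatible[OF assms(1,2,8) that])
  moreover have "has_canonical_form U \<eta> L \<epsilon> ?B" if "compatible U ?B (constant_bracket \<eta>)" "convex U"
    by (rule canonical[OF that(1) assms(1) that(2) order_refl])
  ultimately show ?thesis by blast
qed

end
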